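(* For projective manifolds $X$, RC-positivity of $T^{1,0}X$ implies neither uniform RC-positivity of $T^{1,0}X$ nor rational connectedness of $X$. That is: there exists a projective manifold $X$ such that $T^{1,0}X$ is RC-positive but not uniformly RC-positive, and there exists a projective manifold $X$ such that $T^{1,0}X$ is RC-positive but $X$ is not rationally connected.
   Context: A projective manifold is a smooth connected complex projective variety. Let $E\to X$ be a holomorphic vector bundle over a complex manifold with a smooth Hermitian metric $h$. Its Chern connection $\nabla$ is the unique connection compatible with $h$ and the holomorphic structure of $E$, and $R^h=\nabla^2$ is its Chern curvature, a $(1,1)$-form with values in $\mathrm{End}\,E$. For $u\in T^{1,0}_xX$ and $v\in E_x$, $\langle R^h v,v\rangle_h$ is the $(1,1)$-form at $x$ with $\langle R^hv,v\rangle_h(u,\bar u)=\langle R^h(u,\bar u)v,v\rangle_h=\sum R_{i\bar j\alpha\bar\beta}u_i\bar u_jv_\alpha\bar v_\beta$, where, in local coordinates $z_i$ and a local holomorphic frame $e_\alpha$ with $h_{\alpha\bar\beta}=\langle e_\alpha,e_\beta\rangle_h$, $R_{i\bar j\alpha\bar\beta}=-\frac{\partial^2 h_{\alpha\bar\beta}}{\partial z_i\partial\bar z_j}+h^{\gamma\bar\delta}\frac{\partial h_{\alpha\bar\delta}}{\partial z_i}\frac{\partial h_{\gamma\bar\beta}}{\partial\bar z_j}$. The metric $h$ is RC-positive at $x\in X$ if for every nonzero $v\in E_x$ there is a nonzero $u\in T^{1,0}_xX$ with $\langle R^hv,v\rangle_h(u,\bar u)>0$. It is uniformly RC-positive at $x$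 if there is a nonzero $u\in T^{1,0}_xX$ such that $\langle R^hv,v\rangle_h(u,\bar u)>0$ for every nonzero $v\in E_x$. The metric $h$ is (uniformly) RC-positive if it is so at every point of $X$, and $E$ is (uniformly) RC-positive if it admits a (uniformly) RC-positive Hermitian metric. *)

theory Defs
  imports "HOL-Analysis.Analysis" "HOL-Library.Poly_Mapping"
begin

section \<open>Calculus on open subsets of complex n-space\<close>

text \<open>Dimensions are existentially quantified in the theorem, so complex n-space is a subset of
  one fixed type: its vectors are the functions on the naturals vanishing from n on. The product
  topology of the function type induces the usual topology on it.\<close>

type_synonym cvec = "nat \<Rightarrow> complex"

definition cspace :: "nat \<Rightarrow> cvec set"
  where "cspace n = {z. \<forall>i\<ge>n. z i = 0}"

definition czero :: cvec
  where "czero = (\<lambda>i. 0)"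

abbreviation open_in_cspace :: "nat \<Rightarrow> cvec set \<Rightarrow> bool"
  where "open_in_cspace n W \<equiv> openin (top_of_set (cspace n)) W"

definition hol_on :: "nat \<Rightarrow> cvec set \<Rightarrow> (cvec \<Rightarrow> complex) \<Rightarrow> bool"
  where "hol_on n W f \<longleftrightarrow> continuous_on W f \<and>
    (\<forall>z\<in>W. \<forall>j<n. (\<lambda>t. f (z(j := t))) field_differentiable (at (z j)))"

definition cpartial :: "nat \<Rightarrow> (cvec \<Rightarrow> complex) \<Rightarrow> cvec \<Rightarrow> complex"
  where "cpartial j f z = deriv (\<lambda>t. f (z(j := t))) (z j)"

text \<open>The derivative at z in the real direction given by the complex number c in the j-th
  coordinate: c = 1 is the derivative by the real part of that coordinate,
  c = \<open>\<i>\<close> the derivative by its imaginary part.\<close>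

definition rline :: "nat \<Rightarrow> complex \<Rightarrow> (cvec \<Rightarrow> complex) \<Rightarrow> cvec \<Rightarrow> real \<Rightarrow> complex"
  where "rline j c f z = (\<lambda>t. f (z(j := z j + of_real t * c)))"

definition rpartial :: "nat \<Rightarrow> complex \<Rightarrow> (cvec \<Rightarrow> complex) \<Rightarrow> cvec \<Rightarrow> complex"
  where "rpartial j c f z = vector_derivative (rline j c f z) (at 0)"

primrec Ck_on :: "nat \<Rightarrow> nat \<Rightarrow> cvec set \<Rightarrow> (cvec \<Rightarrow> complex) \<Rightarrow> bool"
  where
    "Ck_on 0 n W f \<longleftrightarrow> continuous_on W f"
  | "Ck_on (Suc k) n W f \<longleftrightarrow> continuous_on W f \<and>
       (\<forall>j<n. \<forall>c\<in>{1, \<i>}.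
          (\<forall>z\<in>W. rline j c f z differentiable (at 0)) \<and> Ck_on k n W (rpartial j c f))"

definition smooth_fun_on :: "nat \<Rightarrow> cvec set \<Rightarrow> (cvec \<Rightarrow> complex) \<Rightarrow> bool"
  where "smooth_fun_on n W f \<longleftrightarrow> (\<forall>k. Ck_on k n W f)"

definition d_z :: "nat \<Rightarrow> (cvec \<Rightarrow> complex) \<Rightarrow> cvec \<Rightarrow> complex"
  where "d_z j f z = (rpartial j 1 f z - \<i> * rpartial j \<i> f z) / 2"

definition d_zbar :: "nat \<Rightarrow> (cvec \<Rightarrow> complex) \<Rightarrow> cvec \<Rightarrow> complex"
  where "d_zbar j f z = (rpartial j 1 f z + \<i> * rpartial j \<i> f z) / 2"

definition lin_indep :: "nat \<Rightarrow> nat \<Rightarrow> (nat \<Rightarrow> cvec) \<Rightarrow> bool"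
  where "lin_indep m K a \<longleftrightarrow>
    (\<forall>c. (\<forall>k<K. (\<Sum>i<m. c i * a i k) = 0) \<longrightarrow> (\<forall>i<m. c i = 0))"


section \<open>Complex manifolds, holomorphic vector bundles and Hermitian metrics\<close>

text \<open>A complex manifold is given by its dimension and its maximal holomorphic atlas; a chart is
  its domain together with the coordinate map. The coordinate map is irrelevant off the domain.\<close>

type_synonym 'p chart = "'p set \<times> ('p \<Rightarrow> cvec)"

record 'p cmanifold =
  cdim :: nat
  charts :: "'p chart set"

definition points :: "'p cmanifold \<Rightarrow> 'p set"
  where "points M = (\<Union>(U, \<phi>)\<in>charts M. U)"

definition from_coords :: "'p chart \<Rightarrow> cvec \<Rightarrow> 'p"
  where "from_coords c = inv_into (fst c) (snd c)"

text \<open>A holomorphic vector bundle is given by a family of local holomorphic frames on open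
  sets covering the base, and by the holomorphic matrices relating them: the vector with index b
  of the frame j is at x the sum over a of \<open>transition E i j x a b\<close> times the vector with
  index a of the frame i. An element of the fibre at x is represented by its coefficients with
  respect to a frame around x. The record type itself does not enforce the conditions on these
  data.\<close>

record ('p, 'i) vbundle =
  bundle_rank :: nat
  frames :: "'i set"
  frame_dom :: "'i \<Rightarrow> 'p set"
  transition :: "'i \<Rightarrow> 'i \<Rightarrow> 'p \<Rightarrow> nat \<Rightarrow> nat \<Rightarrow> complex"

text \<open>The holomorphic tangent bundle: every chart has its coordinate frame, and the transition
  matrices are the Jacobian matrices of the coordinate changes.\<close>

definition tangent_bundle :: "'p cmanifold \<Rightarrow> ('p, 'p chart) vbundle"
  where "tangent_bundle M =
    \<lparr> bundle_rank = cdim M,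
      frames = charts M,
      frame_dom = fst,
      transition = (\<lambda>c d x a b. cpartial b (\<lambda>w. snd c (from_coords d w) a) (snd d x)) \<rparr>"

text \<open>\<open>h i x a b\<close> is the inner product at x of the vectors with indices a and b of
  the frame i.\<close>

type_synonym ('p, 'i) metric = "'i \<Rightarrow> 'p \<Rightarrow> nat \<Rightarrow> nat \<Rightarrow> complex"

definition hermitian_metric ::
    "'p cmanifold \<Rightarrow> ('p, 'i) vbundle \<Rightarrow> ('p, 'i) metric \<Rightarrow> bool"
  where "hermitian_metric M E h \<longleftrightarrow>
    (\<forall>i\<in>frames E. \<forall>x\<in>frame_dom E i.
        (\<forall>a<bundle_rank E. \<forall>b<bundle_rank E. h i x a b = cnj (h i x b a)) \<and>
        (\<forall>v\<in>cspace (bundle_rank E) - {czero}.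
            Re (\<Sum>a<bundle_rank E. \<Sum>b<bundle_rank E. h i x a b * v a * cnj (v b)) > 0)) \<and>
    (\<forall>i\<in>frames E. \<forall>j\<in>frames E. \<forall>x\<in>frame_dom E i \<inter> frame_dom E j.
        \<forall>a<bundle_rank E. \<forall>b<bundle_rank E.
          h j x a b = (\<Sum>p<bundle_rank E. \<Sum>q<bundle_rank E.
            transition E i j x p a * cnj (transition E i j x q b) * h i x p q)) \<and>
    (\<forall>i\<in>frames E. \<forall>c\<in>charts M. \<forall>a<bundle_rank E. \<forall>b<bundle_rank E.
        smooth_fun_on (cdim M) (snd c ` (fst c \<inter> frame_dom E i))
          (\<lambda>z. h i (from_coords c z) a b))"


section \<open>Chern curvature and RC-positivity\<close>

text \<open>The inverse metric with upper indices: \<open>inverse_metric r H g d\<close> is determined for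
  \<open>g, d < r\<close> by the equations below if H is invertible. Note that as a matrix it is the
  transpose of the inverse of H.\<close>

definition inverse_metric ::
    "nat \<Rightarrow> (nat \<Rightarrow> nat \<Rightarrow> complex) \<Rightarrow> nat \<Rightarrow> nat \<Rightarrow> complex"
  where "inverse_metric r H = (SOME G. \<forall>a<r. \<forall>g<r.
    (\<Sum>d<r. H a d * G g d) = (if a = g then 1 else 0))"

definition chern_curvature ::
    "nat \<Rightarrow> (cvec \<Rightarrow> nat \<Rightarrow> nat \<Rightarrow> complex) \<Rightarrow> cvec \<Rightarrow>
     nat \<Rightarrow> nat \<Rightarrow> nat \<Rightarrow> nat \<Rightarrow> complex"
  where "chern_curvature r h z i j a b =
    - d_z i (d_zbar j (\<lambda>w. h w a b)) z +
    (\<Sum>g<r. \<Sum>d<r. inverse_metric r (h z) g d *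
        d_z i (\<lambda>w. h w a d) z * d_zbar j (\<lambda>w. h w g b) z)"

text \<open>The value at x of the curvature form of v on u, conjugate u, where u and v are given by their
  coefficients in the coordinates c and in the frame i. It is a real number, and independent of
  the choice of c and i for fixed tangent vector and fixed fibre element.\<close>

definition curvature_form ::
    "'p cmanifold \<Rightarrow> ('p, 'i) vbundle \<Rightarrow> ('p, 'i) metric \<Rightarrow> 'p chart \<Rightarrow> 'i \<Rightarrow>
     'p \<Rightarrow> cvec \<Rightarrow> cvec \<Rightarrow> real"
  where "curvature_form M E h c i x u v =
    Re (\<Sum>k<cdim M. \<Sum>l<cdim M. \<Sum>a<bundle_rank E. \<Sum>b<bundle_rank E.
      chern_curvature (bundle_rank E) (\<lambda>z. h i (from_coords c z)) (snd c x) k l a b *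
        u k * cnj (u l) * v a * cnj (v b))"

definition rc_positive_at ::
    "'p cmanifold \<Rightarrow> ('p, 'i) vbundle \<Rightarrow> ('p, 'i) metric \<Rightarrow> 'p \<Rightarrow> bool"
  where "rc_positive_at M E h x \<longleftrightarrow>
    (\<forall>c\<in>charts M. \<forall>i\<in>frames E. x \<in> fst c \<longrightarrow> x \<in> frame_dom E i \<longrightarrow>
      (\<forall>v\<in>cspace (bundle_rank E) - {czero}. \<exists>u\<in>cspace (cdim M) - {czero}.
        curvature_form M E h c i x u v > 0))"

text \<open>If the base has dimension 0, there is no nonzero u: no metric is uniformly RC-positive, while
  every metric on the tangent bundle (which is zero) is RC-positive.\<close>

definition uniformly_rc_positive_at ::
    "'p cmanifold \<Rightarrow> ('p, 'i) vbundle \<Rightarrow> ('p, 'i) metric \<Rightarrow> 'p \<Rightarrow> bool"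
  where "uniformly_rc_positive_at M E h x \<longleftrightarrow>
    (\<forall>c\<in>charts M. \<forall>i\<in>frames E. x \<in> fst c \<longrightarrow> x \<in> frame_dom E i \<longrightarrow>
      (\<exists>u\<in>cspace (cdim M) - {czero}. \<forall>v\<in>cspace (bundle_rank E) - {czero}.
        curvature_form M E h c i x u v > 0))"

definition rc_positive :: "'p cmanifold \<Rightarrow> ('p, 'i) vbundle \<Rightarrow> bool"
  where "rc_positive M E \<longleftrightarrow>
    (\<exists>h. hermitian_metric M E h \<and> (\<forall>x\<in>points M. rc_positive_at M E h x))"

definition uniformly_rc_positive :: "'p cmanifold \<Rightarrow> ('p, 'i) vbundle \<Rightarrow> bool"
  where "uniformly_rc_positive M E \<longleftrightarrow>
    (\<exists>h. hermitian_metric M E h \<and> (\<forall>x\<in>points M. uniformly_rc_positive_at M E h x))"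


section \<open>Projective space and projective manifolds\<close>

text \<open>A point of N-dimensional projective space is the set of its homogeneous coordinate
  vectors.\<close>

type_synonym ppoint = "cvec set"

definition pclass :: "cvec \<Rightarrow> ppoint"
  where "pclass z = {\<lambda>i. c * z i | c. c \<noteq> 0}"

definition proj_space :: "nat \<Rightarrow> ppoint set"
  where "proj_space N = pclass ` (cspace (Suc N) - {czero})"

text \<open>The quotient topology.\<close>

definition proj_top :: "nat \<Rightarrow> ppoint topology"
  where "proj_top N = topology (\<lambda>U. U \<subseteq> proj_space N \<and>
    openin (top_of_set (cspace (Suc N) - {czero})) {z \<in> cspace (Suc N) - {czero}. pclass z \<in> U})"

lemma openin_proj_top:
  "openin (proj_top N) U \<longleftrightarrow> U \<subseteq> proj_space N \<and>
    openin (top_of_set (cspace (Suc N) - {czero})) {z \<in> cspace (Suc N) - {czero}. pclass z \<in> U}"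
proof -
  let ?C = "cspace (Suc N) - {czero}"
  let ?P = "\<lambda>U. U \<subseteq> proj_space N \<and> openin (top_of_set ?C) {z \<in> ?C. pclass z \<in> U}"
  have "istopology ?P"
    unfolding istopology_def
  proof (intro conjI allI impI)
    fix S T assume S: "?P S" and T: "?P T"
    show "S \<inter> T \<subseteq> proj_space N" using S by blast
    have "{z \<in> ?C. pclass z \<in> S \<inter> T} = {z \<in> ?C. pclass z \<in> S} \<inter> {z \<in> ?C. pclass z \<in> T}"
      by blast
    then show "openin (top_of_set ?C) {z \<in> ?C. pclass z \<in> S \<inter> T}"
      using S T by (simp add: openin_Int)
  next
    fix \<K> assume K: "\<forall>K\<in>\<K>. ?P K"
    then show "\<Union>\<K> \<subseteq> proj_space N" by blast
    have "{z \<in> ?C. pclass z \<in> \<Union>\<K>} = \<Union>((\<lambda>K. {z \<in> ?C. pclass z \<in> K}) ` \<K>)"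
      by blast
    then show "openin (top_of_set ?C) {z \<in> ?C. pclass z \<in> \<Union>\<K>}"
      using K by (metis (no_types, lifting) imageE openin_Union)
  qed
  then show ?thesis
    unfolding proj_top_def by (simp add: topology_inverse')
qed

text \<open>Polynomials in the variables with indices \<open>0, 1, 2, \<dots>\<close>: finitely supported maps
  from monomials, which are finitely supported exponent functions, to coefficients.\<close>

type_synonym mvpoly = "(nat \<Rightarrow>\<^sub>0 nat) \<Rightarrow>\<^sub>0 complex"

definition peval :: "mvpoly \<Rightarrow> cvec \<Rightarrow> complex"
  where "peval F z =
    (\<Sum>m\<in>Poly_Mapping.keys F. Poly_Mapping.lookup F m *
      (\<Prod>i\<in>Poly_Mapping.keys m. z i ^ Poly_Mapping.lookup m i))"

definition hform :: "nat \<Rightarrow> nat \<Rightarrow> mvpoly \<Rightarrow> bool"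
  where "hform N d F \<longleftrightarrow> (\<forall>m\<in>Poly_Mapping.keys F. Poly_Mapping.keys m \<subseteq> {..N} \<and>
    (\<Sum>i\<in>Poly_Mapping.keys m. Poly_Mapping.lookup m i) = d)"

definition vanishes_at :: "mvpoly \<Rightarrow> ppoint \<Rightarrow> bool"
  where "vanishes_at F p \<longleftrightarrow> (\<forall>z\<in>p. peval F z = 0)"

definition projective_algebraic_set :: "nat \<Rightarrow> ppoint set \<Rightarrow> bool"
  where "projective_algebraic_set N X \<longleftrightarrow>
    (\<exists>S. (\<forall>F\<in>S. \<exists>d. hform N d F) \<and> X = {p \<in> proj_space N. \<forall>F\<in>S. vanishes_at F p})"

text \<open>Jacobian criterion: near p, the set X is cut out by N - n forms vanishing on X whose
  differentials are linearly independent at p (at one or, equivalently, at each vector of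
  homogeneous coordinates of p).\<close>

definition smooth_of_dim_at :: "nat \<Rightarrow> nat \<Rightarrow> ppoint set \<Rightarrow> ppoint \<Rightarrow> bool"
  where "smooth_of_dim_at N n X p \<longleftrightarrow> n \<le> N \<and>
    (\<exists>F U. (\<forall>i<N - n. (\<exists>d. hform N d (F i)) \<and> (\<forall>q\<in>X. vanishes_at (F i) q)) \<and>
      (\<forall>z\<in>p. lin_indep (N - n) (Suc N) (\<lambda>i k. cpartial k (peval (F i)) z)) \<and>
      openin (proj_top N) U \<and> p \<in> U \<and>
      (\<forall>q\<in>U. (\<forall>i<N - n. vanishes_at (F i) q) \<longrightarrow> q \<in> X))"

definition projective_manifold :: "nat \<Rightarrow> nat \<Rightarrow> ppoint set \<Rightarrow> bool"
  where "projective_manifold N n X \<longleftrightarrow>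
    projective_algebraic_set N X \<and> X \<noteq> {} \<and> connectedin (proj_top N) X \<and>
    (\<forall>p\<in>X. smooth_of_dim_at N n X p)"

text \<open>The complex structure that a projective manifold X of dimension n inherits from projective
  space. The charts of X are the bijections from open subsets of X to open subsets of complex
  n-space whose inverse is a holomorphic immersion into projective space. In terms of a local
  lift \<open>\<psi>\<close> of the inverse to homogeneous coordinates, the immersion property says that
  \<open>\<psi>\<close> and its n partial derivatives are linearly independent.\<close>

definition as_cmanifold :: "nat \<Rightarrow> nat \<Rightarrow> ppoint set \<Rightarrow> ppoint cmanifold"
  where "as_cmanifold N n X =
    \<lparr> cdim = n,
      charts = {(U, \<phi>). openin (subtopology (proj_top N) X) U \<and> inj_on \<phi> U \<and>
        open_in_cspace n (\<phi> ` U) \<and>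
        (\<forall>p\<in>U. \<exists>W \<psi>. open_in_cspace n W \<and> \<phi> p \<in> W \<and> W \<subseteq> \<phi> ` U \<and>
          (\<forall>w\<in>W. \<psi> w \<in> cspace (Suc N) - {czero} \<and>
             pclass (\<psi> w) \<in> U \<and> \<phi> (pclass (\<psi> w)) = w) \<and>
          (\<forall>k\<le>N. hol_on n W (\<lambda>w. \<psi> w k)) \<and>
          lin_indep (Suc n) (Suc N)
            (case_nat (\<psi> (\<phi> p)) (\<lambda>j k. cpartial j (\<lambda>w. \<psi> w k) (\<phi> p))))} \<rparr>"

abbreviation T10 :: "nat \<Rightarrow> nat \<Rightarrow> ppoint set \<Rightarrow> (ppoint, ppoint chart) vbundle"
  where "T10 N n X \<equiv> tangent_bundle (as_cmanifold N n X)"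


section \<open>Rational connectedness\<close>

text \<open>A morphism from the projective line to N-dimensional projective space is given by N + 1
  binary forms of the same degree without common zero.\<close>

definition P1_morphism :: "nat \<Rightarrow> (nat \<Rightarrow> mvpoly) \<Rightarrow> bool"
  where "P1_morphism N F \<longleftrightarrow> (\<exists>d. \<forall>k\<le>N. hform 1 d (F k)) \<and>
    (\<forall>s\<in>cspace 2 - {czero}. \<exists>k\<le>N. peval (F k) s \<noteq> 0)"

definition P1_image :: "nat \<Rightarrow> (nat \<Rightarrow> mvpoly) \<Rightarrow> ppoint set"
  where "P1_image N F =
    (\<lambda>s. pclass (\<lambda>k. if k \<le> N then peval (F k) s else 0)) ` (cspace 2 - {czero})"

text \<open>Any two points lie on a common rational curve. The morphism below is automatically
  nonconstant if the two points are distinct.\<close>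

definition rationally_connected :: "nat \<Rightarrow> ppoint set \<Rightarrow> bool"
  where "rationally_connected N X \<longleftrightarrow>
    (\<forall>x\<in>X. \<forall>y\<in>X. \<exists>F. P1_morphism N F \<and> P1_image N F \<subseteq> X \<and>
      x \<in> P1_image N F \<and> y \<in> P1_image N F)"

end

theory Submission
  imports Defs "HOL-Complex_Analysis.Complex_Analysis"
begin

text \<open>Give a smooth surface X in projective 3-space the Fubini-Study metric. By the Gauss equation its
  curvature on (u, v) is that of projective space, which is positive, minus the squared norm of the
  second fundamental form B(u, v). For fixed v, the equation B(u, v) = 0 is one linear condition on u in
  a space of dimension 2, so it has a nonzero solution: the tangent bundle of X is RC-positive. The
  examples are Fermat surfaces.

  In degree 4 there is a holomorphic 2-form \<open>\<omega>\<close> without zeros, the residue form. For any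
  Hermitian metric h on the tangent bundle, the function \<open>det h / |\<omega>|\<^sup>2\<close> attains a minimum. A vector
  u with \<open>R(u, u, v, v) > 0\<close> for all v makes the trace of R over v positive, so the logarithm of this
  function has a negative mixed second derivative along u, which is impossible at a minimum.

  In degree 8, the forms parametrizing a rational curve satisfy \<open>p\<^sub>0\<^sup>8 + p\<^sub>1\<^sup>8 + p\<^sub>2\<^sup>8 + p\<^sub>3\<^sup>8 = 0\<close>. The Wronskian
  of three of the summands has too many zeros for its degree and so vanishes; hence the curve is constant
  unless one of the \<open>p\<^sub>k\<close> or \<open>p\<^sub>i\<^sup>8 + p\<^sub>j\<^sup>8\<close> is zero. So no nonconstant rational curve passes through a
  general point.\<close>


section \<open>Smooth and holomorphic functions on complex n-space\<close>

text \<open>The degrees are forced by two counts. The canonical bundle of a smooth surface of degree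
  d is O(d - 4), so the residue form has neither zeros nor poles for d = 4. In the Wronskian count,
  a zero of a coordinate is worth d - 2 zeros of W, and with \<open>s\<close> of maximal degree (d -
  2) (deg p + deg q + deg r + deg s) \<le> d (deg p + deg q + deg r) - 3 is contradictory as soon as
  d - 2 \<ge> 6; hence d = 8. The manifold carries its maximal atlas, and RC-positivity is tested
  with coordinates and frame from two unrelated charts. So arbitrary charts have to be compared,
  which is done by lifts to homogeneous coordinates and a holomorphic inverse function theorem. As
  \<open>hol_on\<close> asks only for continuity and separate holomorphy, smoothness must be
  extracted from Cauchy's formula. The curvature is computed from arbitrary lifts, normalized at one
  point by rescaling, without any special coordinates.\<close>

lemma cspace_upd: "z \<in> cspace n \<Longrightarrow> j < n \<Longrightarrow> z(j := t) \<in> cspace n"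
  by (auto simp: cspace_def)

lemma open_in_cspace_subset: "open_in_cspace n W \<Longrightarrow> W \<subseteq> cspace n"
  using openin_imp_subset by blast

lemma continuous_on_upd [continuous_intros]:
  fixes f :: "'a::topological_space \<Rightarrow> 'i \<Rightarrow> 'b::topological_space"
  assumes "continuous_on S f" "continuous_on S g"
  shows "continuous_on S (\<lambda>x. (f x)(j := g x))"
proof (rule continuous_on_coordinatewise_then_product)
  fix i
  have "continuous_on S (\<lambda>x. f x i)"
    by (rule continuous_on_product_then_coordinatewise[OF assms(1)])
  with assms(2) show "continuous_on S (\<lambda>x. ((f x)(j := g x)) i)"
    by (cases "i = j") auto
qed

lemma open_slice:
  assumes W: "open_in_cspace n W" and z: "z \<in> cspace n" and j: "j < n"
  shows "open {t. z(j := t) \<in> W}"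
proof -
  obtain O' where O': "open O'" "W = cspace n \<inter> O'"
    using W by (auto simp: openin_open)
  have "continuous_on UNIV (\<lambda>t. z(j := t))"
    by (intro continuous_intros)
  then have "open ((\<lambda>t. z(j := t)) -` O')"
    using O'(1) by (simp add: continuous_on_open_vimage)
  moreover have "{t. z(j := t) \<in> W} = (\<lambda>t. z(j := t)) -` O'"
    using O'(2) cspace_upd[OF z j] by auto
  ultimately show ?thesis by simp
qed

lemma eventually_rline_in:
  assumes W: "open_in_cspace n W" and z: "z \<in> W" and j: "j < n"
  shows "\<forall>\<^sub>F t in nhds 0. z(j := z j + of_real t * c) \<in> W"
proof -
  have "open {t. z(j := t) \<in> W}"
    using open_slice[OF W _ j] z open_in_cspace_subset[OF W] by blast
  then have "open ((\<lambda>t. z j + of_real t * c) -` {t. z(j := t) \<in> W})"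
    by (intro open_vimage continuous_intros)
  then show ?thesis
    using z by (simp add: eventually_nhds) (rule exI[where x="(\<lambda>t. z j + of_real t * c) -` {t. z(j := t) \<in> W}"], auto)
qed

lemma rline_deriv_cong:
  assumes W: "open_in_cspace n W" and z: "z \<in> W" and j: "j < n"
    and eq: "\<And>w. w \<in> W \<Longrightarrow> f w = g w"
    and d: "(rline j c f z has_vector_derivative D) (at 0)"
  shows "(rline j c g z has_vector_derivative D) (at 0)"
proof -
  have ev: "\<forall>\<^sub>F t in nhds 0. rline j c g z t = rline j c f z t"
    using eventually_rline_in[OF W z j, where c=c]
    by eventually_elim (simp add: rline_def eq)
  show ?thesis
    using d has_vector_derivative_cong_ev[of UNIV "rline j c g z" "rline j c f z" 0 D] ev
    by (auto elim: eventually_mono dest: eventually_nhds_x_imp_x)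
qed

lemma rpartial_eqI: "(rline j c f z has_vector_derivative D) (at 0) \<Longrightarrow> rpartial j c f z = D"
  unfolding rpartial_def by (rule vector_derivative_at)

section \<open>Calculus of k times continuously differentiable functions\<close>

text \<open>\<open>Ck_on\<close> refers to \<open>rpartial\<close>, a derivative of a function
  defined everywhere; on an open set only the values on the set matter. Derivatives may thus be
  replaced by explicit formulas that hold on W.\<close>

lemma Ck_on_cong:
  assumes W: "open_in_cspace n W" and eq: "\<And>w. w \<in> W \<Longrightarrow> f w = g w" and f: "Ck_on k n W f"
  shows "Ck_on k n W g"
  using eq f
proof (induction k arbitrary: f g)
  case 0
  then show ?case by (simp cong: continuous_on_cong)
next
  case (Suc k)
  have c: "continuous_on W g" using Suc.prems by (simp cong: continuous_on_cong)
  have "(\<forall>z\<in>W. rline j c g z differentiable (at 0)) \<and> Ck_on k n W (rpartial j c g)"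
    if j: "j < n" and c: "c \<in> {1, \<i>}" for j c
  proof -
    have d: "rline j c f z differentiable (at 0)" if "z \<in> W" for z
      using Suc.prems(2) j c that by auto
    then have d: "(rline j c f z has_vector_derivative rpartial j c f z) (at 0)" if "z \<in> W" for z
      using that unfolding rpartial_def by (simp add: vector_derivative_works)
    have d': "(rline j c g z has_vector_derivative rpartial j c f z) (at 0)" if "z \<in> W" for z
      using rline_deriv_cong[OF W that j Suc.prems(1) d[OF that]] by blast
    have "Ck_on k n W (rpartial j c g)"
    proof (rule Suc.IH)
      show "Ck_on k n W (rpartial j c f)" using Suc.prems(2) j c by auto
      show "rpartial j c f w = rpartial j c g w" if "w \<in> W" for w
        using rpartial_eqI[OF d'[OF that]] by simp
    qed
    then show ?thesis using d' differentiableI_vector by blast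
  qed
  with c show ?case by simp
qed

text \<open>The practical form of the recursion: any functions g that compute the derivatives on W
  may stand for \<open>rpartial\<close>.\<close>

lemma Ck_on_SucI:
  assumes W: "open_in_cspace n W" and c: "continuous_on W f"
    and d: "\<And>j c. j < n \<Longrightarrow> c \<in> {1, \<i>} \<Longrightarrow> Ck_on k n W (g j c)"
    and dd: "\<And>j c z. j < n \<Longrightarrow> c \<in> {1, \<i>} \<Longrightarrow> z \<in> W \<Longrightarrow>
               (rline j c f z has_vector_derivative g j c z) (at 0)"
  shows "Ck_on (Suc k) n W f"
proof -
  have "(\<forall>z\<in>W. rline j c f z differentiable (at 0)) \<and> Ck_on k n W (rpartial j c f)"
    if j: "j < n" and c: "c \<in> {1, \<i>}" for j c
  proof
    show "\<forall>z\<in>W. rline j c f z differentiable (at 0)"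
      using dd[OF j c] differentiableI_vector by blast
    show "Ck_on k n W (rpartial j c f)"
      using Ck_on_cong[OF W _ d[OF j c]] rpartial_eqI[OF dd[OF j c]] by simp
  qed
  with c show ?thesis by simp
qed

lemma Ck_on_SucD:
  assumes "Ck_on (Suc k) n W f" "j < n" "c \<in> {1, \<i>}"
  shows "Ck_on k n W (rpartial j c f)"
    and "z \<in> W \<Longrightarrow> (rline j c f z has_vector_derivative rpartial j c f z) (at 0)"
  using assms by (auto simp: rpartial_def vector_derivative_works[symmetric])

lemma Ck_on_continuous: "Ck_on k n W f \<Longrightarrow> continuous_on W f"
  by (cases k) auto

lemma Ck_on_mono: "Ck_on (Suc k) n W f \<Longrightarrow> Ck_on k n W f"
proof (induction k arbitrary: f)
  case (Suc k)
  have "continuous_on W f" using Suc.prems by simp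
  moreover have "(\<forall>z\<in>W. rline j c f z differentiable (at 0)) \<and> Ck_on k n W (rpartial j c f)"
    if j: "j < n" and c: "c \<in> {1, \<i>}" for j c
  proof -
    have "Ck_on (Suc k) n W (rpartial j c f)" using Suc.prems j c unfolding Ck_on.simps(2)[of "Suc k"] by blast
    moreover have "\<forall>z\<in>W. rline j c f z differentiable (at 0)"
      using Suc.prems j c unfolding Ck_on.simps(2)[of "Suc k"] by blast
    ultimately show ?thesis using Suc.IH by blast
  qed
  ultimately show ?case by (simp only: Ck_on.simps(2)) blast
qed simp

lemma rline_0 [simp]: "rline j c f z 0 = f z"
  by (simp add: rline_def)

lemma Ck_on_const: "open_in_cspace n W \<Longrightarrow> Ck_on k n W (\<lambda>z. a)"
proof (induction k arbitrary: a)
  case (Suc k)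
  show ?case
    by (rule Ck_on_SucI[where g="\<lambda>j c z. 0"])
       (use Suc in \<open>auto simp: rline_def\<close>)
qed simp

lemma Ck_on_add:
  assumes "open_in_cspace n W" "Ck_on k n W f" "Ck_on k n W g"
  shows "Ck_on k n W (\<lambda>z. f z + g z)"
  using assms(2,3)
proof (induction k arbitrary: f g)
  case (Suc k)
  show ?case
  proof (rule Ck_on_SucI[OF assms(1), where g="\<lambda>j c z. rpartial j c f z + rpartial j c g z"])
    show "continuous_on W (\<lambda>z. f z + g z)"
      using Suc.prems by (auto intro: continuous_intros)
    fix j c assume jc: "j < n" "c \<in> {1, \<i>}"
    show "Ck_on k n W (\<lambda>z. rpartial j c f z + rpartial j c g z)"
      by (intro Suc.IH Ck_on_SucD[OF _ jc] Suc.prems)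
    fix z assume "z \<in> W"
    from Ck_on_SucD(2)[OF Suc.prems(1) jc this] Ck_on_SucD(2)[OF Suc.prems(2) jc this]
    show "(rline j c (\<lambda>z. f z + g z) z has_vector_derivative rpartial j c f z + rpartial j c g z) (at 0)"
      unfolding rline_def by (rule has_vector_derivative_add)
  qed
qed (auto intro: continuous_intros)

lemma Ck_on_mult:
  assumes "open_in_cspace n W" "Ck_on k n W f" "Ck_on k n W g"
  shows "Ck_on k n W (\<lambda>z. f z * g z)"
  using assms(2,3)
proof (induction k arbitrary: f g)
  case (Suc k)
  show ?case
  proof (rule Ck_on_SucI[OF assms(1), where g="\<lambda>j c z. f z * rpartial j c g z + rpartial j c f z * g z"])
    show "continuous_on W (\<lambda>z. f z * g z)"
      using Suc.prems by (auto intro: continuous_intros)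
    fix j c assume jc: "j < n" "c \<in> {1, \<i>}"
    show "Ck_on k n W (\<lambda>z. f z * rpartial j c g z + rpartial j c f z * g z)"
      by (intro Ck_on_add[OF assms(1)] Suc.IH Ck_on_SucD(1)[OF _ jc] Suc.prems Ck_on_mono[OF Suc.prems(1)] Ck_on_mono[OF Suc.prems(2)])
    fix z assume "z \<in> W"
    from has_vector_derivative_mult[OF Ck_on_SucD(2)[OF Suc.prems(1) jc this] Ck_on_SucD(2)[OF Suc.prems(2) jc this]]
    show "(rline j c (\<lambda>z. f z * g z) z has_vector_derivative f z * rpartial j c g z + rpartial j c f z * g z) (at 0)"
      by (simp add: rline_def)
  qed
qed (auto intro: continuous_intros)

lemma Ck_on_cnj:
  assumes "open_in_cspace n W" "Ck_on k n W f"
  shows "Ck_on k n W (\<lambda>z. cnj (f z))"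
  using assms(2)
proof (induction k arbitrary: f)
  case (Suc k)
  show ?case
  proof (rule Ck_on_SucI[OF assms(1), where g="\<lambda>j c z. cnj (rpartial j c f z)"])
    show "continuous_on W (\<lambda>z. cnj (f z))"
      using Suc.prems by (auto intro: continuous_intros)
    fix j c assume jc: "j < n" "c \<in> {1, \<i>}"
    show "Ck_on k n W (\<lambda>z. cnj (rpartial j c f z))"
      by (intro Suc.IH Ck_on_SucD[OF _ jc] Suc.prems)
    fix z assume "z \<in> W"
    from Ck_on_SucD(2)[OF Suc.prems(1) jc this]
    show "(rline j c (\<lambda>z. cnj (f z)) z has_vector_derivative cnj (rpartial j c f z)) (at 0)"
      unfolding rline_def by (rule has_vector_derivative_cnj)
  qed
qed (auto intro: continuous_intros)

lemma Ck_on_inverse: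
  assumes "open_in_cspace n W" "Ck_on k n W f" and nz: "\<And>z. z \<in> W \<Longrightarrow> f z \<noteq> 0"
  shows "Ck_on k n W (\<lambda>z. inverse (f z))"
  using assms(2)
proof (induction k)
  case (Suc k)
  show ?case
  proof (rule Ck_on_SucI[OF assms(1), where g="\<lambda>j c z. (-1) * (rpartial j c f z * (inverse (f z) * inverse (f z)))"])
    show "continuous_on W (\<lambda>z. inverse (f z))"
      using Suc.prems nz by (auto intro: continuous_intros)
    have f: "Ck_on k n W (\<lambda>z. inverse (f z))" using Suc.IH Ck_on_mono[OF Suc.prems] by blast
    fix j c assume jc: "j < n" "c \<in> {1, \<i>}"
    show "Ck_on k n W (\<lambda>z. (-1) * (rpartial j c f z * (inverse (f z) * inverse (f z))))"
      by (intro Ck_on_mult[OF assms(1)] Ck_on_const[OF assms(1)] f Ck_on_SucD(1)[OF _ jc] Suc.prems)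
    fix z assume z: "z \<in> W"
    have "((inverse \<circ> rline j c f z) has_vector_derivative rpartial j c f z * (- (inverse (f z) ^ Suc (Suc 0)))) (at 0)"
      by (rule field_vector_diff_chain_at[OF Ck_on_SucD(2)[OF Suc.prems jc z]])
        (use DERIV_inverse[of "f z" UNIV] nz[OF z] in simp)
    then show "(rline j c (\<lambda>z. inverse (f z)) z has_vector_derivative (-1) * (rpartial j c f z * (inverse (f z) * inverse (f z)))) (at 0)"
      by (simp add: rline_def o_def)
  qed
qed (use nz in \<open>auto intro: continuous_intros\<close>)

lemma Ck_on_diff:
  assumes "open_in_cspace n W" "Ck_on k n W f" "Ck_on k n W g"
  shows "Ck_on k n W (\<lambda>z. f z - g z)"
  using Ck_on_add[OF assms(1,2) Ck_on_mult[OF assms(1) Ck_on_const[OF assms(1), of _ "-1"] assms(3)]] by simp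

lemma Ck_on_sum:
  assumes "open_in_cspace n W" "\<And>i. i \<in> I \<Longrightarrow> Ck_on k n W (f i)"
  shows "Ck_on k n W (\<lambda>z. \<Sum>i\<in>I. f i z)"
  using assms(2)
proof (induction I rule: infinite_finite_induct)
  case (insert x F)
  then show ?case by (simp add: Ck_on_add assms(1))
qed (auto simp: Ck_on_const assms(1))

lemma continuous_on_local:
  assumes "\<And>z. z \<in> W \<Longrightarrow> \<exists>V. open_in_cspace n V \<and> z \<in> V \<and> V \<subseteq> W \<and> continuous_on V f"
  shows "continuous_on W f"
proof -
  have W: "open_in_cspace n W"
    by (subst openin_subopen) (use assms in blast)
  have "continuous (at z within W) f" if z: "z \<in> W" for z
  proof -
    obtain V where V: "open_in_cspace n V" "z \<in> V" "V \<subseteq> W" "continuous_on V f"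
      using assms[OF z] by blast
    obtain O' where O': "open O'" "V = cspace n \<inter> O'"
      using V(1) by (auto simp: openin_open)
    then have "V = W \<inter> O'" using V(3) open_in_cspace_subset[OF W] by blast
    moreover have "at z within W = at z within (W \<inter> O')"
      using O' V(2) by (intro at_within_nhd[where S=O']) auto
    moreover have "continuous (at z within V) f"
      using V(2,4) by (simp add: continuous_on_eq_continuous_within)
    ultimately show ?thesis by simp
  qed
  then show ?thesis by (simp add: continuous_on_eq_continuous_within)
qed

lemma Ck_on_local:
  assumes "\<And>z. z \<in> W \<Longrightarrow> \<exists>V. open_in_cspace n V \<and> z \<in> V \<and> V \<subseteq> W \<and> Ck_on k n V f"
  shows "Ck_on k n W f"
  using assms
proof (induction k arbitrary: f)
  case 0
  then show ?case using continuous_on_local[of W n f] by simp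
next
  case (Suc k)
  have "continuous_on W f"
    using Suc.prems by (intro continuous_on_local[of W n f]) fastforce
  moreover have "(\<forall>z\<in>W. rline j c f z differentiable (at 0)) \<and> Ck_on k n W (rpartial j c f)"
    if j: "j < n" and c: "c \<in> {1, \<i>}" for j c
  proof
    show "\<forall>z\<in>W. rline j c f z differentiable (at 0)"
      using Suc.prems j c by fastforce
    show "Ck_on k n W (rpartial j c f)"
    proof (rule Suc.IH)
      fix z assume "z \<in> W"
      from Suc.prems[OF this] show "\<exists>V. open_in_cspace n V \<and> z \<in> V \<and> V \<subseteq> W \<and> Ck_on k n V (rpartial j c f)"
        using j c by (metis Ck_on.simps(2))
    qed
  qed
  ultimately show ?case by simp
qed

section \<open>Cauchy's formula and smoothness of holomorphic functions\<close>

lemma hol_on_slice_deriv: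
  assumes "hol_on n W f" "z \<in> W" "j < n"
  shows "((\<lambda>t. f (z(j := t))) has_field_derivative cpartial j f z) (at (z j))"
  using assms unfolding hol_on_def cpartial_def by (metis DERIV_deriv_iff_field_differentiable)

lemma hol_on_slice_holomorphic:
  assumes W: "open_in_cspace n W" and f: "hol_on n W f" and z: "z \<in> cspace n" and j: "j < n"
  shows "(\<lambda>t. f (z(j := t))) holomorphic_on {t. z(j := t) \<in> W}"
proof -
  have "(\<lambda>t. f (z(j := t))) field_differentiable (at s)" if "z(j := s) \<in> W" for s
    using hol_on_slice_deriv[OF f that j] by (simp add: field_differentiable_def) blast
  then show ?thesis
    by (auto simp: holomorphic_on_def intro: field_differentiable_at_within)
qed

text \<open>Separate holomorphy and continuity suffice: Cauchy's formula in the j-th variable represents the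
  partial derivative by an integral, which inherits continuity and holomorphy in the other variables.\<close>

lemma Cauchy_cpartial:
  assumes W: "open_in_cspace n W" and f: "hol_on n W f" and j: "j < n" and z0: "z0 \<in> W"
  obtains V r where "open_in_cspace n V" "z0 \<in> V" "V \<subseteq> W" "r > 0"
    "\<And>z \<zeta>. z \<in> V \<Longrightarrow> \<zeta> \<in> sphere (z0 j) r \<Longrightarrow> z(j := \<zeta>) \<in> W \<and> \<zeta> \<noteq> z j"
    "\<And>z. z \<in> V \<Longrightarrow> cpartial j f z = integral {0..1}
       (\<lambda>t. f (z(j := circlepath (z0 j) r t)) * (r * exp (2 * of_real pi * \<i> * of_real t) / (circlepath (z0 j) r t - z j)\<^sup>2))"
proof -
  obtain O' where O': "open O'" "W = cspace n \<inter> O'"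
    using W by (auto simp: openin_open)
  have "continuous_on UNIV (\<lambda>(z::cvec, t). z(j := t))"
    unfolding case_prod_unfold by (intro continuous_intros)
  then have "open ((\<lambda>(z::cvec, t). z(j := t)) -` O')"
    using O'(1) by (simp add: continuous_on_open_vimage)
  moreover have "(z0, z0 j) \<in> (\<lambda>(z::cvec, t). z(j := t)) -` O'"
    using z0 O'(2) by simp
  \<comment> \<open>A product neighbourhood: replacing the j-th coordinate of a point of A by any
    element of B leads to \<open>O'\<close>.\<close>
  ultimately obtain A B where AB: "open A" "open B" "z0 \<in> A" "z0 j \<in> B"
    "A \<times> B \<subseteq> (\<lambda>(z::cvec, t). z(j := t)) -` O'"
    by (rule open_prod_elim) (auto simp: mem_Times_iff)
  obtain r where r: "r > 0" "cball (z0 j) r \<subseteq> B"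
    using AB(2,4) open_contains_cball by blast
  \<comment> \<open>Points of V have their j-th coordinate strictly inside a fixed circle, so one
    contour serves for all of them.\<close>
  define V where "V = cspace n \<inter> (A \<inter> (\<lambda>z. z j) -` ball (z0 j) r \<inter> O')"
  have "open ((\<lambda>z::cvec. z j) -` ball (z0 j) r)"
    by (simp add: open_vimage)
  then have V: "open_in_cspace n V"
    unfolding V_def using AB(1) O'(1) by (intro openin_open_Int open_Int)
  have W': "z(j := \<zeta>) \<in> W" if "z \<in> V" "\<zeta> \<in> cball (z0 j) r" for z \<zeta>
  proof -
    have "(z, \<zeta>) \<in> A \<times> B" using that r(2) unfolding V_def by blast
    from subsetD[OF AB(5) this] have "z(j := \<zeta>) \<in> O'" by simp
    moreover have "z(j := \<zeta>) \<in> cspace n" using that(1) cspace_upd[OF _ j] unfolding V_def by blast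
    ultimately show ?thesis using O'(2) by blast
  qed
  show thesis
  proof (rule that[OF V _ _ r(1)])
    show "z0 \<in> V" using z0 AB(3) r(1) O' by (auto simp: V_def)
    show "V \<subseteq> W" using O'(2) by (auto simp: V_def)
    show "z(j := \<zeta>) \<in> W \<and> \<zeta> \<noteq> z j" if "z \<in> V" "\<zeta> \<in> sphere (z0 j) r" for z \<zeta>
      using that W'[of z \<zeta>] by (auto simp: V_def)
    fix z assume z: "z \<in> V"
    let ?g = "\<lambda>t. f (z(j := t))"
    have zc: "z \<in> cspace n" using z by (auto simp: V_def)
    have hol: "?g holomorphic_on cball (z0 j) r"
      by (rule holomorphic_on_subset[OF hol_on_slice_holomorphic[OF W f zc j]]) (use W'[OF z] in auto)
    have "(?g has_field_derivative (1 / (2 * of_real pi * \<i>) *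
        contour_integral (circlepath (z0 j) r) (\<lambda>u. ?g u / (u - z j)\<^sup>2))) (at (z j))"
    proof (rule Cauchy_derivative_integral_circlepath)
      show "continuous_on (cball (z0 j) r) ?g" by (rule holomorphic_on_imp_continuous_on[OF hol])
      show "?g holomorphic_on ball (z0 j) r" by (rule holomorphic_on_subset[OF hol]) auto
      show "z j \<in> ball (z0 j) r" using z by (auto simp: V_def)
    qed
    then have "cpartial j f z = 1 / (2 * of_real pi * \<i>) *
        contour_integral (circlepath (z0 j) r) (\<lambda>u. ?g u / (u - z j)\<^sup>2)"
      unfolding cpartial_def by (rule DERIV_imp_deriv)
    also have "contour_integral (circlepath (z0 j) r) (\<lambda>u. ?g u / (u - z j)\<^sup>2) =
        integral {0..1} (\<lambda>t. ?g (circlepath (z0 j) r t) / (circlepath (z0 j) r t - z j)\<^sup>2 *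
           (2 * pi * \<i> * r * exp (2 * of_real pi * \<i> * t)))"
      unfolding contour_integral_integral
      by (intro integral_cong) (simp add: vector_derivative_circlepath)
    also have "1 / (2 * of_real pi * \<i>) * \<dots> = integral {0..1}
       (\<lambda>t. ?g (circlepath (z0 j) r t) * (r * exp (2 * of_real pi * \<i> * of_real t) / (circlepath (z0 j) r t - z j)\<^sup>2))"
      unfolding integral_mult_right[symmetric]
      by (intro integral_cong) (simp add: field_simps)
    finally show "cpartial j f z = integral {0..1}
       (\<lambda>t. ?g (circlepath (z0 j) r t) * (r * exp (2 * of_real pi * \<i> * of_real t) / (circlepath (z0 j) r t - z j)\<^sup>2))" .
  qed
qed

lemma circlepath_in_sphere: "r > 0 \<Longrightarrow> circlepath z r t \<in> sphere z r"
  by (simp add: circlepath dist_norm norm_mult)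

lemma continuous_on_cpartial:
  assumes W: "open_in_cspace n W" and f: "hol_on n W f" and j: "j < n"
  shows "continuous_on W (cpartial j f)"
proof (rule continuous_on_local[of W n])
  fix z0 assume z0: "z0 \<in> W"
  obtain V r where V: "open_in_cspace n V" "z0 \<in> V" "V \<subseteq> W" "r > 0"
    and VW: "\<And>z \<zeta>. z \<in> V \<Longrightarrow> \<zeta> \<in> sphere (z0 j) r \<Longrightarrow> z(j := \<zeta>) \<in> W \<and> \<zeta> \<noteq> z j"
    and eq: "\<And>z. z \<in> V \<Longrightarrow> cpartial j f z = integral {0..1}
       (\<lambda>t. f (z(j := circlepath (z0 j) r t)) * (r * exp (2 * of_real pi * \<i> * of_real t) / (circlepath (z0 j) r t - z j)\<^sup>2))"
    by (rule Cauchy_cpartial[OF W f j z0]) (rule that)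
  have cf: "continuous_on W f" using f by (simp add: hol_on_def)
  define \<gamma> where "\<gamma> = circlepath (z0 j) r"
  have c\<gamma>: "continuous_on A \<gamma>" for A
    unfolding \<gamma>_def circlepath by (intro continuous_intros)
  have in_W: "z(j := \<gamma> t) \<in> W" and ne: "\<gamma> t - z j \<noteq> 0" if "z \<in> V" for z t
    using VW[OF that circlepath_in_sphere[OF V(4)]] by (auto simp: \<gamma>_def)
  have "continuous_on V (\<lambda>z. integral (cbox 0 1)
       (\<lambda>t. f (z(j := \<gamma> t)) * (r * exp (2 * of_real pi * \<i> * of_real t) / (\<gamma> t - z j)\<^sup>2)))"
  proof (rule integral_continuous_on_param)
    have c\<gamma>': "continuous_on (V \<times> cbox 0 (1::real)) (\<lambda>p. \<gamma> (snd p))"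
      by (rule continuous_on_compose2[OF c\<gamma>[of UNIV]]) (auto intro: continuous_intros)
    have 1: "continuous_on (V \<times> cbox 0 (1::real)) (\<lambda>p. f ((fst p)(j := \<gamma> (snd p))))"
      by (rule continuous_on_compose2[OF cf]) (use in_W in \<open>auto intro!: continuous_on_upd c\<gamma>'[simplified] continuous_on_fst continuous_on_id\<close>)
    have 2: "continuous_on (V \<times> cbox 0 (1::real)) (\<lambda>p. fst p j)"
      by (rule continuous_on_product_then_coordinatewise) (intro continuous_intros)
    show "continuous_on (V \<times> cbox 0 1) (\<lambda>(z, t). f (z(j := \<gamma> t)) * (r * exp (2 * of_real pi * \<i> * of_real t) / (\<gamma> t - z j)\<^sup>2))"
      unfolding case_prod_unfold
    proof (intro continuous_on_mult 1 continuous_on_divide continuous_on_power continuous_on_diff c\<gamma>' 2 ballI)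
      show "(\<gamma> (snd p) - fst p j)\<^sup>2 \<noteq> 0" if "p \<in> V \<times> cbox 0 1" for p
        using ne[of "fst p" "snd p"] that by auto
    qed (auto intro!: continuous_intros)
  qed
  then have "continuous_on V (cpartial j f)"
    using eq by (simp add: \<gamma>_def cong: continuous_on_cong)
  with V show "\<exists>V. open_in_cspace n V \<and> z0 \<in> V \<and> V \<subseteq> W \<and> continuous_on V (cpartial j f)"
    by blast
qed

text \<open>In direction j itself this is the holomorphy of the derivative in one variable. In
  another direction k, Cauchy's integral is differentiated under the integral sign; the continuity
  of \<open>cpartial k f\<close> that this requires is already available.\<close>

lemma hol_on_cpartial:
  assumes W: "open_in_cspace n W" and f: "hol_on n W f" and j: "j < n"
  shows "hol_on n W (cpartial j f)"
  unfolding hol_on_def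
proof (intro conjI ballI allI impI)
  show "continuous_on W (cpartial j f)" by (rule continuous_on_cpartial[OF assms])
  fix z0 k assume z0: "z0 \<in> W" and k: "k < n"
  have zc: "z0 \<in> cspace n" using z0 open_in_cspace_subset[OF W] by blast
  show "(\<lambda>t. cpartial j f (z0(k := t))) field_differentiable at (z0 k)"
  proof (cases "k = j")
    case True
    have "deriv (\<lambda>t. f (z0(j := t))) holomorphic_on {t. z0(j := t) \<in> W}"
      by (intro holomorphic_deriv hol_on_slice_holomorphic[OF W f zc j] open_slice[OF W zc j])
    moreover have "(\<lambda>t. cpartial j f (z0(k := t))) = deriv (\<lambda>t. f (z0(j := t)))"
      by (simp add: cpartial_def True)
    ultimately show ?thesis
      using z0 True holomorphic_on_imp_differentiable_at[OF _ open_slice[OF W zc j]] by auto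
  next
    case False
    obtain V r where V: "open_in_cspace n V" "z0 \<in> V" "V \<subseteq> W" "r > 0"
      and VW: "\<And>z \<zeta>. z \<in> V \<Longrightarrow> \<zeta> \<in> sphere (z0 j) r \<Longrightarrow> z(j := \<zeta>) \<in> W \<and> \<zeta> \<noteq> z j"
      and eq: "\<And>z. z \<in> V \<Longrightarrow> cpartial j f z = integral {0..1}
         (\<lambda>t. f (z(j := circlepath (z0 j) r t)) * (r * exp (2 * of_real pi * \<i> * of_real t) / (circlepath (z0 j) r t - z j)\<^sup>2))"
      by (rule Cauchy_cpartial[OF W f j z0]) (rule that)
    obtain e where e: "e > 0" "ball (z0 k) e \<subseteq> {t. z0(k := t) \<in> V}"
      using open_slice[OF V(1) zc k] V(2) open_contains_ball
      by (metis (mono_tags, lifting) fun_upd_triv mem_Collect_eq)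
    define U where "U = ball (z0 k) e"
    define K where "K = (\<lambda>t. r * exp (2 * of_real pi * \<i> * of_real t) / (circlepath (z0 j) r t - z0 j)\<^sup>2)"
    define \<gamma> where "\<gamma> = circlepath (z0 j) r"
    have UV: "z0(k := s) \<in> V" if "s \<in> U" for s using that e by (auto simp: U_def)
    have UW: "z0(k := s, j := \<gamma> t) \<in> W" if "s \<in> U" for s t
      using VW[OF UV[OF that]] circlepath_in_sphere[OF V(4)] by (auto simp: \<gamma>_def)
    have ne: "\<gamma> t \<noteq> z0 j" for t
      using circlepath_in_sphere[OF V(4), of "z0 j" t] V(4) by (auto simp: \<gamma>_def)
    have c\<gamma>: "continuous_on A \<gamma>" for A
      unfolding \<gamma>_def circlepath by (intro continuous_intros)
    have cK: "continuous_on A K" for A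
      unfolding K_def \<gamma>_def[symmetric]
      by (intro continuous_on_divide continuous_on_power continuous_on_diff c\<gamma>)
        (use ne in \<open>auto intro!: continuous_intros\<close>)
    have c\<gamma>': "continuous_on (U \<times> cbox 0 (1::real)) (\<lambda>p. \<gamma> (snd p))"
      by (rule continuous_on_compose2[OF c\<gamma>[of UNIV]]) (auto intro: continuous_intros)
    have c2: "continuous_on (U \<times> cbox 0 (1::real)) (\<lambda>p. g (z0(k := fst p, j := \<gamma> (snd p))))"
      if "continuous_on W g" for g :: "cvec \<Rightarrow> complex"
      by (rule continuous_on_compose2[OF that])
         (use UW in \<open>auto intro!: continuous_on_upd c\<gamma>'[simplified] continuous_on_fst continuous_on_id continuous_on_const\<close>)
    have eq': "cpartial j f (z0(k := s)) = integral (cbox 0 1) (\<lambda>t. f (z0(k := s, j := \<gamma> t)) * K t)"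
      if "s \<in> U" for s
      using eq[OF UV[OF that]] False by (simp add: K_def \<gamma>_def)
    have "((\<lambda>s. integral (cbox 0 1) (\<lambda>t. f (z0(k := s, j := \<gamma> t)) * K t)) has_field_derivative
        integral (cbox 0 1) (\<lambda>t. cpartial k f (z0(k := z0 k, j := \<gamma> t)) * K t)) (at (z0 k) within U)"
    proof (rule leibniz_rule_field_derivative)
      show "z0 k \<in> U" "convex U" using e(1) by (auto simp: U_def)
      have cK': "continuous_on (U \<times> cbox 0 (1::real)) (\<lambda>p. K (snd p))"
        by (rule continuous_on_compose2[OF cK[of UNIV]]) (auto intro: continuous_intros)
      have "continuous_on W (cpartial k f)" by (rule continuous_on_cpartial[OF W f k])
      from c2[OF this] show "continuous_on (U \<times> cbox 0 1) (\<lambda>(s, t). cpartial k f (z0(k := s, j := \<gamma> t)) * K t)"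
        unfolding case_prod_unfold by (intro continuous_on_mult cK')
      fix s assume s: "s \<in> U"
      have "continuous_on (cbox 0 1) (\<lambda>t. f (z0(k := s, j := \<gamma> t)))"
        by (rule continuous_on_compose2[of W f]) (use f UW[OF s] in \<open>auto simp: hol_on_def intro!: continuous_on_upd c\<gamma> continuous_on_const\<close>)
      from continuous_on_mult[OF this cK] show "(\<lambda>t. f (z0(k := s, j := \<gamma> t)) * K t) integrable_on cbox 0 1"
        by (rule integrable_continuous)
      fix t :: real
      have *: "((\<lambda>s'. f ((z0(k := s, j := \<gamma> t))(k := s'))) has_field_derivative cpartial k f (z0(k := s, j := \<gamma> t))) (at s)"
        using hol_on_slice_deriv[OF f UW[OF s, of t] k] False by simp
      have "((\<lambda>s'. f (z0(k := s', j := \<gamma> t))) has_field_derivative cpartial k f (z0(k := s, j := \<gamma> t))) (at s)"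
      proof -
        have "(z0(k := s, j := \<gamma> t))(k := s') = z0(k := s', j := \<gamma> t)" for s'
          using False by (auto simp: fun_eq_iff)
        then show ?thesis using * by simp
      qed
      from this show "((\<lambda>s'. f (z0(k := s', j := \<gamma> t)) * K t) has_field_derivative cpartial k f (z0(k := s, j := \<gamma> t)) * K t) (at s within U)"
        by (intro DERIV_cmult_right) (rule has_field_derivative_at_within)
    qed
    then have "((\<lambda>s. integral (cbox 0 1) (\<lambda>t. f (z0(k := s, j := \<gamma> t)) * K t)) has_field_derivative
        integral (cbox 0 1) (\<lambda>t. cpartial k f (z0(k := z0 k, j := \<gamma> t)) * K t)) (at (z0 k))"
      using e(1) at_within_open[of "z0 k" U] by (simp add: U_def)
    then have "((\<lambda>s. cpartial j f (z0(k := s))) has_field_derivative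
        integral (cbox 0 1) (\<lambda>t. cpartial k f (z0(k := z0 k, j := \<gamma> t)) * K t)) (at (z0 k))"
      by (rule has_field_derivative_transform_within_open[where S=U]) (use e(1) eq' in \<open>auto simp: U_def\<close>)
    then show ?thesis by (auto simp: field_differentiable_def)
  qed
qed

text \<open>The Cauchy-Riemann equations in disguise: the derivatives in the directions 1 and
  \<open>\<i>\<close> come from one complex derivative by the factor c.\<close>

lemma hol_on_rline:
  assumes "hol_on n W f" "z \<in> W" "j < n"
  shows "(rline j c f z has_vector_derivative c * cpartial j f z) (at 0)"
proof -
  have "((\<lambda>t. z j + of_real t * c) has_vector_derivative c) (at 0)"
    by (auto intro!: derivative_eq_intros)
  from field_vector_diff_chain_at[OF this, of "\<lambda>t. f (z(j := t))" "cpartial j f z"]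
  show ?thesis using hol_on_slice_deriv[OF assms] by (simp add: rline_def o_def)
qed

text \<open>The real derivatives are constant multiples of \<open>cpartial j f\<close>, which is
  again holomorphic; so the induction never leaves the holomorphic functions.\<close>

lemma hol_on_imp_Ck_on:
  assumes W: "open_in_cspace n W" and "hol_on n W f"
  shows "Ck_on k n W f"
  using assms(2)
proof (induction k arbitrary: f)
  case 0
  then show ?case by (simp add: hol_on_def)
next
  case (Suc k)
  show ?case
    by (rule Ck_on_SucI[OF W, where g="\<lambda>j c z. c * cpartial j f z"])
      (use Suc hol_on_rline[OF Suc.prems] hol_on_cpartial[OF W Suc.prems] in
        \<open>auto simp: hol_on_def intro!: Ck_on_mult[OF W] Ck_on_const[OF W]\<close>)
qed

section \<open>Rules for holomorphic functions and their partial derivatives\<close>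

lemma hol_on_subset: "hol_on n W f \<Longrightarrow> V \<subseteq> W \<Longrightarrow> hol_on n V f"
  unfolding hol_on_def by (meson continuous_on_subset subsetD)

lemma hol_on_cong:
  assumes W: "open_in_cspace n W" and f: "hol_on n W f" and eq: "\<And>z. z \<in> W \<Longrightarrow> f z = g z"
  shows "hol_on n W g"
  unfolding hol_on_def
proof (intro conjI ballI allI impI)
  show "continuous_on W g" using f eq by (simp add: hol_on_def cong: continuous_on_cong)
  fix z j assume z: "z \<in> W" and j: "j < n"
  have "((\<lambda>t. g (z(j := t))) has_field_derivative cpartial j f z) (at (z j))"
    by (rule has_field_derivative_transform_within_open[OF hol_on_slice_deriv[OF f z j] open_slice[OF W _ j]])
      (use z eq open_in_cspace_subset[OF W] in auto)
  then show "(\<lambda>t. g (z(j := t))) field_differentiable at (z j)"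
    by (auto simp: field_differentiable_def)
qed

lemma cpartial_eqI: "((\<lambda>t. f (z(j := t))) has_field_derivative D) (at (z j)) \<Longrightarrow> cpartial j f z = D"
  unfolding cpartial_def by (rule DERIV_imp_deriv)

lemma cpartial_cong:
  assumes W: "open_in_cspace n W" and z: "z \<in> W" and j: "j < n" and eq: "\<And>z. z \<in> W \<Longrightarrow> f z = g z"
  shows "cpartial j f z = cpartial j g z"
proof -
  have "open {t. z(j := t) \<in> W}" using open_slice[OF W _ j] z open_in_cspace_subset[OF W] by blast
  then have "\<forall>\<^sub>F t in nhds (z j). f (z(j := t)) = g (z(j := t))"
    using z eq by (auto simp: eventually_nhds intro!: exI[of _ "{t. z(j := t) \<in> W}"])
  then show ?thesis unfolding cpartial_def by (rule deriv_cong_ev) simp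
qed

lemma hol_on_const [simp]: "hol_on n W (\<lambda>z. a)"
  by (simp add: hol_on_def)

lemma hol_on_coord [simp]: "hol_on n W (\<lambda>z. z k)"
  unfolding hol_on_def
proof (intro conjI ballI allI impI)
  show "continuous_on W (\<lambda>z. z k)"
    by (rule continuous_on_product_then_coordinatewise) (intro continuous_intros)
  show "(\<lambda>t. (z(j := t)) k) field_differentiable at (z j)" for z :: cvec and j
    by (cases "j = k") auto
qed

lemma hol_on_add: "hol_on n W f \<Longrightarrow> hol_on n W g \<Longrightarrow> hol_on n W (\<lambda>z. f z + g z)"
  by (auto simp: hol_on_def intro!: continuous_intros field_differentiable_add)

lemma hol_on_diff: "hol_on n W f \<Longrightarrow> hol_on n W g \<Longrightarrow> hol_on n W (\<lambda>z. f z - g z)"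
  by (auto simp: hol_on_def intro!: continuous_intros field_differentiable_diff)

lemma hol_on_mult: "hol_on n W f \<Longrightarrow> hol_on n W g \<Longrightarrow> hol_on n W (\<lambda>z. f z * g z)"
  by (auto simp: hol_on_def intro!: continuous_intros field_differentiable_mult)

lemma hol_on_divide:
  "hol_on n W f \<Longrightarrow> hol_on n W g \<Longrightarrow> (\<And>z. z \<in> W \<Longrightarrow> g z \<noteq> 0) \<Longrightarrow> hol_on n W (\<lambda>z. f z / g z)"
  by (auto simp: hol_on_def intro!: continuous_intros field_differentiable_divide)

lemma hol_on_power: "hol_on n W f \<Longrightarrow> hol_on n W (\<lambda>z. f z ^ k)"
  by (induction k) (auto intro: hol_on_mult)

lemma hol_on_compose_holomorphic:
  assumes f: "hol_on n W f" and g: "g holomorphic_on S" "open S" and "\<And>z. z \<in> W \<Longrightarrow> f z \<in> S"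
  shows "hol_on n W (\<lambda>z. g (f z))"
  unfolding hol_on_def
proof (intro conjI ballI allI impI)
  show "continuous_on W (\<lambda>z. g (f z))"
    by (rule continuous_on_compose2[OF holomorphic_on_imp_continuous_on[OF g(1)]])
      (use assms in \<open>auto simp: hol_on_def\<close>)
  fix z j assume z: "z \<in> W" and j: "j < n"
  have "(g has_field_derivative deriv g (f z)) (at (f (z(j := z j))))"
    using holomorphic_derivI[OF g assms(4)[OF z]] by simp
  from DERIV_chain2[OF this hol_on_slice_deriv[OF f z j]]
  show "(\<lambda>t. g (f (z(j := t)))) field_differentiable at (z j)"
    by (auto simp: field_differentiable_def)
qed

lemma cpartial_add:
  assumes "hol_on n W f" "hol_on n W g" "z \<in> W" "j < n"
  shows "cpartial j (\<lambda>z. f z + g z) z = cpartial j f z + cpartial j g z"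
  by (rule cpartial_eqI) (intro DERIV_add hol_on_slice_deriv[OF _ assms(3,4)] assms)

lemma cpartial_mult:
  assumes "hol_on n W f" "hol_on n W g" "z \<in> W" "j < n"
  shows "cpartial j (\<lambda>z. f z * g z) z = cpartial j f z * g z + f z * cpartial j g z"
  by (rule cpartial_eqI)
    (use DERIV_mult[OF hol_on_slice_deriv[OF assms(1,3,4)] hol_on_slice_deriv[OF assms(2,3,4)]] in \<open>simp add: algebra_simps\<close>)

lemma cpartial_divide:
  assumes "hol_on n W f" "hol_on n W g" "z \<in> W" "j < n" "g z \<noteq> 0"
  shows "cpartial j (\<lambda>z. f z / g z) z = (cpartial j f z * g z - f z * cpartial j g z) / (g z * g z)"
  by (rule cpartial_eqI)
    (use DERIV_divide[OF hol_on_slice_deriv[OF assms(1,3,4)] hol_on_slice_deriv[OF assms(2,3,4)]] assms(5) in simp)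

lemma cpartial_const [simp]: "cpartial j (\<lambda>z. a) z = 0"
  by (rule cpartial_eqI) simp

lemma cpartial_coord: "cpartial j (\<lambda>z. z k) z = (if k = j then 1 else 0)"
  by (rule cpartial_eqI) (auto intro!: derivative_eq_intros)

section \<open>Holomorphic maps in dimension 2\<close>

text \<open>Pairs of complex numbers form a normed space, while \<open>cvec\<close> is used with its
  product topology only. Total derivatives are therefore taken on pairs and carried over by this
  map.\<close>

definition cv :: "complex \<times> complex \<Rightarrow> cvec"
  where "cv p = (\<lambda>i. if i = 0 then fst p else if i = 1 then snd p else 0)"

lemma cv_simps [simp]: "cv p 0 = fst p" "cv p (Suc 0) = snd p" "cv p \<in> cspace 2"
  by (auto simp: cv_def cspace_def)

lemma cv_coords [simp]: "z \<in> cspace 2 \<Longrightarrow> cv (z 0, z (Suc 0)) = z"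
  by (auto simp: cv_def cspace_def fun_eq_iff)

lemma cspace2_eqI: "z \<in> cspace 2 \<Longrightarrow> w \<in> cspace 2 \<Longrightarrow> z 0 = w 0 \<Longrightarrow> z 1 = w 1 \<Longrightarrow> z = w"
  by (metis One_nat_def cv_coords)

lemma cv_upd [simp]: "(cv (a, b))(0 := t) = cv (t, b)" "(cv (a, b))(Suc 0 := t) = cv (a, t)"
  by (auto simp: cv_def)

lemma continuous_on_cv [continuous_intros]:
  "continuous_on S f \<Longrightarrow> continuous_on S (\<lambda>x. cv (f x))"
proof (rule continuous_on_coordinatewise_then_product)
  fix i assume "continuous_on S f"
  then show "continuous_on S (\<lambda>x. cv (f x) i)"
    by (cases "i = 0"; cases "i = 1") (auto simp: cv_def intro!: continuous_on_fst continuous_on_snd)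
qed

lemma open_cv_vimage:
  assumes "open_in_cspace 2 W"
  shows "open (cv -` W)"
proof -
  obtain O' where O': "open O'" "W = cspace 2 \<inter> O'"
    using assms by (auto simp: openin_open)
  have "continuous_on UNIV cv" using continuous_on_cv[OF continuous_on_id] by simp
  then have "open (cv -` O')"
    using O'(1) by (simp add: continuous_on_open_vimage)
  moreover have "cv -` W = cv -` O'" using O'(2) by auto
  ultimately show ?thesis by simp
qed

lemma open_in_cspace_coords:
  assumes "open S"
  shows "open_in_cspace 2 {z \<in> cspace 2. (z 0, z (Suc 0)) \<in> S}"
proof -
  have "continuous_on UNIV (\<lambda>z::cvec. (z 0, z (Suc 0)))" by (intro continuous_intros) simp_all
  then have "open ((\<lambda>z::cvec. (z 0, z (Suc 0))) -` S)"
    using assms by (simp add: continuous_on_open_vimage)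
  moreover have "{z \<in> cspace 2. (z 0, z (Suc 0)) \<in> S} = cspace 2 \<inter> ((\<lambda>z::cvec. (z 0, z (Suc 0))) -` S)"
    by auto
  ultimately show ?thesis by (auto simp: openin_open)
qed

text \<open>Continuous partial derivatives give a total derivative. The second partial derivative is
  needed on a product neighbourhood with a convex second factor, the first one only at the
  point.\<close>

lemma hol_on_has_derivative:
  assumes W: "open_in_cspace 2 W" and f: "hol_on 2 W f" and z: "z \<in> W"
  shows "((\<lambda>p. f (cv p)) has_derivative (\<lambda>(a, b). cpartial 0 f z * a + cpartial (Suc 0) f z * b))
    (at (z 0, z (Suc 0)))"
proof -
  have zc: "z \<in> cspace 2" using z open_in_cspace_subset[OF W] by blast
  obtain A B where AB: "open A" "open B" "z 0 \<in> A" "z (Suc 0) \<in> B" "A \<times> B \<subseteq> cv -` W"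
    by (rule open_prod_elim[OF open_cv_vimage[OF W], of "(z 0, z (Suc 0))"])
      (use z zc in \<open>auto simp: mem_Times_iff\<close>)
  obtain e where e: "e > 0" "ball (z (Suc 0)) e \<subseteq> B" using AB open_contains_ball by blast
  define Y where "Y = ball (z (Suc 0)) e"
  have AY: "cv (x, y) \<in> W" if "x \<in> A" "y \<in> Y" for x y
  proof -
    have "(x, y) \<in> A \<times> B" using that e(2) by (auto simp: Y_def)
    then show ?thesis using AB(5) by blast
  qed
  have op: "open (A \<times> Y)" using AB(1) by (simp add: Y_def open_Times)
  have "((\<lambda>(x, y). f (cv (x, y))) has_derivative
       (\<lambda>(tx, ty). cpartial 0 f z * tx + blinfun_mult_right (cpartial (Suc 0) f (cv (z 0, z (Suc 0)))) ty))
     (at (z 0, z (Suc 0)) within A \<times> Y)"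
  proof (rule has_derivative_partialsI[where fy="\<lambda>x y. blinfun_mult_right (cpartial (Suc 0) f (cv (x, y)))"])
    show "z (Suc 0) \<in> Y" "convex Y" using e by (auto simp: Y_def)
    have "((\<lambda>t. f (z(0 := t))) has_field_derivative cpartial 0 f z) (at (z 0))"
      using hol_on_slice_deriv[OF f z, of 0] by simp
    moreover have "z(0 := t) = cv (t, z (Suc 0))" for t
      using cv_coords[OF zc] cv_upd(1)[of "z 0" "z (Suc 0)" t] by metis
    ultimately show "((\<lambda>x. f (cv (x, z (Suc 0)))) has_derivative (*) (cpartial 0 f z)) (at (z 0) within A)"
      by (simp add: has_field_derivative_def has_derivative_at_withinI)
    show "((\<lambda>y. f (cv (x, y))) has_derivative blinfun_apply (blinfun_mult_right (cpartial (Suc 0) f (cv (x, y))))) (at y within Y)"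
      if "x \<in> A" "y \<in> Y" for x y
      using hol_on_slice_deriv[OF f AY[OF that], of "Suc 0"]
      by (simp add: has_field_derivative_def has_derivative_at_withinI)
    have "continuous_on (A \<times> Y) (\<lambda>p. cpartial (Suc 0) f (cv p))"
      by (rule continuous_on_compose2[OF continuous_on_cpartial[OF W f, of "Suc 0"]])
        (use AY in \<open>auto intro!: continuous_intros\<close>)
    then have "continuous_on (A \<times> Y) (\<lambda>p. blinfun_mult_right (cpartial (Suc 0) f (cv p)))"
      by (rule bounded_linear.continuous_on[OF bounded_linear_blinfun_mult_right])
    then show "continuous (at (z 0, z (Suc 0)) within A \<times> Y) (\<lambda>(x, y). blinfun_mult_right (cpartial (Suc 0) f (cv (x, y))))"
      using AB(3) e(1) by (auto simp: continuous_on_eq_continuous_within Y_def case_prod_unfold)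
  qed
  then have "((\<lambda>p. f (cv p)) has_derivative
       (\<lambda>(tx, ty). cpartial 0 f z * tx + blinfun_mult_right (cpartial (Suc 0) f (cv (z 0, z (Suc 0)))) ty))
     (at (z 0, z (Suc 0)))"
    using at_within_open[OF _ op] AB(3) e(1) by (simp add: Y_def case_prod_unfold)
  then show ?thesis using zc by (simp add: case_prod_unfold)
qed

lemma hol_on_chain:
  assumes W: "open_in_cspace 2 W" and f: "hol_on 2 W f" and z: "g t \<in> W"
    and g: "\<And>s. g s \<in> cspace 2"
    and d: "((\<lambda>s. g s 0) has_field_derivative d0) (at t)" "((\<lambda>s. g s (Suc 0)) has_field_derivative d1) (at t)"
  shows "((\<lambda>s. f (g s)) has_field_derivative (cpartial 0 f (g t) * d0 + cpartial (Suc 0) f (g t) * d1)) (at t)"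
proof -
  have "((\<lambda>s. (g s 0, g s (Suc 0))) has_derivative (\<lambda>h. (d0 * h, d1 * h))) (at t)"
    using d by (intro has_derivative_Pair) (auto simp: has_field_derivative_def)
  from has_derivative_compose[OF this hol_on_has_derivative[OF W f z]]
  have "((\<lambda>s. f (cv (g s 0, g s (Suc 0)))) has_derivative
     (\<lambda>h. cpartial 0 f (g t) * (d0 * h) + cpartial (Suc 0) f (g t) * (d1 * h))) (at t)"
    by simp
  moreover have "(\<lambda>h. cpartial 0 f (g t) * (d0 * h) + cpartial (Suc 0) f (g t) * (d1 * h)) =
      (*) (cpartial 0 f (g t) * d0 + cpartial (Suc 0) f (g t) * d1)"
    by (auto simp: algebra_simps)
  ultimately show ?thesis using g by (simp add: has_field_derivative_def)
qed

section \<open>Holomorphic maps and the chain rule\<close>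

definition hol_map :: "cvec set \<Rightarrow> (cvec \<Rightarrow> cvec) \<Rightarrow> bool"
  where "hol_map W \<tau> \<longleftrightarrow> (\<forall>z\<in>W. \<tau> z \<in> cspace 2) \<and> (\<forall>k<2. hol_on 2 W (\<lambda>z. \<tau> z k))"

lemma hol_map_continuous:
  assumes "hol_map W \<tau>" shows "continuous_on W \<tau>"
proof (rule continuous_on_coordinatewise_then_product)
  fix i show "continuous_on W (\<lambda>z. \<tau> z i)"
  proof (cases "i < 2")
    case True then show ?thesis using assms by (simp add: hol_map_def hol_on_def)
  next
    case False
    then have "\<And>z. z \<in> W \<Longrightarrow> \<tau> z i = 0" using assms by (auto simp: hol_map_def cspace_def)
    then show ?thesis using continuous_on_const[of W 0] by (simp cong: continuous_on_cong)
  qed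
qed

lemma hol_map_deriv:
  assumes V: "open_in_cspace 2 V" and W: "open_in_cspace 2 W" and f: "hol_on 2 V f" and \<tau>: "hol_map W \<tau>" and z: "z \<in> W" "\<tau> z \<in> V" and j: "j < 2"
  shows "((\<lambda>t. f (\<tau> (z(j := t)))) has_field_derivative (\<Sum>a<2. cpartial a f (\<tau> z) * cpartial j (\<lambda>z. \<tau> z a) z)) (at (z j))"
proof -
  \<comment> \<open>Off W the map \<open>\<tau>\<close> is arbitrary, but
    \<open>hol_on_chain\<close> wants a curve that stays in \<open>cspace 2\<close> for all
    parameters; the default value provides it.\<close>
  define g where "g t = (if z(j := t) \<in> W then \<tau> (z(j := t)) else cv (0, 0))" for t
  have gc: "g t \<in> cspace 2" for t using \<tau> by (auto simp: g_def hol_map_def)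
  have op: "open {t. z(j := t) \<in> W}" using open_slice[OF W _ j] z open_in_cspace_subset[OF W] by blast
  have d: "((\<lambda>t. g t k) has_field_derivative cpartial j (\<lambda>z. \<tau> z k) z) (at (z j))" if "k < 2" for k
    by (rule has_field_derivative_transform_within_open[OF hol_on_slice_deriv[of 2 W "\<lambda>z. \<tau> z k" z j] op])
      (use \<tau> that z j in \<open>auto simp: g_def hol_map_def\<close>)
  have gz: "g (z j) = \<tau> z" using z by (simp add: g_def)
  have "((\<lambda>s. f (g s)) has_field_derivative (cpartial 0 f (g (z j)) * cpartial j (\<lambda>z. \<tau> z 0) z + cpartial (Suc 0) f (g (z j)) * cpartial j (\<lambda>z. \<tau> z (Suc 0)) z)) (at (z j))"
    by (rule hol_on_chain[OF V f]) (use z gz gc d in auto)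
  then have "((\<lambda>s. f (g s)) has_field_derivative (\<Sum>a<2. cpartial a f (\<tau> z) * cpartial j (\<lambda>z. \<tau> z a) z)) (at (z j))"
    by (simp add: gz numeral_2_eq_2)
  then show ?thesis
    by (rule has_field_derivative_transform_within_open[OF _ op]) (use z in \<open>auto simp: g_def\<close>)
qed

lemma hol_on_compose:
  assumes "open_in_cspace 2 V" "open_in_cspace 2 W" "hol_on 2 V f" and \<tau>: "hol_map W \<tau>" and "\<And>z. z \<in> W \<Longrightarrow> \<tau> z \<in> V"
  shows "hol_on 2 W (\<lambda>z. f (\<tau> z))"
  unfolding hol_on_def
proof (intro conjI ballI allI impI)
  show "continuous_on W (\<lambda>z. f (\<tau> z))"
    by (rule continuous_on_compose2[of V f]) (use assms hol_map_continuous[OF \<tau>] in \<open>auto simp: hol_on_def\<close>)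
  show "(\<lambda>t. f (\<tau> (z(j := t)))) field_differentiable at (z j)" if "z \<in> W" "j < 2" for z j
    unfolding field_differentiable_def
    by (rule exI) (rule hol_map_deriv[OF assms(1-4) that(1) assms(5)[OF that(1)] that(2)])
qed

lemma cpartial_compose:
  assumes "open_in_cspace 2 V" "open_in_cspace 2 W" "hol_on 2 V f" "hol_map W \<tau>" "z \<in> W" "\<tau> z \<in> V" "j < 2"
  shows "cpartial j (\<lambda>z. f (\<tau> z)) z = (\<Sum>a<2. cpartial a f (\<tau> z) * cpartial j (\<lambda>z. \<tau> z a) z)"
  by (rule cpartial_eqI) (rule hol_map_deriv[OF assms])

section \<open>The holomorphic inverse function theorem\<close>

text \<open>A complex 2 by 2 matrix as a real bounded linear map, the form in which
  \<open>inverse_function_theorem\<close> takes derivatives.\<close>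

definition blin2 :: "complex \<Rightarrow> complex \<Rightarrow> complex \<Rightarrow> complex \<Rightarrow> (complex \<times> complex) \<Rightarrow>\<^sub>L (complex \<times> complex)"
  where "blin2 a b c d = Blinfun (\<lambda>p. (a * fst p + b * snd p, c * fst p + d * snd p))"

lemma blin2_apply [simp]: "blinfun_apply (blin2 a b c d) p = (a * fst p + b * snd p, c * fst p + d * snd p)"
proof -
  have "bounded_linear (\<lambda>p::complex \<times> complex. (a * fst p + b * snd p, c * fst p + d * snd p))"
    by (intro bounded_linear_Pair bounded_linear_add bounded_linear_const_mult bounded_linear_fst bounded_linear_snd)
  then show ?thesis by (simp add: blin2_def bounded_linear_Blinfun_apply)
qed

lemma continuous_on_blin2:
  assumes "continuous_on S a" "continuous_on S b" "continuous_on S c" "continuous_on S d"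
  shows "continuous_on S (\<lambda>x. blin2 (a x) (b x) (c x) (d x))"
proof -
  have "linear (\<lambda>(a, b, c, d). blin2 a b c d)"
    by (rule linearI) (auto intro!: blinfun_eqI simp: blinfun.bilinear_simps algebra_simps scaleR_conv_of_real)
  then have "bounded_linear (\<lambda>(a, b, c, d). blin2 a b c d)"
    by (simp add: linear_conv_bounded_linear)
  from bounded_linear.continuous_on[OF this, of S "\<lambda>x. (a x, b x, c x, d x)"]
  show ?thesis using assms by (simp add: continuous_on_Pair)
qed

text \<open>The real theorem gives an inverse whose derivative is the inverse of the Jacobian. Since
  the Jacobian is complex linear, so is its inverse, and the inverse map is holomorphic in each
  variable.\<close>

theorem hol_inverse_function:
  assumes W: "open_in_cspace 2 W" and G: "hol_map W G" and w: "w \<in> W"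
    and det: "cpartial 0 (\<lambda>z. G z 0) w * cpartial 1 (\<lambda>z. G z 1) w - cpartial 1 (\<lambda>z. G z 0) w * cpartial 0 (\<lambda>z. G z 1) w \<noteq> 0"
  obtains U V g where "open_in_cspace 2 U" "w \<in> U" "U \<subseteq> W" "open_in_cspace 2 V" "hol_map V g"
    "\<And>z. z \<in> U \<Longrightarrow> G z \<in> V \<and> g (G z) = z" "\<And>v. v \<in> V \<Longrightarrow> g v \<in> U \<and> G (g v) = v"
proof -
  define F where "F p = (G (cv p) 0, G (cv p) (Suc 0))" for p
  define J where "J z = blin2 (cpartial 0 (\<lambda>z. G z 0) z) (cpartial (Suc 0) (\<lambda>z. G z 0) z)
      (cpartial 0 (\<lambda>z. G z (Suc 0)) z) (cpartial (Suc 0) (\<lambda>z. G z (Suc 0)) z)" for z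
  have Gh: "hol_on 2 W (\<lambda>z. G z k)" if "k < 2" for k using G that by (simp add: hol_map_def)
  have wc: "w \<in> cspace 2" using w W open_in_cspace_subset by blast
  have dF: "(F has_derivative blinfun_apply (J (cv p))) (at p)" if "p \<in> cv -` W" for p
  proof -
    have "(F has_derivative (\<lambda>h. ((\<lambda>(a, b). cpartial 0 (\<lambda>z. G z 0) (cv p) * a + cpartial (Suc 0) (\<lambda>z. G z 0) (cv p) * b) h,
        (\<lambda>(a, b). cpartial 0 (\<lambda>z. G z (Suc 0)) (cv p) * a + cpartial (Suc 0) (\<lambda>z. G z (Suc 0)) (cv p) * b) h))) (at p)"
      unfolding F_def
      using hol_on_has_derivative[OF W Gh[of 0], of "cv p"] hol_on_has_derivative[OF W Gh[of "Suc 0"], of "cv p"] that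
      by (intro has_derivative_Pair) auto
    moreover have "(\<lambda>h. ((\<lambda>(a, b). cpartial 0 (\<lambda>z. G z 0) (cv p) * a + cpartial (Suc 0) (\<lambda>z. G z 0) (cv p) * b) h,
        (\<lambda>(a, b). cpartial 0 (\<lambda>z. G z (Suc 0)) (cv p) * a + cpartial (Suc 0) (\<lambda>z. G z (Suc 0)) (cv p) * b) h)) = blinfun_apply (J (cv p))"
      by (auto simp: J_def)
    ultimately show ?thesis by simp
  qed
  have cJ: "continuous_on (cv -` W) (\<lambda>p. J (cv p))"
    unfolding J_def
    by (intro continuous_on_blin2 continuous_on_compose2[OF continuous_on_cpartial[OF W Gh]])
      (auto intro!: continuous_intros)
  define D where "D = cpartial 0 (\<lambda>z. G z 0) w * cpartial (Suc 0) (\<lambda>z. G z (Suc 0)) w - cpartial (Suc 0) (\<lambda>z. G z 0) w * cpartial 0 (\<lambda>z. G z (Suc 0)) w"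
  have D: "D \<noteq> 0" using det by (simp add: D_def)
  \<comment> \<open>The adjugate matrix divided by the determinant.\<close>
  have inv: "blin2 (cpartial (Suc 0) (\<lambda>z. G z (Suc 0)) w / D) (- cpartial (Suc 0) (\<lambda>z. G z 0) w / D)
      (- cpartial 0 (\<lambda>z. G z (Suc 0)) w / D) (cpartial 0 (\<lambda>z. G z 0) w / D) o\<^sub>L J (cv (w 0, w (Suc 0))) = id_blinfun"
  proof (rule blinfun_eqI)
    fix p :: "complex \<times> complex"
    define a b c d where "a = cpartial 0 (\<lambda>z. G z 0) w" "b = cpartial (Suc 0) (\<lambda>z. G z 0) w"
      "c = cpartial 0 (\<lambda>z. G z (Suc 0)) w" "d = cpartial (Suc 0) (\<lambda>z. G z (Suc 0)) w"
    have Dd: "D = a * d - b * c" by (simp add: D_def a_b_c_d_def)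
    have "d / D * (a * x + b * y) + - b / D * (c * x + d * y) = x" for x y
    proof -
      have "d / D * (a * x + b * y) + - b / D * (c * x + d * y) = (d * (a * x + b * y) - b * (c * x + d * y)) / D"
        by (simp add: diff_divide_distrib)
      also have "d * (a * x + b * y) - b * (c * x + d * y) = D * x" by (simp add: Dd algebra_simps)
      finally show ?thesis using D by simp
    qed
    moreover have "- c / D * (a * x + b * y) + a / D * (c * x + d * y) = y" for x y
    proof -
      have "- c / D * (a * x + b * y) + a / D * (c * x + d * y) = (a * (c * x + d * y) - c * (a * x + b * y)) / D"
        by (simp add: diff_divide_distrib)
      also have "a * (c * x + d * y) - c * (a * x + b * y) = D * y" by (simp add: Dd algebra_simps)
      finally show ?thesis using D by simp
    qed
    ultimately show "blinfun_apply (blin2 (cpartial (Suc 0) (\<lambda>z. G z (Suc 0)) w / D) (- cpartial (Suc 0) (\<lambda>z. G z 0) w / D)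
      (- cpartial 0 (\<lambda>z. G z (Suc 0)) w / D) (cpartial 0 (\<lambda>z. G z 0) w / D) o\<^sub>L J (cv (w 0, w (Suc 0)))) p = blinfun_apply id_blinfun p"
      by (simp add: J_def wc a_b_c_d_def[symmetric] prod_eq_iff)
  qed
  have wU: "(w 0, w (Suc 0)) \<in> cv -` W" using w wc by simp
  obtain U' V' g g' where I: "open U'" "U' \<subseteq> cv -` W" "(w 0, w (Suc 0)) \<in> U'" "open V'" "F (w 0, w (Suc 0)) \<in> V'"
      "homeomorphism U' V' F g" "\<And>y. y \<in> V' \<Longrightarrow> (g has_derivative (g' y)) (at y)"
      "\<And>y. y \<in> V' \<Longrightarrow> g' y = inv (blinfun_apply (J (cv (g y))))"
      "\<And>y. y \<in> V' \<Longrightarrow> bij (blinfun_apply (J (cv (g y))))"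
    by (rule inverse_function_theorem[OF open_cv_vimage[OF W] dF cJ wU inv]) (assumption, rule that, assumption+)
  define U where "U = {z \<in> cspace 2. (z 0, z (Suc 0)) \<in> U'}"
  define V where "V = {z \<in> cspace 2. (z 0, z (Suc 0)) \<in> V'}"
  define k where "k v = cv (g (v 0, v (Suc 0)))" for v
  have Uo: "open_in_cspace 2 U" and Vo: "open_in_cspace 2 V"
    unfolding U_def V_def using I by (auto intro: open_in_cspace_coords)
  have UW: "U \<subseteq> W" using I(2) by (auto simp: U_def dest!: subsetD)
  have gU: "g y \<in> U'" "F (g y) = y" if "y \<in> V'" for y using I(6) that by (auto simp: homeomorphism_def)
  have FV: "F p \<in> V'" "g (F p) = p" if "p \<in> U'" for p using I(6) that by (auto simp: homeomorphism_def)
  \<comment> \<open>Homogeneity under complex scalars passes to the inverse: both sides have the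
    same image under the Jacobian, which is injective.\<close>
  have lin: "g' y (c * x, c * x') = (c * fst (g' y (x, x')), c * snd (g' y (x, x')))" if "y \<in> V'" for y c x x'
  proof -
    let ?L = "blinfun_apply (J (cv (g y)))"
    have "?L (g' y (x, x')) = (x, x')"
      using I(8,9)[OF that] by (simp add: bij_is_surj surj_f_inv_f del: blin2_apply)
    then have "?L (c * fst (g' y (x, x')), c * snd (g' y (x, x'))) = (c * x, c * x')"
      by (auto simp: J_def mult.left_commute[of _ c] simp flip: distrib_left)
    then show ?thesis
      using I(8,9)[OF that] by (metis bij_inv_eq_iff)
  qed
  have kd: "((\<lambda>t. k (v(j := t)) i) has_field_derivative (if i = 0 then fst else snd) (g' (v 0, v (Suc 0)) (if j = 0 then (1, 0) else (0, 1)))) (at (v j))"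
    if v: "v \<in> V" and j: "j < 2" and i: "i < 2" for v j i
  proof -
    have vc: "v \<in> cspace 2" and vV: "(v 0, v (Suc 0)) \<in> V'" using v by (auto simp: V_def)
    note dg = I(7)[OF vV]
    have d1: "((\<lambda>t. ((v(j := t)) 0, (v(j := t)) (Suc 0))) has_derivative (\<lambda>h. if j = 0 then (h * 1, h * 0) else (h * 0, h * 1))) (at (v j))"
      using j by (cases "j = 0") (auto simp: less_2_cases_iff intro!: has_derivative_Pair derivative_eq_intros)
    have "((\<lambda>t. g ((v(j := t)) 0, (v(j := t)) (Suc 0))) has_derivative (\<lambda>h. g' (v 0, v (Suc 0)) (if j = 0 then (h * 1, h * 0) else (h * 0, h * 1)))) (at (v j))"
      by (rule has_derivative_compose[OF d1]) (use dg in simp)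
    moreover have e: "g' (v 0, v (Suc 0)) (if j = 0 then (h * 1, h * 0) else (h * 0, h * 1)) =
        (h * fst (g' (v 0, v (Suc 0)) (if j = 0 then (1, 0) else (0, 1))),
         h * snd (g' (v 0, v (Suc 0)) (if j = 0 then (1, 0) else (0, 1))))" for h
    proof (cases "j = 0")
      case True
      show ?thesis unfolding if_P[OF True] by (rule lin[OF vV])
    next
      case False
      show ?thesis unfolding if_not_P[OF False] by (rule lin[OF vV])
    qed
    ultimately have d2: "((\<lambda>t. g ((v(j := t)) 0, (v(j := t)) (Suc 0))) has_derivative (\<lambda>h. (h * fst (g' (v 0, v (Suc 0)) (if j = 0 then (1, 0) else (0, 1))),
        h * snd (g' (v 0, v (Suc 0)) (if j = 0 then (1, 0) else (0, 1)))))) (at (v j))"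
      by (metis (no_types, lifting) has_derivative_eq_rhs ext)
    show ?thesis
      using has_derivative_fst[OF d2] has_derivative_snd[OF d2] i
      by (auto simp: k_def cv_def has_field_derivative_def less_2_cases_iff mult_commute_abs)
  qed
  have gc: "continuous_on V' g" using I(6) by (simp add: homeomorphism_def)
  have "hol_map V k"
    unfolding hol_map_def hol_on_def
  proof (intro conjI ballI allI impI)
    show "k z \<in> cspace 2" for z by (simp add: k_def)
    show "continuous_on V (\<lambda>z. k z i)" for i
      unfolding k_def
      by (rule continuous_on_product_then_coordinatewise)
        (auto simp: V_def intro!: continuous_intros continuous_on_compose2[OF gc] continuous_on_product_then_coordinatewise[of _ "\<lambda>x. x"])
    show "(\<lambda>t. k (z(j := t)) i) field_differentiable at (z j)" if "i < 2" "z \<in> V" "j < 2" for i z j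
      using kd[OF that(2,3,1)] by (auto simp: field_differentiable_def)
  qed
  moreover have "G z \<in> V \<and> k (G z) = z" if "z \<in> U" for z
  proof -
    have zU: "(z 0, z (Suc 0)) \<in> U'" "z \<in> cspace 2" using that by (auto simp: U_def)
    have "G z \<in> cspace 2" using G UW that by (auto simp: hol_map_def)
    moreover have "F (z 0, z (Suc 0)) = (G z 0, G z (Suc 0))" using zU by (simp add: F_def)
    ultimately show ?thesis using FV[OF zU(1)] zU(2) by (auto simp: V_def k_def)
  qed
  moreover have "k v \<in> U \<and> G (k v) = v" if "v \<in> V" for v
  proof -
    have vV: "(v 0, v (Suc 0)) \<in> V'" "v \<in> cspace 2" using that by (auto simp: V_def)
    have kU: "k v \<in> U" using gU[OF vV(1)] by (simp add: U_def k_def)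
    then have Gc: "G (k v) \<in> cspace 2" using G UW by (auto simp: hol_map_def)
    have "F (g (v 0, v (Suc 0))) = (v 0, v (Suc 0))" using gU[OF vV(1)] by simp
    then have "G (k v) 0 = v 0" "G (k v) (Suc 0) = v (Suc 0)" by (auto simp: F_def k_def)
    then show ?thesis using cspace2_eqI[OF Gc vV(2)] kU by simp
  qed
  moreover have "w \<in> U" using I(3) wc by (simp add: U_def)
  ultimately show thesis using that[OF Uo _ UW Vo] by blast
qed

section \<open>The Fubini-Study form and its derivatives\<close>

text \<open>The Wirtinger derivatives of f at z in the j-th variable exist and are a and b.\<close>

definition WD :: "nat \<Rightarrow> (cvec \<Rightarrow> complex) \<Rightarrow> cvec \<Rightarrow> complex \<Rightarrow> complex \<Rightarrow> bool"
  where "WD j f z a b \<longleftrightarrow> (rline j 1 f z has_vector_derivative (a + b)) (at 0) \<and>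
    (rline j \<i> f z has_vector_derivative (\<i> * (a - b))) (at 0)"

lemma WD_d_z: "WD j f z a b \<Longrightarrow> d_z j f z = a"
  and WD_d_zbar: "WD j f z a b \<Longrightarrow> d_zbar j f z = b"
  unfolding WD_def d_z_def d_zbar_def by (auto simp: rpartial_eqI algebra_simps)

lemma WD_cong:
  assumes "open_in_cspace n W" "z \<in> W" "j < n" "\<And>w. w \<in> W \<Longrightarrow> f w = g w" "WD j f z a b"
  shows "WD j g z a b"
  using assms(5) rline_deriv_cong[OF assms(1-3), of f g] assms(4) unfolding WD_def by blast

lemma Ck_on_WD:
  assumes "Ck_on (Suc k) n W f" "z \<in> W" "j < n"
  shows "WD j f z (d_z j f z) (d_zbar j f z)"
  using Ck_on_SucD(2)[OF assms(1,3) _ assms(2), of 1] Ck_on_SucD(2)[OF assms(1,3) _ assms(2), of \<i>]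
  by (auto simp: WD_def d_z_def d_zbar_def field_simps)

lemma WD_hol:
  assumes "hol_on n W f" "z \<in> W" "j < n"
  shows "WD j f z (cpartial j f z) 0"
  using hol_on_rline[OF assms, of 1] hol_on_rline[OF assms, of \<i>] by (simp add: WD_def)

lemma WD_cnj:
  assumes "WD j f z a b"
  shows "WD j (\<lambda>z. cnj (f z)) z (cnj b) (cnj a)"
proof -
  have eq: "rline j e (\<lambda>z. cnj (f z)) z = (\<lambda>t. cnj (rline j e f z t))" for e
    by (simp add: rline_def)
  show ?thesis
    using has_vector_derivative_cnj[OF conjunct1[OF assms[unfolded WD_def]]]
      has_vector_derivative_cnj[OF conjunct2[OF assms[unfolded WD_def]]]
    unfolding WD_def eq by (simp add: algebra_simps)
qed

lemma WD_const: "WD j (\<lambda>z. c) z 0 0"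
  by (simp add: WD_def rline_def)

lemma WD_add:
  assumes "WD j f z a b" "WD j g z c d"
  shows "WD j (\<lambda>z. f z + g z) z (a + c) (b + d)"
proof -
  have eq: "rline j e (\<lambda>z. f z + g z) z = (\<lambda>t. rline j e f z t + rline j e g z t)" for e
    by (simp add: rline_def)
  show ?thesis
    using assms has_vector_derivative_add[of "rline j 1 f z" "a + b" "at 0" "rline j 1 g z" "c + d"]
      has_vector_derivative_add[of "rline j \<i> f z" "\<i> * (a - b)" "at 0" "rline j \<i> g z" "\<i> * (c - d)"]
    unfolding WD_def eq by (simp add: algebra_simps)
qed

lemma WD_mult:
  assumes "WD j f z a b" "WD j g z c d"
  shows "WD j (\<lambda>z. f z * g z) z (a * g z + f z * c) (b * g z + f z * d)"
proof -
  have eq: "rline j e (\<lambda>z. f z * g z) z = (\<lambda>t. rline j e f z t * rline j e g z t)" for e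
    by (simp add: rline_def)
  show ?thesis
    using has_vector_derivative_mult[of "rline j 1 f z" "a + b" 0 UNIV "rline j 1 g z" "c + d"]
      has_vector_derivative_mult[of "rline j \<i> f z" "\<i> * (a - b)" 0 UNIV "rline j \<i> g z" "\<i> * (c - d)"] assms
    unfolding WD_def eq by (simp add: algebra_simps)
qed

lemma WD_diff:
  assumes "WD j f z a b" "WD j g z c d"
  shows "WD j (\<lambda>z. f z - g z) z (a - c) (b - d)"
  using WD_add[OF assms(1) WD_mult[OF WD_const[of j "-1"] assms(2)]] by simp

lemma WD_inverse:
  assumes "WD j f z a b" "f z \<noteq> 0"
  shows "WD j (\<lambda>z. inverse (f z)) z (- a / (f z)\<^sup>2) (- b / (f z)\<^sup>2)"
proof -
  have "(rline j e (\<lambda>z. inverse (f z)) z has_vector_derivative D * (- (inverse (f z) ^ Suc (Suc 0)))) (at 0)"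
    if "(rline j e f z has_vector_derivative D) (at 0)" for e D
  proof -
    have "((inverse \<circ> rline j e f z) has_vector_derivative D * (- (inverse (f z) ^ Suc (Suc 0)))) (at 0)"
      by (rule field_vector_diff_chain_at[OF that]) (use DERIV_inverse[of "f z" UNIV] assms(2) in simp)
    then show ?thesis by (simp add: rline_def o_def)
  qed
  from this[of 1 "a + b"] this[of \<i> "\<i> * (a - b)"] assms show ?thesis
    by (simp add: WD_def power2_eq_square divide_inverse algebra_simps)
qed

lemma WD_sum:
  assumes "\<And>i. i \<in> I \<Longrightarrow> WD j (f i) z (a i) (b i)"
  shows "WD j (\<lambda>z. \<Sum>i\<in>I. f i z) z (\<Sum>i\<in>I. a i) (\<Sum>i\<in>I. b i)"
  using assms by (induction I rule: infinite_finite_induct) (auto simp: WD_const intro!: WD_add)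

section \<open>The Hermitian product and the Fubini-Study form\<close>

definition ip :: "cvec \<Rightarrow> cvec \<Rightarrow> complex"
  where "ip a b = (\<Sum>k<4. a k * cnj (b k))"

lemma ip_cnj: "cnj (ip a b) = ip b a"
  by (simp add: ip_def cnj_sum mult.commute)

lemma ip_add_left: "ip (\<lambda>k. a k + a' k) b = ip a b + ip a' b"
  and ip_scale_left: "ip (\<lambda>k. c * a k) b = c * ip a b"
  and ip_add_right: "ip b (\<lambda>k. a k + a' k) = ip b a + ip b a'"
  and ip_scale_right: "ip b (\<lambda>k. c * a k) = cnj c * ip b a"
  and ip_diff_left: "ip (\<lambda>k. a k - a' k) b = ip a b - ip a' b"
  and ip_diff_right: "ip b (\<lambda>k. a k - a' k) = ip b a - ip b a'"
  by (simp_all add: ip_def algebra_simps sum.distrib sum_subtractf sum_distrib_left)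

lemmas ip_simps = ip_add_left ip_add_right ip_scale_left ip_scale_right ip_diff_left ip_diff_right

lemma ip_cong: "(\<And>k. k < 4 \<Longrightarrow> a k = a' k) \<Longrightarrow> (\<And>k. k < 4 \<Longrightarrow> b k = b' k) \<Longrightarrow> ip a b = ip a' b'"
  by (simp add: ip_def)

lemma ip_self: "ip a a = of_real (\<Sum>k<4. (cmod (a k))\<^sup>2)"
  by (simp add: ip_def complex_norm_square[symmetric])

lemma ip_self_pos: "k < 4 \<Longrightarrow> a k \<noteq> 0 \<Longrightarrow> Re (ip a a) > 0"
  unfolding ip_self by (simp, rule sum_pos2[of _ k]) auto

lemma ip_self_nonzero: "k < 4 \<Longrightarrow> a k \<noteq> 0 \<Longrightarrow> ip a a \<noteq> 0"
  using ip_self_pos[of k a] by auto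

lemma Re_ip_mult: "Re (ip a b * ip b a) \<ge> 0"
  by (subst ip_cnj[symmetric, of a b]) (simp add: complex_mult_cnj)

text \<open>The Fubini-Study product at the point with homogeneous coordinates P of the tangent vectors
  represented by a and b. Adding multiples of P to them does not change it (\<open>fs_invariant\<close>).\<close>

definition fs :: "cvec \<Rightarrow> cvec \<Rightarrow> cvec \<Rightarrow> complex"
  where "fs P a b = (ip a b * ip P P - ip a P * ip P b) * (inverse (ip P P) * inverse (ip P P))"

text \<open>The numerator of \<open>fs\<close> is the Gram determinant of a, P against b, P, so
  multiples of P drop out. Both it and the square of \<open>ip P P\<close> scale by the fourth power
  of the modulus of l. This is why the form does not depend on the lift to homogeneous
  coordinates.\<close>

lemma fs_invariant:
  assumes "l \<noteq> 0"
  shows "fs (\<lambda>k. l * P k) (\<lambda>k. l * a k + m * P k) (\<lambda>k. l * b k + n * P k) = fs P a b"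
proof -
  have 1: "ip (\<lambda>k. l * a k + m * P k) (\<lambda>k. l * b k + n * P k) * ip (\<lambda>k. l * P k) (\<lambda>k. l * P k) -
      ip (\<lambda>k. l * a k + m * P k) (\<lambda>k. l * P k) * ip (\<lambda>k. l * P k) (\<lambda>k. l * b k + n * P k) =
      (l * cnj l) * (l * cnj l) * (ip a b * ip P P - ip a P * ip P b)"
    by (simp add: ip_simps algebra_simps)
  have 2: "ip (\<lambda>k. l * P k) (\<lambda>k. l * P k) = (l * cnj l) * ip P P"
    by (simp add: ip_simps algebra_simps)
  have 3: "l * cnj l \<noteq> 0" using assms by simp
  have "(c * c * x) * (inverse (c * N) * inverse (c * N)) = x * (inverse N * inverse N)" if "c \<noteq> 0" for c x N :: complex
    using that by (simp add: inverse_mult_distrib field_simps)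
  note 4 = this[OF 3]
  show ?thesis unfolding fs_def 1 unfolding 2 by (rule 4)
qed

lemma fs_cnj: "cnj (fs P a b) = fs P b a"
  unfolding fs_def by (simp add: ip_cnj algebra_simps)

definition pd :: "nat \<Rightarrow> (cvec \<Rightarrow> cvec) \<Rightarrow> cvec \<Rightarrow> cvec"
  where "pd j E z = (\<lambda>k. cpartial j (\<lambda>w. E w k) z)"

definition holv :: "nat \<Rightarrow> cvec set \<Rightarrow> (cvec \<Rightarrow> cvec) \<Rightarrow> bool"
  where "holv n W E \<longleftrightarrow> (\<forall>k<4. hol_on n W (\<lambda>z. E z k))"

lemma holv_pd: "open_in_cspace n W \<Longrightarrow> holv n W E \<Longrightarrow> j < n \<Longrightarrow> holv n W (pd j E)"
  unfolding holv_def pd_def by (auto intro: hol_on_cpartial[unfolded cpartial_def] hol_on_cpartial)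

text \<open>E is holomorphic and the conjugate of F antiholomorphic, so each Wirtinger derivative
  falls on one factor only.\<close>

lemma WD_ip:
  assumes "holv n W E" "holv n W F" "z \<in> W" "j < n"
  shows "WD j (\<lambda>z. ip (E z) (F z)) z (ip (pd j E z) (F z)) (ip (E z) (pd j F z))"
proof -
  have "WD j (\<lambda>z. E z k * cnj (F z k)) z (pd j E z k * cnj (F z k) + E z k * cnj 0) (0 * cnj (F z k) + E z k * cnj (pd j F z k))"
    if "k < 4" for k
    using assms that unfolding pd_def holv_def by (intro WD_mult WD_cnj WD_hol) auto
  from WD_sum[of "{..<4}", OF this] show ?thesis by (simp add: ip_def)
qed

lemma Ck_on_ip:
  assumes W: "open_in_cspace n W" and "holv n W E" "holv n W F"
  shows "Ck_on k n W (\<lambda>z. ip (E z) (F z))"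
  unfolding ip_def using assms(2,3) unfolding holv_def
  by (intro Ck_on_sum Ck_on_mult Ck_on_cnj hol_on_imp_Ck_on W) auto

lemma Ck_on_fs:
  assumes W: "open_in_cspace n W" and "holv n W P" "holv n W E" "holv n W F" "\<And>z. z \<in> W \<Longrightarrow> ip (P z) (P z) \<noteq> 0"
  shows "Ck_on k n W (\<lambda>z. fs (P z) (E z) (F z))"
  unfolding fs_def
  by (intro Ck_on_mult Ck_on_diff Ck_on_inverse Ck_on_ip W assms)

text \<open>The hypotheses at z are a normalization, achieved by rescaling P and adding multiples of P to
  P, E and F. The subtracted terms of the mixed derivative are the curvature of projective space.\<close>

lemma fs_derivs:
  assumes W: "open_in_cspace n W" and P: "holv n W P" and E: "holv n W E" and F: "holv n W F"
    and nz: "\<And>z. z \<in> W \<Longrightarrow> ip (P z) (P z) \<noteq> 0" and z: "z \<in> W" and i: "i < n" and j: "j < n"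
    and N1: "ip (P z) (P z) = 1"
    and o: "ip (E z) (P z) = 0" "ip (F z) (P z) = 0"
      "\<And>i. i < n \<Longrightarrow> ip (pd i P z) (P z) = 0" "\<And>i. i < n \<Longrightarrow> ip (pd i E z) (P z) = 0" "\<And>i. i < n \<Longrightarrow> ip (pd i F z) (P z) = 0"
  shows "d_z i (\<lambda>z. fs (P z) (E z) (F z)) z = ip (pd i E z) (F z)"
    and "d_zbar j (\<lambda>z. fs (P z) (E z) (F z)) z = ip (E z) (pd j F z)"
    and "d_z i (d_zbar j (\<lambda>z. fs (P z) (E z) (F z))) z =
      ip (pd i E z) (pd j F z) - ip (E z) (F z) * ip (pd i P z) (pd j P z) - ip (E z) (pd j P z) * ip (pd i P z) (F z)"
proof -
  have o': "ip (P z) (E z) = 0" "ip (P z) (F z) = 0" "\<And>i. i < n \<Longrightarrow> ip (P z) (pd i P z) = 0"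
     "\<And>i. i < n \<Longrightarrow> ip (P z) (pd i E z) = 0" "\<And>i. i < n \<Longrightarrow> ip (P z) (pd i F z) = 0"
    using o by (metis ip_cnj complex_cnj_zero)+
  let ?N = "\<lambda>z. ip (P z) (P z)"
  let ?M = "\<lambda>z. ip (E z) (F z) * ip (P z) (P z) - ip (E z) (P z) * ip (P z) (F z)"
  let ?I = "\<lambda>z. inverse (ip (P z) (P z))"
  \<comment> \<open>The normalization holds at z alone, but a second differentiation needs the first
    derivatives on a neighbourhood; hence the unsimplified formula at every point of W.\<close>
  have gen: "WD j (\<lambda>z. fs (P z) (E z) (F z)) z
     (((ip (pd j E z) (F z) * ?N z + ip (E z) (F z) * ip (pd j P z) (P z)) - (ip (pd j E z) (P z) * ip (P z) (F z) + ip (E z) (P z) * ip (pd j P z) (F z))) * (?I z * ?I z)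
        + ?M z * (- ip (pd j P z) (P z) / (?N z)\<^sup>2 * ?I z + ?I z * (- ip (pd j P z) (P z) / (?N z)\<^sup>2)))
     (((ip (E z) (pd j F z) * ?N z + ip (E z) (F z) * ip (P z) (pd j P z)) - (ip (E z) (pd j P z) * ip (P z) (F z) + ip (E z) (P z) * ip (P z) (pd j F z))) * (?I z * ?I z)
        + ?M z * (- ip (P z) (pd j P z) / (?N z)\<^sup>2 * ?I z + ?I z * (- ip (P z) (pd j P z) / (?N z)\<^sup>2)))"
    if "z \<in> W" "j < n" for z j
    unfolding fs_def
    by (intro WD_mult WD_diff WD_inverse WD_ip[OF E F that] WD_ip[OF P P that] WD_ip[OF E P that] WD_ip[OF P F that] nz that)
  show "d_z i (\<lambda>z. fs (P z) (E z) (F z)) z = ip (pd i E z) (F z)"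
    using WD_d_z[OF gen[OF z i]] o o' i N1 by simp
  show "d_zbar j (\<lambda>z. fs (P z) (E z) (F z)) z = ip (E z) (pd j F z)"
    using WD_d_zbar[OF gen[OF z j]] o o' j N1 by simp
  define B where "B z = ((ip (E z) (pd j F z) * ?N z + ip (E z) (F z) * ip (P z) (pd j P z)) - (ip (E z) (pd j P z) * ip (P z) (F z) + ip (E z) (P z) * ip (P z) (pd j F z))) * (?I z * ?I z)
        - ?M z * (2 * (ip (P z) (pd j P z) * (?I z * ?I z * ?I z)))" for z
  have BB: "d_zbar j (\<lambda>z. fs (P z) (E z) (F z)) z = B z" if "z \<in> W" for z
    using WD_d_zbar[OF gen[OF that j]] by (simp add: B_def power2_eq_square divide_inverse)
  note pP = holv_pd[OF W P j] and pF = holv_pd[OF W F j]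
  note dI = WD_inverse[OF WD_ip[OF P P z i] nz[OF z]]
  note dA = WD_add[OF WD_mult[OF WD_ip[OF E pF z i] WD_ip[OF P P z i]] WD_mult[OF WD_ip[OF E F z i] WD_ip[OF P pP z i]]]
  note dP = WD_add[OF WD_mult[OF WD_ip[OF E pP z i] WD_ip[OF P F z i]] WD_mult[OF WD_ip[OF E P z i] WD_ip[OF P pF z i]]]
  note dM = WD_diff[OF WD_mult[OF WD_ip[OF E F z i] WD_ip[OF P P z i]] WD_mult[OF WD_ip[OF E P z i] WD_ip[OF P F z i]]]
  note dB = WD_diff[OF WD_mult[OF WD_diff[OF dA dP] WD_mult[OF dI dI]]
    WD_mult[OF dM WD_mult[OF WD_const[of i 2] WD_mult[OF WD_ip[OF P pP z i] WD_mult[OF WD_mult[OF dI dI] dI]]]]]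
  \<comment> \<open>The derivative of B is assembled from the product rules and evaluated at z,
    where the orthogonality relations remove nearly all of its terms.\<close>
  have "\<exists>x y. WD i B z x y \<and> x = ip (pd i E z) (pd j F z) - ip (E z) (F z) * ip (pd i P z) (pd j P z) - ip (E z) (pd j P z) * ip (pd i P z) (F z)"
    unfolding B_def by (rule exI, rule exI, rule conjI, rule dB) (simp add: o o' i j N1)
  then obtain x y where xy: "WD i B z x y"
    "x = ip (pd i E z) (pd j F z) - ip (E z) (F z) * ip (pd i P z) (pd j P z) - ip (E z) (pd j P z) * ip (pd i P z) (F z)"
    by blast
  have "WD i (d_zbar j (\<lambda>z. fs (P z) (E z) (F z))) z x y"
    by (rule WD_cong[OF W z i _ xy(1)]) (use BB in simp)
  from WD_d_z[OF this] xy(2) show "d_z i (d_zbar j (\<lambda>z. fs (P z) (E z) (F z))) z =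
      ip (pd i E z) (pd j F z) - ip (E z) (F z) * ip (pd i P z) (pd j P z) - ip (E z) (pd j P z) * ip (pd i P z) (F z)"
    by simp
qed

section \<open>Linear algebra and Hermitian matrices of rank 2\<close>

text \<open>Gaussian elimination: an equation is removed together with an unknown whose coefficient
  in it does not vanish.\<close>

lemma underdetermined_system:
  fixes a :: "'i \<Rightarrow> 'k \<Rightarrow> 'f::field"
  assumes "finite K" "finite I" "card K < card I"
  shows "\<exists>c. (\<exists>i\<in>I. c i \<noteq> 0) \<and> (\<forall>k\<in>K. (\<Sum>i\<in>I. c i * a i k) = 0)"
  using assms
proof (induction K arbitrary: I a rule: finite_induct)
  case empty
  then obtain i where "i \<in> I" by fastforce
  then show ?case by (intro exI[of _ "\<lambda>_. 1"]) auto
next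
  case (insert k0 K)
  show ?case
  proof (cases "\<forall>i\<in>I. a i k0 = 0")
    case True
    have "card K < card I" using insert by simp
    from insert.IH[OF insert.prems(1) this, of a] True show ?thesis by auto
  next
    case False
    then obtain i0 where i0: "i0 \<in> I" "a i0 k0 \<noteq> 0" by blast
    have "card K < card (I - {i0})" using insert i0 by simp
    from insert.IH[OF _ this, of "\<lambda>i k. a i k - a i k0 / a i0 k0 * a i0 k"] insert.prems(1)
    obtain c where c: "\<exists>i\<in>I - {i0}. c i \<noteq> 0"
      "\<And>k. k \<in> K \<Longrightarrow> (\<Sum>i\<in>I - {i0}. c i * (a i k - a i k0 / a i0 k0 * a i0 k)) = 0" by blast
    define c' where "c' = c(i0 := - (\<Sum>i\<in>I - {i0}. c i * (a i k0 / a i0 k0)))"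
    have *: "(\<Sum>i\<in>I. c' i * a i k) = (\<Sum>i\<in>I - {i0}. c i * (a i k - a i k0 / a i0 k0 * a i0 k))" for k
    proof -
      have "(\<Sum>i\<in>I. c' i * a i k) = c' i0 * a i0 k + (\<Sum>i\<in>I - {i0}. c i * a i k)"
        using sum.remove[OF insert.prems(1) i0(1), of "\<lambda>i. c' i * a i k"] by (simp add: c'_def)
      then show ?thesis
        by (simp add: c'_def sum_subtractf sum_distrib_right right_diff_distrib mult.assoc)
    qed
    have "(\<Sum>i\<in>I. c' i * a i k) = 0" if "k \<in> insert k0 K" for k
      using that c(2) i0(2) unfolding * by auto
    moreover have "\<exists>i\<in>I. c' i \<noteq> 0" using c(1) by (auto simp: c'_def)
    ultimately show ?thesis by blast
  qed
qed

lemma rpartial_cong: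
  assumes "open_in_cspace n W" "z \<in> W" "j < n" "\<And>w. w \<in> W \<Longrightarrow> f w = g w"
  shows "rpartial j c f z = rpartial j c g z"
proof -
  have "(rline j c f z has_vector_derivative D) (at 0) \<longleftrightarrow> (rline j c g z has_vector_derivative D) (at 0)" for D
    using rline_deriv_cong[OF assms(1-3), of f g c D] rline_deriv_cong[OF assms(1-3), of g f c D] assms(4) by auto
  then show ?thesis by (simp add: rpartial_def vector_derivative_def)
qed

lemma d_z_cong:
  assumes "open_in_cspace n W" "z \<in> W" "j < n" "\<And>w. w \<in> W \<Longrightarrow> f w = g w"
  shows "d_z j f z = d_z j g z" "d_zbar j f z = d_zbar j g z"
  using rpartial_cong[OF assms(1-3), of f g] assms(4) by (simp_all add: d_z_def d_zbar_def)

lemma sum_lessThan_2: "(\<Sum>i<2. f i) = f 0 + f (Suc 0)" for f :: "nat \<Rightarrow> 'a::comm_monoid_add"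
  by (simp add: numeral_2_eq_2)

lemma chern_curvature_cong:
  assumes W: "open_in_cspace 2 W" and z: "z \<in> W" and "i < 2" "j < 2" "a < 2" "b < 2"
    and eq: "\<And>w a b. w \<in> W \<Longrightarrow> a < 2 \<Longrightarrow> b < 2 \<Longrightarrow> h w a b = g w a b"
  shows "chern_curvature 2 h z i j a b = chern_curvature 2 g z i j a b"
proof -
  have "d_z i (d_zbar j (\<lambda>w. h w a b)) z = d_z i (d_zbar j (\<lambda>w. g w a b)) z"
  proof (rule d_z_cong(1)[OF W z \<open>i < 2\<close>])
    fix w assume w: "w \<in> W"
    show "d_zbar j (\<lambda>w. h w a b) w = d_zbar j (\<lambda>w. g w a b) w"
      by (rule d_z_cong(2)[OF W w \<open>j < 2\<close>]) (rule eq[OF _ \<open>a < 2\<close> \<open>b < 2\<close>])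
  qed
  moreover have "d_z i (\<lambda>w. h w a d) z = d_z i (\<lambda>w. g w a d) z" "d_zbar j (\<lambda>w. h w d b) z = d_zbar j (\<lambda>w. g w d b) z" if "d < 2" for d
  proof -
    show "d_z i (\<lambda>w. h w a d) z = d_z i (\<lambda>w. g w a d) z"
      by (rule d_z_cong(1)[OF W z \<open>i < 2\<close>]) (rule eq[OF _ \<open>a < 2\<close> that])
    show "d_zbar j (\<lambda>w. h w d b) z = d_zbar j (\<lambda>w. g w d b) z"
      by (rule d_z_cong(2)[OF W z \<open>j < 2\<close>]) (rule eq[OF _ that \<open>b < 2\<close>])
  qed
  \<comment> \<open>The predicates under the choice operator only involve entries with indices below
    2, so they coincide, and with them the chosen matrices.\<close>
  moreover have "inverse_metric 2 (h z) = inverse_metric 2 (g z)"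
    using eq[OF z] by (simp add: inverse_metric_def sum_lessThan_2 less_2_cases_iff all_conj_distrib)
  ultimately show ?thesis by (simp add: chern_curvature_def)
qed

text \<open>The pointwise condition of \<open>hermitian_metric\<close> for rank 2.\<close>

definition herm2 :: "(nat \<Rightarrow> nat \<Rightarrow> complex) \<Rightarrow> bool"
  where "herm2 H \<longleftrightarrow> (\<forall>a<2. \<forall>b<2. H a b = cnj (H b a)) \<and>
    (\<forall>v\<in>cspace 2 - {czero}. Re (\<Sum>a<2. \<Sum>b<2. H a b * v a * cnj (v b)) > 0)"

definition det2 :: "(nat \<Rightarrow> nat \<Rightarrow> complex) \<Rightarrow> complex"
  where "det2 H = H 0 0 * H 1 1 - H 0 1 * H 1 0"

lemma cv_nonzero: "a \<noteq> 0 \<or> b \<noteq> 0 \<Longrightarrow> cv (a, b) \<in> cspace 2 - {czero}"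
  using cv_simps(1,2)[of "(a, b)"] by (auto simp: czero_def simp del: cv_simps(1,2))

lemma cspace2_nonzero: "v \<in> cspace 2 - {czero} \<Longrightarrow> v 0 \<noteq> 0 \<or> v (Suc 0) \<noteq> 0"
  using cspace2_eqI[of v czero] by (auto simp: czero_def cspace_def)

lemma herm2_pos:
  assumes "herm2 H"
  shows "Re (H 0 0) > 0" "Im (H 0 0) = 0" "Re (det2 H) > 0" "Im (det2 H) = 0"
proof -
  have hc: "H a b = cnj (H b a)" if "a < 2" "b < 2" for a b
    using assms that unfolding herm2_def by blast
  have c: "cnj (H 0 0) = H 0 0" "cnj (H 1 1) = H 1 1" "cnj (H 1 0) = H 0 1" "cnj (H 0 1) = H 1 0"
    by (rule sym, rule hc; simp)+
  have pos: "Re (\<Sum>a<2. \<Sum>b<2. H a b * v a * cnj (v b)) > 0" if "v \<in> cspace 2 - {czero}" for v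
    using assms that unfolding herm2_def by blast
  show p0: "Re (H 0 0) > 0"
    using pos[OF cv_nonzero[of 1 0]] by (simp add: sum_lessThan_2)
  show i0: "Im (H 0 0) = 0" using c(1) by (simp add: complex_eq_iff)
  have "cnj (det2 H) = det2 H" using c by (simp add: det2_def mult.commute)
  then show "Im (det2 H) = 0" by (simp add: complex_eq_iff)
  \<comment> \<open>On this vector the form takes the value \<open>H 0 0 * det2 H\<close>, which
    carries the sign of the determinant.\<close>
  have "cv (- H 1 0, H 0 0) \<in> cspace 2 - {czero}" by (rule cv_nonzero) (use p0 in auto)
  note pos[OF this]
  also have "(\<Sum>a<2. \<Sum>b<2. H a b * cv (- H 1 0, H 0 0) a * cnj (cv (- H 1 0, H 0 0) b)) = H 0 0 * det2 H"
    using c by (simp add: sum_lessThan_2 det2_def algebra_simps)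
  finally have "Re (H 0 0) * Re (det2 H) > 0" using i0 by simp
  then show "Re (det2 H) > 0" using p0 by (simp add: zero_less_mult_iff)
qed

text \<open>The transpose of the adjugate divided by the determinant solves the equations, so the
  choice in \<open>inverse_metric\<close> is a choice among existing solutions.\<close>

lemma inverse_metric2:
  assumes "det2 H \<noteq> 0" "a < 2" "g < 2"
  shows "(\<Sum>d<2. H a d * inverse_metric 2 H g d) = (if a = g then 1 else 0)"
proof -
  define G :: "nat \<Rightarrow> nat \<Rightarrow> complex" where
    "G g d = (if g = 0 then (if d = 0 then H 1 1 else - H 1 0) else (if d = 0 then - H 0 1 else H 0 0)) / det2 H" for g d
  have G': "G 0 0 = H 1 1 / det2 H" "G 0 (Suc 0) = - H 1 0 / det2 H"
    "G (Suc 0) 0 = - H 0 1 / det2 H" "G (Suc 0) (Suc 0) = H 0 0 / det2 H"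
    by (simp_all add: G_def)
  have "H 0 0 * G 0 0 + H 0 (Suc 0) * G 0 (Suc 0) = det2 H / det2 H"
    "H (Suc 0) 0 * G (Suc 0) 0 + H (Suc 0) (Suc 0) * G (Suc 0) (Suc 0) = det2 H / det2 H"
    "H 0 0 * G (Suc 0) 0 + H 0 (Suc 0) * G (Suc 0) (Suc 0) = 0 / det2 H"
    "H (Suc 0) 0 * G 0 0 + H (Suc 0) (Suc 0) * G 0 (Suc 0) = 0 / det2 H"
    unfolding G' times_divide_eq_right add_divide_distrib[symmetric]
    by (simp_all add: det2_def mult.commute)
  then have "\<forall>a<2. \<forall>g<2. (\<Sum>d<2. H a d * G g d) = (if a = g then 1 else 0)"
    using assms(1) by (auto simp: sum_lessThan_2 less_2_cases_iff)
  then have "\<forall>a<2. \<forall>g<2. (\<Sum>d<2. H a d * inverse_metric 2 H g d) = (if a = g then 1 else 0)"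
    unfolding inverse_metric_def
    by (rule someI[where P="\<lambda>G. \<forall>a<2. \<forall>g<2. (\<Sum>d<2. H a d * G g d) = (if a = g then 1 else 0)"])
  then show ?thesis using assms by blast
qed

section \<open>RC-positivity of a Fubini-Study form\<close>

text \<open>The second fundamental form of u and v is the part of the derivative Q of v along u that
  is orthogonal to P and the frame E. Five vectors of 4-space are dependent: the derivatives of v in
  the two coordinate directions, the two frame vectors and P. The dependency yields a direction u
  for which Q lies in the span of the frame. Then the term with the second derivatives cancels
  against the term with the inverse metric, and the curvature of projective space is left. The frame
  E is not tied to the derivatives of P, because frame and coordinates may come from different
  charts.\<close>

lemma fs_rc_positive_normalized:
  fixes E :: "nat \<Rightarrow> cvec \<Rightarrow> cvec"
  assumes W: "open_in_cspace 2 W" and P: "holv 2 W P" and E: "\<And>a. a < 2 \<Longrightarrow> holv 2 W (E a)"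
    and nz: "\<And>z. z \<in> W \<Longrightarrow> ip (P z) (P z) \<noteq> 0" and z: "z \<in> W"
    and N1: "ip (P z) (P z) = 1"
    and o: "\<And>a. a < 2 \<Longrightarrow> ip (E a z) (P z) = 0" "\<And>i. i < 2 \<Longrightarrow> ip (pd i P z) (P z) = 0"
      "\<And>a i. a < 2 \<Longrightarrow> i < 2 \<Longrightarrow> ip (pd i (E a) z) (P z) = 0"
    and indE: "\<And>c d. (\<And>k. k < 4 \<Longrightarrow> c * E 0 z k + d * E 1 z k = 0) \<Longrightarrow> c = 0 \<and> d = 0"
    and indP: "\<And>c d. (\<And>k. k < 4 \<Longrightarrow> c * pd 0 P z k + d * pd 1 P z k = 0) \<Longrightarrow> c = 0 \<and> d = 0"
    and v: "v \<in> cspace 2 - {czero}"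
  shows "\<exists>u\<in>cspace 2 - {czero}. Re (\<Sum>k<2. \<Sum>l<2. \<Sum>a<2. \<Sum>b<2.
    chern_curvature 2 (\<lambda>w a b. fs (P w) (E a w) (E b w)) z k l a b * u k * cnj (u l) * v a * cnj (v b)) > 0"
proof -
  define H where "H a b = ip (E a z) (E b z)" for a b
  have o': "\<And>a. a < 2 \<Longrightarrow> ip (P z) (E a z) = 0"
    using o(1) by (metis ip_cnj complex_cnj_zero)
  have Hfs: "fs (P z) (E a z) (E b z) = H a b" if "a < 2" "b < 2" for a b
    using o o' N1 that by (simp add: fs_def H_def)
  define ev where "ev w = (\<lambda>k. w 0 * E 0 z k + w 1 * E 1 z k)" for w :: cvec
  have Hv: "(\<Sum>a<2. \<Sum>b<2. H a b * w a * cnj (w b)) = ip (ev w) (ev w)" for w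
    by (simp add: H_def ev_def ip_simps sum_lessThan_2 algebra_simps)
  have ev_ne: "\<exists>k<4. ev w k \<noteq> 0" if "w \<in> cspace 2 - {czero}" for w
    using indE[of "w 0" "w 1"] cspace2_nonzero[OF that] by (auto simp: ev_def)
  have herm: "herm2 H"
    unfolding herm2_def Hv
  proof (intro conjI allI impI ballI)
    show "H a b = cnj (H b a)" for a b by (simp add: H_def ip_cnj)
    show "Re (ip (ev w) (ev w)) > 0" if "w \<in> cspace 2 - {czero}" for w
      using ev_ne[OF that] ip_self_pos by blast
  qed
  then have det: "det2 H \<noteq> 0" using herm2_pos(3) by fastforce
  define G where "G = inverse_metric 2 H"
  have G: "(\<Sum>d<2. H a d * G g d) = (if a = g then 1 else 0)" if "a < 2" "g < 2" for a g
    unfolding G_def by (rule inverse_metric2[OF det that])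
  have Gm: "inverse_metric 2 (\<lambda>a b. fs (P z) (E a z) (E b z)) = G"
    using Hfs by (simp add: G_def inverse_metric_def sum_lessThan_2 less_2_cases_iff all_conj_distrib)
  have chern: "chern_curvature 2 (\<lambda>w a b. fs (P w) (E a w) (E b w)) z k l a b =
      - (ip (pd k (E a) z) (pd l (E b) z) - H a b * ip (pd k P z) (pd l P z) - ip (E a z) (pd l P z) * ip (pd k P z) (E b z))
      + (\<Sum>g<2. \<Sum>d<2. G g d * ip (pd k (E a) z) (E d z) * ip (E g z) (pd l (E b) z))"
    if "k < 2" "l < 2" "a < 2" "b < 2" for k l a b
  proof -
    have D: "d_z k (\<lambda>z. fs (P z) (E a z) (E d z)) z = ip (pd k (E a) z) (E d z)"
         "d_zbar l (\<lambda>z. fs (P z) (E d z) (E b z)) z = ip (E d z) (pd l (E b) z)" if "d < 2" for d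
      by (rule fs_derivs[OF W P _ _ nz z _ _ N1]; use that E o \<open>k < 2\<close> \<open>l < 2\<close> \<open>a < 2\<close> \<open>b < 2\<close> in simp)+
    have "d_z k (d_zbar l (\<lambda>z. fs (P z) (E a z) (E b z))) z =
       ip (pd k (E a) z) (pd l (E b) z) - H a b * ip (pd k P z) (pd l P z) - ip (E a z) (pd l P z) * ip (pd k P z) (E b z)"
      unfolding H_def
      by (rule fs_derivs[OF W P _ _ nz z _ _ N1]) (use that E o in simp_all)
    then show ?thesis
      unfolding chern_curvature_def Gm by (simp add: D)
  qed
  define A where "A i = (\<lambda>k. v 0 * pd i (E 0) z k + v 1 * pd i (E 1) z k)" for i
  define vec where "vec i = (if i < 2 then A i else if i = 2 then E 0 z else if i = 3 then E 1 z else P z)" for i :: nat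
  obtain c where c: "\<exists>i<5. c i \<noteq> 0" "\<And>k. k < 4 \<Longrightarrow> (\<Sum>i<5. c i * vec i k) = 0"
    using underdetermined_system[of "{..<4::nat}" "{..<5::nat}" vec] by auto
  have c5: "c 0 * A 0 k + c 1 * A 1 k + c 2 * E 0 z k + c 3 * E 1 z k + c 4 * P z k = 0" if "k < 4" for k
    using c(2)[OF that] by (simp add: vec_def eval_nat_numeral)
  define Q where "Q = (\<lambda>k. c 0 * A 0 k + c 1 * A 1 k)"
  have oA: "ip (A i) (P z) = 0" if "i < 2" for i using o(3) that by (simp add: A_def ip_simps)
  have "ip (\<lambda>k. c 0 * A 0 k + c 1 * A 1 k + c 2 * E 0 z k + c 3 * E 1 z k + c 4 * P z k) (P z) = ip (\<lambda>k. 0) (P z)"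
    by (rule ip_cong) (use c5 in auto)
  then have c4: "c 4 = 0" using oA o(1) N1 by (simp add: ip_simps) (simp add: ip_def)
  have Qk: "Q k = - c 2 * E 0 z k + - c 3 * E 1 z k" if "k < 4" for k
    using c5[OF that] c4 by (simp add: Q_def algebra_simps eq_neg_iff_add_eq_0)
  \<comment> \<open>The coefficient of P has been seen to vanish, so otherwise only a dependency
    between the frame vectors would remain.\<close>
  have "c 0 \<noteq> 0 \<or> c 1 \<noteq> 0"
  proof (rule ccontr)
    assume n: "\<not> (c 0 \<noteq> 0 \<or> c 1 \<noteq> 0)"
    then have "c 2 = 0 \<and> c 3 = 0" using c5 c4 by (intro indE) auto
    with n c4 c(1) show False by (auto simp: less_Suc_eq eval_nat_numeral)
  qed
  define u where "u = cv (c 0, c 1)"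
  have u: "u \<in> cspace 2 - {czero}" "u 0 = c 0" "u (Suc 0) = c 1"
    unfolding u_def using cv_nonzero \<open>c 0 \<noteq> 0 \<or> c 1 \<noteq> 0\<close> by auto
  define pu where "pu = (\<lambda>k. c 0 * pd 0 P z k + c 1 * pd 1 P z k)"
  have QE: "ip Q b = - c 2 * ip (E 0 z) b + - c 3 * ip (E 1 z) b" for b
  proof -
    have "ip Q b = ip (\<lambda>k. - c 2 * E 0 z k + - c 3 * E 1 z k) b"
      by (rule ip_cong) (use Qk in auto)
    then show ?thesis by (simp only: ip_simps)
  qed
  \<comment> \<open>Contraction with the inverse metric is the squared norm of the orthogonal
    projection to the span of the frame, and Q lies in this span.\<close>
  have QQ: "(\<Sum>g<2. \<Sum>d<2. G g d * ip Q (E d z) * ip (E g z) Q) = ip Q Q"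
  proof -
    have g: "H 0 0 * G 0 0 + H 0 (Suc 0) * G 0 (Suc 0) = 1" "H 0 0 * G (Suc 0) 0 + H 0 (Suc 0) * G (Suc 0) (Suc 0) = 0"
      "H (Suc 0) 0 * G 0 0 + H (Suc 0) (Suc 0) * G 0 (Suc 0) = 0" "H (Suc 0) 0 * G (Suc 0) 0 + H (Suc 0) (Suc 0) * G (Suc 0) (Suc 0) = 1"
      using G[of 0 0] G[of 0 1] G[of 1 0] G[of 1 1] by (simp_all add: sum_lessThan_2)
    have "(\<Sum>g<2. \<Sum>d<2. G g d * ip Q (E d z) * ip (E g z) Q) =
      - c 2 * ((H 0 0 * G 0 0 + H 0 (Suc 0) * G 0 (Suc 0)) * ip (E 0 z) Q + (H 0 0 * G (Suc 0) 0 + H 0 (Suc 0) * G (Suc 0) (Suc 0)) * ip (E 1 z) Q)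
      - c 3 * ((H (Suc 0) 0 * G 0 0 + H (Suc 0) (Suc 0) * G 0 (Suc 0)) * ip (E 0 z) Q + (H (Suc 0) 0 * G (Suc 0) 0 + H (Suc 0) (Suc 0) * G (Suc 0) (Suc 0)) * ip (E 1 z) Q)"
      unfolding QE[of "E _ z"] by (simp add: sum_lessThan_2 H_def algebra_simps)
    also have "\<dots> = ip Q Q" unfolding g QE[of Q] by simp
    finally show ?thesis .
  qed
  have e1: "(\<Sum>k<2. \<Sum>l<2. \<Sum>a<2. \<Sum>b<2. ip (pd k (E a) z) (pd l (E b) z) * u k * cnj (u l) * v a * cnj (v b)) = ip Q Q"
    by (simp add: sum_lessThan_2 u Q_def A_def ip_simps algebra_simps)
  have e2: "(\<Sum>k<2. \<Sum>l<2. \<Sum>a<2. \<Sum>b<2. (H a b * ip (pd k P z) (pd l P z)) * u k * cnj (u l) * v a * cnj (v b)) = ip (ev v) (ev v) * ip pu pu"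
    by (simp add: sum_lessThan_2 u H_def ev_def pu_def ip_simps algebra_simps)
  have e3: "(\<Sum>k<2. \<Sum>l<2. \<Sum>a<2. \<Sum>b<2. (ip (E a z) (pd l P z) * ip (pd k P z) (E b z)) * u k * cnj (u l) * v a * cnj (v b)) = ip (ev v) pu * ip pu (ev v)"
    by (simp add: sum_lessThan_2 u ev_def pu_def ip_simps algebra_simps)
  have e4: "(\<Sum>k<2. \<Sum>l<2. \<Sum>a<2. \<Sum>b<2. (ip (pd k (E a) z) x * ip y (pd l (E b) z)) * u k * cnj (u l) * v a * cnj (v b)) = ip Q x * ip y Q" for x y
    by (simp add: sum_lessThan_2 u Q_def A_def ip_simps algebra_simps)
  have e5: "(\<Sum>k<2. \<Sum>l<2. \<Sum>a<2. \<Sum>b<2. (\<Sum>g<2. \<Sum>d<2. G g d * ip (pd k (E a) z) (E d z) * ip (E g z) (pd l (E b) z)) * u k * cnj (u l) * v a * cnj (v b))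
     = (\<Sum>g<2. \<Sum>d<2. G g d * (\<Sum>k<2. \<Sum>l<2. \<Sum>a<2. \<Sum>b<2. (ip (pd k (E a) z) (E d z) * ip (E g z) (pd l (E b) z)) * u k * cnj (u l) * v a * cnj (v b)))"
    by (simp add: sum_lessThan_2 algebra_simps)
  have "(\<Sum>k<2. \<Sum>l<2. \<Sum>a<2. \<Sum>b<2.
    chern_curvature 2 (\<lambda>w a b. fs (P w) (E a w) (E b w)) z k l a b * u k * cnj (u l) * v a * cnj (v b)) =
    (\<Sum>k<2. \<Sum>l<2. \<Sum>a<2. \<Sum>b<2. (- (ip (pd k (E a) z) (pd l (E b) z) - H a b * ip (pd k P z) (pd l P z) - ip (E a z) (pd l P z) * ip (pd k P z) (E b z))
      + (\<Sum>g<2. \<Sum>d<2. G g d * ip (pd k (E a) z) (E d z) * ip (E g z) (pd l (E b) z))) * u k * cnj (u l) * v a * cnj (v b))"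
    by (intro sum.cong refl) (simp only: chern lessThan_iff)
  also have "\<dots> = - ip Q Q + ip (ev v) (ev v) * ip pu pu + ip (ev v) pu * ip pu (ev v) + (\<Sum>g<2. \<Sum>d<2. G g d * (ip Q (E d z) * ip (E g z) Q))"
    unfolding e1[symmetric] e2[symmetric] e3[symmetric] e4[symmetric] e5[symmetric]
    by (simp only: sum.distrib sum_negf minus_diff_eq distrib_right left_diff_distrib sum_subtractf mult_minus_left) (simp add: algebra_simps)
  also have "\<dots> = ip (ev v) (ev v) * ip pu pu + ip (ev v) pu * ip pu (ev v)"
    using QQ by (simp add: mult.assoc)
  finally have "Re (\<Sum>k<2. \<Sum>l<2. \<Sum>a<2. \<Sum>b<2.
    chern_curvature 2 (\<lambda>w a b. fs (P w) (E a w) (E b w)) z k l a b * u k * cnj (u l) * v a * cnj (v b)) =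
     Re (ip (ev v) (ev v) * ip pu pu) + Re (ip (ev v) pu * ip pu (ev v))" by simp
  moreover have "Re (ip (ev v) (ev v) * ip pu pu) > 0"
  proof -
    have "\<exists>k<4. pu k \<noteq> 0" using indP[of "c 0" "c 1"] \<open>c 0 \<noteq> 0 \<or> c 1 \<noteq> 0\<close> by (auto simp: pu_def)
    then have "Re (ip pu pu) > 0" "Re (ip (ev v) (ev v)) > 0" using ip_self_pos ev_ne[OF v] by blast+
    moreover have "Im (ip pu pu) = 0" by (simp add: ip_self)
    ultimately show ?thesis by simp
  qed
  moreover have "Re (ip (ev v) pu * ip pu (ev v)) \<ge> 0" by (rule Re_ip_mult)
  ultimately show ?thesis using u(1) by (intro bexI[of _ u]) auto
qed

lemma pd_mult_add:
  assumes "hol_on n W l" "hol_on n W m" "holv n W E" "holv n W P" "z \<in> W" "j < n" "k < 4"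
  shows "pd j (\<lambda>w k. l w * E w k + m w * P w k) z k =
    cpartial j l z * E z k + l z * pd j E z k + cpartial j m z * P z k + m z * pd j P z k"
proof -
  have h: "hol_on n W (\<lambda>w. E w k)" "hol_on n W (\<lambda>w. P w k)" using assms by (auto simp: holv_def)
  show ?thesis
    unfolding pd_def
    by (subst cpartial_add[OF hol_on_mult hol_on_mult assms(5,6)], (rule assms h)+)
      (simp add: cpartial_mult[OF _ _ assms(5,6)] assms h)
qed

lemma holv_mult_add:
  assumes "hol_on n W l" "hol_on n W m" "holv n W E" "holv n W P"
  shows "holv n W (\<lambda>w k. l w * E w k + m w * P w k)"
  using assms by (auto simp: holv_def intro!: hol_on_add hol_on_mult)

lemma cpartial_affine2:
  assumes "j < 2"
  shows "cpartial j (\<lambda>w. c * (d - (a (0::nat) * (w 0 - z 0) + a (Suc 0) * (w (Suc 0) - z (Suc 0))))) y = - c * a j"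
  by (rule cpartial_eqI) (use assms in \<open>auto simp: less_2_cases_iff intro!: derivative_eq_intros\<close>)

text \<open>Reduction to the normalized case. By \<open>fs_invariant\<close> the form is unchanged
  if P becomes \<open>la * P\<close> and \<open>E a\<close> becomes
  \<open>la * E a + \<mu> a * P\<close>. Affine functions \<open>la\<close> and
  \<open>\<mu> a\<close> suffice, since only their values and first derivatives at z have to be
  prescribed.\<close>

theorem fs_rc_positive:
  fixes E :: "nat \<Rightarrow> cvec \<Rightarrow> cvec"
  assumes W: "open_in_cspace 2 W" and P: "holv 2 W P" and E: "\<And>a. a < 2 \<Longrightarrow> holv 2 W (E a)"
    and nz: "\<And>z. z \<in> W \<Longrightarrow> ip (P z) (P z) \<noteq> 0" and z: "z \<in> W"
    and h: "\<And>w a b. w \<in> W \<Longrightarrow> a < 2 \<Longrightarrow> b < 2 \<Longrightarrow> h w a b = fs (P w) (E a w) (E b w)"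
    and indE: "\<And>e c d. (\<And>k. k < 4 \<Longrightarrow> e * P z k + c * E 0 z k + d * E 1 z k = 0) \<Longrightarrow> c = 0 \<and> d = 0"
    and indP: "\<And>e c d. (\<And>k. k < 4 \<Longrightarrow> e * P z k + c * pd 0 P z k + d * pd 1 P z k = 0) \<Longrightarrow> c = 0 \<and> d = 0"
    and v: "v \<in> cspace 2 - {czero}"
  shows "\<exists>u\<in>cspace 2 - {czero}. Re (\<Sum>k<2. \<Sum>l<2. \<Sum>a<2. \<Sum>b<2.
    chern_curvature 2 h z k l a b * u k * cnj (u l) * v a * cnj (v b)) > 0"
proof -
  define N where "N = ip (P z) (P z)"
  have N: "N \<noteq> 0" using nz[OF z] by (simp add: N_def)
  have Nr: "N = of_real (Re N)" by (simp add: N_def ip_self)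
  have "Re N \<ge> 0" by (simp add: N_def ip_self sum_nonneg)
  then have Np: "Re N > 0" using N Nr by (metis less_eq_real_def of_real_0)
  define s :: complex where "s = of_real (1 / sqrt (Re N))"
  have s: "s * cnj s * N = 1"
  proof -
    have "s * cnj s * of_real (Re N) = of_real (1 / sqrt (Re N) * (1 / sqrt (Re N)) * Re N)"
      by (simp only: s_def complex_cnj_complex_of_real of_real_mult)
    also have "1 / sqrt (Re N) * (1 / sqrt (Re N)) * Re N = 1" using Np by (simp add: field_simps)
    finally show ?thesis using Nr by simp
  qed
  have s0: "s \<noteq> 0" using s by auto
  \<comment> \<open>These constants solve the conditions of the normalization: s gives P norm 1, m
    makes E orthogonal to P, while \<open>\<alpha>\<close> and \<open>nn\<close> make the first
    derivatives of P and of E orthogonal to P.\<close>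
  define \<alpha> where "\<alpha> j = ip (pd j P z) (P z) / N" for j
  define m where "m a = s * ip (E a z) (P z) / N" for a
  define nn where "nn a j = (s * ip (pd j (E a) z) (P z) - s * \<alpha> j * ip (E a z) (P z) - m a * ip (pd j P z) (P z)) / N" for a j
  define la where "la w = s * (1 - (\<alpha> 0 * (w 0 - z 0) + \<alpha> (Suc 0) * (w (Suc 0) - z (Suc 0))))" for w :: cvec
  define \<mu> where "\<mu> a w = 1 * (- m a - (nn a 0 * (w 0 - z 0) + nn a (Suc 0) * (w (Suc 0) - z (Suc 0))))" for a and w :: cvec
  have hla: "hol_on 2 S la" and h\<mu>: "hol_on 2 S (\<mu> a)" for S a
    unfolding la_def \<mu>_def by (intro hol_on_mult hol_on_diff hol_on_add hol_on_const hol_on_coord)+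
  have vla: "la z = s" and v\<mu>: "\<mu> a z = - m a" for a by (simp_all add: la_def \<mu>_def)
  have dla: "cpartial j la z = - s * \<alpha> j" and d\<mu>: "cpartial j (\<mu> a) z = - nn a j" if "j < 2" for j a
    unfolding la_def \<mu>_def cpartial_affine2[OF that] by simp_all
  \<comment> \<open>An affine function may vanish away from z, where the rescaling would break
    down.\<close>
  define V where "V = {w \<in> W. la w \<noteq> 0}"
  have "continuous_on W la" using hla by (simp add: hol_on_def)
  then have "openin (top_of_set W) (W \<inter> la -` (- {0}))"
    by (rule continuous_openin_preimage_gen) auto
  then have V: "open_in_cspace 2 V"
    using openin_trans[OF _ W] by (simp add: V_def Int_def)
  have zV: "z \<in> V" using z s0 vla by (simp add: V_def)
  have VW: "V \<subseteq> W" by (auto simp: V_def)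
  define P' where "P' = (\<lambda>w k. la w * P w k + 0 * P w k)"
  define E' where "E' a = (\<lambda>w k. la w * E a w k + \<mu> a w * P w k)" for a
  have PV: "holv 2 V P" and EV: "\<And>a. a < 2 \<Longrightarrow> holv 2 V (E a)"
    using P E VW by (auto simp: holv_def intro: hol_on_subset)
  have hP': "holv 2 V P'" unfolding P'_def by (rule holv_mult_add[OF hla hol_on_const PV PV])
  have hE': "holv 2 V (E' a)" if "a < 2" for a unfolding E'_def by (rule holv_mult_add[OF hla h\<mu> EV[OF that] PV])
  have pP: "pd j P' z k = - s * \<alpha> j * P z k + s * pd j P z k" if "j < 2" "k < 4" for j k
    unfolding P'_def pd_mult_add[OF hla hol_on_const PV PV zV that] dla[OF that(1)] vla by simp
  have pE: "pd j (E' a) z k = - s * \<alpha> j * E a z k + s * pd j (E a) z k - nn a j * P z k - m a * pd j P z k"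
    if "a < 2" "j < 2" "k < 4" for a j k
    unfolding E'_def pd_mult_add[OF hla h\<mu> EV[OF that(1)] PV zV that(2,3)] dla[OF that(2)] d\<mu>[OF that(2)] vla v\<mu> by simp
  have P'z: "P' z = (\<lambda>k. s * P z k)" and E'z: "E' a z = (\<lambda>k. s * E a z k + - m a * P z k)" for a
    by (simp_all add: P'_def E'_def vla v\<mu>)
  have eq: "fs (P' w) (E' a w) (E' b w) = fs (P w) (E a w) (E b w)" if "w \<in> V" for w a b
    unfolding P'_def E'_def using that by (simp add: V_def fs_invariant)
  have "\<exists>u\<in>cspace 2 - {czero}. Re (\<Sum>k<2. \<Sum>l<2. \<Sum>a<2. \<Sum>b<2.
    chern_curvature 2 (\<lambda>w a b. fs (P' w) (E' a w) (E' b w)) z k l a b * u k * cnj (u l) * v a * cnj (v b)) > 0"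
  proof (rule fs_rc_positive_normalized[OF V hP' hE' _ zV])
    show "ip (P' w) (P' w) \<noteq> 0" if "w \<in> V" for w
      using nz[of w] that by (simp add: V_def P'_def ip_simps)
    show "ip (P' z) (P' z) = 1" using s by (simp add: P'z ip_simps N_def mult_ac)
    show "ip (E' a z) (P' z) = 0" if "a < 2" for a
      unfolding P'z E'z ip_simps N_def[symmetric] using N by (simp add: m_def)
    show "ip (pd j P' z) (P' z) = 0" if "j < 2" for j
    proof -
      have "ip (pd j P' z) (P' z) = ip (\<lambda>k. - s * \<alpha> j * P z k + s * pd j P z k) (P' z)"
        by (rule ip_cong) (use pP that in auto)
      also have "\<dots> = 0" unfolding P'z ip_simps N_def[symmetric] using N by (simp add: \<alpha>_def)
      finally show ?thesis .
    qed
    show "ip (pd j (E' a) z) (P' z) = 0" if "a < 2" "j < 2" for a j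
    proof -
      have "ip (pd j (E' a) z) (P' z) = ip (\<lambda>k. - s * \<alpha> j * E a z k + s * pd j (E a) z k - nn a j * P z k - m a * pd j P z k) (P' z)"
        by (rule ip_cong) (use pE that in auto)
      also have "\<dots> = cnj s * (- s * \<alpha> j * ip (E a z) (P z) + s * ip (pd j (E a) z) (P z) - nn a j * N - m a * ip (pd j P z) (P z))"
        unfolding P'z ip_simps N_def[symmetric] by (simp add: algebra_simps)
      also have "\<dots> = 0" using N by (simp add: nn_def)
      finally show ?thesis .
    qed
    show "c = 0 \<and> d = 0" if *: "\<And>k. k < 4 \<Longrightarrow> c * E' 0 z k + d * E' 1 z k = 0" for c d
    proof -
      have "c * s = 0 \<and> d * s = 0"
        by (rule indE[of "- (c * m 0 + d * m 1)"]) (use * in \<open>simp add: E'z algebra_simps\<close>)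
      then show ?thesis using s0 by simp
    qed
    show "c = 0 \<and> d = 0" if *: "\<And>k. k < 4 \<Longrightarrow> c * pd 0 P' z k + d * pd 1 P' z k = 0" for c d
    proof -
      have "c * s = 0 \<and> d * s = 0"
        by (rule indP[of "- s * (c * \<alpha> 0 + d * \<alpha> 1)"]) (use * in \<open>simp add: pP algebra_simps\<close>)
      then show ?thesis using s0 by simp
    qed
  qed (use v in auto)
  moreover have "chern_curvature 2 h z k l a b = chern_curvature 2 (\<lambda>w a b. fs (P' w) (E' a w) (E' b w)) z k l a b"
    if "k < 2" "l < 2" "a < 2" "b < 2" for k l a b
    by (rule chern_curvature_cong[OF V zV that]) (use h eq VW in auto)
  then have "(\<Sum>k<2. \<Sum>l<2. \<Sum>a<2. \<Sum>b<2. chern_curvature 2 h z k l a b * u k * cnj (u l) * v a * cnj (v b)) =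
    (\<Sum>k<2. \<Sum>l<2. \<Sum>a<2. \<Sum>b<2. chern_curvature 2 (\<lambda>w a b. fs (P' w) (E' a w) (E' b w)) z k l a b * u k * cnj (u l) * v a * cnj (v b))" for u
    by (intro sum.cong refl) simp
  ultimately show ?thesis by simp
qed

section \<open>Fermat surfaces and their charts\<close>

lemma peval_superset:
  assumes "finite S" "Poly_Mapping.keys F \<subseteq> S"
  shows "peval F z = (\<Sum>m\<in>S. Poly_Mapping.lookup F m * (\<Prod>i\<in>Poly_Mapping.keys m. z i ^ Poly_Mapping.lookup m i))"
  unfolding peval_def by (rule sum.mono_neutral_left[OF assms]) (auto simp: in_keys_iff)

definition fermat :: "nat \<Rightarrow> mvpoly"
  where "fermat d = (\<Sum>i<4. Poly_Mapping.single (Poly_Mapping.single i d) 1)"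

lemma lookup_fermat: "Poly_Mapping.lookup (fermat d) m = (\<Sum>i<4. if Poly_Mapping.single i d = m then 1 else 0)"
  unfolding fermat_def by (simp add: lookup_sum lookup_single when_def)

lemma keys_fermat: "Poly_Mapping.keys (fermat d) \<subseteq> (\<lambda>i. Poly_Mapping.single i d) ` {..<4}"
proof
  fix m assume "m \<in> Poly_Mapping.keys (fermat d)"
  then have "(\<Sum>i<4. if Poly_Mapping.single i d = m then 1 else 0 :: complex) \<noteq> 0"
    by (simp add: in_keys_iff lookup_fermat)
  then show "m \<in> (\<lambda>i. Poly_Mapping.single i d) ` {..<4}"
    by (rule contrapos_np) (auto intro!: sum.neutral)
qed

lemma peval_fermat:
  assumes d: "d > 0"
  shows "peval (fermat d) z = (\<Sum>i<4. z i ^ d)"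
proof -
  have inj: "Poly_Mapping.single i d = Poly_Mapping.single j d \<longleftrightarrow> i = j" for i j :: nat
    using d by (metis keys_single less_numeral_extra(3) singleton_inject)
  have l: "Poly_Mapping.lookup (fermat d) (Poly_Mapping.single j d) = 1" if "j < 4" for j
    using that by (simp add: lookup_fermat inj)
  have "peval (fermat d) z = (\<Sum>m\<in>(\<lambda>i. Poly_Mapping.single i d) ` {..<4}.
      Poly_Mapping.lookup (fermat d) m * (\<Prod>i\<in>Poly_Mapping.keys m. z i ^ Poly_Mapping.lookup m i))"
    by (rule peval_superset[OF _ keys_fermat]) simp
  also have "\<dots> = (\<Sum>j<4. z j ^ d)"
    by (subst sum.reindex) (use d in \<open>auto simp: inj_on_def inj l lookup_single intro!: sum.cong\<close>)
  finally show ?thesis .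
qed

lemma hform_fermat: "d > 0 \<Longrightarrow> hform 3 d (fermat d)"
  unfolding hform_def using keys_fermat[of d] by (auto simp: dest!: subsetD)

definition fermat_cone :: "nat \<Rightarrow> cvec set"
  where "fermat_cone d = {z \<in> cspace 4 - {czero}. (\<Sum>i<4. z i ^ d) = 0}"

definition fermat_surface :: "nat \<Rightarrow> ppoint set"
  where "fermat_surface d = pclass ` fermat_cone d"

lemma pclass_self [simp]: "z \<in> pclass z"
  unfolding pclass_def by (auto intro!: exI[of _ 1])

lemma pclass_eqD:
  assumes "pclass z = pclass w"
  obtains c where "c \<noteq> 0" "z = (\<lambda>i. c * w i)"
proof -
  have "z \<in> pclass w" using assms pclass_self[of z] by simp
  then show thesis using that by (auto simp: pclass_def)
qed

lemma pclass_eqI: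
  assumes "c \<noteq> 0" "\<And>i. z i = c * w i"
  shows "pclass z = pclass w"
proof -
  have z: "z = (\<lambda>i. c * w i)" using assms(2) by auto
  have "\<exists>e. (\<lambda>i. d * (c * w i)) = (\<lambda>i. e * w i) \<and> e \<noteq> 0" if "d \<noteq> 0" for d
    using that assms(1) by (intro exI[of _ "d * c"]) (auto simp: mult.assoc)
  moreover have "\<exists>e. (\<lambda>i. d * w i) = (\<lambda>i. e * (c * w i)) \<and> e \<noteq> 0" if "d \<noteq> 0" for d
    using that assms(1) by (intro exI[of _ "d / c"]) auto
  ultimately show ?thesis unfolding pclass_def z by auto
qed

lemma mem_pclassD: "w \<in> pclass z \<Longrightarrow> pclass w = pclass z"
  by (auto simp: pclass_def intro!: pclass_eqI[unfolded pclass_def])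

lemma cone_scale: "c \<noteq> 0 \<Longrightarrow> z \<in> fermat_cone d \<Longrightarrow> (\<lambda>i. c * z i) \<in> fermat_cone d"
  by (auto simp: fermat_cone_def cspace_def czero_def fun_eq_iff power_mult_distrib simp flip: sum_distrib_left)

lemma cone_pclass_iff: "pclass z \<in> fermat_surface d \<longleftrightarrow> z \<in> fermat_cone d"
proof
  assume "pclass z \<in> fermat_surface d"
  then obtain w where "w \<in> fermat_cone d" "pclass z = pclass w" by (auto simp: fermat_surface_def)
  then show "z \<in> fermat_cone d" using pclass_eqD cone_scale by metis
qed (simp add: fermat_surface_def)

lemma cone_subset: "fermat_cone d \<subseteq> cspace 4 - {czero}"
  by (auto simp: fermat_cone_def)

lemma vanishes_at_pclass:
  assumes "d > 0"
  shows "vanishes_at (fermat d) (pclass z) \<longleftrightarrow> (\<Sum>i<4. z i ^ d) = 0"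
proof -
  have "peval (fermat d) (\<lambda>i. c * z i) = c ^ d * (\<Sum>i<4. z i ^ d)" for c
    by (simp add: peval_fermat assms power_mult_distrib sum_distrib_left)
  then show ?thesis by (auto simp: vanishes_at_def pclass_def intro: exI[of _ 1])
qed

lemma fermat_surface_eq:
  assumes "d > 0"
  shows "fermat_surface d = {p \<in> proj_space 3. vanishes_at (fermat d) p}"
proof -
  have "Suc 3 = 4" by simp
  then show ?thesis
    using vanishes_at_pclass[OF assms] unfolding fermat_surface_def fermat_cone_def proj_space_def by auto
qed

lemma fermat_surface_subset: "fermat_surface d \<subseteq> proj_space 3"
  using cone_subset[of d] by (auto simp: fermat_surface_def proj_space_def)

lemma topspace_proj_top [simp]: "topspace (proj_top 3) = proj_space 3"
proof -
  have "{z \<in> cspace 4 - {czero}. pclass z \<in> proj_space 3} = cspace 4 - {czero}"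
    by (auto simp: proj_space_def)
  then have "openin (proj_top 3) (proj_space 3)"
    unfolding openin_proj_top by simp
  then show ?thesis unfolding topspace_def by (auto simp: openin_proj_top)
qed

text \<open>The k-th partial derivative is \<open>of_nat d * z k ^ (d - 1)\<close>, and some
  coordinate of a point is nonzero. One form is enough, so the whole projective space serves as the
  neighbourhood.\<close>

lemma fermat_smooth:
  assumes d: "d > 0" and p: "p \<in> fermat_surface d"
  shows "smooth_of_dim_at 3 2 (fermat_surface d) p"
  unfolding smooth_of_dim_at_def
proof (intro conjI exI[of _ "\<lambda>_. fermat d"] exI[of _ "proj_space 3"] allI impI ballI)
  show "\<exists>e. hform 3 e (fermat d)" using hform_fermat[OF d] by blast
  show "vanishes_at (fermat d) q" if "q \<in> fermat_surface d" for q
    using that by (simp add: fermat_surface_eq[OF d])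
  show "openin (proj_top 3) (proj_space 3)" by (metis openin_topspace topspace_proj_top)
  show "p \<in> proj_space 3" using p fermat_surface_subset by blast
  show "q \<in> fermat_surface d" if "q \<in> proj_space 3" "\<forall>i<3 - (2::nat). vanishes_at (fermat d) q" for q
    using that by (simp add: fermat_surface_eq[OF d])
  fix z assume "z \<in> p"
  then have "pclass z = p" using p by (auto simp: fermat_surface_def dest: mem_pclassD)
  then have z: "z \<in> fermat_cone d" using p cone_pclass_iff by blast
  then obtain k where k: "k < 4" "z k \<noteq> 0"
    by (auto simp: fermat_cone_def cspace_def czero_def fun_eq_iff) (metis not_less)
  have "cpartial k (peval (fermat d)) z = of_nat d * z k ^ (d - 1)"
  proof (rule cpartial_eqI)
    have "((\<lambda>t. \<Sum>i<4. (z(k := t)) i ^ d) has_field_derivative (\<Sum>i<4. if i = k then of_nat d * z k ^ (d - 1) else 0)) (at (z k))"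
      by (rule DERIV_sum) (auto intro!: derivative_eq_intros)
    then show "((\<lambda>t. peval (fermat d) (z(k := t))) has_field_derivative of_nat d * z k ^ (d - 1)) (at (z k))"
      using k by (simp add: peval_fermat[OF d])
  qed
  then have "cpartial k (peval (fermat d)) z \<noteq> 0" using k d by simp
  then show "lin_indep (3 - 2) (Suc 3) (\<lambda>i k. cpartial k (peval (fermat d)) z)"
    using k by (auto simp: lin_indep_def)
qed simp_all

section \<open>Ratios of homogeneous coordinates and branches of the d-th root\<close>

text \<open>Both coordinates scale alike, so the quotient does not depend on the representative that
  is chosen.\<close>

definition rat :: "nat \<Rightarrow> nat \<Rightarrow> ppoint \<Rightarrow> complex"
  where "rat i k p = (SOME z. z \<in> p) i / (SOME z. z \<in> p) k"

lemma rat_pclass [simp]: "rat i k (pclass z) = z i / z k"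
proof -
  have "(SOME w. w \<in> pclass z) \<in> pclass z" by (rule someI[of _ z]) simp
  then show ?thesis unfolding rat_def by (auto simp: pclass_def)
qed

text \<open>The d-th power maps the sector biholomorphically onto the slit plane; \<open>rt d\<close> is the inverse.\<close>

definition sector :: "nat \<Rightarrow> complex set"
  where "sector d = {\<zeta>. \<zeta> \<notin> \<real>\<^sub>\<le>\<^sub>0 \<and> \<bar>Im (Ln \<zeta>)\<bar> < pi / real d}"

definition rt :: "nat \<Rightarrow> complex \<Rightarrow> complex"
  where "rt d \<eta> = exp (Ln \<eta> / of_nat d)"

text \<open>The imaginary part of \<open>Ln\<close> lies in the interval from -pi to pi, with pi
  included and attained exactly on the negative real axis.\<close>

lemma slit_iff: "\<eta> \<notin> \<real>\<^sub>\<le>\<^sub>0 \<longleftrightarrow> \<eta> \<noteq> 0 \<and> \<bar>Im (Ln \<eta>)\<bar> < pi"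
proof (cases "\<eta> = 0")
  case False
  have "\<bar>Im (Ln \<eta>)\<bar> < pi \<longleftrightarrow> Im (Ln \<eta>) \<noteq> pi"
    using Im_Ln_le_pi[OF False] mpi_less_Im_Ln[OF False] by auto
  then show ?thesis using False Im_Ln_eq_pi[OF False]
    by (auto simp: complex_nonpos_Reals_iff less_le) (metis complex_eq_iff zero_complex.simps)+
qed simp

text \<open>On the sector, d times the logarithm still has imaginary part of modulus below pi, so it
  is the principal logarithm of the power.\<close>

lemma sector_power:
  assumes d: "d > 0" and \<zeta>: "\<zeta> \<in> sector d"
  shows "\<zeta> ^ d \<notin> \<real>\<^sub>\<le>\<^sub>0" "rt d (\<zeta> ^ d) = \<zeta>"
proof -
  have z0: "\<zeta> \<noteq> 0" using \<zeta> by (auto simp: sector_def)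
  have e: "\<zeta> ^ d = exp (of_nat d * Ln \<zeta>)" using z0 by (simp add: exp_of_nat_mult)
  have i: "\<bar>Im (of_nat d * Ln \<zeta>)\<bar> < pi"
    using \<zeta> d by (simp add: sector_def abs_mult field_simps)
  then have l: "Ln (\<zeta> ^ d) = of_nat d * Ln \<zeta>" unfolding e by (intro Ln_exp) auto
  show "\<zeta> ^ d \<notin> \<real>\<^sub>\<le>\<^sub>0" unfolding slit_iff l using z0 i by simp
  show "rt d (\<zeta> ^ d) = \<zeta>" using d z0 by (simp add: rt_def l)
qed

lemma rt_sector:
  assumes d: "d > 0" and \<eta>: "\<eta> \<notin> \<real>\<^sub>\<le>\<^sub>0"
  shows "rt d \<eta> \<in> sector d" "rt d \<eta> ^ d = \<eta>"
proof -
  have n0: "\<eta> \<noteq> 0" and i: "\<bar>Im (Ln \<eta>)\<bar> < pi" using \<eta> by (auto simp: slit_iff)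
  have i': "\<bar>Im (Ln \<eta> / of_nat d)\<bar> < pi / d" using i d by (simp add: divide_strict_right_mono)
  also have "pi / d \<le> pi" using d by (simp add: field_simps)
  finally have i'': "\<bar>Im (Ln \<eta> / of_nat d)\<bar> < pi" .
  then have l: "Ln (rt d \<eta>) = Ln \<eta> / of_nat d" unfolding rt_def by (intro Ln_exp; use i'' in linarith)
  have "rt d \<eta> \<notin> \<real>\<^sub>\<le>\<^sub>0" unfolding slit_iff l using i'' by (simp add: rt_def)
  then show "rt d \<eta> \<in> sector d" using i' by (simp add: sector_def l)
  show "rt d \<eta> ^ d = \<eta>" using d n0 by (simp add: rt_def exp_of_nat_mult[symmetric])
qed

lemma open_sector: "open (sector d)"
proof -
  have "open ({\<zeta>. \<zeta> \<notin> \<real>\<^sub>\<le>\<^sub>0} \<inter> (\<lambda>\<zeta>. \<bar>Im (Ln \<zeta>)\<bar>) -` {..<pi / real d})"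
  proof (rule continuous_open_preimage)
    show "continuous_on {\<zeta>. \<zeta> \<notin> \<real>\<^sub>\<le>\<^sub>0} (\<lambda>\<zeta>. \<bar>Im (Ln \<zeta>)\<bar>)"
      by (intro continuous_intros) auto
    show "open {\<zeta>::complex. \<zeta> \<notin> \<real>\<^sub>\<le>\<^sub>0}"
      using closed_nonpos_Reals_complex by (metis Compl_eq open_Compl)
  qed simp
  moreover have "sector d = {\<zeta>. \<zeta> \<notin> \<real>\<^sub>\<le>\<^sub>0} \<inter> (\<lambda>\<zeta>. \<bar>Im (Ln \<zeta>)\<bar>) -` {..<pi / real d}"
    by (auto simp: sector_def)
  ultimately show ?thesis by simp
qed

lemma one_in_sector: "d > 0 \<Longrightarrow> 1 \<in> sector d"
  by (simp add: sector_def)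

lemma rt_holomorphic: "rt d holomorphic_on - \<real>\<^sub>\<le>\<^sub>0"
  unfolding rt_def[abs_def] by (intro holomorphic_intros) auto

text \<open>The roles of the indices in a standard chart: i and j belong to the affine coordinates,
  k to the coordinate that is divided by, and l to the one recovered by a root.\<close>

definition perm4 :: "nat \<Rightarrow> nat \<Rightarrow> nat \<Rightarrow> nat \<Rightarrow> bool"
  where "perm4 i j k l \<longleftrightarrow> distinct [i, j, k, l] \<and> {i, j, k, l} = {..<4}"

lemma perm4_less: "perm4 i j k l \<Longrightarrow> i < 4 \<and> j < 4 \<and> k < 4 \<and> l < 4"
  by (auto simp: perm4_def)

lemma perm4_cases: "perm4 i j k l \<Longrightarrow> m < 4 \<Longrightarrow> m = i \<or> m = j \<or> m = k \<or> m = l"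
  by (auto simp: perm4_def)

lemma perm4_sum: "perm4 i j k l \<Longrightarrow> (\<Sum>m<4. f m) = f i + f j + f k + f l" for f :: "nat \<Rightarrow> complex"
  unfolding perm4_def by (elim conjE, drule sym) (simp add: add.assoc)

lemma perm4_exists:
  assumes "k < 4" "l < 4" "k \<noteq> l"
  shows "\<exists>i j. perm4 i j k l"
proof -
  have "card ({..<4} - {k, l}) = 2" using assms by (simp add: card_Diff_subset)
  then obtain i j where "{..<4} - {k, l} = {i, j}" "i \<noteq> j" by (auto simp: card_2_iff)
  then have "distinct [i, j, k, l] \<and> {i, j, k, l} = {..<4}" using assms by auto
  then show ?thesis by (auto simp: perm4_def)
qed

text \<open>A single nonzero power cannot cancel in the Fermat equation. Two nonzero coordinates are
  what a standard chart around a point requires.\<close>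

lemma cone_two_nonzero:
  assumes "d > 0" "z \<in> fermat_cone d"
  obtains k l where "k < 4" "l < 4" "k \<noteq> l" "z k \<noteq> 0" "z l \<noteq> 0"
proof -
  obtain k where k: "k < 4" "z k \<noteq> 0"
    using assms by (auto simp: fermat_cone_def cspace_def czero_def fun_eq_iff) (metis not_less)
  have "\<exists>l<4. l \<noteq> k \<and> z l \<noteq> 0"
  proof (rule ccontr)
    assume "\<not> ?thesis"
    then have "(\<Sum>i<4. z i ^ d) = (\<Sum>i<4. if i = k then z k ^ d else 0)"
      using assms(1) by (intro sum.cong) auto
    then show False using assms k by (simp add: fermat_cone_def)
  qed
  with k that show thesis by blast
qed

section \<open>Charts, local lifts and standard charts\<close>

abbreviation FM :: "nat \<Rightarrow> ppoint cmanifold"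
  where "FM d \<equiv> as_cmanifold 3 2 (fermat_surface d)"

text \<open>A local lift of the inverse of a chart to homogeneous coordinates, as in the definition of
  \<open>as_cmanifold\<close>.\<close>

definition lift :: "ppoint chart \<Rightarrow> cvec set \<Rightarrow> (cvec \<Rightarrow> cvec) \<Rightarrow> bool"
  where "lift c W \<psi> \<longleftrightarrow> open_in_cspace 2 W \<and> W \<subseteq> snd c ` fst c \<and> holv 2 W \<psi> \<and>
    (\<forall>w\<in>W. \<psi> w \<in> cspace 4 - {czero} \<and> pclass (\<psi> w) \<in> fst c \<and> snd c (pclass (\<psi> w)) = w)"

text \<open>The linear independence required in \<open>as_cmanifold\<close>, written out for a
  surface in projective 3-space.\<close>

definition immersive_at :: "cvec \<Rightarrow> (cvec \<Rightarrow> cvec) \<Rightarrow> bool"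
  where "immersive_at w \<psi> \<longleftrightarrow> (\<forall>e c d. (\<forall>k<4. e * \<psi> w k + c * pd 0 \<psi> w k + d * pd 1 \<psi> w k = 0) \<longrightarrow> e = 0 \<and> c = 0 \<and> d = 0)"

lemma lin_indep_immersive:
  "lin_indep (Suc 2) (Suc 3) (case_nat (\<psi> w) (\<lambda>j k. cpartial j (\<lambda>w. \<psi> w k) w)) \<longleftrightarrow> immersive_at w \<psi>"
proof -
  have s: "(\<Sum>i<Suc 2. f i) = f 0 + f 1 + f (Suc 1)" for f :: "nat \<Rightarrow> complex"
    by (simp add: eval_nat_numeral)
  have n: "Suc 3 = 4" by simp
  have q: "(\<forall>i<Suc 2. c i = 0) \<longleftrightarrow> c 0 = 0 \<and> c 1 = 0 \<and> c (Suc 1) = 0" for c :: "nat \<Rightarrow> complex"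
    by (auto simp: less_Suc_eq numeral_2_eq_2)
  have "(\<forall>c::nat \<Rightarrow> complex. P (c 0) (c 1) (c (Suc 1))) \<longleftrightarrow> (\<forall>e c d. P e c d)" for P
  proof
    assume *: "\<forall>c::nat \<Rightarrow> complex. P (c 0) (c 1) (c (Suc 1))"
    show "\<forall>e c d. P e c d"
    proof (intro allI)
      fix e c d
      from *[rule_format, of "\<lambda>i. if i = 0 then e else if i = 1 then c else d"] show "P e c d" by simp
    qed
  qed simp
  from this[of "\<lambda>e c d. (\<forall>k<4. e * \<psi> w k + c * cpartial 0 (\<lambda>w. \<psi> w k) w + d * cpartial 1 (\<lambda>w. \<psi> w k) w = 0) \<longrightarrow> e = 0 \<and> c = 0 \<and> d = 0"]
  show ?thesis
    unfolding lin_indep_def immersive_at_def s n q by (simp add: pd_def)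
qed

lemma le3_less4: "k \<le> 3 \<longleftrightarrow> k < (4::nat)" by auto

lemma chart_iff:
  "c \<in> charts (FM d) \<longleftrightarrow> openin (subtopology (proj_top 3) (fermat_surface d)) (fst c) \<and> inj_on (snd c) (fst c) \<and>
    open_in_cspace 2 (snd c ` fst c) \<and> (\<forall>p\<in>fst c. \<exists>W \<psi>. lift c W \<psi> \<and> snd c p \<in> W \<and> immersive_at (snd c p) \<psi>)"
proof -
  obtain U \<phi> where c: "c = (U, \<phi>)" by (cases c)
  have n: "Suc 3 = 4" by simp
  have "(\<exists>W \<psi>. open_in_cspace 2 W \<and> \<phi> p \<in> W \<and> W \<subseteq> \<phi> ` U \<and>
          (\<forall>w\<in>W. \<psi> w \<in> cspace (Suc 3) - {czero} \<and> pclass (\<psi> w) \<in> U \<and> \<phi> (pclass (\<psi> w)) = w) \<and>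
          (\<forall>k\<le>3. hol_on 2 W (\<lambda>w. \<psi> w k)) \<and>
          lin_indep (Suc 2) (Suc 3) (case_nat (\<psi> (\<phi> p)) (\<lambda>j k. cpartial j (\<lambda>w. \<psi> w k) (\<phi> p)))) \<longleftrightarrow>
        (\<exists>W \<psi>. lift (U, \<phi>) W \<psi> \<and> \<phi> p \<in> W \<and> immersive_at (\<phi> p) \<psi>)" for p
    unfolding lin_indep_immersive unfolding lift_def holv_def fst_conv snd_conv le3_less4 n
    by (intro ex_cong1) (simp only: conj_ac)
  then show ?thesis
    unfolding c as_cmanifold_def by simp
qed

lemma chart_subset: "c \<in> charts (FM d) \<Longrightarrow> fst c \<subseteq> fermat_surface d"
  unfolding chart_iff using openin_subset by fastforce

lemma cdim_FM [simp]: "cdim (FM d) = 2"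
  by (simp add: as_cmanifold_def)

lemma from_coords_snd:
  assumes "c \<in> charts (FM d)" "x \<in> fst c" shows "from_coords c (snd c x) = x"
  using assms by (simp add: chart_iff from_coords_def)

lemma chart_openin:
  assumes "c \<in> charts (FM d)" shows "open_in_cspace 2 (snd c ` fst c)"
  using assms by (simp add: chart_iff)

lemma snd_from_coords:
  assumes "w \<in> snd c ` fst c" shows "snd c (from_coords c w) = w" "from_coords c w \<in> fst c"
  using assms by (auto simp: from_coords_def f_inv_into_f inv_into_into)

lemma lift_from_coords:
  assumes "c \<in> charts (FM d)" "lift c W \<psi>" "w \<in> W"
  shows "from_coords c w = pclass (\<psi> w)"
proof -
  have "pclass (\<psi> w) \<in> fst c" "snd c (pclass (\<psi> w)) = w" using assms(2,3) by (auto simp: lift_def)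
  then show ?thesis using from_coords_snd[OF assms(1), of "pclass (\<psi> w)"] by simp
qed

lemma lift_cone:
  assumes "c \<in> charts (FM d)" "lift c W \<psi>" "w \<in> W"
  shows "\<psi> w \<in> fermat_cone d"
  using assms chart_subset[OF assms(1)] cone_pclass_iff by (auto simp: lift_def)

lemma cone_nonzero:
  assumes "z \<in> fermat_cone d" shows "\<exists>k<4. z k \<noteq> 0"
  using assms by (auto simp: fermat_cone_def cspace_def czero_def fun_eq_iff) (metis not_less)

lemma ip_cone_nonzero: "z \<in> fermat_cone d \<Longrightarrow> ip z z \<noteq> 0"
  using cone_nonzero ip_self_nonzero by blast

text \<open>The affine coordinates \<open>z\<^sub>i / z\<^sub>k\<close> and \<open>z\<^sub>j / z\<^sub>k\<close>, where the last coordinate is determined by a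
  branch of the d-th root: the number \<open>\<rho>\<close> selects the branch.\<close>

definition std_chart :: "nat \<Rightarrow> nat \<Rightarrow> nat \<Rightarrow> nat \<Rightarrow> nat \<Rightarrow> complex \<Rightarrow> ppoint chart"
  where "std_chart d i j k l \<rho> =
    (pclass ` {z \<in> fermat_cone d. z k \<noteq> 0 \<and> z l / z k / \<rho> \<in> sector d}, \<lambda>p. cv (rat i k p, rat j k p))"

text \<open>The d-th power of \<open>z l / (z k * \<rho>)\<close>, as the Fermat equation determines
  it from the affine coordinates.\<close>

definition std_arg :: "nat \<Rightarrow> complex \<Rightarrow> cvec \<Rightarrow> complex"
  where "std_arg d \<rho> w = - (1 + w 0 ^ d + w (Suc 0) ^ d) / \<rho> ^ d"

definition std_lift :: "nat \<Rightarrow> nat \<Rightarrow> nat \<Rightarrow> nat \<Rightarrow> nat \<Rightarrow> complex \<Rightarrow> cvec \<Rightarrow> cvec"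
  where "std_lift d i j k l \<rho> w = (\<lambda>m. if m = i then w 0 else if m = j then w (Suc 0)
     else if m = k then 1 else if m = l then \<rho> * rt d (std_arg d \<rho> w) else 0)"

lemma std_chart_mem:
  assumes "perm4 i j k l"
  shows "pclass z \<in> fst (std_chart d i j k l \<rho>) \<longleftrightarrow> z \<in> fermat_cone d \<and> z k \<noteq> 0 \<and> z l / z k / \<rho> \<in> sector d"
proof
  assume "pclass z \<in> fst (std_chart d i j k l \<rho>)"
  then obtain w where w: "w \<in> fermat_cone d" "w k \<noteq> 0" "w l / w k / \<rho> \<in> sector d" "pclass z = pclass w"
    by (auto simp: std_chart_def)
  from w(4) obtain c where "c \<noteq> 0" "z = (\<lambda>i. c * w i)" by (rule pclass_eqD)
  then show "z \<in> fermat_cone d \<and> z k \<noteq> 0 \<and> z l / z k / \<rho> \<in> sector d"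
    using w cone_scale by auto
qed (auto simp: std_chart_def)

lemma std_chart_snd [simp]: "snd (std_chart d i j k l \<rho>) (pclass z) = cv (z i / z k, z j / z k)"
  by (simp add: std_chart_def)

context
  fixes d i j k l :: nat and \<rho> :: complex
  assumes d: "d > 0" and perm: "perm4 i j k l" and \<rho>: "\<rho> \<noteq> 0"
begin

lemma std_lift_coords:
  "std_lift d i j k l \<rho> w i = w 0" "std_lift d i j k l \<rho> w j = w (Suc 0)" "std_lift d i j k l \<rho> w k = 1"
  "std_lift d i j k l \<rho> w l = \<rho> * rt d (std_arg d \<rho> w)"
  using perm by (auto simp: std_lift_def perm4_def)

lemma std_lift_in_chart:
  assumes w: "w \<in> cspace 2" "std_arg d \<rho> w \<notin> \<real>\<^sub>\<le>\<^sub>0"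
  shows "std_lift d i j k l \<rho> w \<in> fermat_cone d" "pclass (std_lift d i j k l \<rho> w) \<in> fst (std_chart d i j k l \<rho>)"
    "snd (std_chart d i j k l \<rho>) (pclass (std_lift d i j k l \<rho> w)) = w"
proof -
  have "std_lift d i j k l \<rho> w \<in> cspace 4"
    using perm4_less[OF perm] by (auto simp: std_lift_def cspace_def)
  moreover have "std_lift d i j k l \<rho> w \<noteq> czero"
    using std_lift_coords(3)[of w] by (auto simp: czero_def)
  moreover have "(\<Sum>m<4. std_lift d i j k l \<rho> w m ^ d) = 0"
  proof -
    have "(\<rho> * rt d (std_arg d \<rho> w)) ^ d = \<rho> ^ d * std_arg d \<rho> w"
      by (simp add: power_mult_distrib rt_sector(2)[OF d w(2)])
    also have "\<dots> = - (1 + w 0 ^ d + w (Suc 0) ^ d)" using \<rho> by (simp add: std_arg_def)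
    finally show ?thesis unfolding perm4_sum[OF perm] std_lift_coords by simp
  qed
  ultimately show c: "std_lift d i j k l \<rho> w \<in> fermat_cone d" by (simp add: fermat_cone_def)
  show "pclass (std_lift d i j k l \<rho> w) \<in> fst (std_chart d i j k l \<rho>)"
    using c \<rho> rt_sector(1)[OF d w(2)] by (simp add: std_chart_mem[OF perm] std_lift_coords)
  show "snd (std_chart d i j k l \<rho>) (pclass (std_lift d i j k l \<rho> w)) = w"
    using w(1) by (simp add: std_lift_coords)
qed

lemma std_chart_inverse:
  assumes z: "pclass z \<in> fst (std_chart d i j k l \<rho>)"
  shows "std_arg d \<rho> (snd (std_chart d i j k l \<rho>) (pclass z)) \<notin> \<real>\<^sub>\<le>\<^sub>0"
    "pclass (std_lift d i j k l \<rho> (snd (std_chart d i j k l \<rho>) (pclass z))) = pclass z"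
proof -
  have zc: "z \<in> fermat_cone d" "z k \<noteq> 0" "z l / z k / \<rho> \<in> sector d"
    using z by (auto simp: std_chart_mem[OF perm])
  have "z i ^ d + z j ^ d + z k ^ d + z l ^ d = 0"
    using zc(1) by (simp add: fermat_cone_def perm4_sum[OF perm])
  then have "z l ^ d = - (z i ^ d + z j ^ d + z k ^ d)" by (simp add: eq_neg_iff_add_eq_0 algebra_simps)
  then have "(z l / z k / \<rho>) ^ d = - (z i ^ d + z j ^ d + z k ^ d) / z k ^ d / \<rho> ^ d"
    by (simp add: power_divide power_mult_distrib)
  also have "- (z i ^ d + z j ^ d + z k ^ d) / z k ^ d = - (1 + (z i / z k) ^ d + (z j / z k) ^ d)"
    using zc(2) by (simp add: power_divide field_simps)
  finally have eq: "std_arg d \<rho> (snd (std_chart d i j k l \<rho>) (pclass z)) = (z l / z k / \<rho>) ^ d"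
    by (simp add: std_arg_def)
  show "std_arg d \<rho> (snd (std_chart d i j k l \<rho>) (pclass z)) \<notin> \<real>\<^sub>\<le>\<^sub>0"
    unfolding eq by (rule sector_power[OF d zc(3)])
  have r: "\<rho> * rt d (std_arg d \<rho> (snd (std_chart d i j k l \<rho>) (pclass z))) = z l / z k"
    unfolding eq sector_power(2)[OF d zc(3)] using \<rho> by simp
  \<comment> \<open>The lift reproduces the representative whose k-th coordinate is 1.\<close>
  have "std_lift d i j k l \<rho> (snd (std_chart d i j k l \<rho>) (pclass z)) m = inverse (z k) * z m" for m
  proof (cases "m < 4")
    case True
    then show ?thesis using perm4_cases[OF perm True] r zc(2)
      by (auto simp: std_lift_coords divide_inverse mult.commute)
  next
    case False
    then have "z m = 0" using zc(1) by (auto simp: fermat_cone_def cspace_def)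
    then show ?thesis using False perm4_less[OF perm] by (auto simp: std_lift_def)
  qed
  then show "pclass (std_lift d i j k l \<rho> (snd (std_chart d i j k l \<rho>) (pclass z))) = pclass z"
    using zc(2) by (intro pclass_eqI[of "inverse (z k)"]) auto
qed

lemma std_chart_image:
  "snd (std_chart d i j k l \<rho>) ` fst (std_chart d i j k l \<rho>) = {w \<in> cspace 2. std_arg d \<rho> w \<notin> \<real>\<^sub>\<le>\<^sub>0}"
proof (intro equalityI subsetI)
  fix w assume "w \<in> snd (std_chart d i j k l \<rho>) ` fst (std_chart d i j k l \<rho>)"
  then obtain p where p: "p \<in> fst (std_chart d i j k l \<rho>)" "w = snd (std_chart d i j k l \<rho>) p" by blast
  then obtain z where "p = pclass z" by (auto simp: std_chart_def)
  then show "w \<in> {w \<in> cspace 2. std_arg d \<rho> w \<notin> \<real>\<^sub>\<le>\<^sub>0}"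
    using std_chart_inverse(1)[of z] p by simp
next
  fix w assume "w \<in> {w \<in> cspace 2. std_arg d \<rho> w \<notin> \<real>\<^sub>\<le>\<^sub>0}"
  then show "w \<in> snd (std_chart d i j k l \<rho>) ` fst (std_chart d i j k l \<rho>)"
    using std_lift_in_chart[of w] by (metis (mono_tags, lifting) imageI mem_Collect_eq)
qed

lemma hol_std_arg: "hol_on 2 W (std_arg d \<rho>)"
proof -
  have "hol_on 2 W (\<lambda>w. (0 - (1 + w 0 ^ d + w (Suc 0) ^ d)) / \<rho> ^ d)"
    using \<rho> by (intro hol_on_divide hol_on_diff hol_on_add hol_on_power hol_on_const hol_on_coord) simp
  then show ?thesis by (simp add: std_arg_def[abs_def])
qed

lemma open_std_image: "open_in_cspace 2 {w \<in> cspace 2. std_arg d \<rho> w \<notin> \<real>\<^sub>\<le>\<^sub>0}"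
proof -
  have "continuous_on (cspace 2) (std_arg d \<rho>)" using hol_std_arg by (simp add: hol_on_def)
  then have "openin (top_of_set (cspace 2)) (cspace 2 \<inter> std_arg d \<rho> -` (- \<real>\<^sub>\<le>\<^sub>0))"
    by (rule continuous_openin_preimage_gen) (simp add: open_Compl)
  moreover have "cspace 2 \<inter> std_arg d \<rho> -` (- \<real>\<^sub>\<le>\<^sub>0) = {w \<in> cspace 2. std_arg d \<rho> w \<notin> \<real>\<^sub>\<le>\<^sub>0}" by auto
  ultimately show ?thesis by simp
qed

lemma lift_std_lift:
  "lift (std_chart d i j k l \<rho>) {w \<in> cspace 2. std_arg d \<rho> w \<notin> \<real>\<^sub>\<le>\<^sub>0} (std_lift d i j k l \<rho>)"
  unfolding lift_def
proof (intro conjI ballI)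
  let ?W = "{w \<in> cspace 2. std_arg d \<rho> w \<notin> \<real>\<^sub>\<le>\<^sub>0}"
  show "open_in_cspace 2 ?W" by (rule open_std_image)
  show "?W \<subseteq> snd (std_chart d i j k l \<rho>) ` fst (std_chart d i j k l \<rho>)" by (simp add: std_chart_image)
  show "holv 2 ?W (std_lift d i j k l \<rho>)"
    unfolding holv_def
  proof (intro allI impI)
    fix m :: nat assume "m < 4"
    have "hol_on 2 ?W (\<lambda>w. \<rho> * rt d (std_arg d \<rho> w))"
      by (intro hol_on_mult hol_on_const hol_on_compose_holomorphic[OF hol_std_arg rt_holomorphic]) (auto simp: open_Compl)
    then show "hol_on 2 ?W (\<lambda>w. std_lift d i j k l \<rho> w m)"
      using perm4_cases[OF perm \<open>m < 4\<close>] by (auto simp: std_lift_coords)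
  qed
  fix w assume "w \<in> ?W"
  then have w: "w \<in> cspace 2" "std_arg d \<rho> w \<notin> \<real>\<^sub>\<le>\<^sub>0" by auto
  show "std_lift d i j k l \<rho> w \<in> cspace 4 - {czero}" by (rule subsetD[OF cone_subset std_lift_in_chart(1)[OF w]])
  show "pclass (std_lift d i j k l \<rho> w) \<in> fst (std_chart d i j k l \<rho>)" by (rule std_lift_in_chart(2)[OF w])
  show "snd (std_chart d i j k l \<rho>) (pclass (std_lift d i j k l \<rho> w)) = w" by (rule std_lift_in_chart(3)[OF w])
qed

text \<open>In the rows k, i and j the lift and its derivatives form a unitriangular matrix, since
  these coordinates of the lift are 1, \<open>w 0\<close> and \<open>w (Suc 0)\<close>. The row l
  with the root is never looked at.\<close>

lemma immersive_std_lift: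
  "immersive_at w (std_lift d i j k l \<rho>)"
  unfolding immersive_at_def
proof (intro allI impI)
  fix e c f
  assume *: "\<forall>m<4. e * std_lift d i j k l \<rho> w m + c * pd 0 (std_lift d i j k l \<rho>) w m + f * pd 1 (std_lift d i j k l \<rho>) w m = 0"
  have p: "pd a (std_lift d i j k l \<rho>) w i = (if a = 0 then 1 else 0)" "pd a (std_lift d i j k l \<rho>) w j = (if a = 1 then 1 else 0)"
    "pd a (std_lift d i j k l \<rho>) w k = 0" for a
    by (auto simp: pd_def std_lift_coords cpartial_coord)
  show "e = 0 \<and> c = 0 \<and> f = 0"
    using *[rule_format, of k] *[rule_format, of i] *[rule_format, of j] perm4_less[OF perm]
    by (simp add: p std_lift_coords)
qed

lemma openin_std_set:
  "openin (top_of_set (cspace 4 - {czero})) {z \<in> cspace 4 - {czero}. z k \<noteq> 0 \<and> z l / z k / \<rho> \<in> sector d}"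
proof -
  let ?C = "cspace 4 - {czero}"
  have c: "continuous_on S (\<lambda>z::cvec. z m)" for S m
    by (rule continuous_on_subset[OF continuous_on_product_coordinates]) simp
  have 1: "openin (top_of_set ?C) (?C \<inter> (\<lambda>z. z k) -` (- {0}))"
    by (rule continuous_openin_preimage_gen[OF c]) auto
  have "continuous_on (?C \<inter> (\<lambda>z. z k) -` (- {0})) (\<lambda>z. z l / z k / \<rho>)"
    using \<rho> by (intro continuous_on_divide c continuous_on_const) auto
  from continuous_openin_preimage_gen[OF this open_sector[of d]]
  have "openin (top_of_set (?C \<inter> (\<lambda>z. z k) -` (- {0}))) (?C \<inter> (\<lambda>z. z k) -` (- {0}) \<inter> (\<lambda>z. z l / z k / \<rho>) -` sector d)" .
  from openin_trans[OF this 1]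
  have "openin (top_of_set ?C) (?C \<inter> (\<lambda>z. z k) -` (- {0}) \<inter> (\<lambda>z. z l / z k / \<rho>) -` sector d)" .
  moreover have "?C \<inter> (\<lambda>z. z k) -` (- {0}) \<inter> (\<lambda>z. z l / z k / \<rho>) -` sector d = {z \<in> ?C. z k \<noteq> 0 \<and> z l / z k / \<rho> \<in> sector d}"
    by auto
  ultimately show ?thesis by simp
qed

lemma std_chart_in_charts: "std_chart d i j k l \<rho> \<in> charts (FM d)"
  unfolding chart_iff
proof (intro conjI ballI)
  let ?C = "cspace 4 - {czero}"
  let ?U = "pclass ` {z \<in> ?C. z k \<noteq> 0 \<and> z l / z k / \<rho> \<in> sector d}"
  \<comment> \<open>The conditions are invariant under scaling, so openness of their solution set in
    the cone is openness of \<open>?U\<close> in the quotient topology.\<close>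
  have "{z \<in> ?C. pclass z \<in> ?U} = {z \<in> ?C. z k \<noteq> 0 \<and> z l / z k / \<rho> \<in> sector d}" (is "?A = ?B")
  proof (intro equalityI subsetI)
    fix z assume "z \<in> ?A"
    then obtain w where w: "w \<in> ?B" "pclass z = pclass w" "z \<in> ?C" by auto
    from w(2) obtain c where "c \<noteq> 0" "z = (\<lambda>i. c * w i)" by (rule pclass_eqD)
    then show "z \<in> ?B" using w by auto
  qed auto
  moreover have "?U \<subseteq> proj_space 3" by (auto simp: proj_space_def)
  moreover have "Suc 3 = 4" by simp
  ultimately have "openin (proj_top 3) ?U"
    unfolding openin_proj_top using openin_std_set by simp
  moreover have "fst (std_chart d i j k l \<rho>) = ?U \<inter> fermat_surface d"
  proof (intro equalityI subsetI)
    fix p assume "p \<in> fst (std_chart d i j k l \<rho>)"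
    then show "p \<in> ?U \<inter> fermat_surface d" using cone_subset by (auto simp: std_chart_def fermat_surface_def)
  next
    fix p assume p: "p \<in> ?U \<inter> fermat_surface d"
    then obtain z where "p = pclass z" "z k \<noteq> 0" "z l / z k / \<rho> \<in> sector d" by auto
    then show "p \<in> fst (std_chart d i j k l \<rho>)" using p by (auto simp: std_chart_mem[OF perm] cone_pclass_iff)
  qed
  ultimately show "openin (subtopology (proj_top 3) (fermat_surface d)) (fst (std_chart d i j k l \<rho>))"
    unfolding openin_subtopology by blast
  show "inj_on (snd (std_chart d i j k l \<rho>)) (fst (std_chart d i j k l \<rho>))"
  proof (rule inj_on_inverseI[of _ "\<lambda>w. pclass (std_lift d i j k l \<rho> w)"])
    fix p assume p: "p \<in> fst (std_chart d i j k l \<rho>)"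
    then obtain z where "p = pclass z" by (auto simp: std_chart_def)
    with p show "pclass (std_lift d i j k l \<rho> (snd (std_chart d i j k l \<rho>) p)) = p"
      using std_chart_inverse(2)[of z] by blast
  qed
  show "open_in_cspace 2 (snd (std_chart d i j k l \<rho>) ` fst (std_chart d i j k l \<rho>))"
    unfolding std_chart_image by (rule open_std_image)
  fix p assume "p \<in> fst (std_chart d i j k l \<rho>)"
  then have "snd (std_chart d i j k l \<rho>) p \<in> {w \<in> cspace 2. std_arg d \<rho> w \<notin> \<real>\<^sub>\<le>\<^sub>0}"
    unfolding std_chart_image[symmetric] by blast
  then show "\<exists>W \<psi>. lift (std_chart d i j k l \<rho>) W \<psi> \<and> snd (std_chart d i j k l \<rho>) p \<in> W \<and> immersive_at (snd (std_chart d i j k l \<rho>) p) \<psi>"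
    using lift_std_lift immersive_std_lift by blast
qed

end

lemma std_chart_exists:
  assumes d: "d > 0" and p: "p \<in> fermat_surface d"
  obtains i j k l \<rho> where "perm4 i j k l" "\<rho> \<noteq> 0" "p \<in> fst (std_chart d i j k l \<rho>)"
proof -
  obtain z where z: "z \<in> fermat_cone d" "p = pclass z" using p by (auto simp: fermat_surface_def)
  obtain k l where kl: "k < 4" "l < 4" "k \<noteq> l" "z k \<noteq> 0" "z l \<noteq> 0"
    by (rule cone_two_nonzero[OF d z(1)])
  obtain i j where perm: "perm4 i j k l" using perm4_exists[OF kl(1-3)] by blast
  \<comment> \<open>With this choice of \<open>\<rho>\<close> the quotient tested against the sector
    is 1.\<close>
  show thesis
    by (rule that[OF perm, of "z l / z k"])
      (use z kl one_in_sector[OF d] in \<open>simp_all add: std_chart_mem[OF perm]\<close>)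
qed

section \<open>Changes of charts\<close>

lemma lift_continuous:
  assumes "lift c W \<psi>" shows "continuous_on W \<psi>"
proof (rule continuous_on_coordinatewise_then_product)
  fix m show "continuous_on W (\<lambda>w. \<psi> w m)"
  proof (cases "m < 4")
    case True then show ?thesis using assms by (simp add: lift_def holv_def hol_on_def)
  next
    case False
    then have "\<And>w. w \<in> W \<Longrightarrow> \<psi> w m = 0" using assms by (auto simp: lift_def cspace_def)
    then show ?thesis using continuous_on_const[of W 0] by (simp cong: continuous_on_cong)
  qed
qed

lemma lift_preimage_open:
  assumes "lift c W \<psi>" "openin (top_of_set (cspace 4 - {czero})) S"
  shows "open_in_cspace 2 {w \<in> W. \<psi> w \<in> S}"
proof -
  have "openin (top_of_set W) (W \<inter> \<psi> -` S)"
    by (rule continuous_openin_preimage[OF lift_continuous[OF assms(1)] _ assms(2)])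
      (use assms(1) in \<open>auto simp: lift_def\<close>)
  then have "open_in_cspace 2 (W \<inter> \<psi> -` S)"
    by (rule openin_trans) (use assms(1) in \<open>simp add: lift_def\<close>)
  moreover have "W \<inter> \<psi> -` S = {w \<in> W. \<psi> w \<in> S}" by auto
  ultimately show ?thesis by simp
qed

lemma hol_map_cong:
  assumes W: "open_in_cspace 2 W" and f: "hol_map W f" and eq: "\<And>z. z \<in> W \<Longrightarrow> f z = g z"
  shows "hol_map W g"
  unfolding hol_map_def
proof (intro conjI ballI allI impI)
  show "g z \<in> cspace 2" if "z \<in> W" for z using f eq[OF that] that unfolding hol_map_def by metis
  show "hol_on 2 W (\<lambda>z. g z k)" if "k < 2" for k
    by (rule hol_on_cong[OF W, of "\<lambda>z. f z k"]) (use f eq that in \<open>auto simp: hol_map_def\<close>)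
qed

lemma det2_kernel:
  fixes a b c d :: complex
  assumes "a * d - b * c = 0"
  obtains x y where "x \<noteq> 0 \<or> y \<noteq> 0" "a * x + b * y = 0" "c * x + d * y = 0"
proof (cases "a = 0 \<and> b = 0")
  case True
  show thesis
  proof (cases "c = 0 \<and> d = 0")
    case True2: True
    then show thesis using True that[of 1 0] by simp
  next
    case False
    then show thesis using True that[of "- d" c] by auto
  qed
next
  case False
  then show thesis using assms that[of "- b" a] by (auto simp: algebra_simps)
qed

text \<open>The Fermat equation holds identically along a lift; this is its derivative, divided by
  d.\<close>

lemma lift_tangent:
  assumes d: "d > 0" and c: "c \<in> charts (FM d)" and L: "lift c W \<psi>" and w: "w \<in> W" and e: "e < 2"
  shows "(\<Sum>m<4. \<psi> w m ^ (d - 1) * pd e \<psi> w m) = 0"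
proof -
  have W: "open_in_cspace 2 W" using L by (simp add: lift_def)
  have "cpartial e (\<lambda>w. \<Sum>m<4. \<psi> w m ^ d) w = (\<Sum>m<4. of_nat d * (pd e \<psi> w m * \<psi> w m ^ (d - 1)))"
  proof (rule cpartial_eqI, rule DERIV_sum)
    fix m :: nat assume "m \<in> {..<4}"
    then have "hol_on 2 W (\<lambda>w. \<psi> w m)" using L by (simp add: lift_def holv_def)
    then have "((\<lambda>t. \<psi> (w(e := t)) m) has_field_derivative pd e \<psi> w m) (at (w e))"
      unfolding pd_def by (rule hol_on_slice_deriv[OF _ w e])
    from DERIV_power[OF this, of d]
    show "((\<lambda>t. \<psi> (w(e := t)) m ^ d) has_field_derivative of_nat d * (pd e \<psi> w m * \<psi> w m ^ (d - 1))) (at (w e))"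
      by simp
  qed
  moreover have "cpartial e (\<lambda>w. \<Sum>m<4. \<psi> w m ^ d) w = cpartial e (\<lambda>w. 0) w"
    by (rule cpartial_cong[OF W w e]) (use lift_cone[OF c L] in \<open>auto simp: fermat_cone_def\<close>)
  ultimately have "of_nat d * (\<Sum>m<4. \<psi> w m ^ (d - 1) * pd e \<psi> w m) = 0"
    by (simp add: sum_distrib_left mult.commute)
  then show ?thesis using d by simp
qed

text \<open>Towards the standard chart the transition consists of ratios of coordinates of a lift
  and is visibly holomorphic. For the other direction its Jacobian must be invertible. A kernel
  vector would make the derivative D of the lift proportional to the lift in the coordinates i, j
  and k, and then, by the derivative of the Fermat equation, also in the coordinate l. This
  contradicts immersivity.\<close>

lemma std_transition:
  assumes d: "d > 0" and c: "c \<in> charts (FM d)" and x: "x \<in> fst c"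
    and perm: "perm4 i j k l" and \<rho>: "\<rho> \<noteq> 0" and xs: "x \<in> fst (std_chart d i j k l \<rho>)"
  defines "s \<equiv> std_chart d i j k l \<rho>"
  shows "\<exists>V. open_in_cspace 2 V \<and> snd c x \<in> V \<and> V \<subseteq> snd c ` (fst c \<inter> fst s) \<and> hol_map V (\<lambda>w. snd s (from_coords c w))"
    and "\<exists>V. open_in_cspace 2 V \<and> snd s x \<in> V \<and> V \<subseteq> snd s ` (fst c \<inter> fst s) \<and> hol_map V (\<lambda>w. snd c (from_coords s w))"
proof -
  have sc: "s \<in> charts (FM d)" unfolding s_def by (rule std_chart_in_charts[OF d perm \<rho>])
  obtain W \<psi> where L: "lift c W \<psi>" "snd c x \<in> W" "immersive_at (snd c x) \<psi>"
    using c x unfolding chart_iff by blast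
  define w0 where "w0 = snd c x"
  have Wo: "open_in_cspace 2 W" using L(1) by (simp add: lift_def)
  define V where "V = {w \<in> W. \<psi> w \<in> {z \<in> cspace 4 - {czero}. z k \<noteq> 0 \<and> z l / z k / \<rho> \<in> sector d}}"
  have Vo: "open_in_cspace 2 V" unfolding V_def
    by (rule lift_preimage_open[OF L(1) openin_std_set[OF d perm \<rho>]])
  have VW: "V \<subseteq> W" by (auto simp: V_def)
  have Vs: "pclass (\<psi> w) \<in> fst s" "\<psi> w k \<noteq> 0" if "w \<in> V" for w
    using that lift_cone[OF c L(1)] by (auto simp: V_def s_def std_chart_mem[OF perm])
  have Vc: "pclass (\<psi> w) \<in> fst c" "snd c (pclass (\<psi> w)) = w" "from_coords c w = pclass (\<psi> w)" if "w \<in> V" for w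
    using that VW L(1) lift_from_coords[OF c L(1)] by (auto simp: lift_def)
  have x0: "pclass (\<psi> w0) = x"
    using lift_from_coords[OF c L(1,2)] from_coords_snd[OF c x] by (simp add: w0_def)
  have w0: "w0 \<in> V"
  proof -
    have "pclass (\<psi> w0) \<in> fst (std_chart d i j k l \<rho>)" using x0 xs by simp
    then have "\<psi> w0 k \<noteq> 0 \<and> \<psi> w0 l / \<psi> w0 k / \<rho> \<in> sector d" unfolding std_chart_mem[OF perm] by blast
    moreover have "\<psi> w0 \<in> cspace 4 - {czero}" "w0 \<in> W" using L(1,2) unfolding lift_def w0_def by blast+
    ultimately show ?thesis unfolding V_def by blast
  qed
  define G where "G w = snd s (pclass (\<psi> w))" for w
  have G: "G w = cv (\<psi> w i / \<psi> w k, \<psi> w j / \<psi> w k)" for w by (simp add: G_def s_def)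
  have lt: "i < 4" "j < 4" "k < 4" "l < 4" using perm4_less[OF perm] by auto
  have h\<psi>: "hol_on 2 V (\<lambda>w. \<psi> w m)" if "m < 4" for m
    using L(1) that VW by (auto simp: lift_def holv_def intro: hol_on_subset)
  have hG0: "hol_on 2 V (\<lambda>w. G w 0)" and hG1: "hol_on 2 V (\<lambda>w. G w (Suc 0))"
    unfolding G cv_simps fst_conv snd_conv using h\<psi> lt Vs(2) by (auto intro!: hol_on_divide)
  have hG: "hol_map V G"
    using hG0 hG1 by (auto simp: hol_map_def less_2_cases_iff G)
  have "hol_map V (\<lambda>w. snd s (from_coords c w))"
    by (rule hol_map_cong[OF Vo hG]) (simp add: G_def Vc(3))
  moreover have "V \<subseteq> snd c ` (fst c \<inter> fst s)"
  proof
    fix w assume "w \<in> V"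
    then show "w \<in> snd c ` (fst c \<inter> fst s)"
      using Vc(1,2)[of w] Vs(1)[of w] by (intro image_eqI[of _ _ "pclass (\<psi> w)"]) simp_all
  qed
  ultimately show "\<exists>V. open_in_cspace 2 V \<and> snd c x \<in> V \<and> V \<subseteq> snd c ` (fst c \<inter> fst s) \<and> hol_map V (\<lambda>w. snd s (from_coords c w))"
    using Vo w0 unfolding w0_def by blast
  have det: "cpartial 0 (\<lambda>z. G z 0) w0 * cpartial 1 (\<lambda>z. G z 1) w0 - cpartial 1 (\<lambda>z. G z 0) w0 * cpartial 0 (\<lambda>z. G z 1) w0 \<noteq> 0"
  proof
    assume "cpartial 0 (\<lambda>z. G z 0) w0 * cpartial 1 (\<lambda>z. G z 1) w0 - cpartial 1 (\<lambda>z. G z 0) w0 * cpartial 0 (\<lambda>z. G z 1) w0 = 0"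
    then obtain a b where ab: "a \<noteq> 0 \<or> b \<noteq> 0"
      "cpartial 0 (\<lambda>z. G z 0) w0 * a + cpartial 1 (\<lambda>z. G z 0) w0 * b = 0"
      "cpartial 0 (\<lambda>z. G z 1) w0 * a + cpartial 1 (\<lambda>z. G z 1) w0 * b = 0"
      by (rule det2_kernel)
    define D where "D m = a * pd 0 \<psi> w0 m + b * pd 1 \<psi> w0 m" for m
    define \<beta> where "\<beta> = D k / \<psi> w0 k"
    have k0: "\<psi> w0 k \<noteq> 0" by (rule Vs(2)[OF w0])
    \<comment> \<open>If the quotient of the coordinates m and k is stationary in the direction (a,
      b), then D and the lift have the same ratio \<open>\<beta>\<close> in both
      coordinates.\<close>
    have quot: "D m = \<beta> * \<psi> w0 m"
      if "m < 4" "cpartial 0 (\<lambda>w. \<psi> w m / \<psi> w k) w0 * a + cpartial 1 (\<lambda>w. \<psi> w m / \<psi> w k) w0 * b = 0" for m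
    proof -
      have "(pd 0 \<psi> w0 m * \<psi> w0 k - \<psi> w0 m * pd 0 \<psi> w0 k) / (\<psi> w0 k * \<psi> w0 k) * a +
            (pd 1 \<psi> w0 m * \<psi> w0 k - \<psi> w0 m * pd 1 \<psi> w0 k) / (\<psi> w0 k * \<psi> w0 k) * b = 0"
        using that cpartial_divide[OF h\<psi> h\<psi> w0 _ k0, of m 0] cpartial_divide[OF h\<psi> h\<psi> w0 _ k0, of m 1] lt
        by (simp add: pd_def)
      then have "(D m * \<psi> w0 k - \<psi> w0 m * D k) / (\<psi> w0 k * \<psi> w0 k) = 0"
        using k0 by (simp add: D_def add_divide_distrib diff_divide_distrib algebra_simps)
      then show ?thesis using k0 by (simp add: \<beta>_def field_simps)
    qed
    have Di: "D i = \<beta> * \<psi> w0 i" by (rule quot) (use ab(2) lt in \<open>simp_all add: G\<close>)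
    have Dj: "D j = \<beta> * \<psi> w0 j" by (rule quot) (use ab(3) lt in \<open>simp_all add: G\<close>)
    have Dk: "D k = \<beta> * \<psi> w0 k" using k0 by (simp add: \<beta>_def)
    have cone0: "\<psi> w0 \<in> fermat_cone d" using lift_cone[OF c L(1)] VW w0 by blast
    have cp0: "(\<Sum>m<4. \<psi> w0 m ^ (d - 1) * pd e \<psi> w0 m) = 0" if "e < 2" for e
      using lift_tangent[OF d c L(1,2) that] by (simp add: w0_def)
    have "(\<Sum>m<4. \<psi> w0 m ^ (d - 1) * D m) =
      a * (\<Sum>m<4. \<psi> w0 m ^ (d - 1) * pd 0 \<psi> w0 m) + b * (\<Sum>m<4. \<psi> w0 m ^ (d - 1) * pd 1 \<psi> w0 m)"
      by (simp add: D_def sum.distrib sum_distrib_left algebra_simps)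
    then have "(\<Sum>m<4. \<psi> w0 m ^ (d - 1) * D m) = 0" using cp0 by simp
    moreover have "(\<Sum>m<4. \<psi> w0 m ^ (d - 1) * (\<beta> * \<psi> w0 m)) = 0"
    proof -
      have *: "\<psi> w0 m ^ (d - 1) * (\<beta> * \<psi> w0 m) = \<beta> * \<psi> w0 m ^ d" for m
        using power_minus_mult[OF d, of "\<psi> w0 m"] by (simp add: mult.left_commute)
      have "(\<Sum>m<4. \<psi> w0 m ^ (d - 1) * (\<beta> * \<psi> w0 m)) = \<beta> * (\<Sum>m<4. \<psi> w0 m ^ d)"
        by (simp only: * sum_distrib_left)
      then show ?thesis using cone0 by (simp add: fermat_cone_def)
    qed
    \<comment> \<open>The derivative of the Fermat equation and \<open>\<beta>\<close> times the
      equation itself agree in the terms i, j and k, hence in the last one.\<close>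
    ultimately have "\<psi> w0 l ^ (d - 1) * D l = \<psi> w0 l ^ (d - 1) * (\<beta> * \<psi> w0 l)"
      unfolding perm4_sum[OF perm] Di Dj Dk by (metis add_left_cancel)
    moreover have "\<psi> w0 l \<noteq> 0"
    proof -
      have "\<psi> w0 l / \<psi> w0 k / \<rho> \<in> sector d" using w0 by (simp add: V_def)
      then show ?thesis by (auto simp: sector_def)
    qed
    ultimately have Dl: "D l = \<beta> * \<psi> w0 l" by simp
    have "\<forall>m<4. - \<beta> * \<psi> w0 m + a * pd 0 \<psi> w0 m + b * pd 1 \<psi> w0 m = 0"
    proof (intro allI impI)
      fix m :: nat assume "m < 4"
      then have "D m = \<beta> * \<psi> w0 m" using perm4_cases[OF perm] Di Dj Dk Dl by blast
      then show "- \<beta> * \<psi> w0 m + a * pd 0 \<psi> w0 m + b * pd 1 \<psi> w0 m = 0" by (simp add: D_def algebra_simps)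
    qed
    with L(3) ab(1) show False unfolding immersive_at_def w0_def[symmetric] by blast
  qed
  obtain U' V' g where I: "open_in_cspace 2 U'" "w0 \<in> U'" "U' \<subseteq> V" "open_in_cspace 2 V'" "hol_map V' g"
    "\<And>z. z \<in> U' \<Longrightarrow> G z \<in> V' \<and> g (G z) = z" "\<And>v. v \<in> V' \<Longrightarrow> g v \<in> U' \<and> G (g v) = v"
    by (rule hol_inverse_function[OF Vo hG w0 det]) (rule that)
  have g: "snd c (from_coords s v) = g v" "from_coords s v \<in> fst c \<inter> fst s" "snd s (from_coords s v) = v" if "v \<in> V'" for v
  proof -
    have gv: "g v \<in> V" "G (g v) = v" using I(7)[OF that] I(3) by auto
    have "from_coords s v = pclass (\<psi> (g v))"
      using from_coords_snd[OF sc Vs(1)[OF gv(1)]] gv(2) by (simp add: G_def)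
    then show "snd c (from_coords s v) = g v" "from_coords s v \<in> fst c \<inter> fst s" "snd s (from_coords s v) = v"
      using Vc[OF gv(1)] Vs[OF gv(1)] gv(2) by (auto simp: G_def)
  qed
  have "hol_map V' (\<lambda>w. snd c (from_coords s w))"
    by (rule hol_map_cong[OF I(4,5)]) (simp add: g)
  moreover have "V' \<subseteq> snd s ` (fst c \<inter> fst s)"
  proof
    fix v assume "v \<in> V'"
    then show "v \<in> snd s ` (fst c \<inter> fst s)" using g[of v] by (intro image_eqI[of _ _ "from_coords s v"]) auto
  qed
  moreover have "snd s x \<in> V'" using I(6)[OF I(2)] x0 by (simp add: G_def)
  ultimately show "\<exists>V. open_in_cspace 2 V \<and> snd s x \<in> V \<and> V \<subseteq> snd s ` (fst c \<inter> fst s) \<and> hol_map V (\<lambda>w. snd c (from_coords s w))"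
    using I(4) by blast
qed

lemma hol_map_preimage_open:
  assumes "open_in_cspace 2 V" "hol_map V \<tau>" "open_in_cspace 2 W"
  shows "open_in_cspace 2 {w \<in> V. \<tau> w \<in> W}"
proof -
  have "openin (top_of_set V) (V \<inter> \<tau> -` W)"
    by (rule continuous_openin_preimage[OF hol_map_continuous[OF assms(2)] _ assms(3)])
      (use assms(2) in \<open>auto simp: hol_map_def\<close>)
  then have "open_in_cspace 2 (V \<inter> \<tau> -` W)" by (rule openin_trans[OF _ assms(1)])
  moreover have "V \<inter> \<tau> -` W = {w \<in> V. \<tau> w \<in> W}" by auto
  ultimately show ?thesis by simp
qed

text \<open>Any two charts around x are compared by way of a standard chart, where both directions
  of the transition are under control.\<close>

lemma transition_holomorphic:
  assumes d: "d > 0" and c: "c \<in> charts (FM d)" and e: "e \<in> charts (FM d)" and x: "x \<in> fst c" "x \<in> fst e"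
  obtains V where "open_in_cspace 2 V" "snd e x \<in> V" "V \<subseteq> snd e ` (fst c \<inter> fst e)"
    "hol_map V (\<lambda>w. snd c (from_coords e w))"
proof -
  have "x \<in> fermat_surface d" using chart_subset[OF c] x by blast
  then obtain i j k l \<rho> where s: "perm4 i j k l" "\<rho> \<noteq> 0" "x \<in> fst (std_chart d i j k l \<rho>)"
    by (rule std_chart_exists[OF d])
  define s where "s = std_chart d i j k l \<rho>"
  have sc: "s \<in> charts (FM d)" unfolding s_def by (rule std_chart_in_charts[OF d s(1,2)])
  obtain V1 where V1: "open_in_cspace 2 V1" "snd e x \<in> V1" "V1 \<subseteq> snd e ` (fst e \<inter> fst s)"
      "hol_map V1 (\<lambda>w. snd s (from_coords e w))"
    using std_transition(1)[OF d e x(2) s] unfolding s_def by blast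
  obtain V2 where V2: "open_in_cspace 2 V2" "snd s x \<in> V2" "V2 \<subseteq> snd s ` (fst c \<inter> fst s)"
      "hol_map V2 (\<lambda>w. snd c (from_coords s w))"
    using std_transition(2)[OF d c x(1) s] unfolding s_def by blast
  define V where "V = {w \<in> V1. snd s (from_coords e w) \<in> V2}"
  have V: "open_in_cspace 2 V" unfolding V_def by (rule hol_map_preimage_open[OF V1(1,4) V2(1)])
  have fe: "from_coords e w \<in> fst e \<inter> fst s" "snd e (from_coords e w) = w" if "w \<in> V1" for w
    using subsetD[OF V1(3) that] from_coords_snd[OF e] by auto
  have fs: "from_coords s (snd s (from_coords e w)) = from_coords e w" if "w \<in> V1" for w
    using from_coords_snd[OF sc] fe[OF that] by blast
  have fc: "from_coords e w \<in> fst c" if "w \<in> V" for w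
  proof -
    have "snd s (from_coords e w) \<in> snd s ` (fst c \<inter> fst s)" using that V2(3) by (auto simp: V_def)
    then obtain y where y: "y \<in> fst c" "y \<in> fst s" "snd s y = snd s (from_coords e w)" by auto
    then have "y = from_coords e w"
      using from_coords_snd[OF sc y(2)] fs[of w] that by (simp add: V_def)
    then show ?thesis using y by simp
  qed
  show thesis
  proof (rule that[OF V])
    show "snd e x \<in> V" using V1(2) V2(2) from_coords_snd[OF e x(2)] by (simp add: V_def)
    show "V \<subseteq> snd e ` (fst c \<inter> fst e)"
    proof
      fix w assume w: "w \<in> V"
      then have "w \<in> V1" by (simp add: V_def)
      then show "w \<in> snd e ` (fst c \<inter> fst e)"
        using fe[of w] fc[OF w] by (intro image_eqI[of _ _ "from_coords e w"]) auto
    qed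
    have hV: "hol_map V (\<lambda>w. snd s (from_coords e w))"
      using V1(4) by (auto simp: hol_map_def V_def intro: hol_on_subset)
    show "hol_map V (\<lambda>w. snd c (from_coords e w))"
      unfolding hol_map_def
    proof (intro conjI ballI allI impI)
      have eq: "snd c (from_coords s (snd s (from_coords e w))) = snd c (from_coords e w)" if "w \<in> V" for w
        using fs[of w] that by (simp add: V_def)
      show "snd c (from_coords e w) \<in> cspace 2" if "w \<in> V" for w
        using V2(4) eq[OF that] that by (auto simp: hol_map_def V_def)
      show "hol_on 2 V (\<lambda>w. snd c (from_coords e w) m)" if "m < 2" for m
      proof (rule hol_on_cong[OF V])
        show "hol_on 2 V (\<lambda>w. snd c (from_coords s (snd s (from_coords e w))) m)"
          by (rule hol_on_compose[OF V2(1) V _ hV, of "\<lambda>w. snd c (from_coords s w) m"])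
            (use V2(4) that in \<open>auto simp: hol_map_def V_def\<close>)
      qed (simp add: eq)
    qed
  qed
qed

section \<open>The Fubini-Study metric is RC-positive\<close>

definition jac :: "ppoint chart \<Rightarrow> ppoint chart \<Rightarrow> ppoint \<Rightarrow> nat \<Rightarrow> nat \<Rightarrow> complex"
  where "jac c e x a b = cpartial b (\<lambda>w. snd c (from_coords e w) a) (snd e x)"

lemma openin_coord_nonzero:
  "openin (top_of_set (cspace 4 - {czero})) {z \<in> cspace 4 - {czero}. z k \<noteq> 0}"
proof -
  have "continuous_on (cspace 4 - {czero}) (\<lambda>z::cvec. z k)"
    by (rule continuous_on_subset[OF continuous_on_product_coordinates]) simp
  then have "openin (top_of_set (cspace 4 - {czero})) ((cspace 4 - {czero}) \<inter> (\<lambda>z. z k) -` (- {0}))"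
    by (rule continuous_openin_preimage_gen) auto
  moreover have "(cspace 4 - {czero}) \<inter> (\<lambda>z. z k) -` (- {0}) = {z \<in> cspace 4 - {czero}. z k \<noteq> 0}" by auto
  ultimately show ?thesis by simp
qed

text \<open>Two lifts of the same points differ by a nonvanishing holomorphic factor.
  Differentiating the relation between them by the product and chain rules gives l as the value and
  \<open>\<mu>\<close> as the derivatives of this factor.\<close>

lemma lift_change:
  assumes d: "d > 0" and c: "c \<in> charts (FM d)" and e: "e \<in> charts (FM d)" and x: "x \<in> fst c" "x \<in> fst e"
    and L: "lift c W \<psi>" "snd c x \<in> W" and L': "lift e W' \<psi>'" "snd e x \<in> W'"
  obtains l \<mu> where "l \<noteq> 0" "\<And>k. k < 4 \<Longrightarrow> \<psi>' (snd e x) k = l * \<psi> (snd c x) k"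
    "\<And>b k. b < 2 \<Longrightarrow> k < 4 \<Longrightarrow> pd b \<psi>' (snd e x) k = \<mu> b * \<psi> (snd c x) k + l * (\<Sum>a<2. pd a \<psi> (snd c x) k * jac c e x a b)"
proof -
  define \<tau> where "\<tau> w = snd c (from_coords e w)" for w
  obtain V where V: "open_in_cspace 2 V" "snd e x \<in> V" "V \<subseteq> snd e ` (fst c \<inter> fst e)" "hol_map V \<tau>"
    unfolding \<tau>_def by (rule transition_holomorphic[OF d c e x])
  define w0 where "w0 = snd e x"
  have \<tau>0: "\<tau> w0 = snd c x" using from_coords_snd[OF e x(2)] by (simp add: \<tau>_def w0_def)
  obtain k0 where k0: "k0 < 4" "\<psi> (snd c x) k0 \<noteq> 0"
    using cone_nonzero[OF lift_cone[OF c L]] by blast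
  define W1 where "W1 = {w \<in> W. \<psi> w \<in> {z \<in> cspace 4 - {czero}. z k0 \<noteq> 0}}"
  have W1: "open_in_cspace 2 W1" unfolding W1_def by (rule lift_preimage_open[OF L(1) openin_coord_nonzero])
  have W1W: "W1 \<subseteq> W" and W1k: "\<And>w. w \<in> W1 \<Longrightarrow> \<psi> w k0 \<noteq> 0" by (auto simp: W1_def)
  have xW1: "snd c x \<in> W1" using L k0 by (auto simp: W1_def lift_def)
  define V1 where "V1 = {w \<in> V \<inter> W'. \<tau> w \<in> W1}"
  have VW: "open_in_cspace 2 (V \<inter> W')" using V(1) L'(1) by (auto simp: lift_def)
  have "hol_map (V \<inter> W') \<tau>" using V(4) by (auto simp: hol_map_def intro: hol_on_subset)
  then have V1: "open_in_cspace 2 V1" unfolding V1_def by (rule hol_map_preimage_open[OF VW _ W1])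
  have h\<tau>: "hol_map V1 \<tau>" using V(4) by (auto simp: V1_def hol_map_def intro: hol_on_subset)
  have w0: "w0 \<in> V1" using V(2) L'(2) \<tau>0 xW1 by (simp add: V1_def w0_def)
  have \<tau>1: "\<tau> w \<in> W1" if "w \<in> V1" for w using that by (simp add: V1_def)
  have h\<psi>: "hol_on 2 V1 (\<lambda>w. \<psi> (\<tau> w) m)" if "m < 4" for m
    by (rule hol_on_compose[OF W1 V1 _ h\<tau> \<tau>1])
      (use L(1) that W1W in \<open>auto simp: lift_def holv_def intro: hol_on_subset\<close>)
  have h\<psi>': "hol_on 2 V1 (\<lambda>w. \<psi>' w m)" if "m < 4" for m
    using L'(1) that by (auto simp: lift_def holv_def V1_def intro: hol_on_subset)
  \<comment> \<open>The factor is read off from a coordinate that does not vanish near the point; as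
    a quotient of holomorphic functions it is holomorphic.\<close>
  define la where "la w = \<psi>' w k0 / \<psi> (\<tau> w) k0" for w
  have hla: "hol_on 2 V1 la" unfolding la_def
    by (rule hol_on_divide[OF h\<psi>'[OF k0(1)] h\<psi>[OF k0(1)]]) (use W1k \<tau>1 in blast)
  have eq: "\<psi>' w m = la w * \<psi> (\<tau> w) m" if w: "w \<in> V1" for w m
  proof -
    have wV: "w \<in> V" "w \<in> W'" using w by (auto simp: V1_def)
    obtain y where y: "y \<in> fst c" "y \<in> fst e" "w = snd e y" using V(3) wV(1) by blast
    have "pclass (\<psi>' w) = y" using lift_from_coords[OF e L'(1) wV(2)] from_coords_snd[OF e y(2)] y(3) by simp
    moreover have "pclass (\<psi> (\<tau> w)) = y"
      using lift_from_coords[OF c L(1), of "\<tau> w"] \<tau>1[OF w] W1W from_coords_snd[OF c y(1)] from_coords_snd[OF e y(2)]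
      by (auto simp: \<tau>_def y(3))
    ultimately have "pclass (\<psi>' w) = pclass (\<psi> (\<tau> w))" by simp
    then obtain r where r: "r \<noteq> 0" "\<psi>' w = (\<lambda>i. r * \<psi> (\<tau> w) i)" by (rule pclass_eqD)
    then have "la w = r" using W1k[OF \<tau>1[OF w]] by (simp add: la_def)
    with r show ?thesis by simp
  qed
  have "la w0 \<noteq> 0"
  proof
    assume "la w0 = 0"
    then have "\<psi>' w0 m = 0" for m using eq[OF w0, of m] by simp
    then show False using cone_nonzero[OF lift_cone[OF e L']] by (auto simp: w0_def)
  qed
  moreover have "\<psi>' (snd e x) m = la w0 * \<psi> (snd c x) m" for m
    using eq[OF w0] \<tau>0 by (simp add: w0_def)
  moreover have "pd b \<psi>' (snd e x) m = cpartial b la w0 * \<psi> (snd c x) m + la w0 * (\<Sum>a<2. pd a \<psi> (snd c x) m * jac c e x a b)"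
    if b: "b < 2" and m: "m < 4" for b m
  proof -
    have "pd b \<psi>' w0 m = cpartial b (\<lambda>w. la w * \<psi> (\<tau> w) m) w0"
      unfolding pd_def by (rule cpartial_cong[OF V1 w0 b]) (rule eq)
    also have "\<dots> = cpartial b la w0 * \<psi> (\<tau> w0) m + la w0 * cpartial b (\<lambda>w. \<psi> (\<tau> w) m) w0"
      by (rule cpartial_mult[OF hla h\<psi>[OF m] w0 b])
    also have "cpartial b (\<lambda>w. \<psi> (\<tau> w) m) w0 = (\<Sum>a<2. cpartial a (\<lambda>w. \<psi> w m) (\<tau> w0) * cpartial b (\<lambda>z. \<tau> z a) w0)"
      by (rule cpartial_compose[OF W1 V1 _ h\<tau> w0 \<tau>1[OF w0] b])
        (use L(1) m W1W in \<open>auto simp: lift_def holv_def intro: hol_on_subset\<close>)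
    finally show ?thesis unfolding \<tau>0 unfolding w0_def jac_def \<tau>_def pd_def .
  qed
  ultimately show thesis by (rule that)
qed

lemma jac_self:
  assumes c: "c \<in> charts (FM d)" and x: "x \<in> fst c" and b: "b < 2"
  shows "jac c c x a b = (if a = b then 1 else 0)"
proof -
  have "jac c c x a b = cpartial b (\<lambda>w. w a) (snd c x)"
    unfolding jac_def
  proof (rule cpartial_cong[OF chart_openin[OF c] _ b])
    show "snd c x \<in> snd c ` fst c" using x by blast
    show "snd c (from_coords c w) a = w a" if "w \<in> snd c ` fst c" for w
      by (simp add: snd_from_coords(1)[OF that])
  qed
  then show ?thesis by (simp add: cpartial_coord)
qed

lemma fs_cong:
  assumes "\<And>k. k < 4 \<Longrightarrow> P k = P' k" "\<And>k. k < 4 \<Longrightarrow> a k = a' k" "\<And>k. k < 4 \<Longrightarrow> b k = b' k"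
  shows "fs P a b = fs P' a' b'"
  using ip_cong[of P P' P P'] ip_cong[of a a' P P'] ip_cong[of P P' b b'] ip_cong[of a a' b b'] assms
  unfolding fs_def by simp

lemma fs_sesquilinear:
  fixes E :: "nat \<Rightarrow> cvec"
  shows "fs P (\<lambda>k. \<Sum>p<2. E p k * s p) (\<lambda>k. \<Sum>q<2. E q k * t q) = (\<Sum>p<2. \<Sum>q<2. s p * cnj (t q) * fs P (E p) (E q))"
  unfolding sum_lessThan_2 fs_def mult.commute[of "E _ _"] ip_simps by (simp add: algebra_simps)

text \<open>The lift is chosen anew for every point. By \<open>fs_metric_eq\<close> the value does
  not depend on it, so a single lift can be used on a whole neighbourhood.\<close>

definition fs_metric :: "ppoint chart \<Rightarrow> ppoint \<Rightarrow> nat \<Rightarrow> nat \<Rightarrow> complex"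
  where "fs_metric c x a b = (let \<psi> = (SOME \<psi>. \<exists>W. lift c W \<psi> \<and> snd c x \<in> W)
    in fs (\<psi> (snd c x)) (pd a \<psi> (snd c x)) (pd b \<psi> (snd c x)))"

text \<open>By \<open>lift_change\<close> the derivatives transform by the Jacobian up to the common
  factor and multiples of the point, and \<open>fs_invariant\<close> absorbs both.\<close>

lemma fs_lift_change:
  assumes d: "d > 0" and c: "c \<in> charts (FM d)" and e: "e \<in> charts (FM d)" and x: "x \<in> fst c" "x \<in> fst e"
    and L: "lift c W \<psi>" "snd c x \<in> W" and L': "lift e W' \<psi>'" "snd e x \<in> W'" and ab: "a < 2" "b < 2"
  shows "fs (\<psi>' (snd e x)) (pd a \<psi>' (snd e x)) (pd b \<psi>' (snd e x)) =
    (\<Sum>p<2. \<Sum>q<2. jac c e x p a * cnj (jac c e x q b) * fs (\<psi> (snd c x)) (pd p \<psi> (snd c x)) (pd q \<psi> (snd c x)))"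
proof -
  obtain l \<mu> where l: "l \<noteq> 0" "\<And>k. k < 4 \<Longrightarrow> \<psi>' (snd e x) k = l * \<psi> (snd c x) k"
    "\<And>b k. b < 2 \<Longrightarrow> k < 4 \<Longrightarrow> pd b \<psi>' (snd e x) k = \<mu> b * \<psi> (snd c x) k + l * (\<Sum>a<2. pd a \<psi> (snd c x) k * jac c e x a b)"
    by (rule lift_change[OF d c e x L L']) (rule that)
  have "fs (\<psi>' (snd e x)) (pd a \<psi>' (snd e x)) (pd b \<psi>' (snd e x)) =
    fs (\<lambda>k. l * \<psi> (snd c x) k) (\<lambda>k. l * (\<Sum>p<2. pd p \<psi> (snd c x) k * jac c e x p a) + \<mu> a * \<psi> (snd c x) k)
      (\<lambda>k. l * (\<Sum>q<2. pd q \<psi> (snd c x) k * jac c e x q b) + \<mu> b * \<psi> (snd c x) k)"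
    by (rule fs_cong) (simp_all add: l ab add.commute)
  also have "\<dots> = fs (\<psi> (snd c x)) (\<lambda>k. \<Sum>p<2. pd p \<psi> (snd c x) k * jac c e x p a) (\<lambda>k. \<Sum>q<2. pd q \<psi> (snd c x) k * jac c e x q b)"
    by (rule fs_invariant[OF l(1)])
  finally show ?thesis by (simp only: fs_sesquilinear)
qed

text \<open>The case of two lifts for the same chart, where the Jacobian is the identity.\<close>

lemma fs_metric_eq:
  assumes d: "d > 0" and c: "c \<in> charts (FM d)" and x: "x \<in> fst c" and L: "lift c W \<psi>" "snd c x \<in> W"
    and ab: "a < 2" "b < 2"
  shows "fs_metric c x a b = fs (\<psi> (snd c x)) (pd a \<psi> (snd c x)) (pd b \<psi> (snd c x))"
proof -
  define \<psi>' where "\<psi>' = (SOME \<psi>. \<exists>W. lift c W \<psi> \<and> snd c x \<in> W)"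
  have "\<exists>W. lift c W \<psi>' \<and> snd c x \<in> W"
    unfolding \<psi>'_def by (rule someI[of _ \<psi>]) (use L in blast)
  then obtain W' where L': "lift c W' \<psi>'" "snd c x \<in> W'" by blast
  have "fs (\<psi>' (snd c x)) (pd a \<psi>' (snd c x)) (pd b \<psi>' (snd c x)) = fs (\<psi> (snd c x)) (pd a \<psi> (snd c x)) (pd b \<psi> (snd c x))"
    using fs_lift_change[OF d c c x x L L' ab] ab jac_self[OF c x]
    by (auto simp: sum_lessThan_2 less_2_cases_iff)
  then show ?thesis by (simp add: fs_metric_def \<psi>'_def Let_def)
qed

lemma fs_metric_transform:
  assumes d: "d > 0" and c: "c \<in> charts (FM d)" and e: "e \<in> charts (FM d)" and x: "x \<in> fst c" "x \<in> fst e"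
    and ab: "a < 2" "b < 2"
  shows "fs_metric e x a b = (\<Sum>p<2. \<Sum>q<2. jac c e x p a * cnj (jac c e x q b) * fs_metric c x p q)"
proof -
  obtain W \<psi> where L: "lift c W \<psi>" "snd c x \<in> W" using c x(1) unfolding chart_iff by blast
  obtain W' \<psi>' where L': "lift e W' \<psi>'" "snd e x \<in> W'" using e x(2) unfolding chart_iff by blast
  show ?thesis
    unfolding fs_metric_eq[OF d e x(2) L' ab] fs_lift_change[OF d c e x L L' ab]
    by (intro sum.cong refl) (simp add: fs_metric_eq[OF d c x(1) L])
qed

text \<open>Subtracting from a its projection onto P does not change the form, which then becomes a
  quotient of two squared norms.\<close>

lemma fs_positive:
  assumes P: "ip P P \<noteq> 0" and a: "\<And>m. \<exists>k<4. a k - m * P k \<noteq> 0"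
  shows "Re (fs P a a) > 0"
proof -
  define m where "m = ip a P / ip P P"
  define y where "y = (\<lambda>k. a k - m * P k)"
  have o: "ip y P = 0" "ip P y = 0"
  proof -
    show "ip y P = 0" unfolding y_def ip_simps using P by (simp add: m_def)
    then show "ip P y = 0" using ip_cnj[of y P] by simp
  qed
  have "fs P a a = fs (\<lambda>k. 1 * P k) (\<lambda>k. 1 * y k + m * P k) (\<lambda>k. 1 * y k + m * P k)"
    by (simp add: y_def)
  also have "\<dots> = fs P y y" by (rule fs_invariant) simp
  also have "\<dots> = ip y y / ip P P" using P by (simp add: fs_def o divide_inverse)
  also have "\<dots> = of_real (Re (ip y y) / Re (ip P P))"
    by (simp add: ip_self)
  finally have "Re (fs P a a) = Re (ip y y) / Re (ip P P)" by simp
  moreover have "Re (ip y y) > 0" using a[of m] ip_self_pos[of _ y] by (auto simp: y_def)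
  moreover have "Re (ip P P) > 0"
  proof -
    have "\<exists>k<4. P k \<noteq> 0"
    proof (rule ccontr)
      assume "\<not> ?thesis"
      then have "ip P P = 0" by (simp add: ip_def)
      with P show False by simp
    qed
    then show ?thesis using ip_self_pos by blast
  qed
  ultimately show ?thesis by simp
qed

lemma fs_metric_herm:
  assumes d: "d > 0" and c: "c \<in> charts (FM d)" and x: "x \<in> fst c"
  shows "herm2 (fs_metric c x)"
proof -
  obtain W \<psi> where L: "lift c W \<psi>" "snd c x \<in> W" "immersive_at (snd c x) \<psi>" using c x unfolding chart_iff by blast
  note eq = fs_metric_eq[OF d c x L(1,2)]
  show ?thesis
    unfolding herm2_def
  proof (intro conjI allI impI ballI)
    show "fs_metric c x a b = cnj (fs_metric c x b a)" if "a < 2" "b < 2" for a b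
      using that by (simp add: eq fs_cnj)
    fix v assume v: "v \<in> cspace 2 - {czero}"
    have "(\<Sum>a<2. \<Sum>b<2. fs_metric c x a b * v a * cnj (v b)) =
      (\<Sum>a<2. \<Sum>b<2. v a * cnj (v b) * fs (\<psi> (snd c x)) (pd a \<psi> (snd c x)) (pd b \<psi> (snd c x)))"
      by (intro sum.cong refl) (simp add: eq)
    also have "\<dots> = fs (\<psi> (snd c x)) (\<lambda>k. \<Sum>a<2. pd a \<psi> (snd c x) k * v a) (\<lambda>k. \<Sum>a<2. pd a \<psi> (snd c x) k * v a)"
      by (simp only: fs_sesquilinear)
    also have "Re \<dots> > 0"
    proof (rule fs_positive)
      show "ip (\<psi> (snd c x)) (\<psi> (snd c x)) \<noteq> 0" by (rule ip_cone_nonzero[OF lift_cone[OF c L(1,2)]])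
      show "\<exists>k<4. (\<Sum>a<2. pd a \<psi> (snd c x) k * v a) - m * \<psi> (snd c x) k \<noteq> 0" for m
      proof (rule ccontr)
        assume "\<not> ?thesis"
        then have "\<forall>k<4. - m * \<psi> (snd c x) k + v 0 * pd 0 \<psi> (snd c x) k + v 1 * pd 1 \<psi> (snd c x) k = 0"
          by (simp add: sum_lessThan_2 algebra_simps)
        then have "v 0 = 0 \<and> v 1 = 0" using L(3) unfolding immersive_at_def by blast
        then show False using cspace2_nonzero[OF v] by simp
      qed
    qed
    finally show "Re (\<Sum>a<2. \<Sum>b<2. fs_metric c x a b * v a * cnj (v b)) > 0" .
  qed
qed

text \<open>Prepares the metric for \<open>Ck_on_fs\<close> and \<open>fs_rc_positive\<close>. The
  coordinates are those of c, the frame is that of i: P is a lift for i composed with the change of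
  coordinates, and E consists of its derivatives in the coordinates of i, composed likewise.\<close>

lemma fs_metric_local:
  assumes d: "d > 0" and c: "c \<in> charts (FM d)" and i: "i \<in> charts (FM d)" and x: "x \<in> fst c" "x \<in> fst i"
  obtains V P E where "open_in_cspace 2 V" "snd c x \<in> V" "V \<subseteq> snd c ` (fst c \<inter> fst i)" "holv 2 V P" "\<And>a. a < 2 \<Longrightarrow> holv 2 V (E a)"
    "\<And>z. z \<in> V \<Longrightarrow> ip (P z) (P z) \<noteq> 0"
    "\<And>z a b. z \<in> V \<Longrightarrow> a < 2 \<Longrightarrow> b < 2 \<Longrightarrow> fs_metric i (from_coords c z) a b = fs (P z) (E a z) (E b z)"
    "\<And>e f g. (\<And>k. k < 4 \<Longrightarrow> e * P (snd c x) k + f * E 0 (snd c x) k + g * E 1 (snd c x) k = 0) \<Longrightarrow> f = 0 \<and> g = 0"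
    "\<And>e f g. (\<And>k. k < 4 \<Longrightarrow> e * P (snd c x) k + f * pd 0 P (snd c x) k + g * pd 1 P (snd c x) k = 0) \<Longrightarrow> f = 0 \<and> g = 0"
proof -
  obtain W \<psi> where L: "lift i W \<psi>" "snd i x \<in> W" "immersive_at (snd i x) \<psi>" using i x(2) unfolding chart_iff by blast
  obtain W' \<psi>' where L': "lift c W' \<psi>'" "snd c x \<in> W'" "immersive_at (snd c x) \<psi>'" using c x(1) unfolding chart_iff by blast
  have Wo: "open_in_cspace 2 W" using L(1) by (simp add: lift_def)
  define \<tau> where "\<tau> w = snd i (from_coords c w)" for w
  obtain V0 where V0: "open_in_cspace 2 V0" "snd c x \<in> V0" "V0 \<subseteq> snd c ` (fst i \<inter> fst c)" "hol_map V0 \<tau>"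
    unfolding \<tau>_def by (rule transition_holomorphic[OF d i c x(2,1)])
  define V where "V = {w \<in> V0. \<tau> w \<in> W}"
  have V: "open_in_cspace 2 V" unfolding V_def by (rule hol_map_preimage_open[OF V0(1,4) Wo])
  have h\<tau>: "hol_map V \<tau>" using V0(4) by (auto simp: V_def hol_map_def intro: hol_on_subset)
  have \<tau>W: "\<tau> z \<in> W" if "z \<in> V" for z using that by (simp add: V_def)
  have \<tau>0: "\<tau> (snd c x) = snd i x" using from_coords_snd[OF c x(1)] by (simp add: \<tau>_def)
  have z0: "snd c x \<in> V" using V0(2) L(2) \<tau>0 by (simp add: V_def)
  have hW: "holv 2 W \<psi>" using L(1) by (simp add: lift_def)
  have comp: "holv 2 V (\<lambda>z. F (\<tau> z))" if "holv 2 W F" for F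
    unfolding holv_def
  proof (intro allI impI)
    fix k :: nat assume "k < 4"
    then show "hol_on 2 V (\<lambda>z. F (\<tau> z) k)"
      using that by (intro hol_on_compose[OF Wo V _ h\<tau> \<tau>W, of "\<lambda>w. F w k"]) (simp_all add: holv_def)
  qed
  define P where "P z = \<psi> (\<tau> z)" for z
  define E where "E a z = pd a \<psi> (\<tau> z)" for a z
  have pdP: "pd b P (snd c x) k = (\<Sum>a<2. pd a \<psi> (snd i x) k * jac i c x a b)" if "b < 2" "k < 4" for b k
    unfolding pd_def P_def jac_def \<tau>0[symmetric]
    using cpartial_compose[OF Wo V _ h\<tau> z0 \<tau>W[OF z0] that(1), of "\<lambda>w. \<psi> w k"] hW that(2)
    by (simp add: holv_def \<tau>_def)
  show thesis
  proof (rule that[of V P E])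
    show "open_in_cspace 2 V" by (rule V)
    show "snd c x \<in> V" by (rule z0)
    show "V \<subseteq> snd c ` (fst c \<inter> fst i)" using V0(3) by (auto simp: V_def)
    show "holv 2 V P" unfolding P_def by (rule comp[OF hW])
    show "holv 2 V (E a)" if "a < 2" for a unfolding E_def by (rule comp[OF holv_pd[OF Wo hW that]])
    show "ip (P z) (P z) \<noteq> 0" if "z \<in> V" for z
      unfolding P_def by (rule ip_cone_nonzero[OF lift_cone[OF i L(1) \<tau>W[OF that]]])
    show "fs_metric i (from_coords c z) a b = fs (P z) (E a z) (E b z)" if "z \<in> V" "a < 2" "b < 2" for z a b
    proof -
      have "z \<in> snd c ` (fst i \<inter> fst c)" using that(1) V0(3) by (auto simp: V_def)
      then have "from_coords c z \<in> fst i" using from_coords_snd[OF c] by auto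
      from fs_metric_eq[OF d i this L(1) _ that(2,3)] \<tau>W[OF that(1)]
      show ?thesis by (simp add: P_def E_def \<tau>_def)
    qed
    show "f = 0 \<and> g = 0" if "\<And>k. k < 4 \<Longrightarrow> e * P (snd c x) k + f * E 0 (snd c x) k + g * E 1 (snd c x) k = 0" for e f g
      using that L(3) unfolding immersive_at_def P_def E_def \<tau>0 by blast
    \<comment> \<open>Up to the factor l and multiples of P, the derivatives of P are those of a
      lift for c, whose immersivity therefore carries over.\<close>
    obtain l \<mu> where l: "l \<noteq> 0" "\<And>k. k < 4 \<Longrightarrow> \<psi>' (snd c x) k = l * \<psi> (snd i x) k"
      "\<And>b k. b < 2 \<Longrightarrow> k < 4 \<Longrightarrow> pd b \<psi>' (snd c x) k = \<mu> b * \<psi> (snd i x) k + l * (\<Sum>a<2. pd a \<psi> (snd i x) k * jac i c x a b)"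
      by (rule lift_change[OF d i c x(2,1) L(1,2) L'(1,2)]) (rule that)
    show "f = 0 \<and> g = 0" if *: "\<And>k. k < 4 \<Longrightarrow> e * P (snd c x) k + f * pd 0 P (snd c x) k + g * pd 1 P (snd c x) k = 0" for e f g
    proof -
      have "(e - (f * \<mu> 0 + g * \<mu> 1) / l) * \<psi>' (snd c x) k + f * pd 0 \<psi>' (snd c x) k + g * pd 1 \<psi>' (snd c x) k = 0"
        if k: "k < 4" for k
      proof -
        have alg: "(e - (f * m0 + g * m1) / l) * (l * p) + f * (m0 * p + l * q0) + g * (m1 * p + l * q1) = l * (e * p + f * q0 + g * q1)"
          for m0 m1 p q0 q1 :: complex
          using l(1) by (simp add: field_simps)
        have "pd 0 \<psi>' (snd c x) k = \<mu> 0 * \<psi> (snd i x) k + l * pd 0 P (snd c x) k"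
          "pd 1 \<psi>' (snd c x) k = \<mu> 1 * \<psi> (snd i x) k + l * pd 1 P (snd c x) k"
          using l(3)[OF _ k, of 0] l(3)[OF _ k, of 1] pdP[OF _ k, of 0] pdP[OF _ k, of 1] by simp_all
        then show ?thesis
          using alg[of "\<mu> 0" "\<mu> 1" "\<psi> (snd i x) k" "pd 0 P (snd c x) k" "pd 1 P (snd c x) k"] *[OF k]
          by (simp add: l(2)[OF k] P_def \<tau>0)
      qed
      then show ?thesis using L'(3) unfolding immersive_at_def by blast
    qed
  qed
qed

lemma tangent_bundle_simps [simp]:
  "bundle_rank (tangent_bundle M) = cdim M" "frames (tangent_bundle M) = charts M" "frame_dom (tangent_bundle M) = fst"
  "transition (tangent_bundle M) c e x a b = jac c e x a b" if "M = FM d" for M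
  by (simp_all add: tangent_bundle_def jac_def)

theorem fs_metric_hermitian_metric:
  assumes d: "d > 0"
  shows "hermitian_metric (FM d) (tangent_bundle (FM d)) fs_metric"
  unfolding hermitian_metric_def tangent_bundle_simps[OF refl] cdim_FM
proof (intro conjI ballI)
  fix i x assume "i \<in> charts (FM d)" "x \<in> fst i"
  from fs_metric_herm[OF d this]
  show "\<forall>a<2. \<forall>b<2. fs_metric i x a b = cnj (fs_metric i x b a)"
    "\<And>v. v \<in> cspace 2 - {czero} \<Longrightarrow> 0 < Re (\<Sum>a<2. \<Sum>b<2. fs_metric i x a b * v a * cnj (v b))"
    unfolding herm2_def by blast+
next
  fix i j x assume "i \<in> charts (FM d)" "j \<in> charts (FM d)" "x \<in> fst i \<inter> fst j"
  then show "\<forall>a<2. \<forall>b<2. fs_metric j x a b = (\<Sum>p<2. \<Sum>q<2. jac i j x p a * cnj (jac i j x q b) * fs_metric i x p q)"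
    using fs_metric_transform[OF d] by blast
next
  fix i c assume i: "i \<in> charts (FM d)" and c: "c \<in> charts (FM d)"
  show "\<forall>a<2. \<forall>b<2. smooth_fun_on 2 (snd c ` (fst c \<inter> fst i)) (\<lambda>z. fs_metric i (from_coords c z) a b)"
    unfolding smooth_fun_on_def
  proof (intro allI impI)
    fix a b k :: nat assume ab: "a < 2" "b < 2"
    show "Ck_on k 2 (snd c ` (fst c \<inter> fst i)) (\<lambda>z. fs_metric i (from_coords c z) a b)"
    proof (rule Ck_on_local)
      fix z assume "z \<in> snd c ` (fst c \<inter> fst i)"
      then obtain x where x: "x \<in> fst c" "x \<in> fst i" "z = snd c x" by blast
      obtain V P E where V: "open_in_cspace 2 V" "snd c x \<in> V" "V \<subseteq> snd c ` (fst c \<inter> fst i)"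
        and P: "holv 2 V P" and E: "\<And>a. a < 2 \<Longrightarrow> holv 2 V (E a)" and nz: "\<And>z. z \<in> V \<Longrightarrow> ip (P z) (P z) \<noteq> 0"
        and eq: "\<And>z a b. z \<in> V \<Longrightarrow> a < 2 \<Longrightarrow> b < 2 \<Longrightarrow> fs_metric i (from_coords c z) a b = fs (P z) (E a z) (E b z)"
        by (rule fs_metric_local[OF d c i x(1,2)]) (rule that)
      have "Ck_on k 2 V (\<lambda>z. fs (P z) (E a z) (E b z))"
        by (rule Ck_on_fs[OF V(1) P E[OF ab(1)] E[OF ab(2)] nz])
      then have "Ck_on k 2 V (\<lambda>z. fs_metric i (from_coords c z) a b)"
        by (rule Ck_on_cong[OF V(1), rotated]) (simp add: eq ab)
      then show "\<exists>V. open_in_cspace 2 V \<and> z \<in> V \<and> V \<subseteq> snd c ` (fst c \<inter> fst i) \<and> Ck_on k 2 V (\<lambda>z. fs_metric i (from_coords c z) a b)"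
        using V x(3) by blast
    qed
  qed
qed

theorem fermat_rc_positive:
  assumes d: "d > 0"
  shows "rc_positive (FM d) (tangent_bundle (FM d))"
  unfolding rc_positive_def rc_positive_at_def curvature_form_def tangent_bundle_simps[OF refl] cdim_FM
proof (intro exI[of _ fs_metric] conjI ballI impI)
  show "hermitian_metric (FM d) (tangent_bundle (FM d)) fs_metric" by (rule fs_metric_hermitian_metric[OF d])
  fix x c i v
  assume c: "c \<in> charts (FM d)" and i: "i \<in> charts (FM d)" and x: "x \<in> fst c" "x \<in> fst i" and v: "v \<in> cspace 2 - {czero}"
  show "\<exists>u\<in>cspace 2 - {czero}. 0 < Re (\<Sum>k<2. \<Sum>l<2. \<Sum>a<2. \<Sum>b<2.
      chern_curvature 2 (\<lambda>z. fs_metric i (from_coords c z)) (snd c x) k l a b * u k * cnj (u l) * v a * cnj (v b))"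
  proof (rule fs_metric_local[OF d c i x])
    fix V P E
    assume V: "open_in_cspace 2 V" "snd c x \<in> V"
      and P: "holv 2 V P" and E: "\<And>a. a < 2 \<Longrightarrow> holv 2 V (E a)" and nz: "\<And>z. z \<in> V \<Longrightarrow> ip (P z) (P z) \<noteq> 0"
      and eq: "\<And>z a b. z \<in> V \<Longrightarrow> a < 2 \<Longrightarrow> b < 2 \<Longrightarrow> fs_metric i (from_coords c z) a b = fs (P z) (E a z) (E b z)"
      and i1: "\<And>e f g. (\<And>k. k < 4 \<Longrightarrow> e * P (snd c x) k + f * E 0 (snd c x) k + g * E 1 (snd c x) k = 0) \<Longrightarrow> f = 0 \<and> g = 0"
      and i2: "\<And>e f g. (\<And>k. k < 4 \<Longrightarrow> e * P (snd c x) k + f * pd 0 P (snd c x) k + g * pd 1 P (snd c x) k = 0) \<Longrightarrow> f = 0 \<and> g = 0"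
    show ?thesis by (rule fs_rc_positive[OF V(1) P E nz V(2) eq i1 i2 v])
  qed
qed

section \<open>Connectedness of Fermat surfaces\<close>

lemma complex_root_exists:
  assumes "d > 0" obtains \<alpha> :: complex where "\<alpha> ^ d = a"
proof (cases "a = 0")
  case True then show thesis using assms that[of 0] by simp
next
  case False
  have "exp (Ln a / of_nat d) ^ d = a" using assms False by (simp add: exp_of_nat_mult[symmetric])
  then show thesis by (rule that)
qed

text \<open>The segment from \<open>y ^ d\<close> to a is lifted through the d-th power, although it
  may run through the branch point 0. For y = 0 the real root of the parameter does it. Otherwise
  divide by \<open>y ^ d\<close>: the segment from 1 to r either stays in the slit plane, where
  \<open>rt d\<close> is continuous, or lies on the real axis. In the latter case real roots are
  used on the positive part, and real roots times a d-th root of -1 on the negative part; they meet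
  at 0.\<close>

lemma segment_root_lift:
  fixes y a :: complex
  assumes d: "d > 0"
  obtains g where "continuous_on {0..1} g" "g 0 = y"
    "\<And>t. 0 \<le> t \<Longrightarrow> t \<le> 1 \<Longrightarrow> g t ^ d = of_real (1 - t) * y ^ d + of_real t * a"
proof (cases "y = 0")
  case True
  obtain \<alpha> where \<alpha>: "\<alpha> ^ d = a" by (rule complex_root_exists[OF d])
  show thesis
  proof (rule that[of "\<lambda>t. of_real (root d t) * \<alpha>"])
    show "continuous_on {0..1} (\<lambda>t. complex_of_real (root d t) * \<alpha>)" by (intro continuous_intros)
    show "complex_of_real (root d 0) * \<alpha> = y" using d True by simp
    show "(of_real (root d t) * \<alpha>) ^ d = of_real (1 - t) * y ^ d + of_real t * a" if "0 \<le> t" for t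
      using d True that by (simp add: power_mult_distrib \<alpha> flip: of_real_power)
  qed
next
  case y: False
  define r where "r = a / y ^ d"
  have a: "a = y ^ d * r" using y by (simp add: r_def)
  show thesis
  proof (cases "r \<in> \<real>\<^sub>\<le>\<^sub>0")
    case False
    have slit: "of_real (1 - t) + of_real t * r \<notin> \<real>\<^sub>\<le>\<^sub>0" if "0 \<le> t" "t \<le> 1" for t
    proof
      assume "of_real (1 - t) + of_real t * r \<in> \<real>\<^sub>\<le>\<^sub>0"
      then have *: "1 - t + t * Re r \<le> 0" "t * Im r = 0" by (auto simp: complex_nonpos_Reals_iff)
      then have "t \<noteq> 0" by auto
      then have "Im r = 0" using * by simp
      then have "Re r > 0" using False by (auto simp: complex_nonpos_Reals_iff)
      then have "t * Re r > 0" using \<open>t \<noteq> 0\<close> that by simp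
      then show False using * that by simp
    qed
    show thesis
    proof (rule that[of "\<lambda>t. y * rt d (of_real (1 - t) + of_real t * r)"])
      have "continuous_on {0..1} (\<lambda>t. rt d (of_real (1 - t) + of_real t * r))"
        by (rule continuous_on_compose2[OF holomorphic_on_imp_continuous_on[OF rt_holomorphic]])
          (use slit in \<open>auto intro!: continuous_intros simp del: of_real_diff\<close>)
      then show "continuous_on {0..1} (\<lambda>t. y * rt d (of_real (1 - t) + of_real t * r))"
        by (intro continuous_on_mult continuous_on_const)
      show "y * rt d (of_real (1 - 0) + of_real 0 * r) = y" by (simp add: rt_def)
      show "(y * rt d (of_real (1 - t) + of_real t * r)) ^ d = of_real (1 - t) * y ^ d + of_real t * a" if "0 \<le> t" "t \<le> 1" for t
        unfolding power_mult_distrib rt_sector(2)[OF d slit[OF that]] a by (simp add: algebra_simps)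
    qed
  next
    case True
    then obtain s where s: "r = of_real s" by (auto elim!: nonpos_Reals_cases)
    obtain \<zeta> :: complex where \<zeta>: "\<zeta> ^ d = -1" by (rule complex_root_exists[OF d])
    define v where "v t = 1 - t + t * s" for t
    show thesis
    proof (rule that[of "\<lambda>t. y * (of_real (root d (max (v t) 0)) + \<zeta> * of_real (root d (max (- v t) 0)))"])
      show "continuous_on {0..1} (\<lambda>t. y * (of_real (root d (max (v t) 0)) + \<zeta> * of_real (root d (max (- v t) 0))))"
        unfolding v_def by (intro continuous_intros)
      show "y * (of_real (root d (max (v 0) 0)) + \<zeta> * of_real (root d (max (- v 0) 0))) = y"
        using d by (simp add: v_def)
      show "(y * (of_real (root d (max (v t) 0)) + \<zeta> * of_real (root d (max (- v t) 0)))) ^ d = of_real (1 - t) * y ^ d + of_real t * a" for t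
      proof -
        have *: "(of_real (root d (max (v t) 0)) + \<zeta> * of_real (root d (max (- v t) 0))) ^ d = (of_real (v t) :: complex)"
          using d by (cases "v t \<ge> 0") (simp_all add: max_def power_mult_distrib \<zeta> flip: of_real_power)
        show ?thesis
          unfolding power_mult_distrib[of y] * unfolding a s v_def by (simp add: algebra_simps)
      qed
    qed
  qed
qed

section \<open>Paths in the cone over a Fermat surface\<close>

definition vec4 :: "complex \<Rightarrow> complex \<Rightarrow> complex \<Rightarrow> complex \<Rightarrow> cvec"
  where "vec4 a b c e = (\<lambda>i. if i = 0 then a else if i = 1 then b else if i = 2 then c else if i = 3 then e else 0)"

lemma vec4_simps [simp]: "vec4 a b c e 0 = a" "vec4 a b c e (Suc 0) = b" "vec4 a b c e 2 = c" "vec4 a b c e 3 = e"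
  "vec4 a b c e \<in> cspace 4"
  by (auto simp: vec4_def cspace_def)

lemma sum_lessThan_4: "(\<Sum>i<4. f i) = f 0 + f (Suc 0) + f 2 + f 3" for f :: "nat \<Rightarrow> 'a::comm_monoid_add"
  by (simp add: eval_nat_numeral add.assoc)

lemma vec4_coords: "z \<in> cspace 4 \<Longrightarrow> z = vec4 (z 0) (z (Suc 0)) (z 2) (z 3)"
proof
  fix i assume z: "z \<in> cspace 4"
  show "z i = vec4 (z 0) (z (Suc 0)) (z 2) (z 3) i"
  proof (cases "i < 4")
    case True
    then have "i = 0 \<or> i = 1 \<or> i = 2 \<or> i = 3" by auto
    then show ?thesis by auto
  qed (use z in \<open>auto simp: cspace_def vec4_def\<close>)
qed

lemma vec4_cone:
  "vec4 a b c e \<in> fermat_cone d \<longleftrightarrow> a ^ d + b ^ d + c ^ d + e ^ d = 0 \<and> \<not> (a = 0 \<and> b = 0 \<and> c = 0 \<and> e = 0)"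
proof -
  have "vec4 a b c e = czero \<longleftrightarrow> a = 0 \<and> b = 0 \<and> c = 0 \<and> e = 0"
  proof
    assume h: "vec4 a b c e = czero"
    show "a = 0 \<and> b = 0 \<and> c = 0 \<and> e = 0"
      using fun_cong[OF h, of 0] fun_cong[OF h, of 1] fun_cong[OF h, of 2] fun_cong[OF h, of 3] by (simp add: czero_def)
  qed (auto simp: vec4_def czero_def)
  then show ?thesis by (auto simp: fermat_cone_def sum_lessThan_4)
qed

lemma continuous_on_vec4:
  assumes "continuous_on S a" "continuous_on S b" "continuous_on S c" "continuous_on S e"
  shows "continuous_on S (\<lambda>x. vec4 (a x) (b x) (c x) (e x))"
proof (rule continuous_on_coordinatewise_then_product)
  fix i :: nat
  consider "i = 0" | "i = 1" | "i = 2" | "i = 3" | "i \<ge> 4" by linarith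
  then show "continuous_on S (\<lambda>x. vec4 (a x) (b x) (c x) (e x) i)"
    by cases (use assms in \<open>auto simp: vec4_def\<close>)
qed

text \<open>Such vectors fill a complex plane inside the cone, lying over a line of the surface;
  without the origin the plane is still path connected.\<close>

lemma cone_line:
  assumes "d > 0" "\<zeta> ^ d = -1" "\<eta> ^ d = -1" "a \<noteq> 0 \<or> b \<noteq> 0" "a' \<noteq> 0 \<or> b' \<noteq> 0"
  shows "path_component (fermat_cone d) (vec4 a (\<zeta> * a) b (\<eta> * b)) (vec4 a' (\<zeta> * a') b' (\<eta> * b'))"
proof -
  let ?f = "\<lambda>p. vec4 (fst p) (\<zeta> * fst p) (snd p) (\<eta> * snd p)"
  have "path_connected (- {0 :: complex \<times> complex})"
    by (rule path_connected_punctured_universe) simp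
  then have "path_connected (?f ` (- {0}))"
    by (rule path_connected_continuous_image[rotated]) (intro continuous_on_vec4 continuous_intros)
  then have "path_component (?f ` (- {0})) (?f (a, b)) (?f (a', b'))"
    using assms(4,5) by (intro path_connected_component[THEN iffD1, rule_format] conjI imageI) (auto simp: prod_eq_iff)
  then have pc: "path_component (?f ` (- {0})) (vec4 a (\<zeta> * a) b (\<eta> * b)) (vec4 a' (\<zeta> * a') b' (\<eta> * b'))" by simp
  have "?f ` (- {0}) \<subseteq> fermat_cone d"
    using assms(1-3) by (auto simp: vec4_cone power_mult_distrib prod_eq_iff)
  from path_component_of_subset[OF this pc] show ?thesis .
qed

lemma path_componentI:
  fixes g :: "real \<Rightarrow> 'a::topological_space"
  assumes "continuous_on {0..1} g" "\<And>t. t \<in> {0..1} \<Longrightarrow> g t \<in> S"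
  shows "path_component S (g 0) (g 1)"
  unfolding path_component_def
  by (rule exI[of _ g]) (use assms in \<open>auto simp: path_def path_image_def pathstart_def pathfinish_def\<close>)

text \<open>With x and u fixed, \<open>y ^ d\<close> moves straight to \<open>- (x ^ d)\<close> and
  \<open>w ^ d\<close> to \<open>- (u ^ d)\<close>. The sum of the powers stays 0, and x or u keeps
  the path away from the origin. The endpoint lies in a plane as in \<open>cone_line\<close>, given
  by two roots \<open>\<zeta>\<close> and \<open>\<eta>\<close>. It meets the plane of
  \<open>\<zeta>0\<close> and \<open>\<eta>\<close>, which contains the base point.\<close>

lemma cone_to_base:
  assumes d: "d > 0" and \<zeta>0: "\<zeta>0 ^ d = -1" and z: "vec4 x y u w \<in> fermat_cone d" and xu: "x \<noteq> 0 \<or> u \<noteq> 0"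
  shows "path_component (fermat_cone d) (vec4 x y u w) (vec4 1 \<zeta>0 0 0)"
proof -
  obtain g where g: "continuous_on {0..1} g" "g 0 = y" "\<And>t. 0 \<le> t \<Longrightarrow> t \<le> 1 \<Longrightarrow> g t ^ d = of_real (1 - t) * y ^ d + of_real t * (- (x ^ d))"
    by (rule segment_root_lift[OF d, of y "- (x ^ d)"]) (rule that)
  obtain h where h: "continuous_on {0..1} h" "h 0 = w" "\<And>t. 0 \<le> t \<Longrightarrow> t \<le> 1 \<Longrightarrow> h t ^ d = of_real (1 - t) * w ^ d + of_real t * (- (u ^ d))"
    by (rule segment_root_lift[OF d, of w "- (u ^ d)"]) (rule that)
  have 1: "path_component (fermat_cone d) (vec4 x (g 0) u (h 0)) (vec4 x (g 1) u (h 1))"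
  proof (rule path_componentI[of "\<lambda>t. vec4 x (g t) u (h t)"])
    show "continuous_on {0..1} (\<lambda>t. vec4 x (g t) u (h t))" by (intro continuous_on_vec4 continuous_on_const g h)
    fix t :: real assume t: "t \<in> {0..1}"
    have "x ^ d + g t ^ d + u ^ d + h t ^ d = of_real (1 - t) * (x ^ d + y ^ d + u ^ d + w ^ d)"
    proof -
      have "g t ^ d = of_real (1 - t) * y ^ d + of_real t * (- (x ^ d))" "h t ^ d = of_real (1 - t) * w ^ d + of_real t * (- (u ^ d))"
        using g(3)[of t] h(3)[of t] t by auto
      then show ?thesis by (simp only:) (simp add: algebra_simps)
    qed
    then show "vec4 x (g t) u (h t) \<in> fermat_cone d" using z xu by (auto simp: vec4_cone)
  qed
  have root: "\<exists>\<zeta>. \<zeta> ^ d = -1 \<and> y = \<zeta> * x" if "y ^ d = - (x ^ d)" for x y :: complex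
  proof (cases "x = 0")
    case True
    then have "y = 0" using that d by (simp add: power_0_left)
    then show ?thesis using True \<zeta>0 by auto
  next
    case False
    then show ?thesis using that by (intro exI[of _ "y / x"]) (simp add: power_divide)
  qed
  obtain \<zeta> where \<zeta>: "\<zeta> ^ d = -1" "g 1 = \<zeta> * x" using root[of "g 1" x] g(3)[of 1] by auto
  obtain \<eta> where \<eta>: "\<eta> ^ d = -1" "h 1 = \<eta> * u" using root[of "h 1" u] h(3)[of 1] by auto
  have 2: "path_component (fermat_cone d) (vec4 x (\<zeta> * x) u (\<eta> * u)) (vec4 0 (\<zeta> * 0) 1 (\<eta> * 1))"
    by (rule cone_line[OF d \<zeta>(1) \<eta>(1) xu]) simp
  have 3: "path_component (fermat_cone d) (vec4 0 (\<zeta>0 * 0) 1 (\<eta> * 1)) (vec4 1 (\<zeta>0 * 1) 0 (\<eta> * 0))"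
    by (rule cone_line[OF d \<zeta>0 \<eta>(1)]) simp_all
  show ?thesis
    using path_component_trans[OF path_component_trans[OF 1[unfolded g(2) h(2) \<zeta>(2) \<eta>(2)] 2]] 3 by simp
qed

lemma path_connected_cone:
  assumes d: "d > 0"
  shows "path_connected (fermat_cone d)"
proof -
  obtain \<zeta>0 :: complex where \<zeta>0: "\<zeta>0 ^ d = -1" by (rule complex_root_exists[OF d])
  have base: "path_component (fermat_cone d) z (vec4 1 \<zeta>0 0 0)" if z: "z \<in> fermat_cone d" for z
  proof -
    define x y u w where "x = z 0" "y = z (Suc 0)" "u = z 2" "w = z 3"
    have zv: "z = vec4 x y u w" unfolding x_y_u_w_def using z cone_subset by (intro vec4_coords) auto
    show ?thesis
    proof (cases "x = 0 \<and> u = 0")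
      case False
      then show ?thesis using cone_to_base[OF d \<zeta>0] z zv by blast
    next
      case True
      \<comment> \<open>If x and u vanish, both are moved away from 0 so that their d-th powers
        cancel all along the path.\<close>
      have "path_component (fermat_cone d) (vec4 (of_real 0) y (\<zeta>0 * of_real 0) w) (vec4 (of_real 1) y (\<zeta>0 * of_real 1) w)"
      proof (rule path_componentI[of "\<lambda>t. vec4 (of_real t) y (\<zeta>0 * of_real t) w"])
        show "continuous_on {0..1} (\<lambda>t. vec4 (complex_of_real t) y (\<zeta>0 * of_real t) w)"
          by (intro continuous_on_vec4 continuous_intros)
        show "vec4 (of_real t) y (\<zeta>0 * of_real t) w \<in> fermat_cone d" for t
          using z True d \<zeta>0 unfolding zv vec4_cone by (auto simp: power_mult_distrib power_0_left)
      qed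
      then have 1: "path_component (fermat_cone d) z (vec4 1 y \<zeta>0 w)" using True by (simp add: zv)
      then have "vec4 1 y \<zeta>0 w \<in> fermat_cone d" by (rule path_component_mem)
      from path_component_trans[OF 1 cone_to_base[OF d \<zeta>0 this]] show ?thesis by simp
    qed
  qed
  show ?thesis
    unfolding path_connected_component using base path_component_sym path_component_trans by metis
qed

lemma continuous_map_pclass:
  "continuous_map (top_of_set (cspace 4 - {czero})) (proj_top 3) pclass"
proof -
  have n: "Suc 3 = 4" by simp
  show ?thesis
    unfolding continuous_map topspace_proj_top
  proof (intro conjI allI impI)
    show "pclass ` topspace (top_of_set (cspace 4 - {czero})) \<subseteq> proj_space 3" by (simp add: proj_space_def)
    show "openin (top_of_set (cspace 4 - {czero})) {x \<in> topspace (top_of_set (cspace 4 - {czero})). pclass x \<in> U}"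
      if "openin (proj_top 3) U" for U
      using that by (simp add: openin_proj_top n)
  qed
qed

theorem fermat_projective_manifold:
  assumes d: "d > 0"
  shows "projective_manifold 3 2 (fermat_surface d)"
  unfolding projective_manifold_def
proof (intro conjI ballI)
  show "projective_algebraic_set 3 (fermat_surface d)"
    unfolding projective_algebraic_set_def
    by (intro exI[of _ "{fermat d}"]) (use hform_fermat[OF d] in \<open>auto simp: fermat_surface_eq[OF d]\<close>)
  obtain \<zeta>0 :: complex where \<zeta>0: "\<zeta>0 ^ d = -1" by (rule complex_root_exists[OF d])
  have "vec4 1 \<zeta>0 0 0 \<in> fermat_cone d" using \<zeta>0 d by (simp add: vec4_cone)
  then show "fermat_surface d \<noteq> {}" by (auto simp: fermat_surface_def)
  have "connected (fermat_cone d)" by (rule path_connected_imp_connected[OF path_connected_cone[OF d]])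
  then have "connectedin (top_of_set (cspace 4 - {czero})) (fermat_cone d)"
    using cone_subset[of d] by (simp add: connectedin_subtopology)
  from connectedin_continuous_map_image[OF continuous_map_pclass this]
  show "connectedin (proj_top 3) (fermat_surface d)" by (simp add: fermat_surface_def)
qed (rule fermat_smooth[OF d])

section \<open>Rational curves on the Fermat octic\<close>

definition wr2 :: "complex poly \<Rightarrow> complex poly \<Rightarrow> complex poly"
  where "wr2 A B = A * pderiv B - pderiv A * B"

definition wr3 :: "complex poly \<Rightarrow> complex poly \<Rightarrow> complex poly \<Rightarrow> complex poly"
  where "wr3 A B C = A * (pderiv B * pderiv (pderiv C) - pderiv (pderiv B) * pderiv C)
    - pderiv A * (B * pderiv (pderiv C) - pderiv (pderiv B) * C)
    + pderiv (pderiv A) * (B * pderiv C - pderiv B * C)"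

text \<open>Reduces the vanishing of a threefold Wronskian to that of a twofold one, for which
  linear dependence is elementary.\<close>

lemma wr3_wr2: "A * wr3 A B C = wr2 (wr2 A B) (wr2 A C)"
  by (simp add: wr2_def wr3_def pderiv_diff pderiv_mult algebra_simps)

lemma wr3_swap: "wr3 B A C = - wr3 A B C" "wr3 A C B = - wr3 A B C"
  by (simp_all add: wr3_def algebra_simps)

text \<open>Substitute A = -(B + C + D): the Wronskian is multilinear and alternating, so B and C
  contribute nothing.\<close>

lemma wr3_sum_zero:
  assumes "A + B + C + D = 0"
  shows "wr3 A B C = - wr3 D B C"
proof -
  have "A + (B + C + D) = 0" using assms by (simp add: add_ac)
  then have A: "A = - (B + C + D)" by (simp only: eq_neg_iff_add_eq_0)
  show ?thesis unfolding A by (simp add: wr3_def pderiv_minus pderiv_add pderiv_diff algebra_simps)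
qed

lemma wr2_linear:
  "wr2 (smult x A) B = smult x (wr2 A B)" "wr2 (- A) B = - wr2 A B" "wr2 (A + A') B = wr2 A B + wr2 A' B"
  "wr2 A A = 0" "wr2 B A = - wr2 A B"
  by (simp_all add: wr2_def pderiv_smult pderiv_minus pderiv_add smult_diff_right algebra_simps)

lemma wr2_sum_zero:
  assumes "smult a A + smult b B + smult e C = 0"
  shows "smult a (wr2 A B) = - smult e (wr2 C B)"
proof -
  have "smult a A + (smult b B + smult e C) = 0" using assms by (simp add: add_ac)
  then have "smult a A = - (smult b B + smult e C)" by (simp only: eq_neg_iff_add_eq_0)
  then have "wr2 (smult a A) B = wr2 (- (smult b B + smult e C)) B" by simp
  then show ?thesis unfolding wr2_linear(1-4) by simp
qed

text \<open>The top coefficients of the two products differ by the factors deg g and deg f, so a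
  vanishing Wronskian of nonzero polynomials forces equal degrees. Subtracting the multiple of g
  that cancels the leading term leaves a polynomial h with vanishing Wronskian against g, but
  without a coefficient in the degree of g; so h is 0.\<close>

lemma wr2_zero_imp_dependent:
  assumes w: "wr2 f g = 0"
  obtains a b where "a \<noteq> 0 \<or> b \<noteq> 0" "smult a f + smult b g = 0"
proof (cases "g = 0 \<or> f = 0")
  case True
  then show thesis using that[of 0 1] that[of 1 0] by auto
next
  case False
  have lead: "degree f = degree g" if w0: "wr2 f g = 0" and f0: "f \<noteq> 0" and g0: "g \<noteq> 0" for f g :: "complex poly"
  proof (cases "degree f + degree g = 0")
    case False
    have c: "coeff (p * pderiv q) (degree p + degree q - 1) = of_nat (degree q) * (lead_coeff p * lead_coeff q)"
      if "degree p + degree q \<noteq> 0" for p q :: "complex poly"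
    proof (cases "degree q = 0")
      case True
      then have "pderiv q = 0" by (simp add: pderiv_eq_0_iff)
      then show ?thesis using True by simp
    next
      case False
      then have e: "degree p + degree q - 1 = degree p + degree (pderiv q)" by (simp add: degree_pderiv)
      have "lead_coeff (pderiv q) = of_nat (degree q) * lead_coeff q"
        using False by (simp add: degree_pderiv coeff_pderiv)
      then show ?thesis unfolding e coeff_mult_degree_sum by (simp add: mult_ac)
    qed
    have "coeff (f * pderiv g - pderiv f * g) (degree f + degree g - 1) = 0"
      using w0 by (simp add: wr2_def)
    moreover have "coeff (pderiv f * g) (degree f + degree g - 1) = of_nat (degree f) * (lead_coeff f * lead_coeff g)"
      using c[of g f] False by (simp add: add.commute mult.commute)
    ultimately have "of_nat (degree g) * (lead_coeff f * lead_coeff g) = of_nat (degree f) * (lead_coeff f * lead_coeff g)"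
      using c[OF False] by auto
    then show ?thesis using f0 g0 by auto
  qed simp
  from False have fg: "f \<noteq> 0" "g \<noteq> 0" by auto
  define r where "r = lead_coeff f / lead_coeff g"
  define h where "h = f - smult r g"
  have wh: "wr2 h g = 0"
    using w by (simp add: wr2_def h_def pderiv_diff pderiv_smult algebra_simps)
  have "h = 0"
  proof (rule ccontr)
    assume h: "h \<noteq> 0"
    have dg: "degree h = degree g" by (rule lead[OF wh h fg(2)])
    have "coeff h (degree g) = 0"
      using lead[OF w fg] fg(2) by (simp add: h_def r_def)
    then show False using h dg by (metis leading_coeff_0_iff)
  qed
  then show thesis using that[of 1 "- r"] by (simp add: h_def)
qed

section \<open>Multiplicities and degrees of Wronskians\<close>

lemma pow_dvd_pderiv:
  fixes L :: "complex poly"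
  assumes "L ^ n dvd A" shows "L ^ (n - 1) dvd pderiv A"
proof (cases n)
  case (Suc k)
  from assms obtain q where q: "A = L ^ Suc k * q" unfolding Suc by (elim dvdE)
  have "pderiv A = L ^ k * (L * pderiv q + smult (of_nat (Suc k)) (pderiv L) * q)"
    unfolding q pderiv_mult pderiv_power_Suc by (simp add: algebra_simps)
  then show ?thesis by (simp add: Suc)
qed simp

lemma pow_dvd_le: "L ^ n dvd A \<Longrightarrow> m \<le> n \<Longrightarrow> L ^ m dvd A" for L :: "complex poly"
  by (meson dvd_trans le_imp_power_dvd)

text \<open>In every term each argument is differentiated at most twice and so loses at most 2 in
  multiplicity. Truncated subtraction takes care of small exponents.\<close>

lemma wr3_dvd:
  fixes L :: "complex poly"
  assumes "L ^ a dvd A" "L ^ b dvd B" "L ^ c dvd C"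
  shows "L ^ ((a - 2) + (b - 2) + (c - 2)) dvd wr3 A B C"
proof -
  have D: "L ^ (n - 2) dvd X \<and> L ^ (n - 2) dvd pderiv X \<and> L ^ (n - 2) dvd pderiv (pderiv X)" if "L ^ n dvd X" for n X
    using that pow_dvd_pderiv[OF that] pow_dvd_pderiv[OF pow_dvd_pderiv[OF that]]
    by (auto intro: pow_dvd_le simp: numeral_2_eq_2)
  have M: "L ^ ((a - 2) + (b - 2) + (c - 2)) dvd X * (Y * Z - Y' * Z')"
    if "L ^ (a - 2) dvd X" "L ^ (b - 2) dvd Y" "L ^ (c - 2) dvd Z" "L ^ (b - 2) dvd Y'" "L ^ (c - 2) dvd Z'" for X Y Z Y' Z'
    using that unfolding power_add mult.assoc by (intro mult_dvd_mono dvd_diff)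
  show ?thesis
    unfolding wr3_def using D[OF assms(1)] D[OF assms(2)] D[OF assms(3)] by (intro dvd_add dvd_diff M) auto
qed

lemma wr2_dvd:
  fixes L :: "complex poly"
  assumes "L ^ a dvd A"
  shows "L ^ (a - 1) dvd wr2 A B"
  unfolding wr2_def using pow_dvd_pderiv[OF assms] pow_dvd_le[OF assms, of "a - 1"]
  by (intro dvd_diff dvd_mult2) auto

text \<open>The degree bound n - s for products containing s derivatives, kept additive to avoid
  truncated subtraction. Zero is exempt, because the derivative of a constant has degree 0 rather
  than a negative one.\<close>

definition bounded_degree :: "nat \<Rightarrow> nat \<Rightarrow> complex poly \<Rightarrow> bool"
  where "bounded_degree n s p \<longleftrightarrow> p = 0 \<or> degree p + s \<le> n"

lemma bounded_degree_rules:
  "bounded_degree n s p \<Longrightarrow> bounded_degree n s q \<Longrightarrow> bounded_degree n s (p + q)"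
  "bounded_degree n s p \<Longrightarrow> bounded_degree n s q \<Longrightarrow> bounded_degree n s (p - q)"
  "bounded_degree n s p \<Longrightarrow> bounded_degree m t q \<Longrightarrow> bounded_degree (n + m) (s + t) (p * q)"
  "bounded_degree n s p \<Longrightarrow> bounded_degree n (Suc s) (pderiv p)"
  "bounded_degree (degree p) 0 p"
proof -
  show "bounded_degree n s p \<Longrightarrow> bounded_degree n s q \<Longrightarrow> bounded_degree n s (p + q)"
    using degree_add_le_max[of p q] by (auto simp: bounded_degree_def)
  show "bounded_degree n s p \<Longrightarrow> bounded_degree n s q \<Longrightarrow> bounded_degree n s (p - q)"
    using degree_diff_le_max[of p q] by (auto simp: bounded_degree_def)
  show "bounded_degree n s p \<Longrightarrow> bounded_degree m t q \<Longrightarrow> bounded_degree (n + m) (s + t) (p * q)"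
    using degree_mult_le[of p q] by (auto simp: bounded_degree_def)
  show "bounded_degree n s p \<Longrightarrow> bounded_degree n (Suc s) (pderiv p)"
    by (cases "degree p = 0") (auto simp: bounded_degree_def degree_pderiv pderiv_eq_0_iff)
qed (simp add: bounded_degree_def)

lemma degree_wr2:
  assumes "wr2 A B \<noteq> 0" shows "degree (wr2 A B) + 1 \<le> degree A + degree B"
proof -
  note b = bounded_degree_rules
  have "bounded_degree (degree A + degree B) (0 + Suc 0) (A * pderiv B)"
    "bounded_degree (degree A + degree B) (Suc 0 + 0) (pderiv A * B)"
    by (intro b)+
  then have "bounded_degree (degree A + degree B) 1 (wr2 A B)" unfolding wr2_def by (intro b) auto
  then show ?thesis using assms by (simp add: bounded_degree_def)
qed

text \<open>Every term of the Wronskian contains 0 + 1 + 2 derivatives.\<close>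

lemma degree_wr3:
  assumes "wr3 A B C \<noteq> 0" shows "degree (wr3 A B C) + 3 \<le> degree A + degree B + degree C"
proof -
  note b = bounded_degree_rules
  have B1: "bounded_degree (degree B + degree C) (Suc 0 + Suc (Suc 0)) (pderiv B * pderiv (pderiv C))"
    "bounded_degree (degree B + degree C) (Suc (Suc 0) + Suc 0) (pderiv (pderiv B) * pderiv C)"
    "bounded_degree (degree B + degree C) (0 + Suc (Suc 0)) (B * pderiv (pderiv C))"
    "bounded_degree (degree B + degree C) (Suc (Suc 0) + 0) (pderiv (pderiv B) * C)"
    "bounded_degree (degree B + degree C) (0 + Suc 0) (B * pderiv C)"
    "bounded_degree (degree B + degree C) (Suc 0 + 0) (pderiv B * C)"
    by (intro b)+
  have "bounded_degree (degree B + degree C) 3 (pderiv B * pderiv (pderiv C) - pderiv (pderiv B) * pderiv C)"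
    "bounded_degree (degree B + degree C) 2 (B * pderiv (pderiv C) - pderiv (pderiv B) * C)"
    "bounded_degree (degree B + degree C) 1 (B * pderiv C - pderiv B * C)"
    using B1 by (auto intro!: b(2) simp: eval_nat_numeral)
  note B2 = this
  have "bounded_degree (degree A + (degree B + degree C)) (0 + 3) (A * (pderiv B * pderiv (pderiv C) - pderiv (pderiv B) * pderiv C))"
    by (rule b(3)[OF b(5) B2(1)])
  moreover have "bounded_degree (degree A + (degree B + degree C)) (Suc 0 + 2) (pderiv A * (B * pderiv (pderiv C) - pderiv (pderiv B) * C))"
    by (rule b(3)[OF b(4)[OF b(5)] B2(2)])
  moreover have "bounded_degree (degree A + (degree B + degree C)) (Suc (Suc 0) + 1) (pderiv (pderiv A) * (B * pderiv C - pderiv B * C))"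
    by (rule b(3)[OF b(4)[OF b(4)[OF b(5)]] B2(3)])
  ultimately have "bounded_degree (degree A + (degree B + degree C)) 3 (wr3 A B C)"
    unfolding wr3_def by (auto intro!: b(1,2) simp: eval_nat_numeral)
  then show ?thesis using assms by (simp add: bounded_degree_def)
qed

lemma complex_poly_root:
  fixes p :: "complex poly"
  assumes "degree p \<noteq> 0" obtains z where "poly p z = 0"
proof -
  have "coeff p 0 = 0 \<or> (\<exists>i\<in>{1..degree p}. coeff p i \<noteq> 0)"
    using assms by (intro disjI2 bexI[of _ "degree p"]) (auto simp: leading_coeff_0_iff)
  then obtain z where "(\<Sum>i\<le>degree p. coeff p i * z ^ i) = 0"
    by (rule fundamental_theorem_of_algebra)
  then show thesis by (intro that[of z]) (simp add: poly_altdef)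
qed

lemma size_proots_eq_degree:
  fixes p :: "complex poly"
  shows "size (proots p) = degree p"
proof (induction "degree p" arbitrary: p)
  case 0
  then show ?case using size_proots_le[of p] by simp
next
  case (Suc n)
  obtain c where "poly p c = 0" using complex_poly_root[of p] Suc.hyps(2) by auto
  then obtain q where q: "p = [:- c, 1:] * q" by (auto simp: poly_eq_0_iff_dvd)
  have q0: "q \<noteq> 0" using q Suc.hyps(2) by auto
  have "degree p = Suc (degree q)" using q0 unfolding q by (subst degree_mult_eq) auto
  then have "size (proots q) = degree q" using Suc.hyps by auto
  then show ?case using q0 \<open>degree p = Suc (degree q)\<close> unfolding q by (subst proots_mult) auto
qed

text \<open>The n-fold multiset of the roots of the four polynomials is contained in that of W, and
  over the complex numbers the number of roots is the degree.\<close>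

lemma degree_le_of_order_le:
  fixes W :: "complex poly"
  assumes W: "W \<noteq> 0" and p: "p \<noteq> 0" "q \<noteq> 0" "r \<noteq> 0" "s \<noteq> 0"
    and le: "\<And>c. n * (order c p + order c q + order c r + order c s) \<le> order c W"
  shows "n * (degree p + degree q + degree r + degree s) \<le> degree W"
proof -
  have "repeat_mset n (proots p + proots q + proots r + proots s) \<subseteq># proots W"
    unfolding subseteq_mset_def using le[unfolded add_mult_distrib2] W p by (simp add: add_mult_distrib2)
  from size_mset_mono[OF this] show ?thesis by (simp add: size_proots_eq_degree add_mult_distrib2)
qed

lemma order_pow_dvd: "[:- c, 1:] ^ (n * order c p) dvd p ^ n" for p :: "complex poly"
  using order_1[of c p] by (metis dvd_power_same mult.commute power_mult)

text \<open>The Wronskian W is, up to sign, the same for any three of the four summands. At each point one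
  of the polynomials does not vanish, so the order of W is at least 6 times the sum of the four orders.
  With s of maximal degree this exceeds the degree of W.\<close>

lemma wr3_fermat_eq_zero:
  fixes p q r s :: "complex poly"
  assumes sum: "p ^ 8 + q ^ 8 + r ^ 8 + s ^ 8 = 0" and nz: "p \<noteq> 0" "q \<noteq> 0" "r \<noteq> 0" "s \<noteq> 0"
    and no_root: "\<And>c. \<not> (poly p c = 0 \<and> poly q c = 0 \<and> poly r c = 0 \<and> poly s c = 0)"
    and deg: "degree p \<le> degree s" "degree q \<le> degree s" "degree r \<le> degree s"
  shows "wr3 (p ^ 8) (q ^ 8) (r ^ 8) = 0"
proof (rule ccontr)
  let ?W = "wr3 (p ^ 8) (q ^ 8) (r ^ 8)"
  assume W: "?W \<noteq> 0"
  have Wp: "?W = - wr3 (s ^ 8) (q ^ 8) (r ^ 8)" by (rule wr3_sum_zero[OF sum])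
  have "wr3 (q ^ 8) (p ^ 8) (r ^ 8) = - wr3 (s ^ 8) (p ^ 8) (r ^ 8)"
    by (rule wr3_sum_zero) (use sum in \<open>simp add: add_ac\<close>)
  then have Wq: "?W = - wr3 (p ^ 8) (s ^ 8) (r ^ 8)"
    using wr3_swap(1)[of "q ^ 8" "p ^ 8" "r ^ 8"] wr3_swap(1)[of "s ^ 8" "p ^ 8" "r ^ 8"] by (metis minus_minus)
  have "wr3 (r ^ 8) (q ^ 8) (p ^ 8) = - wr3 (s ^ 8) (q ^ 8) (p ^ 8)"
    by (rule wr3_sum_zero) (use sum in \<open>simp add: add_ac\<close>)
  moreover have "wr3 A B C = - wr3 C B A" for A B C
    using wr3_swap(1)[of A B C] wr3_swap(2)[of B A C] wr3_swap(1)[of B C A] by simp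
  ultimately have Wr: "?W = - wr3 (p ^ 8) (q ^ 8) (s ^ 8)" by metis
  have "6 * (order c p + order c q + order c r + order c s) \<le> order c ?W" for c
  proof -
    have dv: "[:- c, 1:] ^ (6 * (order c a + order c b + order c e)) dvd wr3 (a ^ 8) (b ^ 8) (e ^ 8)" for a b e
    proof -
      \<comment> \<open>For a positive order o one has 8 o - 2 \<ge> 6 o; for o = 0 the truncated
        difference is 0 as well.\<close>
      have "6 * (order c a + order c b + order c e) \<le> (8 * order c a - 2) + (8 * order c b - 2) + (8 * order c e - 2)"
        by (cases "order c a"; cases "order c b"; cases "order c e") auto
      then show ?thesis using wr3_dvd[OF order_pow_dvd order_pow_dvd order_pow_dvd] pow_dvd_le by blast
    qed
    have "order c p = 0 \<or> order c q = 0 \<or> order c r = 0 \<or> order c s = 0"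
      using no_root[of c] nz by (auto simp: order_root)
    \<comment> \<open>W is written with the three polynomials other than the one that does not
      vanish at c.\<close>
    then have "[:- c, 1:] ^ (6 * (order c p + order c q + order c r + order c s)) dvd ?W"
    proof (elim disjE)
      assume "order c p = 0" then show ?thesis using dv[of s q r] unfolding Wp by (simp add: add_ac)
    next
      assume "order c q = 0" then show ?thesis using dv[of p s r] unfolding Wq by (simp add: add_ac)
    next
      assume "order c r = 0" then show ?thesis using dv[of p q s] unfolding Wr by (simp add: add_ac)
    next
      assume "order c s = 0" then show ?thesis using dv[of p q r] by (simp add: add_ac)
    qed
    then show ?thesis using W by (simp add: order_divides)
  qed
  from degree_le_of_order_le[OF W nz this] degree_wr3[OF W] deg show False
    by (simp add: degree_power_eq nz)
qed

text \<open>The same count one level lower. If the twofold Wronskian vanishes, the eighth powers are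
  proportional and, having no common zero, have no zero at all. Otherwise each zero contributes 7
  and at most one polynomial vanishes at a point, so with S the sum of the degrees W has degree w
  \<ge> 7 S. Adding the degree bounds for the three pairs gives 3 w + 3 \<le> 16 S, a
  contradiction.\<close>

lemma three_term_fermat:
  fixes p q r :: "complex poly"
  assumes sum: "smult a (p ^ 8) + smult b (q ^ 8) + smult e (r ^ 8) = 0" and abe: "a \<noteq> 0" "b \<noteq> 0" "e \<noteq> 0"
    and nz: "p \<noteq> 0" "q \<noteq> 0" "r \<noteq> 0"
    and no_root: "\<And>c. \<not> (poly p c = 0 \<and> poly q c = 0)" "\<And>c. \<not> (poly p c = 0 \<and> poly r c = 0)" "\<And>c. \<not> (poly q c = 0 \<and> poly r c = 0)"
  shows "degree p = 0 \<and> degree q = 0 \<and> degree r = 0"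
proof -
  have const: "degree p = 0 \<and> degree q = 0"
    if w0: "wr2 (p ^ 8) (q ^ 8) = 0" and "p \<noteq> 0" "q \<noteq> 0" "\<And>c. \<not> (poly p c = 0 \<and> poly q c = 0)" for p q :: "complex poly"
  proof -
    obtain x y where xy: "x \<noteq> 0 \<or> y \<noteq> 0" "smult x (p ^ 8) + smult y (q ^ 8) = 0"
      by (rule wr2_zero_imp_dependent[OF w0])
    have "x \<noteq> 0" "y \<noteq> 0" using xy that(2,3) by auto
    have ev: "x * poly p c ^ 8 + y * poly q c ^ 8 = 0" for c
      using arg_cong[OF xy(2), of "\<lambda>u. poly u c"] by simp
    have "\<not> (\<exists>c. poly p c = 0)" "\<not> (\<exists>c. poly q c = 0)"
      using ev that(4) \<open>x \<noteq> 0\<close> \<open>y \<noteq> 0\<close> by (metis add.left_neutral add.right_neutral mult_eq_0_iff power_eq_0_iff zero_power zero_less_numeral)+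
    then show ?thesis
      by (metis complex_poly_root)
  qed
  let ?W = "wr2 (p ^ 8) (q ^ 8)"
  have Wrq: "smult a ?W = - smult e (wr2 (r ^ 8) (q ^ 8))" by (rule wr2_sum_zero[OF sum])
  have "smult b (wr2 (q ^ 8) (p ^ 8)) = - smult e (wr2 (r ^ 8) (p ^ 8))"
    by (rule wr2_sum_zero[where b=a]) (use sum in \<open>simp add: add_ac\<close>)
  moreover have "smult b (wr2 (q ^ 8) (p ^ 8)) = - smult b ?W" "smult e (wr2 (r ^ 8) (p ^ 8)) = - smult e (wr2 (p ^ 8) (r ^ 8))"
    by (simp_all add: wr2_linear(5)[of "q ^ 8" "p ^ 8"] wr2_linear(5)[of "r ^ 8" "p ^ 8"])
  ultimately have Wpr: "smult b ?W = - smult e (wr2 (p ^ 8) (r ^ 8))"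
    by (metis minus_minus)
  show ?thesis
  proof (cases "?W = 0")
    case True
    then have "wr2 (r ^ 8) (q ^ 8) = 0" using Wrq abe by simp
    then show ?thesis using const[OF True] const[of r q] nz no_root by blast
  next
    case W: False
    \<comment> \<open>The constant 1 fills the fourth place of
      \<open>degree_le_of_order_le\<close>.\<close>
    have "7 * (order c p + order c q + order c r + order c 1) \<le> order c ?W" for c
    proof -
      have dv: "[:- c, 1:] ^ (7 * order c u) dvd wr2 (u ^ 8) v" for u v
        using wr2_dvd[OF order_pow_dvd, of c 8 u v] pow_dvd_le[of _ "8 * order c u - 1" _ "7 * order c u"] by (cases "order c u") auto
      have "order c p = 0 \<and> order c q = 0 \<or> order c p = 0 \<and> order c r = 0 \<or> order c q = 0 \<and> order c r = 0"
        using no_root[of c] nz by (auto simp: order_root)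
      then have "[:- c, 1:] ^ (7 * (order c p + order c q + order c r)) dvd ?W"
      proof (elim disjE conjE)
        assume z: "order c p = 0" "order c q = 0"
        have "[:- c, 1:] ^ (7 * order c r) dvd smult a ?W" unfolding Wrq using dv[of r] by (simp add: dvd_smult)
        then show ?thesis using z abe by (simp add: dvd_smult_iff)
      next
        assume z: "order c p = 0" "order c r = 0"
        have "?W = - wr2 (q ^ 8) (p ^ 8)" by (simp add: wr2_def)
        then show ?thesis using z dv[of q "p ^ 8"] by simp
      next
        assume "order c q = 0" "order c r = 0"
        then show ?thesis using dv[of p] by simp
      qed
      then show ?thesis using W by (simp add: order_divides)
    qed
    from degree_le_of_order_le[OF W nz _ this]
    have le: "7 * (degree p + degree q + degree r) \<le> degree ?W" by simp
    have d1: "degree ?W + 1 \<le> 8 * degree p + 8 * degree q" using degree_wr2[OF W] nz by (simp add: degree_power_eq)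
    have "wr2 (r ^ 8) (q ^ 8) \<noteq> 0" using W Wrq abe by auto
    moreover have "degree ?W = degree (wr2 (r ^ 8) (q ^ 8))" using arg_cong[OF Wrq, of degree] abe by simp
    ultimately have d2: "degree ?W + 1 \<le> 8 * degree r + 8 * degree q" using degree_wr2[of "r ^ 8" "q ^ 8"] nz by (simp add: degree_power_eq)
    have "wr2 (p ^ 8) (r ^ 8) \<noteq> 0" using W Wpr abe by auto
    moreover have "degree ?W = degree (wr2 (p ^ 8) (r ^ 8))" using arg_cong[OF Wpr, of degree] abe by simp
    ultimately have d3: "degree ?W + 1 \<le> 8 * degree p + 8 * degree r" using degree_wr2[of "p ^ 8" "r ^ 8"] nz by (simp add: degree_power_eq)
    define S w where "S = degree p + degree q + degree r" and "w = degree ?W"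
    have "(w + 1) + (w + 1) + (w + 1) \<le> (8 * degree p + 8 * degree q) + (8 * degree r + 8 * degree q) + (8 * degree p + 8 * degree r)"
      unfolding w_def by (intro add_mono d1 d2 d3)
    also have "\<dots> = 16 * S" by (simp add: S_def)
    finally have "3 * w + 3 \<le> 16 * S" by simp
    moreover have "7 * S \<le> w" using le by (simp add: S_def w_def)
    ultimately have False by simp
    then show ?thesis ..
  qed
qed


text \<open>By \<open>wr3_wr2\<close>, two applications of \<open>wr2_zero_imp_dependent\<close>
  turn the vanishing of W into a nontrivial linear relation between the first three summands. If one
  of its coefficients is 0, the sum of all four supplies another relation.\<close>

lemma three_term_relation:
  fixes g :: "nat \<Rightarrow> complex poly"
  assumes sum: "g 0 + g 1 + g 2 + g 3 = 0" and nz: "\<And>k. k < 4 \<Longrightarrow> g k \<noteq> 0"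
    and pair: "\<And>i j. i < 4 \<Longrightarrow> j < 4 \<Longrightarrow> i \<noteq> j \<Longrightarrow> g i + g j \<noteq> 0"
    and W: "wr3 (g 0) (g 1) (g 2) = 0"
  obtains i j k l a b e where "perm4 i j k l" "a \<noteq> 0" "b \<noteq> 0" "e \<noteq> 0"
    "smult a (g i) + smult b (g j) + smult e (g k) = 0"
proof -
  note witness = that
  have "wr2 (wr2 (g 0) (g 1)) (wr2 (g 0) (g 2)) = 0" using W by (simp flip: wr3_wr2)
  then obtain x y where xy: "x \<noteq> 0 \<or> y \<noteq> 0" "smult x (wr2 (g 0) (g 1)) + smult y (wr2 (g 0) (g 2)) = 0"
    by (rule wr2_zero_imp_dependent)
  have "wr2 (g 0) (smult x (g 1) + smult y (g 2)) = smult x (wr2 (g 0) (g 1)) + smult y (wr2 (g 0) (g 2))"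
    by (simp add: wr2_def pderiv_add pderiv_smult smult_diff_right algebra_simps)
  then have "wr2 (g 0) (smult x (g 1) + smult y (g 2)) = 0" using xy(2) by simp
  then obtain u v where uv: "u \<noteq> 0 \<or> v \<noteq> 0" "smult u (g 0) + smult v (smult x (g 1) + smult y (g 2)) = 0"
    by (rule wr2_zero_imp_dependent)
  define X Y where "X = v * x" "Y = v * y"
  have rel: "smult u (g 0) + smult X (g 1) + smult Y (g 2) = 0"
    using uv(2) by (simp add: X_Y_def smult_add_right add.assoc)
  have n: "u \<noteq> 0 \<or> X \<noteq> 0 \<or> Y \<noteq> 0" using uv(1) xy(1) by (auto simp: X_Y_def)
  \<comment> \<open>If \<open>g i\<close> and \<open>g j\<close> are proportional, their sum is a
    multiple of \<open>g i\<close>, nonzero by the hypothesis on pairs; so the full sum becomes a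
    relation between \<open>g i\<close>, \<open>g k\<close> and \<open>g l\<close>.\<close>
  have two: thesis if r: "smult s (g i) + smult t (g j) = 0" "s \<noteq> 0 \<or> t \<noteq> 0" and p: "perm4 i j k l" for s t i j k l
  proof -
    have lt: "i < 4" "j < 4" "k < 4" "l < 4" "i \<noteq> j" using p perm4_less[OF p] by (auto simp: perm4_def)
    have s0: "s \<noteq> 0" "t \<noteq> 0" using r nz[OF lt(1)] nz[OF lt(2)] by auto
    have st: "s \<noteq> t"
    proof
      assume "s = t"
      then have "smult s (g i + g j) = 0" using r(1) by (simp add: smult_add_right)
      then show False using s0 pair[OF lt(1,2,5)] by simp
    qed
    have "(\<Sum>m<4. g m) = g i + g j + g k + g l"
      using p unfolding perm4_def by (elim conjE, drule_tac sym) (simp add: add.assoc)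
    moreover have "(\<Sum>m<4. g m) = 0" using sum by (simp add: sum_lessThan_4)
    ultimately have "g i + g j + g k + g l = 0" by simp
    moreover have "smult (1 - s / t) (g i) + smult 1 (g k) + smult 1 (g l) =
      (g i + g j + g k + g l) - smult (1 / t) (smult s (g i) + smult t (g j))"
      using s0 by (simp add: smult_diff_left smult_add_right)
    ultimately have e: "smult (1 - s / t) (g i) + smult 1 (g k) + smult 1 (g l) = 0" using r(1) by simp
    have "1 - s / t \<noteq> 0" using st s0 by simp
    moreover have "perm4 i k l j" using p by (auto simp: perm4_def)
    ultimately show thesis using witness[OF _ _ one_neq_zero one_neq_zero e] by blast
  qed
  have pm: "perm4 0 1 2 3" "perm4 1 2 0 3" "perm4 0 2 1 3" by (auto simp: perm4_def lessThan_Suc eval_nat_numeral)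
  consider "u \<noteq> 0" "X \<noteq> 0" "Y \<noteq> 0" | "u = 0" | "X = 0" | "Y = 0" by blast
  then show thesis
  proof cases
    case 1 then show thesis using witness[OF pm(1)] rel by blast
  next
    case 2 then show thesis using two[of X 1 Y 2, OF _ _ pm(2)] rel n by simp
  next
    case 3 then show thesis using two[of u 0 Y 2, OF _ _ pm(3)] rel n by simp
  next
    case 4 then show thesis using two[of u 0 X 1, OF _ _ pm(1)] rel n by simp
  qed
qed

text \<open>W is the same up to sign for all triples, so the polynomial of largest degree can be
  taken as the one left out. The resulting three-term relation makes three of the polynomials
  constant, and the Fermat equation the fourth.\<close>

theorem fermat_octic_rational_constant:
  fixes p :: "nat \<Rightarrow> complex poly"
  assumes sum: "(\<Sum>k<4. p k ^ 8) = 0" and root: "\<And>c. \<exists>k<4. poly (p k) c \<noteq> 0"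
    and nz: "\<And>k. k < 4 \<Longrightarrow> p k \<noteq> 0"
    and pair: "\<And>i j. i < 4 \<Longrightarrow> j < 4 \<Longrightarrow> i \<noteq> j \<Longrightarrow> p i ^ 8 + p j ^ 8 \<noteq> 0"
  shows "\<forall>k<4. degree (p k) = 0"
proof -
  have sum': "p 0 ^ 8 + p 1 ^ 8 + p 2 ^ 8 + p 3 ^ 8 = 0" using sum by (simp add: sum_lessThan_4)
  have root': "\<not> (poly (p 0) c = 0 \<and> poly (p 1) c = 0 \<and> poly (p 2) c = 0 \<and> poly (p 3) c = 0)" for c
  proof -
    obtain k where "k < 4" "poly (p k) c \<noteq> 0" using root by blast
    moreover from this(1) have "k = 0 \<or> k = 1 \<or> k = 2 \<or> k = 3" by auto
    ultimately show ?thesis by auto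
  qed
  have n4: "p 0 \<noteq> 0" "p 1 \<noteq> 0" "p 2 \<noteq> 0" "p 3 \<noteq> 0" using nz by auto
  have W: "wr3 (p 0 ^ 8) (p 1 ^ 8) (p 2 ^ 8) = 0"
  proof -
    have W3: "wr3 (p 0 ^ 8) (p 1 ^ 8) (p 2 ^ 8) = 0"
      if "degree (p 0) \<le> degree (p 3)" "degree (p 1) \<le> degree (p 3)" "degree (p 2) \<le> degree (p 3)"
      by (rule wr3_fermat_eq_zero[OF sum' n4 root' that])
    have W0: "wr3 (p 3 ^ 8) (p 1 ^ 8) (p 2 ^ 8) = 0"
      if "degree (p 3) \<le> degree (p 0)" "degree (p 1) \<le> degree (p 0)" "degree (p 2) \<le> degree (p 0)"
      by (rule wr3_fermat_eq_zero[OF _ n4(4,2,3,1) _ that]) (use sum' root' in \<open>auto simp: add_ac\<close>)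
    have W1: "wr3 (p 3 ^ 8) (p 0 ^ 8) (p 2 ^ 8) = 0"
      if "degree (p 3) \<le> degree (p 1)" "degree (p 0) \<le> degree (p 1)" "degree (p 2) \<le> degree (p 1)"
      by (rule wr3_fermat_eq_zero[OF _ n4(4,1,3,2) _ that]) (use sum' root' in \<open>auto simp: add_ac\<close>)
    have W2: "wr3 (p 3 ^ 8) (p 1 ^ 8) (p 0 ^ 8) = 0"
      if "degree (p 3) \<le> degree (p 2)" "degree (p 1) \<le> degree (p 2)" "degree (p 0) \<le> degree (p 2)"
      by (rule wr3_fermat_eq_zero[OF _ n4(4,2,1,3) _ that]) (use sum' root' in \<open>auto simp: add_ac\<close>)
    have e0: "wr3 (p 0 ^ 8) (p 1 ^ 8) (p 2 ^ 8) = - wr3 (p 3 ^ 8) (p 1 ^ 8) (p 2 ^ 8)"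
      by (rule wr3_sum_zero[OF sum'])
    have "wr3 (p 1 ^ 8) (p 0 ^ 8) (p 2 ^ 8) = - wr3 (p 3 ^ 8) (p 0 ^ 8) (p 2 ^ 8)"
      by (rule wr3_sum_zero) (use sum' in \<open>simp add: add_ac\<close>)
    then have e1: "wr3 (p 0 ^ 8) (p 1 ^ 8) (p 2 ^ 8) = wr3 (p 3 ^ 8) (p 0 ^ 8) (p 2 ^ 8)"
      using wr3_swap(1)[of "p 1 ^ 8" "p 0 ^ 8" "p 2 ^ 8"] by (metis minus_minus)
    have "wr3 (p 2 ^ 8) (p 1 ^ 8) (p 0 ^ 8) = - wr3 (p 3 ^ 8) (p 1 ^ 8) (p 0 ^ 8)"
      by (rule wr3_sum_zero) (use sum' in \<open>simp add: add_ac\<close>)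
    then have e2: "wr3 (p 3 ^ 8) (p 1 ^ 8) (p 0 ^ 8) = 0 \<Longrightarrow> wr3 (p 0 ^ 8) (p 1 ^ 8) (p 2 ^ 8) = 0"
      using wr3_swap(2)[of "p 0 ^ 8" "p 2 ^ 8" "p 1 ^ 8"] wr3_swap(1)[of "p 2 ^ 8" "p 0 ^ 8" "p 1 ^ 8"] wr3_swap(2)[of "p 2 ^ 8" "p 1 ^ 8" "p 0 ^ 8"]
      by (metis minus_zero minus_minus)
    consider "degree (p 0) \<le> degree (p 3)" "degree (p 1) \<le> degree (p 3)" "degree (p 2) \<le> degree (p 3)"
      | "degree (p 3) \<le> degree (p 0)" "degree (p 1) \<le> degree (p 0)" "degree (p 2) \<le> degree (p 0)"
      | "degree (p 3) \<le> degree (p 1)" "degree (p 0) \<le> degree (p 1)" "degree (p 2) \<le> degree (p 1)"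
      | "degree (p 3) \<le> degree (p 2)" "degree (p 1) \<le> degree (p 2)" "degree (p 0) \<le> degree (p 2)"
      by linarith
    then show ?thesis
    proof cases
      case 1 then show ?thesis by (rule W3)
    next
      case 2 then show ?thesis using W0 e0 by simp
    next
      case 3 then show ?thesis using W1 e1 by simp
    next
      case 4 then show ?thesis by (intro e2 W2)
    qed
  qed
  obtain i j k l a b e where P: "perm4 i j k l" "a \<noteq> 0" "b \<noteq> 0" "e \<noteq> 0"
    and rel: "smult a (p i ^ 8) + smult b (p j ^ 8) + smult e (p k ^ 8) = 0"
    by (rule three_term_relation[of "\<lambda>k. p k ^ 8"]) (use sum' nz pair W in auto)
  have lt: "i < 4" "j < 4" "k < 4" "l < 4" using perm4_less[OF P(1)] by auto
  have psum: "p l ^ 8 = - (p i ^ 8 + p j ^ 8 + p k ^ 8)"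
  proof -
    have "(\<Sum>m<4. p m ^ 8) = (p i ^ 8 + p j ^ 8 + p k ^ 8) + p l ^ 8"
      using P(1) unfolding perm4_def by (elim conjE, drule_tac sym) (simp add: add.assoc)
    then show ?thesis using sum by (simp only: eq_neg_iff_add_eq_0 add.commute)
  qed
  have ev: "a * poly (p i) c ^ 8 + b * poly (p j) c ^ 8 + e * poly (p k) c ^ 8 = 0" for c
    using arg_cong[OF rel, of "\<lambda>u. poly u c"] by simp
  have evl: "poly (p l) c ^ 8 = - (poly (p i) c ^ 8 + poly (p j) c ^ 8 + poly (p k) c ^ 8)" for c
    using arg_cong[OF psum, of "\<lambda>u. poly u c"] by simp
  have nr: "\<not> (poly (p i) c = 0 \<and> poly (p j) c = 0 \<and> poly (p k) c = 0)" for c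
  proof
    assume *: "poly (p i) c = 0 \<and> poly (p j) c = 0 \<and> poly (p k) c = 0"
    then have "poly (p l) c = 0" using evl[of c] by simp
    with * root[of c] perm4_cases[OF P(1)] show False by blast
  qed
  \<comment> \<open>A common zero of two of the three is a zero of the third by the relation, and
    this is excluded by \<open>nr\<close>.\<close>
  have "degree (p i) = 0 \<and> degree (p j) = 0 \<and> degree (p k) = 0"
  proof (rule three_term_fermat[OF rel P(2-4)])
    show "\<not> (poly (p i) c = 0 \<and> poly (p j) c = 0)" "\<not> (poly (p i) c = 0 \<and> poly (p k) c = 0)" "\<not> (poly (p j) c = 0 \<and> poly (p k) c = 0)" for c
      using nr[of c] ev[of c] P(2-4) by auto
  qed (use nz lt in auto)
  then have dijk: "degree (p i) = 0" "degree (p j) = 0" "degree (p k) = 0" by auto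
  have d8: "degree (p m ^ 8) = 0" if "degree (p m) = 0" for m using degree_power_le[of "p m" 8] that by simp
  have "degree (p i ^ 8 + p j ^ 8 + p k ^ 8) = 0"
    using degree_add_le_max[of "p i ^ 8 + p j ^ 8" "p k ^ 8"] degree_add_le_max[of "p i ^ 8" "p j ^ 8"] d8 dijk by simp
  then have "degree (p l ^ 8) = 0" unfolding psum degree_minus .
  then have "degree (p l) = 0" using nz[OF lt(4)] by (simp add: degree_power_eq)
  with dijk perm4_cases[OF P(1)] show ?thesis by blast
qed

section \<open>Rational curves as polynomials in one variable\<close>

text \<open>Homogeneity determines the exponent of the first variable, so coefficients can be
  collected by the exponent of the second.\<close>

lemma binary_form_coeffs:
  assumes F: "hform 1 m F"
  obtains a where "\<And>s. peval F s = (\<Sum>i\<le>m. a i * s 0 ^ (m - i) * s (Suc 0) ^ i)"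
proof -
  let ?K = "Poly_Mapping.keys F" and ?l = "Poly_Mapping.lookup"
  define a where "a i = (\<Sum>\<mu>\<in>?K. if ?l \<mu> (Suc 0) = i then ?l F \<mu> else 0)" for i
  have mono: "?l \<mu> 0 + ?l \<mu> (Suc 0) = m \<and> (\<Prod>i\<in>Poly_Mapping.keys \<mu>. s i ^ ?l \<mu> i) = s 0 ^ ?l \<mu> 0 * s (Suc 0) ^ ?l \<mu> (Suc 0)"
    if "\<mu> \<in> ?K" for \<mu> and s :: cvec
  proof -
    have k: "Poly_Mapping.keys \<mu> \<subseteq> {0, Suc 0}" and d: "(\<Sum>i\<in>Poly_Mapping.keys \<mu>. ?l \<mu> i) = m"
      using F that by (auto simp: hform_def le_Suc_eq dest!: bspec)
    have "(\<Sum>i\<in>Poly_Mapping.keys \<mu>. ?l \<mu> i) = (\<Sum>i\<in>{0, Suc 0}. ?l \<mu> i)"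
      by (rule sum.mono_neutral_left[OF _ k]) (auto simp: in_keys_iff)
    moreover have "(\<Prod>i\<in>Poly_Mapping.keys \<mu>. s i ^ ?l \<mu> i) = (\<Prod>i\<in>{0, Suc 0}. s i ^ ?l \<mu> i)"
      by (rule prod.mono_neutral_left[OF _ k]) (auto simp: in_keys_iff)
    ultimately show ?thesis using d by simp
  qed
  show thesis
  proof (rule that[of a])
    fix s :: cvec
    have "(\<Sum>i\<le>m. a i * s 0 ^ (m - i) * s (Suc 0) ^ i) =
      (\<Sum>i\<le>m. \<Sum>\<mu>\<in>?K. if ?l \<mu> (Suc 0) = i then ?l F \<mu> * s 0 ^ (m - i) * s (Suc 0) ^ i else 0)"
      by (simp add: a_def sum_distrib_right if_distrib[where f="\<lambda>x. x * _"] cong: if_cong)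
    also have "\<dots> = (\<Sum>\<mu>\<in>?K. \<Sum>i\<le>m. if ?l \<mu> (Suc 0) = i then ?l F \<mu> * s 0 ^ (m - i) * s (Suc 0) ^ i else 0)"
      by (rule sum.swap)
    also have "\<dots> = (\<Sum>\<mu>\<in>?K. ?l F \<mu> * s 0 ^ (m - ?l \<mu> (Suc 0)) * s (Suc 0) ^ ?l \<mu> (Suc 0))"
    proof (rule sum.cong[OF refl])
      fix \<mu> assume "\<mu> \<in> ?K"
      then have "?l \<mu> (Suc 0) \<le> m" using mono[of \<mu> "\<lambda>_. 0"] by linarith
      then show "(\<Sum>i\<le>m. if ?l \<mu> (Suc 0) = i then ?l F \<mu> * s 0 ^ (m - i) * s (Suc 0) ^ i else 0) =
          ?l F \<mu> * s 0 ^ (m - ?l \<mu> (Suc 0)) * s (Suc 0) ^ ?l \<mu> (Suc 0)"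
        by (simp add: sum.delta')
    qed
    also have "\<dots> = peval F s"
      unfolding peval_def
    proof (rule sum.cong[OF refl])
      fix \<mu> assume \<mu>: "\<mu> \<in> ?K"
      have "m - ?l \<mu> (Suc 0) = ?l \<mu> 0" using conjunct1[OF mono[OF \<mu>, of s]] by linarith
      then show "?l F \<mu> * s 0 ^ (m - ?l \<mu> (Suc 0)) * s (Suc 0) ^ ?l \<mu> (Suc 0) = ?l F \<mu> * (\<Prod>i\<in>Poly_Mapping.keys \<mu>. s i ^ ?l \<mu> i)"
        using mono[OF \<mu>, of s] by (simp add: mult.assoc)
    qed
    finally show "peval F s = (\<Sum>i\<le>m. a i * s 0 ^ (m - i) * s (Suc 0) ^ i)" by simp
  qed
qed

text \<open>Setting the first parameter to 1 turns the forms into polynomials \<open>p k\<close>.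
  The conditions at the single point s rule out that some \<open>p k\<close>, or the sum of two of
  their eighth powers, is zero identically; this is where a general point of the surface
  enters.\<close>

lemma rational_curve_constant:
  assumes F: "P1_morphism 3 F" and im: "P1_image 3 F \<subseteq> fermat_surface 8"
    and s: "s \<in> cspace 2 - {czero}" "s 0 \<noteq> 0"
    and nz: "\<And>k. k < 4 \<Longrightarrow> peval (F k) s \<noteq> 0"
    and pair: "\<And>i j. i < 4 \<Longrightarrow> j < 4 \<Longrightarrow> i \<noteq> j \<Longrightarrow> peval (F i) s ^ 8 + peval (F j) s ^ 8 \<noteq> 0"
    and s': "s' \<in> cspace 2 - {czero}" and k: "k < 4"
  shows "peval (F k) s' = peval (F k) s"
proof -
  obtain m where m: "\<And>k. k \<le> 3 \<Longrightarrow> hform 1 m (F k)" using F by (auto simp: P1_morphism_def)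
  have "\<exists>a. \<forall>s. peval (F k) s = (\<Sum>i\<le>m. a i * s 0 ^ (m - i) * s (Suc 0) ^ i)" if "k < 4" for k
  proof -
    have "k \<le> 3" using that by simp
    then show ?thesis by (rule binary_form_coeffs[OF m]) blast
  qed
  note ex = this
  define a where "a k = (SOME a. \<forall>s. peval (F k) s = (\<Sum>i\<le>m. a i * s 0 ^ (m - i) * s (Suc 0) ^ i))" for k
  have a: "peval (F k) s = (\<Sum>i\<le>m. a k i * s 0 ^ (m - i) * s (Suc 0) ^ i)" if "k < 4" for k s
    using someI_ex[OF ex[OF that]] unfolding a_def by blast
  define p where "p k = (\<Sum>i\<le>m. monom (a k i) i)" for k
  have cf: "coeff (p k) i = a k i" if "i \<le> m" for k i
    using that by (simp add: p_def coeff_sum sum.delta' cong: if_cong)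
  have ev: "peval (F k) (cv (1, t)) = poly (p k) t" if "k < 4" for k t
    by (simp add: a[OF that] p_def poly_sum poly_monom)
  have hom: "peval (F k) s = s 0 ^ m * poly (p k) (s (Suc 0) / s 0)" if "s 0 \<noteq> 0" "k < 4" for k s
  proof -
    have *: "a k i * s 0 ^ (m - i) * s (Suc 0) ^ i = s 0 ^ m * (a k i * (s (Suc 0) / s 0) ^ i)" if "i \<le> m" for i
      using that \<open>s 0 \<noteq> 0\<close> power_add[of "s 0" "m - i" i] by (simp add: power_divide)
    show ?thesis
      unfolding a[OF that(2)] p_def poly_sum poly_monom sum_distrib_left
      by (intro sum.cong refl *) simp
  qed
  have nonz: "\<forall>s\<in>cspace 2 - {czero}. \<exists>k\<le>3. peval (F k) s \<noteq> 0"
    using F by (simp add: P1_morphism_def)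
  have cone: "(\<Sum>k<4. peval (F k) s ^ 8) = 0" if "s \<in> cspace 2 - {czero}" for s
  proof -
    have "pclass (\<lambda>k. if k \<le> 3 then peval (F k) s else 0) \<in> fermat_surface 8"
      using im that by (auto simp: P1_image_def)
    then have "(\<lambda>k. if k \<le> 3 then peval (F k) s else 0) \<in> fermat_cone 8" by (simp only: cone_pclass_iff)
    then show ?thesis by (simp add: fermat_cone_def le3_less4)
  qed
  have "poly (\<Sum>k<4. p k ^ 8) t = 0" for t
    using cone[OF cv_nonzero[of 1 t]] by (simp add: poly_sum poly_power ev)
  then have sum: "(\<Sum>k<4. p k ^ 8) = 0" by (simp add: poly_all_0_iff_0[symmetric])
  have deg: "\<forall>k<4. degree (p k) = 0"
  proof (rule fermat_octic_rational_constant[OF sum])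
    show "\<exists>k<4. poly (p k) c \<noteq> 0" for c
    proof -
      obtain k where "k \<le> 3" "peval (F k) (cv (1, c)) \<noteq> 0"
        using bspec[OF nonz cv_nonzero[of 1 c]] by auto
      then show ?thesis using ev[of k c] by (auto simp: le3_less4)
    qed
    show "p k \<noteq> 0" if "k < 4" for k using nz[OF that] hom[of s, OF s(2) that] by auto
    show "p i ^ 8 + p j ^ 8 \<noteq> 0" if ij: "i < 4" "j < 4" "i \<noteq> j" for i j
    proof
      assume "p i ^ 8 + p j ^ 8 = 0"
      then have "poly (p i ^ 8 + p j ^ 8) (s (Suc 0) / s 0) = 0" by simp
      then have "(s 0 ^ m) ^ 8 * (poly (p i) (s (Suc 0) / s 0) ^ 8 + poly (p j) (s (Suc 0) / s 0) ^ 8) = 0" by (simp add: poly_power)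
      then have "peval (F i) s ^ 8 + peval (F j) s ^ 8 = 0"
        unfolding hom[of s, OF s(2) ij(1)] hom[of s, OF s(2) ij(2)] power_mult_distrib by (simp add: distrib_left)
      then show False using pair[OF ij] by simp
    qed
  qed
  \<comment> \<open>At (0, 1) only the coefficients of degree m survive. As all \<open>p k\<close>
    are constant, a positive m would make the forms vanish there simultaneously.\<close>
  have "m = 0"
  proof (rule ccontr)
    assume "m \<noteq> 0"
    obtain k where k: "k \<le> 3" "peval (F k) (cv (0, 1)) \<noteq> 0"
      using bspec[OF nonz cv_nonzero[of 0 1]] by auto
    have "peval (F k) (cv (0, 1)) = (\<Sum>i\<le>m. if i = m then a k m else 0)"
      unfolding a[OF k(1)[unfolded le3_less4]] by (intro sum.cong) (auto simp: power_0_left)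
    then have "coeff (p k) m \<noteq> 0" using k(2) cf[of m k] by simp
    moreover have "coeff (p k) m = 0" using deg k(1) \<open>m \<noteq> 0\<close> by (intro coeff_eq_0) (auto simp: le3_less4)
    ultimately show False by simp
  qed
  then show ?thesis using k by (simp add: a)
qed

theorem fermat_octic_not_rationally_connected: "\<not> rationally_connected 3 (fermat_surface 8)"
proof
  assume rc: "rationally_connected 3 (fermat_surface 8)"
  \<comment> \<open>The points (1, 1, 1, c) and (1, 1, c, 1) lie on the surface, and the eighth
    powers of their coordinates are 1 or -3, so that no two of them cancel.\<close>
  obtain c :: complex where c: "c ^ 8 = -3" by (rule complex_root_exists[of 8]) simp
  define x y where "x = vec4 1 1 1 c" "y = vec4 1 1 c 1"
  have "x \<in> fermat_cone 8" "y \<in> fermat_cone 8" using c by (simp_all add: x_y_def vec4_cone)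
  then have "pclass x \<in> fermat_surface 8" "pclass y \<in> fermat_surface 8" by (simp_all add: cone_pclass_iff)
  then obtain F where F: "P1_morphism 3 F" "P1_image 3 F \<subseteq> fermat_surface 8" "pclass x \<in> P1_image 3 F" "pclass y \<in> P1_image 3 F"
    using rc unfolding rationally_connected_def by blast
  let ?f = "\<lambda>s k. if k \<le> 3 then peval (F k) s else 0"
  obtain s where s: "s \<in> cspace 2 - {czero}" "pclass x = pclass (?f s)" using F(3) by (auto simp: P1_image_def)
  obtain t where t: "t \<in> cspace 2 - {czero}" "pclass y = pclass (?f t)" using F(4) by (auto simp: P1_image_def)
  have c1: "c \<noteq> 1" using c by auto
  have xy: "pclass x \<noteq> pclass y"
  proof
    assume "pclass x = pclass y"
    then obtain r where r: "r \<noteq> 0" "x = (\<lambda>i. r * y i)" by (rule pclass_eqD)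
    show False using fun_cong[OF r(2), of 0] fun_cong[OF r(2), of 2] c1 by (simp add: x_y_def)
  qed
  have nondeg: "z i \<noteq> 0 \<and> (j < 4 \<longrightarrow> i \<noteq> j \<longrightarrow> z i ^ 8 + z j ^ 8 \<noteq> 0)" if "z = x \<or> z = y" "i < 4" for z i j
  proof -
    have i: "i = 0 \<or> i = 1 \<or> i = 2 \<or> i = 3" using that(2) by auto
    have "z i ^ 8 = 1 \<or> z i ^ 8 = -3" using i that(1) c by (auto simp: x_y_def)
    moreover have "z j ^ 8 = 1 \<or> z j ^ 8 = -3" if "j < 4"
    proof -
      have "j = 0 \<or> j = 1 \<or> j = 2 \<or> j = 3" using that by auto
      then show ?thesis using \<open>z = x \<or> z = y\<close> c by (auto simp: x_y_def)
    qed
    ultimately show ?thesis by auto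
  qed
  have const: "pclass (?f s') = pclass (?f u)" if u: "u \<in> cspace 2 - {czero}" "u 0 \<noteq> 0" and z: "z = x \<or> z = y" "pclass z = pclass (?f u)"
    and s': "s' \<in> cspace 2 - {czero}" for u z s'
  proof -
    obtain r where r: "r \<noteq> 0" "?f u = (\<lambda>i. r * z i)" using z(2)[symmetric] by (rule pclass_eqD)
    have ru: "peval (F k) u = r * z k" if "k < 4" for k using fun_cong[OF r(2), of k] that by (simp add: le3_less4)
    have "peval (F k) s' = peval (F k) u" if "k < 4" for k
    proof (rule rational_curve_constant[OF F(1,2) u _ _ s' that])
      show "peval (F k) u \<noteq> 0" if "k < 4" for k using ru[OF that] r(1) nondeg[OF z(1) that] by simp
      show "peval (F i) u ^ 8 + peval (F j) u ^ 8 \<noteq> 0" if "i < 4" "j < 4" "i \<noteq> j" for i j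
        using nondeg[OF z(1) that(1), of j] that r(1)
        unfolding ru[OF that(1)] ru[OF that(2)] power_mult_distrib distrib_left[symmetric] by simp
    qed
    then have "?f s' = ?f u" by (auto simp: le3_less4)
    then show ?thesis by simp
  qed
  show False
  proof (cases "s 0 = 0")
    case False
    from const[OF s(1) False _ s(2) t(1)] s(2) t(2) xy show False by simp
  next
    case s0: True
    show False
    proof (cases "t 0 = 0")
      case False
      from const[OF t(1) False _ t(2) s(1)] s(2) t(2) xy show False by simp
    next
      case True
      \<comment> \<open>If both parameters lie at infinity, they represent the same point of the
        projective line and have the same image.\<close>
      obtain m where m: "\<And>k. k \<le> 3 \<Longrightarrow> hform 1 m (F k)" using F by (auto simp: P1_morphism_def)
      have st1: "s (Suc 0) \<noteq> 0" "t (Suc 0) \<noteq> 0" using cspace2_nonzero[OF s(1)] cspace2_nonzero[OF t(1)] s0 True by auto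
      have b: "peval (F k) s * t (Suc 0) ^ m = peval (F k) t * s (Suc 0) ^ m" if k: "k \<le> 3" for k
      proof -
        obtain a where a: "\<And>s. peval (F k) s = (\<Sum>i\<le>m. a i * s 0 ^ (m - i) * s (Suc 0) ^ i)"
          by (rule binary_form_coeffs[OF m[OF k]]) (rule that)
        have "peval (F k) w = (\<Sum>i\<le>m. if i = m then a m * w (Suc 0) ^ m else 0)" if "w 0 = 0" for w
          unfolding a using that by (intro sum.cong) (auto simp: power_0_left)
        then have "peval (F k) w = a m * w (Suc 0) ^ m" if "w 0 = 0" for w using that by simp
        from this[of s, OF s0] this[of t, OF True] show ?thesis by simp
      qed
      have "pclass (?f s) = pclass (?f t)"
        by (rule pclass_eqI[of "(s (Suc 0) / t (Suc 0)) ^ m"]) (use st1 b in \<open>auto simp: power_divide field_simps\<close>)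
      then show False using xy s(2) t(2) by simp
    qed
  qed
qed

section \<open>Directional Wirtinger derivatives\<close>

text \<open>The counterpart of \<open>hol_on_has_derivative\<close> for the real and imaginary parts
  of one complex variable. \<open>Ck_on_has_derivative\<close> then combines the two complex
  variables.\<close>

lemma has_derivative_complex_partials:
  fixes f :: "complex \<Rightarrow> complex"
  assumes S: "open S" "z \<in> S"
    and d1: "\<And>w. w \<in> S \<Longrightarrow> ((\<lambda>t. f (w + of_real t)) has_vector_derivative p w) (at 0)"
    and d2: "\<And>w. w \<in> S \<Longrightarrow> ((\<lambda>t. f (w + of_real t * \<i>)) has_vector_derivative q w) (at 0)"
    and q: "continuous_on S q"
  shows "(f has_derivative (\<lambda>h. of_real (Re h) * p z + of_real (Im h) * q z)) (at z)"
proof -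
  let ?C = "\<lambda>u. Complex (fst u) (snd u)"
  have cC: "continuous_on UNIV ?C"
    unfolding Complex_eq by (intro continuous_intros)
  have "open (?C -` S)" using S(1) cC by (simp add: continuous_on_open_vimage)
  then obtain A B where AB: "open A" "open B" "Re z \<in> A" "Im z \<in> B" "A \<times> B \<subseteq> ?C -` S"
    by (rule open_prod_elim[of "?C -` S" "(Re z, Im z)"]) (use S(2) in \<open>auto simp: mem_Times_iff\<close>)
  obtain e where e: "e > 0" "ball (Im z) e \<subseteq> B" using AB open_contains_ball by blast
  define Y where "Y = ball (Im z) e"
  have AY: "Complex x y \<in> S" if "x \<in> A" "y \<in> Y" for x y
  proof -
    have "(x, y) \<in> A \<times> B" using that e(2) by (auto simp: Y_def)
    then show ?thesis using AB(5) by auto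
  qed
  have op: "open (A \<times> Y)" using AB(1) by (simp add: Y_def open_Times)
  have shift: "((\<lambda>t. F t) has_vector_derivative D) (at x)" if "((\<lambda>t. F (x + t)) has_vector_derivative D) (at 0)" for F :: "real \<Rightarrow> complex" and D x
  proof -
    have "((\<lambda>t. (\<lambda>t. F (x + t)) (t - x)) has_vector_derivative 1 *\<^sub>R D) (at x)"
      by (rule vector_diff_chain_at[unfolded o_def, where f="\<lambda>t. t - x" and g="\<lambda>t. F (x + t)"])
        (use that in \<open>auto intro!: derivative_eq_intros\<close>)
    then show ?thesis by simp
  qed
  have "((\<lambda>(x, y). f (Complex x y)) has_derivative
       (\<lambda>(tx, ty). tx *\<^sub>R p z + blinfun_apply (blinfun_scaleR_left (q (Complex (Re z) (Im z)))) ty)) (at (Re z, Im z) within A \<times> Y)"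
  proof (rule has_derivative_partialsI[where fy="\<lambda>x y. blinfun_scaleR_left (q (Complex x y))"])
    show "Im z \<in> Y" "convex Y" using e by (auto simp: Y_def)
    have "z + of_real t = Complex (Re z + t) (Im z)" for t by (simp add: complex_eq_iff)
    then have eq: "(\<lambda>t. f (z + of_real t)) = (\<lambda>t. f (Complex (Re z + t) (Im z)))" by simp
    from d1[OF S(2)] have "((\<lambda>t. f (Complex (Re z + t) (Im z))) has_vector_derivative p z) (at 0)"
      unfolding eq .
    from shift[OF this] show "((\<lambda>x. f (Complex x (Im z))) has_derivative (\<lambda>tx. tx *\<^sub>R p z)) (at (Re z) within A)"
      unfolding has_vector_derivative_def by (rule has_derivative_at_withinI)
    show "((\<lambda>y. f (Complex x y)) has_derivative blinfun_apply (blinfun_scaleR_left (q (Complex x y)))) (at y within Y)"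
      if "x \<in> A" "y \<in> Y" for x y
    proof -
      have "Complex x y + of_real t * \<i> = Complex x (y + t)" for t by (simp add: complex_eq_iff)
      then have eq: "(\<lambda>t. f (Complex x y + of_real t * \<i>)) = (\<lambda>t. f (Complex x (y + t)))" by simp
      from d2[OF AY[OF that]] have "((\<lambda>t. f (Complex x (y + t))) has_vector_derivative q (Complex x y)) (at 0)"
        unfolding eq .
      from shift[OF this]
      have "((\<lambda>t. f (Complex x t)) has_derivative blinfun_apply (blinfun_scaleR_left (q (Complex x y)))) (at y)"
        by (simp add: has_vector_derivative_def blinfun_scaleR_left.rep_eq)
      then show ?thesis by (rule has_derivative_at_withinI)
    qed
    have "continuous_on (A \<times> Y) (\<lambda>u. q (?C u))"
      by (rule continuous_on_compose2[OF q continuous_on_subset[OF cC]]) (use AY in auto)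
    then have "continuous_on (A \<times> Y) (\<lambda>u. blinfun_scaleR_left (q (?C u)))"
      by (rule bounded_linear.continuous_on[OF bounded_linear_blinfun_scaleR_left])
    then show "continuous (at (Re z, Im z) within A \<times> Y) (\<lambda>(x, y). blinfun_scaleR_left (q (Complex x y)))"
      using AB(3) e(1) by (auto simp: continuous_on_eq_continuous_within Y_def case_prod_unfold)
  qed
  then have "((\<lambda>u. f (?C u)) has_derivative (\<lambda>u. fst u *\<^sub>R p z + snd u *\<^sub>R q z)) (at (Re z, Im z))"
    using at_within_open[OF _ op] AB(3) e(1) by (simp add: Y_def case_prod_unfold)
  moreover have "((\<lambda>w. (Re w, Im w)) has_derivative (\<lambda>h. (Re h, Im h))) (at z)"
    by (intro has_derivative_Pair has_derivative_Re has_derivative_Im has_derivative_ident)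
  ultimately have "((\<lambda>w. f (?C (Re w, Im w))) has_derivative (\<lambda>h. fst (Re h, Im h) *\<^sub>R p z + snd (Re h, Im h) *\<^sub>R q z)) (at z)"
    by (intro has_derivative_compose[where g="\<lambda>u. f (?C u)" and f="\<lambda>w. (Re w, Im w)"])
  then show ?thesis by (simp add: scaleR_conv_of_real)
qed

definition rlin :: "complex \<Rightarrow> complex \<Rightarrow> complex \<Rightarrow>\<^sub>L complex"
  where "rlin p q = Blinfun (\<lambda>h. of_real (Re h) * p + of_real (Im h) * q)"

lemma rlin_apply [simp]: "blinfun_apply (rlin p q) h = of_real (Re h) * p + of_real (Im h) * q"
proof -
  have "bounded_linear (\<lambda>h. of_real (Re h) * p + of_real (Im h) * q)"
    by (intro bounded_linear_add bounded_linear_mult_const bounded_linear_compose[OF bounded_linear_of_real] bounded_linear_Re bounded_linear_Im)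
  then show ?thesis by (simp add: rlin_def bounded_linear_Blinfun_apply)
qed

lemma continuous_on_rlin:
  assumes "continuous_on S p" "continuous_on S q"
  shows "continuous_on S (\<lambda>x. rlin (p x) (q x))"
proof -
  have "linear (\<lambda>(p, q). rlin p q)"
    by (rule linearI) (auto intro!: blinfun_eqI simp: blinfun.bilinear_simps algebra_simps scaleR_conv_of_real)
  then have "bounded_linear (\<lambda>(p, q). rlin p q)"
    by (simp add: linear_conv_bounded_linear)
  from bounded_linear.continuous_on[OF this, of S "\<lambda>x. (p x, q x)"]
  show ?thesis using assms by (simp add: continuous_on_Pair)
qed

lemma Ck_on_has_derivative:
  assumes W: "open_in_cspace 2 W" and f: "Ck_on (Suc k) 2 W f" and z: "z \<in> W"
  shows "((\<lambda>p. f (cv p)) has_derivative (\<lambda>(a, b). rlin (rpartial 0 1 f z) (rpartial 0 \<i> f z) a +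
     rlin (rpartial (Suc 0) 1 f z) (rpartial (Suc 0) \<i> f z) b)) (at (z 0, z (Suc 0)))"
proof -
  have zc: "z \<in> cspace 2" using z open_in_cspace_subset[OF W] by blast
  obtain A B where AB: "open A" "open B" "z 0 \<in> A" "z (Suc 0) \<in> B" "A \<times> B \<subseteq> cv -` W"
    by (rule open_prod_elim[OF open_cv_vimage[OF W], of "(z 0, z (Suc 0))"])
      (use z zc in \<open>auto simp: mem_Times_iff\<close>)
  obtain e where e: "e > 0" "ball (z (Suc 0)) e \<subseteq> B" using AB open_contains_ball by blast
  define Y where "Y = ball (z (Suc 0)) e"
  have AY: "cv (x, y) \<in> W" if "x \<in> A" "y \<in> Y" for x y
  proof -
    have "(x, y) \<in> A \<times> B" using that e(2) by (auto simp: Y_def)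
    then show ?thesis using AB(5) by blast
  qed
  have op: "open (A \<times> Y)" and oY: "open Y" using AB(1) by (simp_all add: Y_def open_Times)
  have cr: "continuous_on W (rpartial j c f)" if "j < 2" "c \<in> {1, \<i>}" for j c
    using Ck_on_continuous[OF Ck_on_SucD(1)[OF f that]] .
  have dr: "(rline j c f w has_vector_derivative rpartial j c f w) (at 0)" if "j < 2" "c \<in> {1, \<i>}" "w \<in> W" for j c w
    by (rule Ck_on_SucD(2)[OF f that])
  have "((\<lambda>(x, y). f (cv (x, y))) has_derivative
       (\<lambda>(tx, ty). (of_real (Re tx) * rpartial 0 1 f (cv (z 0, z (Suc 0))) + of_real (Im tx) * rpartial 0 \<i> f (cv (z 0, z (Suc 0))))
         + blinfun_apply (rlin (rpartial (Suc 0) 1 f (cv (z 0, z (Suc 0)))) (rpartial (Suc 0) \<i> f (cv (z 0, z (Suc 0))))) ty))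
     (at (z 0, z (Suc 0)) within A \<times> Y)"
  proof (rule has_derivative_partialsI[where fy="\<lambda>x y. rlin (rpartial (Suc 0) 1 f (cv (x, y))) (rpartial (Suc 0) \<i> f (cv (x, y)))"])
    show zY: "z (Suc 0) \<in> Y" and "convex Y" using e by (auto simp: Y_def)
    show "((\<lambda>x. f (cv (x, z (Suc 0)))) has_derivative (\<lambda>tx. of_real (Re tx) * rpartial 0 1 f (cv (z 0, z (Suc 0))) + of_real (Im tx) * rpartial 0 \<i> f (cv (z 0, z (Suc 0))))) (at (z 0) within A)"
    proof (rule has_derivative_at_withinI, rule has_derivative_complex_partials[OF AB(1,3), where p="\<lambda>w. rpartial 0 1 f (cv (w, z (Suc 0)))" and q="\<lambda>w. rpartial 0 \<i> f (cv (w, z (Suc 0)))"])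
      show "((\<lambda>t. f (cv (w + of_real t, z (Suc 0)))) has_vector_derivative rpartial 0 1 f (cv (w, z (Suc 0)))) (at 0)" if "w \<in> A" for w
        using dr[OF _ _ AY[OF that zY], of 0 1] by (simp add: rline_def)
      show "((\<lambda>t. f (cv (w + of_real t * \<i>, z (Suc 0)))) has_vector_derivative rpartial 0 \<i> f (cv (w, z (Suc 0)))) (at 0)" if "w \<in> A" for w
        using dr[OF _ _ AY[OF that zY], of 0 \<i>] by (simp add: rline_def)
      show "continuous_on A (\<lambda>w. rpartial 0 \<i> f (cv (w, z (Suc 0))))"
        by (rule continuous_on_compose2[OF cr[of 0 \<i>]]) (use AY zY in \<open>auto intro!: continuous_on_cv continuous_on_Pair continuous_on_id continuous_on_const\<close>)
    qed
    show "((\<lambda>y. f (cv (x, y))) has_derivative blinfun_apply (rlin (rpartial (Suc 0) 1 f (cv (x, y))) (rpartial (Suc 0) \<i> f (cv (x, y))))) (at y within Y)"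
      if xy: "x \<in> A" "y \<in> Y" for x y
      unfolding rlin_apply
    proof (rule has_derivative_at_withinI, rule has_derivative_complex_partials[OF oY xy(2), where p="\<lambda>w. rpartial (Suc 0) 1 f (cv (x, w))" and q="\<lambda>w. rpartial (Suc 0) \<i> f (cv (x, w))"])
      show "((\<lambda>t. f (cv (x, w + of_real t))) has_vector_derivative rpartial (Suc 0) 1 f (cv (x, w))) (at 0)" if "w \<in> Y" for w
        using dr[OF _ _ AY[OF xy(1) that], of "Suc 0" 1] by (simp add: rline_def)
      show "((\<lambda>t. f (cv (x, w + of_real t * \<i>))) has_vector_derivative rpartial (Suc 0) \<i> f (cv (x, w))) (at 0)" if "w \<in> Y" for w
        using dr[OF _ _ AY[OF xy(1) that], of "Suc 0" \<i>] by (simp add: rline_def)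
      show "continuous_on Y (\<lambda>w. rpartial (Suc 0) \<i> f (cv (x, w)))"
        by (rule continuous_on_compose2[OF cr[of "Suc 0" \<i>]]) (use AY xy in \<open>auto intro!: continuous_on_cv continuous_on_Pair continuous_on_id continuous_on_const\<close>)
    qed
    have "continuous_on (A \<times> Y) (\<lambda>p. rlin (rpartial (Suc 0) 1 f (cv p)) (rpartial (Suc 0) \<i> f (cv p)))"
      by (intro continuous_on_rlin continuous_on_compose2[OF cr[of "Suc 0" 1]] continuous_on_compose2[OF cr[of "Suc 0" \<i>]] continuous_on_cv continuous_on_id)
        (use AY in auto)
    then show "continuous (at (z 0, z (Suc 0)) within A \<times> Y) (\<lambda>(x, y). rlin (rpartial (Suc 0) 1 f (cv (x, y))) (rpartial (Suc 0) \<i> f (cv (x, y))))"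
      using AB(3) e(1) by (auto simp: continuous_on_eq_continuous_within Y_def case_prod_unfold)
  qed
  then show ?thesis
    using at_within_open[OF _ op] AB(3) e(1) zc by (simp add: Y_def case_prod_unfold)
qed

section \<open>Derivatives along a complex direction\<close>

text \<open>A real line in the complex line spanned by u. The values 1 and \<open>\<i>\<close> of e
  together recover the mixed second derivative along u.\<close>

definition shift_along :: "cvec \<Rightarrow> cvec \<Rightarrow> complex \<Rightarrow> real \<Rightarrow> cvec"
  where "shift_along z u e t = (\<lambda>j. z j + of_real t * (e * u j))"

definition dir_dz :: "cvec \<Rightarrow> (cvec \<Rightarrow> complex) \<Rightarrow> cvec \<Rightarrow> complex"
  where "dir_dz u f z = (\<Sum>j<2. u j * d_z j f z)"

definition dir_dzbar :: "cvec \<Rightarrow> (cvec \<Rightarrow> complex) \<Rightarrow> cvec \<Rightarrow> complex"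
  where "dir_dzbar u f z = (\<Sum>j<2. cnj (u j) * d_zbar j f z)"

lemma directional_derivative:
  assumes W: "open_in_cspace 2 W" and f: "Ck_on (Suc k) 2 W f" and u: "u \<in> cspace 2" and z: "z \<in> cspace 2"
    and t: "shift_along z u e t \<in> W"
  shows "((\<lambda>t. f (shift_along z u e t)) has_vector_derivative
    (e * dir_dz u f (shift_along z u e t) + cnj e * dir_dzbar u f (shift_along z u e t))) (at t)"
proof -
  let ?z = "shift_along z u e t"
  have eq: "shift_along z u e s = cv (z 0 + of_real s * (e * u 0), z (Suc 0) + of_real s * (e * u (Suc 0)))" for s
  proof (rule cspace2_eqI)
    show "shift_along z u e s \<in> cspace 2" using u z by (simp add: shift_along_def cspace_def)
  qed (simp_all add: shift_along_def)
  have d: "((\<lambda>s. (z 0 + of_real s * (e * u 0), z (Suc 0) + of_real s * (e * u (Suc 0)))) has_derivative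
     (\<lambda>h. (of_real h * (e * u 0), of_real h * (e * u (Suc 0))))) (at t)"
    by (auto intro!: derivative_eq_intros)
  have "((\<lambda>s. f (cv (z 0 + of_real s * (e * u 0), z (Suc 0) + of_real s * (e * u (Suc 0))))) has_derivative
      (\<lambda>h. (\<lambda>(a, b). rlin (rpartial 0 1 f ?z) (rpartial 0 \<i> f ?z) a +
     rlin (rpartial (Suc 0) 1 f ?z) (rpartial (Suc 0) \<i> f ?z) b) (of_real h * (e * u 0), of_real h * (e * u (Suc 0))))) (at t)"
    using Ck_on_has_derivative[OF W f t] by (intro has_derivative_compose[OF d]) (simp add: eq[of t])
  moreover have "(\<lambda>(a, b). rlin (rpartial 0 1 f ?z) (rpartial 0 \<i> f ?z) a +
     rlin (rpartial (Suc 0) 1 f ?z) (rpartial (Suc 0) \<i> f ?z) b) (of_real h * (e * u 0), of_real h * (e * u (Suc 0))) =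
     h *\<^sub>R (e * dir_dz u f ?z + cnj e * dir_dzbar u f ?z)" for h
  proof -
    \<comment> \<open>A real-linear map of the complex plane splits into its complex-linear and its
      antilinear part.\<close>
    have r: "rlin p q (of_real h * w) = of_real h * (w * ((p - \<i> * q) / 2) + cnj w * ((p + \<i> * q) / 2))" for p q w
      by (auto simp: complex_eq_iff field_simps)
    show ?thesis
      unfolding split_conv r dir_dz_def dir_dzbar_def d_z_def d_zbar_def sum_lessThan_2
      by (simp add: scaleR_conv_of_real algebra_simps)
  qed
  ultimately show ?thesis by (simp add: has_vector_derivative_def eq)
qed

lemma Ck_on_d_z:
  assumes W: "open_in_cspace 2 W" and f: "Ck_on (Suc k) 2 W f" and j: "j < 2"
  shows "Ck_on k 2 W (d_z j f)" "Ck_on k 2 W (d_zbar j f)"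
proof -
  have "Ck_on k 2 W (\<lambda>z. (rpartial j 1 f z - \<i> * rpartial j \<i> f z) * (1 / 2))"
    "Ck_on k 2 W (\<lambda>z. (rpartial j 1 f z + \<i> * rpartial j \<i> f z) * (1 / 2))"
    by (intro Ck_on_mult Ck_on_diff Ck_on_add Ck_on_const W Ck_on_SucD(1)[OF f j]; simp)+
  then show "Ck_on k 2 W (d_z j f)" "Ck_on k 2 W (d_zbar j f)" by (simp_all add: d_z_def[abs_def] d_zbar_def[abs_def])
qed

lemma Ck_on_dir:
  assumes W: "open_in_cspace 2 W" and f: "Ck_on (Suc k) 2 W f"
  shows "Ck_on k 2 W (dir_dz u f)" "Ck_on k 2 W (dir_dzbar u f)"
  unfolding dir_dz_def[abs_def] dir_dzbar_def[abs_def]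
  by (intro Ck_on_sum Ck_on_mult Ck_on_const W Ck_on_d_z[OF W f]; simp)+

lemma dir_cong:
  assumes W: "open_in_cspace 2 W" "z \<in> W" and eq: "\<And>w. w \<in> W \<Longrightarrow> f w = g w"
  shows "dir_dz u f z = dir_dz u g z" "dir_dzbar u f z = dir_dzbar u g z"
  using d_z_cong[OF W(1,2) _ eq] unfolding dir_dz_def dir_dzbar_def by simp_all

lemma dir_WD:
  assumes "\<And>j. j < 2 \<Longrightarrow> WD j f z (a j) (b j)"
  shows "dir_dz u f z = (\<Sum>j<2. u j * a j)" "dir_dzbar u f z = (\<Sum>j<2. cnj (u j) * b j)"
  unfolding dir_dz_def dir_dzbar_def using WD_d_z[OF assms] WD_d_zbar[OF assms] by simp_all

context
  fixes W z f g
  assumes z: "z \<in> W" and f: "Ck_on (Suc 0) 2 W f" and g: "Ck_on (Suc 0) 2 W g"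
begin

lemma dir_mult:
  "dir_dz u (\<lambda>w. f w * g w) z = dir_dz u f z * g z + f z * dir_dz u g z"
  "dir_dzbar u (\<lambda>w. f w * g w) z = dir_dzbar u f z * g z + f z * dir_dzbar u g z"
  by (simp_all add: dir_WD[OF WD_mult[OF Ck_on_WD[OF f z] Ck_on_WD[OF g z]]],
    simp_all add: dir_dz_def dir_dzbar_def sum_lessThan_2 algebra_simps)

lemma dir_diff:
  "dir_dz u (\<lambda>w. f w - g w) z = dir_dz u f z - dir_dz u g z"
  "dir_dzbar u (\<lambda>w. f w - g w) z = dir_dzbar u f z - dir_dzbar u g z"
  by (simp_all add: dir_WD[OF WD_diff[OF Ck_on_WD[OF f z] Ck_on_WD[OF g z]]],
    simp_all add: dir_dz_def dir_dzbar_def sum_lessThan_2 algebra_simps)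

lemma dir_add:
  "dir_dz u (\<lambda>w. f w + g w) z = dir_dz u f z + dir_dz u g z"
  "dir_dzbar u (\<lambda>w. f w + g w) z = dir_dzbar u f z + dir_dzbar u g z"
  by (simp_all add: dir_WD[OF WD_add[OF Ck_on_WD[OF f z] Ck_on_WD[OF g z]]],
    simp_all add: dir_dz_def dir_dzbar_def sum_lessThan_2 algebra_simps)

lemma dir_cnj:
  "dir_dz u (\<lambda>w. cnj (f w)) z = cnj (dir_dzbar u f z)"
  "dir_dzbar u (\<lambda>w. cnj (f w)) z = cnj (dir_dz u f z)"
  by (simp_all add: dir_WD[OF WD_cnj[OF Ck_on_WD[OF f z]]],
    simp_all add: dir_dz_def dir_dzbar_def sum_lessThan_2)

end

lemma dir_hol:
  assumes z: "z \<in> W" and g: "hol_on 2 W g"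
  shows "dir_dz u g z = (\<Sum>j<2. u j * cpartial j g z)" "dir_dzbar u g z = 0"
  by (simp_all add: dir_WD[OF WD_hol[OF g z]])

lemma hol_on_dir_dz:
  assumes W: "open_in_cspace 2 W" and g: "hol_on 2 W g"
  shows "hol_on 2 W (dir_dz u g)"
proof -
  have "hol_on 2 W (\<lambda>w. u 0 * cpartial 0 g w + u (Suc 0) * cpartial (Suc 0) g w)"
    by (intro hol_on_add hol_on_mult hol_on_const hol_on_cpartial[OF W g]) simp_all
  then show ?thesis
    by (rule hol_on_cong[OF W]) (simp add: dir_hol(1)[OF _ g] sum_lessThan_2)
qed

lemma dir_dir_mult:
  assumes W: "open_in_cspace 2 W" and z: "z \<in> W" and f: "Ck_on (Suc (Suc 0)) 2 W f" and g: "Ck_on (Suc (Suc 0)) 2 W g"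
  shows "dir_dz u (dir_dzbar u (\<lambda>w. f w * g w)) z =
    dir_dz u (dir_dzbar u f) z * g z + dir_dzbar u f z * dir_dz u g z
    + dir_dz u f z * dir_dzbar u g z + f z * dir_dz u (dir_dzbar u g) z"
proof -
  note f1 = Ck_on_mono[OF f] and g1 = Ck_on_mono[OF g]
  note fb = Ck_on_dir(2)[OF W f, of u] and gb = Ck_on_dir(2)[OF W g, of u]
  have "dir_dz u (dir_dzbar u (\<lambda>w. f w * g w)) z = dir_dz u (\<lambda>w. dir_dzbar u f w * g w + f w * dir_dzbar u g w) z"
    by (rule dir_cong(1)[OF W z]) (rule dir_mult(2)[OF _ f1 g1])
  also have "\<dots> = dir_dz u (\<lambda>w. dir_dzbar u f w * g w) z + dir_dz u (\<lambda>w. f w * dir_dzbar u g w) z"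
    by (rule dir_add(1)[OF z Ck_on_mult[OF W fb g1] Ck_on_mult[OF W f1 gb]])
  finally show ?thesis
    by (simp add: dir_mult(1)[OF z fb g1] dir_mult(1)[OF z f1 gb])
qed

lemma dir_dir_diff:
  assumes W: "open_in_cspace 2 W" and z: "z \<in> W" and f: "Ck_on (Suc (Suc 0)) 2 W f" and g: "Ck_on (Suc (Suc 0)) 2 W g"
  shows "dir_dz u (dir_dzbar u (\<lambda>w. f w - g w)) z = dir_dz u (dir_dzbar u f) z - dir_dz u (dir_dzbar u g) z"
proof -
  have "dir_dz u (dir_dzbar u (\<lambda>w. f w - g w)) z = dir_dz u (\<lambda>w. dir_dzbar u f w - dir_dzbar u g w) z"
    by (rule dir_cong(1)[OF W z]) (rule dir_diff(2)[OF _ Ck_on_mono[OF f] Ck_on_mono[OF g]])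
  also have "\<dots> = dir_dz u (dir_dzbar u f) z - dir_dz u (dir_dzbar u g) z"
    by (rule dir_diff(1)[OF z Ck_on_dir(2)[OF W f] Ck_on_dir(2)[OF W g]])
  finally show ?thesis .
qed

lemma dir_dir_sum:
  assumes W: "open_in_cspace 2 W" and z: "z \<in> W" and f: "Ck_on (Suc (Suc 0)) 2 W f"
  shows "dir_dz u (dir_dzbar u f) z = (\<Sum>k<2. \<Sum>l<2. d_z k (d_zbar l f) z * u k * cnj (u l))"
proof -
  have "WD k (dir_dzbar u f) z (\<Sum>l<2. 0 * d_zbar l f z + cnj (u l) * d_z k (d_zbar l f) z)
      (\<Sum>l<2. 0 * d_zbar l f z + cnj (u l) * d_zbar k (d_zbar l f) z)" if "k < 2" for k
    unfolding dir_dzbar_def[abs_def]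
    by (intro WD_sum WD_mult WD_const Ck_on_WD[OF Ck_on_d_z(2)[OF W f] z that]) simp
  from dir_WD(1)[OF this] show ?thesis
    by (simp add: sum_lessThan_2 algebra_simps)
qed

section \<open>Minima of Hermitian determinants\<close>

text \<open>A negative second derivative would make the first one negative just to the right of 0,
  and the mean value theorem would give a smaller value there.\<close>

lemma second_derivative_at_min:
  fixes \<phi> :: "real \<Rightarrow> real"
  assumes S: "open S" "0 \<in> S"
    and d1: "\<And>t. t \<in> S \<Longrightarrow> (\<phi> has_real_derivative \<phi>' t) (at t)"
    and d2: "(\<phi>' has_real_derivative s) (at 0)"
    and m: "\<And>t. t \<in> S \<Longrightarrow> \<phi> 0 \<le> \<phi> t"
  shows "\<phi>' 0 = 0" "s \<ge> 0"
proof -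
  obtain e where e: "e > 0" "ball 0 e \<subseteq> S" using S open_contains_ball by blast
  then have eS: "t \<in> S" if "\<bar>t\<bar> < e" for t using that by (auto simp: dist_real_def)
  show z: "\<phi>' 0 = 0"
    by (rule DERIV_local_min[OF d1[OF S(2)] e(1)]) (use eS m in simp)
  show "s \<ge> 0"
  proof (rule ccontr)
    assume "\<not> s \<ge> 0"
    then obtain d where d: "d > 0" "\<And>h. 0 < h \<Longrightarrow> h < d \<Longrightarrow> \<phi>' (0 + h) < \<phi>' 0"
      using DERIV_neg_dec_right[OF d2] by auto
    define h where "h = min d e / 2"
    have h: "0 < h" "h < d" "h < e" using d(1) e(1) by (auto simp: h_def min_def)
    obtain \<xi> where \<xi>: "0 < \<xi>" "\<xi> < h" "\<phi> h - \<phi> 0 = (h - 0) * \<phi>' \<xi>"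
      using MVT2[OF h(1), of \<phi> \<phi>'] d1 eS h by auto
    have "\<phi>' \<xi> < 0" using d(2)[of \<xi>] \<xi> h z by simp
    then have "(h - 0) * \<phi>' \<xi> < 0" using h(1) by (simp add: mult_pos_neg)
    moreover have "\<phi> h \<ge> \<phi> 0" by (rule m) (use h eS in simp)
    ultimately show False using \<xi>(3) by simp
  qed
qed

text \<open>The second derivative test on the real lines in the directions u and \<open>\<i>\<close>
  times u. In the sum of the two second derivatives the unmixed Wirtinger terms cancel, and four
  times the mixed derivative is left.\<close>

lemma real_fun_min:
  assumes W: "open_in_cspace 2 W" and w0: "w0 \<in> W" and u: "u \<in> cspace 2"
    and F: "Ck_on (Suc (Suc 0)) 2 W F" and re: "\<And>w. w \<in> W \<Longrightarrow> cnj (F w) = F w"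
    and m: "\<And>w. w \<in> W \<Longrightarrow> Re (F w0) \<le> Re (F w)"
  shows "dir_dz u F w0 = 0" "Re (dir_dz u (dir_dzbar u F) w0) \<ge> 0"
proof -
  define L where "L = dir_dz u F"
  define M where "M = dir_dzbar u F"
  have w0c: "w0 \<in> cspace 2" using w0 open_in_cspace_subset[OF W] by blast
  note F1 = Ck_on_mono[OF F]
  have CL: "Ck_on (Suc 0) 2 W L" and CM: "Ck_on (Suc 0) 2 W M"
    unfolding L_def M_def by (rule Ck_on_dir[OF W F])+
  have Mcnj: "M w = cnj (L w)" if "w \<in> W" for w
  proof -
    have "M w = dir_dzbar u (\<lambda>w. cnj (F w)) w"
      unfolding M_def by (rule dir_cong(2)[OF W that]) (simp add: re)
    also have "\<dots> = cnj (L w)" unfolding L_def by (rule dir_cnj(2)[OF that F1 F1])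
    finally show ?thesis .
  qed
  have mixed: "dir_dzbar u L w0 = cnj (dir_dz u M w0)"
  proof -
    have "dir_dzbar u L w0 = dir_dzbar u (\<lambda>w. cnj (M w)) w0"
      by (rule dir_cong(2)[OF W w0]) (simp add: Mcnj)
    also have "\<dots> = cnj (dir_dz u M w0)" by (rule dir_cnj(2)[OF w0 CM CM])
    finally show ?thesis .
  qed
  define s where "s e = Re (e * (e * dir_dz u L w0 + cnj e * dir_dzbar u L w0) + cnj e * (e * dir_dz u M w0 + cnj e * dir_dzbar u M w0))" for e
  have key: "Re (e * L w0 + cnj e * M w0) = 0 \<and> s e \<ge> 0" for e
  proof -
    let ?p = "shift_along w0 u e"
    have p0: "?p 0 = w0" by (simp add: shift_along_def)
    have "continuous_on UNIV ?p"
      by (rule continuous_on_coordinatewise_then_product) (auto simp: shift_along_def intro!: continuous_intros)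
    moreover have "?p \<in> UNIV \<rightarrow> cspace 2" using u w0c by (auto simp: shift_along_def cspace_def)
    ultimately have "openin (top_of_set UNIV) (UNIV \<inter> ?p -` W)"
      by (rule continuous_openin_preimage[OF _ _ W])
    then have op: "open (?p -` W)" by simp
    have Rd: "((\<lambda>t. Re (f t)) has_real_derivative Re D) (at t)" if "(f has_vector_derivative D) (at t)" for f D t
      using has_derivative_Re[OF that[unfolded has_vector_derivative_def]]
      by (simp add: has_field_derivative_def mult.commute[of _ "Re D"])
    have d1: "((\<lambda>t. Re (F (?p t))) has_real_derivative Re (e * L (?p t) + cnj e * M (?p t))) (at t)" if "t \<in> ?p -` W" for t
      unfolding L_def M_def by (rule Rd, rule directional_derivative[OF W F1 u w0c]) (use that in simp)
    have dd: "((\<lambda>t. f (?p t)) has_vector_derivative (e * dir_dz u f w0 + cnj e * dir_dzbar u f w0)) (at 0)"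
      if "Ck_on (Suc 0) 2 W f" for f
      using directional_derivative[OF W that u w0c, of e 0] w0 by (simp add: p0)
    have d2: "((\<lambda>t. Re (e * L (?p t) + cnj e * M (?p t))) has_real_derivative s e) (at 0)"
      unfolding s_def
      by (intro Rd has_vector_derivative_add has_vector_derivative_mult_right dd CL CM)
    show ?thesis
      using second_derivative_at_min[OF op _ d1 d2] m w0 by (auto simp: p0)
  qed
  have L0: "Re (L w0 + M w0) = 0" "Re (\<i> * L w0 - \<i> * M w0) = 0"
    using key[of 1] key[of \<i>] by simp_all
  then show "dir_dz u F w0 = 0"
    by (simp add: L_def[symmetric] Mcnj[OF w0] complex_eq_iff)
  have "s 1 + s \<i> = 4 * Re (dir_dz u M w0)"
    by (simp add: s_def mixed)
  then show "Re (dir_dz u (dir_dzbar u F) w0) \<ge> 0" using key[of 1] key[of \<i>] by (simp add: M_def)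
qed


section \<open>The trace of the curvature\<close>

text \<open>The trace of the curvature is the curvature of the determinant, that is, minus the mixed
  derivative of log D, here multiplied by the square of D to be polynomial. The letters r, p and q
  stand for the mixed, holomorphic and antiholomorphic derivatives of the entries, and R for D times
  the curvature.\<close>

lemma det2_curvature_identity:
  fixes h00 h01 h10 h11 :: complex
  defines "D \<equiv> h00 * h11 - h01 * h10"
  defines "R \<equiv> \<lambda>r p0 p1 q0 q1. - D * r + (h11 * p0 * q0 - h10 * p1 * q0 - h01 * p0 * q1 + h00 * p1 * q1)"
  shows "h11 * R r00 p00 p01 q00 q10 + h00 * R r11 p10 p11 q01 q11 - h10 * R r01 p00 p01 q01 q11 - h01 * R r10 p10 p11 q00 q10 =
    - (D * (r00 * h11 + q00 * p11 + p00 * q11 + h00 * r11 - (r01 * h10 + q01 * p10 + p01 * q10 + h01 * r10)) -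
       (p00 * h11 + h00 * p11 - (p01 * h10 + h01 * p10)) * (q00 * h11 + h00 * q11 - (q01 * h10 + h01 * q10)))"
  unfolding D_def R_def by (simp add: algebra_simps)

text \<open>The expression is \<open>det2 H\<close> times the trace of R with respect to H.
  Multiplied by \<open>H 0 0\<close>, it is the sum of the value of R on (-h10, h00) and of the
  determinant times the value of R on (1, 0).\<close>

lemma positive_trace2:
  assumes H: "herm2 H" and v: "\<And>v. v \<in> cspace 2 - {czero} \<Longrightarrow> Re (\<Sum>a<2. \<Sum>b<2. R a b * v a * cnj (v b)) > 0"
  shows "Re (H 1 1 * R 0 0 + H 0 0 * R 1 1 - H 1 0 * R 0 1 - H 0 1 * R 1 0) > 0"
proof -
  note pos = herm2_pos[OF H]
  let ?T = "H 1 1 * R 0 0 + H 0 0 * R 1 1 - H 1 0 * R 0 1 - H 0 1 * R 1 0"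
  have h: "H a b = cnj (H b a)" if "a < 2" "b < 2" for a b
    using H that unfolding herm2_def by blast
  have hc: "cnj (H 1 0) = H 0 1" "cnj (H 0 0) = H 0 0"
    by (rule sym, rule h; simp)+
  have e0: "Re (R 0 0) > 0" using v[OF cv_nonzero[of 1 0]] by (simp add: sum_lessThan_2)
  have "H 0 0 \<noteq> 0" using pos(1) by auto
  then have "Re (\<Sum>a<2. \<Sum>b<2. R a b * cv (- H 1 0, H 0 0) a * cnj (cv (- H 1 0, H 0 0) b)) > 0"
    by (intro v cv_nonzero) simp
  moreover have "(\<Sum>a<2. \<Sum>b<2. R a b * cv (- H 1 0, H 0 0) a * cnj (cv (- H 1 0, H 0 0) b)) = H 0 0 * ?T - R 0 0 * det2 H"
    using hc by (simp add: sum_lessThan_2 det2_def algebra_simps)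
  ultimately have "Re (H 0 0 * ?T - R 0 0 * det2 H) > 0" by (simp only:)
  moreover have "Re (R 0 0 * det2 H) > 0" using e0 pos(3,4) by simp
  ultimately have "Re (H 0 0 * ?T) > 0" unfolding minus_complex.sel by linarith
  then show ?thesis using pos(1,2) by (simp add: zero_less_mult_iff)
qed

lemma inverse_metric2_eq:
  assumes "det2 H \<noteq> 0"
  shows "det2 H * inverse_metric 2 H 0 0 = H 1 1" "det2 H * inverse_metric 2 H 0 1 = - H 1 0"
    "det2 H * inverse_metric 2 H 1 0 = - H 0 1" "det2 H * inverse_metric 2 H 1 1 = H 0 0"
proof -
  let ?G = "inverse_metric 2 H"
  have e: "H 0 0 * ?G 0 0 + H 0 1 * ?G 0 1 = 1" "H 1 0 * ?G 0 0 + H 1 1 * ?G 0 1 = 0"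
    "H 0 0 * ?G 1 0 + H 0 1 * ?G 1 1 = 0" "H 1 0 * ?G 1 0 + H 1 1 * ?G 1 1 = 1"
    using inverse_metric2[OF assms, of 0 0] inverse_metric2[OF assms, of 1 0]
      inverse_metric2[OF assms, of 0 1] inverse_metric2[OF assms, of 1 1] by (simp_all add: sum_lessThan_2)
  show "det2 H * ?G 0 0 = H 1 1" using e(1,2) unfolding det2_def by algebra
  show "det2 H * ?G 0 1 = - H 1 0" using e(1,2) unfolding det2_def by algebra
  show "det2 H * ?G 1 0 = - H 0 1" using e(3,4) unfolding det2_def by algebra
  show "det2 H * ?G 1 1 = H 0 0" using e(3,4) unfolding det2_def by algebra
qed

text \<open>A uniformly positive direction u makes the curvature of the determinant positive on u, so the
  determinant times a holomorphic square is strictly superharmonic along u at a critical point.\<close>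

lemma hermitian_determinant_no_minimum:
  assumes W: "open_in_cspace 2 W" and w0: "w0 \<in> W" and u: "u \<in> cspace 2"
    and H: "\<And>a b. a < 2 \<Longrightarrow> b < 2 \<Longrightarrow> Ck_on (Suc (Suc 0)) 2 W (\<lambda>w. H w a b)"
    and herm: "\<And>w. w \<in> W \<Longrightarrow> herm2 (H w)"
    and g: "hol_on 2 W g" "g w0 \<noteq> 0"
    and m: "\<And>w. w \<in> W \<Longrightarrow> Re (det2 (H w0)) * (cmod (g w0))\<^sup>2 \<le> Re (det2 (H w)) * (cmod (g w))\<^sup>2"
  shows "\<exists>v\<in>cspace 2 - {czero}. \<not> Re (\<Sum>k<2. \<Sum>l<2. \<Sum>a<2. \<Sum>b<2.
      chern_curvature 2 H w0 k l a b * u k * cnj (u l) * v a * cnj (v b)) > 0"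
proof (rule ccontr)
  assume "\<not> ?thesis"
  then have pos: "Re (\<Sum>k<2. \<Sum>l<2. \<Sum>a<2. \<Sum>b<2.
      chern_curvature 2 H w0 k l a b * u k * cnj (u l) * v a * cnj (v b)) > 0" if "v \<in> cspace 2 - {czero}" for v
    using that by blast
  define D where "D = (\<lambda>w. det2 (H w))"
  define G where "G = (\<lambda>w. g w * cnj (g w))"
  let ?L = "dir_dz u" and ?M = "dir_dzbar u"
  have g2: "Ck_on (Suc (Suc 0)) 2 W g" by (rule hol_on_imp_Ck_on[OF W g(1)])
  note g1 = Ck_on_mono[OF g2]
  have H2: "Ck_on (Suc (Suc 0)) 2 W (\<lambda>w. H w 0 0)" "Ck_on (Suc (Suc 0)) 2 W (\<lambda>w. H w 0 1)"
    "Ck_on (Suc (Suc 0)) 2 W (\<lambda>w. H w 1 0)" "Ck_on (Suc (Suc 0)) 2 W (\<lambda>w. H w 1 1)"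
    by (rule H; simp)+
  note H1 = H2[THEN Ck_on_mono]
  have D2: "Ck_on (Suc (Suc 0)) 2 W D" unfolding D_def det2_def
    by (intro Ck_on_diff Ck_on_mult W H2)
  note D1 = Ck_on_mono[OF D2]
  have c2: "Ck_on (Suc (Suc 0)) 2 W (\<lambda>w. cnj (g w))" by (rule Ck_on_cnj[OF W g2])
  note c1 = Ck_on_mono[OF c2]
  have G2: "Ck_on (Suc (Suc 0)) 2 W G" unfolding G_def by (rule Ck_on_mult[OF W g2 c2])
  note G1 = Ck_on_mono[OF G2]
  have F2: "Ck_on (Suc (Suc 0)) 2 W (\<lambda>w. D w * G w)" by (rule Ck_on_mult[OF W D2 G2])
  have Dre: "cnj (D w) = D w" "Re (D w) > 0" if "w \<in> W" for w
    using herm2_pos(3,4)[OF herm[OF that]] by (simp_all add: D_def complex_eq_iff)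
  have Gre: "G w = of_real ((cmod (g w))\<^sup>2)" for w
    by (simp add: G_def complex_norm_square[symmetric])
  have F: "?L (\<lambda>w. D w * G w) w0 = 0" "Re (?L (?M (\<lambda>w. D w * G w)) w0) \<ge> 0"
    by (rule real_fun_min[OF W w0 u F2]; use m Dre(1) in \<open>simp add: Gre D_def\<close>)+
  have MD: "?M D w0 = cnj (?L D w0)"
  proof -
    have "?M D w0 = ?M (\<lambda>w. cnj (D w)) w0" by (rule dir_cong(2)[OF W w0]) (simp add: Dre)
    also have "\<dots> = cnj (?L D w0)" by (rule dir_cnj(2)[OF w0 D1 D1])
    finally show ?thesis .
  qed
  have Lc: "?L (\<lambda>w. cnj (g w)) w = 0" "?M (\<lambda>w. cnj (g w)) w = cnj (?L g w)" if "w \<in> W" for w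
    using dir_cnj[OF that g1 g1, of u] dir_hol(2)[OF that g(1), of u] by simp_all
  have Mg: "?M g w = 0" if "w \<in> W" for w by (rule dir_hol(2)[OF that g(1)])
  have LMg: "?L (?M g) w0 = 0"
    using dir_cong(1)[OF W w0, of "?M g" "\<lambda>w. 0" u] Mg dir_WD(1)[of "\<lambda>w. 0" w0 "\<lambda>_. 0" "\<lambda>_. 0" u] WD_const by simp
  have LMc: "?L (?M (\<lambda>w. cnj (g w))) w0 = 0"
  proof -
    have hL: "hol_on 2 W (?L g)" by (rule hol_on_dir_dz[OF W g(1)])
    have "?L (?M (\<lambda>w. cnj (g w))) w0 = ?L (\<lambda>w. cnj (?L g w)) w0"
      by (rule dir_cong(1)[OF W w0]) (simp add: Lc)
    also have "\<dots> = cnj (?M (?L g) w0)"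
      by (rule dir_cnj(1)[OF w0]) (rule Ck_on_dir(1)[OF W g2])+
    finally show ?thesis by (simp add: dir_hol(2)[OF w0 hL])
  qed
  have LG: "?L G w0 = ?L g w0 * cnj (g w0)" and MG: "?M G w0 = g w0 * cnj (?L g w0)"
    unfolding G_def dir_mult[OF w0 g1 c1] by (simp_all add: Lc[OF w0] Mg[OF w0])
  have LMG: "?L (?M G) w0 = ?L g w0 * cnj (?L g w0)"
    unfolding G_def dir_dir_mult[OF W w0 g2 c2] by (simp add: Lc[OF w0] Mg[OF w0] LMg LMc)
  have "(?L D w0 * g w0 + D w0 * ?L g w0) * cnj (g w0) = 0"
    using F(1) unfolding dir_mult(1)[OF w0 D1 G1] LG by (simp add: G_def algebra_simps)
  then have crit: "?L D w0 * g w0 + D w0 * ?L g w0 = 0" using g(2) by simp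
  from arg_cong[OF this, of cnj] have crit': "?M D w0 * cnj (g w0) + D w0 * cnj (?L g w0) = 0"
    by (simp add: MD Dre(1)[OF w0])
  \<comment> \<open>The logarithm of G, the squared modulus of a holomorphic function, is
    pluriharmonic where g is nonzero, so at a critical point only the derivatives of D
    remain.\<close>
  have "D w0 * ?L (?M (\<lambda>w. D w * G w)) w0 = G w0 * (D w0 * ?L (?M D) w0 - ?L D w0 * ?M D w0)"
    unfolding dir_dir_mult[OF W w0 D2 G2] LG MG LMG unfolding G_def using crit crit' by algebra
  moreover have "Re (D w0 * ?L (?M (\<lambda>w. D w * G w)) w0) \<ge> 0"
    using F(2) Dre[OF w0] by (simp add: complex_eq_iff)
  ultimately have "Re (G w0 * (D w0 * ?L (?M D) w0 - ?L D w0 * ?M D w0)) \<ge> 0" by simp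
  then have nonneg: "Re (D w0 * ?L (?M D) w0 - ?L D w0 * ?M D w0) \<ge> 0"
    unfolding Gre using g(2) by (simp add: zero_le_mult_iff power2_less_0)
  \<comment> \<open>The curvature contracted with u in its form indices, as a sesquilinear form in
    v.\<close>
  define R where "R a b = - ?L (?M (\<lambda>w. H w a b)) w0 +
    (\<Sum>g<2. \<Sum>d<2. inverse_metric 2 (H w0) g d * ?L (\<lambda>w. H w a d) w0 * ?M (\<lambda>w. H w g b) w0)" for a b
  have R: "(\<Sum>k<2. \<Sum>l<2. \<Sum>a<2. \<Sum>b<2. chern_curvature 2 H w0 k l a b * u k * cnj (u l) * v a * cnj (v b))
      = (\<Sum>a<2. \<Sum>b<2. R a b * v a * cnj (v b))" for v
  proof -
    have "R a b = (\<Sum>k<2. \<Sum>l<2. chern_curvature 2 H w0 k l a b * u k * cnj (u l))" if "a < 2" "b < 2" for a b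
      unfolding R_def dir_dir_sum[OF W w0 H[OF that]]
      unfolding chern_curvature_def dir_dz_def dir_dzbar_def sum_lessThan_2
      by (simp add: algebra_simps)
    then have "(\<Sum>a<2. \<Sum>b<2. R a b * v a * cnj (v b)) =
      (\<Sum>a<2. \<Sum>b<2. (\<Sum>k<2. \<Sum>l<2. chern_curvature 2 H w0 k l a b * u k * cnj (u l)) * v a * cnj (v b))" by simp
    then show ?thesis unfolding sum_lessThan_2 by (simp add: algebra_simps)
  qed
  let ?T = "H w0 1 1 * R 0 0 + H w0 0 0 * R 1 1 - H w0 1 0 * R 0 1 - H w0 0 1 * R 1 0"
  have T: "Re ?T > 0"
    by (rule positive_trace2[OF herm[OF w0]]) (use pos in \<open>simp add: R\<close>)
  have D0: "det2 (H w0) \<noteq> 0" using Dre(2)[OF w0] by (auto simp: D_def)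
  have DR: "D w0 * R a b = - D w0 * ?L (?M (\<lambda>w. H w a b)) w0 +
     (H w0 1 1 * ?L (\<lambda>w. H w a 0) w0 * ?M (\<lambda>w. H w 0 b) w0 - H w0 1 0 * ?L (\<lambda>w. H w a 1) w0 * ?M (\<lambda>w. H w 0 b) w0
      - H w0 0 1 * ?L (\<lambda>w. H w a 0) w0 * ?M (\<lambda>w. H w 1 b) w0 + H w0 0 0 * ?L (\<lambda>w. H w a 1) w0 * ?M (\<lambda>w. H w 1 b) w0)" for a b
  proof -
    let ?G = "inverse_metric 2 (H w0)"
    have "D w0 * R a b = - D w0 * ?L (?M (\<lambda>w. H w a b)) w0 +
     ((D w0 * ?G 0 0) * ?L (\<lambda>w. H w a 0) w0 * ?M (\<lambda>w. H w 0 b) w0 + (D w0 * ?G 0 1) * ?L (\<lambda>w. H w a 1) w0 * ?M (\<lambda>w. H w 0 b) w0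
      + (D w0 * ?G 1 0) * ?L (\<lambda>w. H w a 0) w0 * ?M (\<lambda>w. H w 1 b) w0 + (D w0 * ?G 1 1) * ?L (\<lambda>w. H w a 1) w0 * ?M (\<lambda>w. H w 1 b) w0)"
      unfolding R_def sum_lessThan_2 by (simp add: algebra_simps)
    then show ?thesis unfolding D_def inverse_metric2_eq[OF D0] by simp
  qed
  have LD: "?L D w0 = ?L (\<lambda>w. H w 0 0) w0 * H w0 1 1 + H w0 0 0 * ?L (\<lambda>w. H w 1 1) w0 -
      (?L (\<lambda>w. H w 0 1) w0 * H w0 1 0 + H w0 0 1 * ?L (\<lambda>w. H w 1 0) w0)"
    "?M D w0 = ?M (\<lambda>w. H w 0 0) w0 * H w0 1 1 + H w0 0 0 * ?M (\<lambda>w. H w 1 1) w0 -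
      (?M (\<lambda>w. H w 0 1) w0 * H w0 1 0 + H w0 0 1 * ?M (\<lambda>w. H w 1 0) w0)"
    unfolding D_def det2_def dir_diff[OF w0 Ck_on_mult[OF W H1(1,4)] Ck_on_mult[OF W H1(2,3)]]
      dir_mult[OF w0 H1(1,4)] dir_mult[OF w0 H1(2,3)] by (rule refl)+
  have LMD: "?L (?M D) w0 = ?L (?M (\<lambda>w. H w 0 0)) w0 * H w0 1 1 + ?M (\<lambda>w. H w 0 0) w0 * ?L (\<lambda>w. H w 1 1) w0
      + ?L (\<lambda>w. H w 0 0) w0 * ?M (\<lambda>w. H w 1 1) w0 + H w0 0 0 * ?L (?M (\<lambda>w. H w 1 1)) w0
      - (?L (?M (\<lambda>w. H w 0 1)) w0 * H w0 1 0 + ?M (\<lambda>w. H w 0 1) w0 * ?L (\<lambda>w. H w 1 0) w0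
      + ?L (\<lambda>w. H w 0 1) w0 * ?M (\<lambda>w. H w 1 0) w0 + H w0 0 1 * ?L (?M (\<lambda>w. H w 1 0)) w0)"
    unfolding D_def det2_def dir_dir_diff[OF W w0 Ck_on_mult[OF W H2(1,4)] Ck_on_mult[OF W H2(2,3)]]
      dir_dir_mult[OF W w0 H2(1,4)] dir_dir_mult[OF W w0 H2(2,3)] by (rule refl)
  have "D w0 * ?T = H w0 1 1 * (D w0 * R 0 0) + H w0 0 0 * (D w0 * R 1 1) - H w0 1 0 * (D w0 * R 0 1) - H w0 0 1 * (D w0 * R 1 0)"
    by (simp add: algebra_simps)
  also have "\<dots> = - (D w0 * ?L (?M D) w0 - ?L D w0 * ?M D w0)"
    unfolding DR LMD LD unfolding D_def det2_def by (rule det2_curvature_identity)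
  finally have "Re (D w0 * ?T) \<le> 0" using nonneg by simp
  moreover have "Re (D w0 * ?T) = Re (D w0) * Re ?T"
    using Dre(1)[OF w0] by (simp add: complex_eq_iff)
  ultimately show False using T Dre(2)[OF w0] mult_pos_pos[of "Re (D w0)" "Re ?T"] by linarith
qed

section \<open>Uniform RC-positivity fails on the Fermat quartic\<close>

text \<open>The minor of the rows i, j and k in the matrix with columns A, B and C.\<close>

definition det3 :: "cvec \<Rightarrow> cvec \<Rightarrow> cvec \<Rightarrow> nat \<Rightarrow> nat \<Rightarrow> nat \<Rightarrow> complex"
  where "det3 A B C i j k = A i * (B j * C k - B k * C j) - A j * (B i * C k - B k * C i) + A k * (B i * C j - B j * C i)"

lemma det3_swap: "det3 A B C j i k = - det3 A B C i j k" "det3 A B C i k j = - det3 A B C i j k"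
  by (simp_all add: det3_def algebra_simps)

lemma det3_same: "det3 A B C i i k = 0" "det3 A B C i k i = 0" "det3 A B C k i i = 0"
  by (simp_all add: det3_def algebra_simps)

text \<open>Once l is fixed, the other three indices are determined up to order, and reordering rows
  only changes the sign. Working with moduli avoids tracking it.\<close>

lemma cmod_det3_perm4:
  assumes "perm4 i j k l" "perm4 p q r l"
  shows "cmod (det3 A B C i j k) = cmod (det3 A B C p q r)"
proof -
  have s: "cmod (det3 A B C b a c) = cmod (det3 A B C a b c)" "cmod (det3 A B C a c b) = cmod (det3 A B C a b c)" for a b c
    by (simp_all add: det3_swap(1)[of A B C b a c] det3_swap(2)[of A B C a c b])
  have d: "p \<noteq> q" "p \<noteq> r" "q \<noteq> r" and m: "p = i \<or> p = j \<or> p = k" "q = i \<or> q = j \<or> q = k" "r = i \<or> r = j \<or> r = k"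
    using perm4_cases[OF assms(1)] perm4_less[OF assms(2)] assms(2) by (auto simp: perm4_def)
  have "cmod (det3 A B C j k i) = cmod (det3 A B C i j k)" by (rule trans[OF s(2) s(1)])
  moreover have "cmod (det3 A B C k i j) = cmod (det3 A B C i j k)" by (rule trans[OF s(1) s(2)])
  moreover have "cmod (det3 A B C k j i) = cmod (det3 A B C i j k)" by (rule trans[OF s(2) trans[OF s(1) s(2)]])
  moreover note s(1)[of j i k] s(2)[of i k j]
  ultimately show ?thesis using m d by auto
qed

text \<open>A covector that annihilates A, B and C is proportional to the vector of their signed minors.\<close>

lemma orthogonal_minors:
  assumes y: "(\<Sum>m<4. y m * A m) = 0" "(\<Sum>m<4. y m * B m) = 0" "(\<Sum>m<4. y m * C m) = 0"
    and perm: "perm4 i j k l" "perm4 i' j' k' l'"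
  shows "cmod (y l') * cmod (det3 A B C i j k) = cmod (y l) * cmod (det3 A B C i' j' k')"
proof (cases "l = l'")
  case True
  then show ?thesis using cmod_det3_perm4[OF perm(1), of i' j' k'] perm(2) by simp
next
  case False
  obtain p q where pq: "perm4 p q l' l"
    using perm4_exists[of l' l] perm4_less[OF perm(1)] perm4_less[OF perm(2)] False by auto
  then have qp: "perm4 p q l l'" by (auto simp: perm4_def)
  \<comment> \<open>The minor with free third row m is expanded along this row. Summed against y it
    is 0, and it vanishes for m = p and m = q, so that just two terms survive.\<close>
  have "(\<Sum>m<4. y m * det3 A B C p q m) = (\<Sum>m<4. y m * A m) * (B p * C q - B q * C p)
     - (\<Sum>m<4. y m * B m) * (A p * C q - A q * C p) + (\<Sum>m<4. y m * C m) * (A p * B q - A q * B p)"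
    by (simp add: sum_lessThan_4 det3_def algebra_simps)
  then have "y l' * det3 A B C p q l' + y l * det3 A B C p q l = 0"
    using y by (simp add: perm4_sum[OF pq] det3_same)
  then have "y l' * det3 A B C p q l' = - (y l * det3 A B C p q l)" by (simp add: eq_neg_iff_add_eq_0)
  from arg_cong[OF this, of cmod] show ?thesis
    using cmod_det3_perm4[OF perm(1) pq] cmod_det3_perm4[OF perm(2) qp] by (simp add: norm_mult)
qed

text \<open>The effect of \<open>lift_change\<close> on minors: multiples of the first column drop
  out, and the common factor and the Jacobian determinant come out in front.\<close>

lemma det3_change:
  "det3 (\<lambda>k. r * A k) (\<lambda>k. m * A k + r * (B k * a + C k * b)) (\<lambda>k. n * A k + r * (B k * c + C k * e)) i j k
    = r ^ 3 * (a * e - c * b) * det3 A B C i j k"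
  unfolding det3_def by algebra

lemma det3_cong:
  assumes "i < 4" "j < 4" "k < 4" "\<And>m. m < 4 \<Longrightarrow> A m = A' m" "\<And>m. m < 4 \<Longrightarrow> B m = B' m" "\<And>m. m < 4 \<Longrightarrow> C m = C' m"
  shows "det3 A B C i j k = det3 A' B' C' i j k"
  using assms by (simp add: det3_def)

lemma det3_std_lift:
  assumes d: "d > 0" and perm: "perm4 i j k l" and \<rho>: "\<rho> \<noteq> 0"
  shows "det3 (std_lift d i j k l \<rho> w) (pd 0 (std_lift d i j k l \<rho>) w) (pd 1 (std_lift d i j k l \<rho>) w) i j k = 1"
proof -
  have p: "pd a (std_lift d i j k l \<rho>) w i = (if a = 0 then 1 else 0)" "pd a (std_lift d i j k l \<rho>) w j = (if a = 1 then 1 else 0)"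
    "pd a (std_lift d i j k l \<rho>) w k = 0" for a
    by (auto simp: pd_def std_lift_coords[OF d perm \<rho>] cpartial_coord)
  show ?thesis by (simp add: det3_def p std_lift_coords[OF d perm \<rho>])
qed

text \<open>K is the product of the transpose of J, of H and of the conjugate of J.\<close>

lemma det2_congruence:
  assumes "\<And>a b. a < 2 \<Longrightarrow> b < 2 \<Longrightarrow> K a b = (\<Sum>p<2. \<Sum>q<2. J p a * cnj (J q b) * H p q)"
  shows "det2 K = of_real ((cmod (det2 J))\<^sup>2) * det2 H"
proof -
  have K: "K 0 0 = (\<Sum>p<2. \<Sum>q<2. J p 0 * cnj (J q 0) * H p q)" "K 0 1 = (\<Sum>p<2. \<Sum>q<2. J p 0 * cnj (J q 1) * H p q)"
    "K 1 0 = (\<Sum>p<2. \<Sum>q<2. J p 1 * cnj (J q 0) * H p q)" "K 1 1 = (\<Sum>p<2. \<Sum>q<2. J p 1 * cnj (J q 1) * H p q)"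
    using assms by simp_all
  show ?thesis unfolding complex_norm_square det2_def K sum_lessThan_2 by (simp add: algebra_simps)
qed

text \<open>In the standard chart, the residue form of the quartic is \<open>dw\<^sub>0 \<and> dw\<^sub>1 / \<psi>\<^sub>l\<^sup>3\<close> up to a constant, where
  \<open>\<psi>\<close> is the standard lift. So this is the squared norm of the dual bivector field, which has no zeros.\<close>

definition residue_norm :: "(ppoint chart \<Rightarrow> ppoint \<Rightarrow> nat \<Rightarrow> nat \<Rightarrow> complex) \<Rightarrow> nat \<Rightarrow> nat \<Rightarrow> nat \<Rightarrow> nat \<Rightarrow> complex \<Rightarrow> ppoint \<Rightarrow> real"
  where "residue_norm h i j k l \<rho> x = (let s = std_chart 4 i j k l \<rho> in
    Re (det2 (h s x)) * (cmod (std_lift 4 i j k l \<rho> (snd s x) l ^ 3))\<^sup>2)"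

text \<open>By \<open>orthogonal_minors\<close> the minors of a lift and its derivatives are
  proportional to the cubes of its coordinates. Rescaling by r multiplies the minors by the cube of
  r, just as it does these cubes; this is where 4 - 1 = 3 enters. What remains is the Jacobian
  determinant, whose squared modulus is the factor by which det h changes.\<close>

lemma residue_norm_unique:
  assumes h: "hermitian_metric (FM 4) (tangent_bundle (FM 4)) h"
    and s: "perm4 i j k l" "\<rho> \<noteq> 0" "x \<in> fst (std_chart 4 i j k l \<rho>)"
    and t: "perm4 i' j' k' l'" "\<rho>' \<noteq> 0" "x \<in> fst (std_chart 4 i' j' k' l' \<rho>')"
  shows "residue_norm h i j k l \<rho> x = residue_norm h i' j' k' l' \<rho>' x"
proof -
  have d: "(4::nat) > 0" by simp
  let ?s = "std_chart 4 i j k l \<rho>" and ?t = "std_chart 4 i' j' k' l' \<rho>'"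
  let ?f = "std_lift 4 i j k l \<rho>" and ?g = "std_lift 4 i' j' k' l' \<rho>'"
  let ?v = "snd ?s x" and ?w = "snd ?t x"
  let ?J = "jac ?s ?t x"
  have sc: "?s \<in> charts (FM 4)" and tc: "?t \<in> charts (FM 4)"
    by (rule std_chart_in_charts[OF d s(1,2)], rule std_chart_in_charts[OF d t(1,2)])
  let ?V = "{w \<in> cspace 2. std_arg 4 \<rho> w \<notin> \<real>\<^sub>\<le>\<^sub>0}" and ?W = "{w \<in> cspace 2. std_arg 4 \<rho>' w \<notin> \<real>\<^sub>\<le>\<^sub>0}"
  have v: "?v \<in> ?V" unfolding std_chart_image[OF d s(1,2), symmetric] by (rule imageI[OF s(3)])
  have w: "?w \<in> ?W" unfolding std_chart_image[OF d t(1,2), symmetric] by (rule imageI[OF t(3)])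
  note Lf = lift_std_lift[OF d s(1,2)] and Lg = lift_std_lift[OF d t(1,2)]
  obtain r \<mu> where r: "r \<noteq> 0" "\<And>k. k < 4 \<Longrightarrow> ?g ?w k = r * ?f ?v k"
    "\<And>b k. b < 2 \<Longrightarrow> k < 4 \<Longrightarrow> pd b ?g ?w k = \<mu> b * ?f ?v k + r * (\<Sum>a<2. pd a ?f ?v k * ?J a b)"
    by (rule lift_change[OF d sc tc s(3) t(3) Lf v Lg w]) (rule that)
  have "det3 (?g ?w) (pd 0 ?g ?w) (pd 1 ?g ?w) i j k =
     det3 (\<lambda>k. r * ?f ?v k) (\<lambda>k. \<mu> 0 * ?f ?v k + r * (pd 0 ?f ?v k * ?J 0 0 + pd 1 ?f ?v k * ?J 1 0))
       (\<lambda>k. \<mu> 1 * ?f ?v k + r * (pd 0 ?f ?v k * ?J 0 1 + pd 1 ?f ?v k * ?J 1 1)) i j k"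
    by (rule det3_cong) (use perm4_less[OF s(1)] r(2,3) in \<open>simp_all add: sum_lessThan_2\<close>)
  also have "\<dots> = r ^ 3 * det2 ?J"
    unfolding det3_change det3_std_lift[OF d s(1,2)] by (simp add: det2_def)
  finally have det: "det3 (?g ?w) (pd 0 ?g ?w) (pd 1 ?g ?w) i j k = r ^ 3 * det2 ?J" .
  have cone: "?g ?w \<in> fermat_cone 4" by (rule lift_cone[OF tc Lg w])
  \<comment> \<open>The cubes form the gradient of the Fermat quartic up to a factor; it annihilates
    the lift, by the equation itself, and the derivatives of the lift.\<close>
  have "(\<Sum>m<4. ?g ?w m ^ 3 * ?g ?w m) = 0"
    using cone by (simp add: fermat_cone_def power_Suc2[symmetric] eval_nat_numeral del: power_Suc)
  moreover have "(\<Sum>m<4. ?g ?w m ^ 3 * pd e ?g ?w m) = 0" if "e < 2" for e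
    using lift_tangent[OF d tc Lg w that] by simp
  ultimately have "cmod (?g ?w l' ^ 3) * cmod (r ^ 3 * det2 ?J) = cmod (?g ?w l ^ 3) * cmod 1"
    using orthogonal_minors[of "\<lambda>m. ?g ?w m ^ 3" "?g ?w" "pd 0 ?g ?w" "pd 1 ?g ?w", OF _ _ _ s(1) t(1)]
    unfolding det det3_std_lift[OF d t(1,2)] by simp
  then have e: "cmod (?g ?w l' ^ 3) * cmod (det2 ?J) = cmod (?f ?v l ^ 3)"
    using r(1) perm4_less[OF s(1)] by (simp add: r(2) norm_mult norm_power power_mult_distrib)
  have "det2 (h ?t x) = of_real ((cmod (det2 ?J))\<^sup>2) * det2 (h ?s x)"
  proof (rule det2_congruence)
    fix a b :: nat assume "a < 2" "b < 2"
    with h sc tc s(3) t(3) show "h ?t x a b = (\<Sum>p<2. \<Sum>q<2. ?J p a * cnj (?J q b) * h ?s x p q)"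
      unfolding hermitian_metric_def tangent_bundle_simps[OF refl] cdim_FM by blast
  qed
  then have "Re (det2 (h ?t x)) = (cmod (det2 ?J))\<^sup>2 * Re (det2 (h ?s x))" by simp
  then show ?thesis
    unfolding residue_norm_def Let_def e[symmetric] by (simp add: power_mult_distrib)
qed


section \<open>Compactness and the minimum on the quartic\<close>

text \<open>Representatives of norm 1. Compactness is used for this set in the cone instead of the
  surface in the quotient topology.\<close>

definition unit_cone :: "nat \<Rightarrow> cvec set"
  where "unit_cone d = (\<lambda>(a, b, c, e). vec4 a b c e) ` {(a, b, c, e). (a, b, c, e) \<in> sphere 0 1 \<and> a ^ d + b ^ d + c ^ d + e ^ d = 0}"

lemma compact_unit_cone: "compact (unit_cone d)"
  unfolding unit_cone_def
proof (rule compact_continuous_image)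
  show "continuous_on {(a, b, c, e). (a, b, c, e) \<in> sphere 0 1 \<and> a ^ d + b ^ d + c ^ d + e ^ d = 0} (\<lambda>(a, b, c, e). vec4 a b c e)"
    unfolding case_prod_unfold by (intro continuous_on_vec4 continuous_intros)
  have "closed {p :: complex \<times> complex \<times> complex \<times> complex. fst p ^ d + fst (snd p) ^ d + fst (snd (snd p)) ^ d + snd (snd (snd p)) ^ d = 0}"
    by (intro closed_Collect_eq continuous_intros)
  then have "compact (sphere 0 1 \<inter> {p :: complex \<times> complex \<times> complex \<times> complex. fst p ^ d + fst (snd p) ^ d + fst (snd (snd p)) ^ d + snd (snd (snd p)) ^ d = 0})"
    by (rule compact_Int_closed[OF compact_sphere])
  then show "compact {(a, b, c, e). (a, b, c, e) \<in> sphere 0 1 \<and> (a :: complex) ^ d + b ^ d + c ^ d + e ^ d = 0}"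
    by (rule back_subst[of compact]) auto
qed

lemma unit_cone_subset:
  assumes "d > 0" shows "unit_cone d \<subseteq> fermat_cone d"
  by (auto simp: unit_cone_def vec4_cone norm_prod_def zero_prod_def[symmetric])

lemma pclass_unit_cone:
  assumes z: "z \<in> fermat_cone d"
  obtains z' where "z' \<in> unit_cone d" "pclass z' = pclass z"
proof -
  have z4: "z = vec4 (z 0) (z (Suc 0)) (z 2) (z 3)" by (rule vec4_coords) (use z in \<open>simp add: fermat_cone_def\<close>)
  define p where "p = (z 0, z (Suc 0), z 2, z 3)"
  from z have c: "z 0 ^ d + z (Suc 0) ^ d + z 2 ^ d + z 3 ^ d = 0" "p \<noteq> 0"
    by (subst (asm) z4, simp add: vec4_cone p_def zero_prod_def)+
  define r where "r = complex_of_real (1 / norm p)"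
  have r: "r \<noteq> 0" using c(2) by (simp add: r_def)
  have rp: "(r * z 0, r * z (Suc 0), r * z 2, r * z 3) = (1 / norm p) *\<^sub>R p"
    by (simp add: p_def r_def scaleR_conv_of_real)
  have "norm (r * z 0, r * z (Suc 0), r * z 2, r * z 3) = 1" unfolding rp using c(2) by simp
  moreover have "(r * z 0) ^ d + (r * z (Suc 0)) ^ d + (r * z 2) ^ d + (r * z 3) ^ d = 0"
    using c(1) by (simp add: power_mult_distrib flip: distrib_left)
  ultimately have "vec4 (r * z 0) (r * z (Suc 0)) (r * z 2) (r * z 3) \<in> unit_cone d"
    by (force simp: unit_cone_def)
  moreover have "vec4 (r * z 0) (r * z (Suc 0)) (r * z 2) (r * z 3) = (\<lambda>i. r * z i)"
    by (subst z4) (auto simp: vec4_def)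
  ultimately show thesis using that pclass_eqI[OF r] by simp
qed

lemma hermitian_metric_smooth:
  assumes h: "hermitian_metric (FM d) (tangent_bundle (FM d)) h" and c: "c \<in> charts (FM d)" and ab: "a < 2" "b < 2"
  shows "smooth_fun_on 2 (snd c ` fst c) (\<lambda>w. h c (from_coords c w) a b)"
proof -
  have "smooth_fun_on 2 (snd c ` (fst c \<inter> fst c)) (\<lambda>w. h c (from_coords c w) a b)"
    using h c ab unfolding hermitian_metric_def tangent_bundle_simps[OF refl] cdim_FM by blast
  then show ?thesis by simp
qed

lemma continuous_residue_norm:
  assumes h: "hermitian_metric (FM 4) (tangent_bundle (FM 4)) h" and s: "perm4 i j k l" "\<rho> \<noteq> 0"
  shows "continuous_on {z \<in> fermat_cone 4. pclass z \<in> fst (std_chart 4 i j k l \<rho>)} (\<lambda>z. residue_norm h i j k l \<rho> (pclass z))"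
proof -
  have d: "(4::nat) > 0" by simp
  let ?s = "std_chart 4 i j k l \<rho>"
  let ?Z = "{z \<in> fermat_cone 4. pclass z \<in> fst ?s}" and ?W = "snd ?s ` fst ?s"
  have sc: "?s \<in> charts (FM 4)" by (rule std_chart_in_charts[OF d s])
  have ch: "continuous_on ?W (\<lambda>w. h ?s (from_coords ?s w) a b)" if "a < 2" "b < 2" for a b
    using hermitian_metric_smooth[OF h sc that] Ck_on_continuous[of 0] unfolding smooth_fun_on_def by blast
  have "hol_on 2 ?W (\<lambda>w. std_lift 4 i j k l \<rho> w l)"
    using lift_std_lift[OF d s] perm4_less[OF s(1)] std_chart_image[OF d s] by (simp add: lift_def holv_def)
  then have cl: "continuous_on ?W (\<lambda>w. std_lift 4 i j k l \<rho> w l)" by (simp add: hol_on_def)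
  have cW: "continuous_on ?W (\<lambda>w. Re (det2 (h ?s (from_coords ?s w))) * (cmod (std_lift 4 i j k l \<rho> w l ^ 3))\<^sup>2)"
    unfolding det2_def by (intro continuous_intros ch cl) simp_all
  have "continuous_on ?Z (\<lambda>z. cv (z i / z k, z j / z k))"
    by (intro continuous_on_cv continuous_on_Pair continuous_on_divide continuous_on_subset[OF continuous_on_product_coordinates])
      (auto simp: std_chart_mem[OF s(1)])
  then have "continuous_on ?Z (\<lambda>z. (\<lambda>w. Re (det2 (h ?s (from_coords ?s w))) * (cmod (std_lift 4 i j k l \<rho> w l ^ 3))\<^sup>2) (cv (z i / z k, z j / z k)))"
    by (rule continuous_on_compose2[OF cW]) (use std_chart_snd[of 4 i j k l \<rho>] in force)
  moreover have "(\<lambda>w. Re (det2 (h ?s (from_coords ?s w))) * (cmod (std_lift 4 i j k l \<rho> w l ^ 3))\<^sup>2) (cv (z i / z k, z j / z k)) = residue_norm h i j k l \<rho> (pclass z)"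
    if "z \<in> ?Z" for z
    using from_coords_snd[OF sc, of "pclass z"] that by (simp add: residue_norm_def Let_def)
  ultimately show ?thesis by (rule continuous_on_eq)
qed

text \<open>By \<open>residue_norm_unique\<close> the local expressions are one function Q on the
  surface, and its pullback to the compact \<open>unit_cone\<close> is continuous. Every point of
  the surface has a representative there, so the minimum is global.\<close>

lemma residue_norm_minimum:
  assumes h: "hermitian_metric (FM 4) (tangent_bundle (FM 4)) h"
  obtains i j k l \<rho> x where "perm4 i j k l" "\<rho> \<noteq> 0" "x \<in> fst (std_chart 4 i j k l \<rho>)"
    "\<And>y. y \<in> fst (std_chart 4 i j k l \<rho>) \<Longrightarrow> residue_norm h i j k l \<rho> x \<le> residue_norm h i j k l \<rho> y"
proof -
  have d: "(4::nat) > 0" by simp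
  define Q where "Q x = (SOME q. \<exists>i j k l \<rho>. perm4 i j k l \<and> \<rho> \<noteq> 0 \<and> x \<in> fst (std_chart 4 i j k l \<rho>) \<and> q = residue_norm h i j k l \<rho> x)" for x
  have Q: "Q x = residue_norm h i j k l \<rho> x" if s: "perm4 i j k l" "\<rho> \<noteq> 0" "x \<in> fst (std_chart 4 i j k l \<rho>)" for x i j k l \<rho>
    unfolding Q_def
  proof (rule some_equality)
    show "\<exists>i' j' k' l' \<rho>'. perm4 i' j' k' l' \<and> \<rho>' \<noteq> 0 \<and> x \<in> fst (std_chart 4 i' j' k' l' \<rho>') \<and>
        residue_norm h i j k l \<rho> x = residue_norm h i' j' k' l' \<rho>' x"
      using s by blast
    show "q = residue_norm h i j k l \<rho> x" if "\<exists>i j k l \<rho>. perm4 i j k l \<and> \<rho> \<noteq> 0 \<and> x \<in> fst (std_chart 4 i j k l \<rho>) \<and> q = residue_norm h i j k l \<rho> x" for q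
      using that residue_norm_unique[OF h _ _ _ s] by blast
  qed
  let ?K = "unit_cone 4"
  note KC = unit_cone_subset[OF d]
  have "continuous_on ?K (\<lambda>z. Q (pclass z))"
    unfolding continuous_on_eq_continuous_within
  proof
    fix z assume z: "z \<in> ?K"
    then have "pclass z \<in> fermat_surface 4" using KC by (auto simp: fermat_surface_def)
    then obtain i j k l \<rho> where s: "perm4 i j k l" "\<rho> \<noteq> 0" "pclass z \<in> fst (std_chart 4 i j k l \<rho>)"
      by (rule std_chart_exists[OF d])
    obtain T where T: "open T" "{z \<in> cspace 4 - {czero}. z k \<noteq> 0 \<and> z l / z k / \<rho> \<in> sector 4} = (cspace 4 - {czero}) \<inter> T"
      using openin_std_set[OF d s(1,2)] unfolding openin_open by blast
    have KT: "pclass z \<in> fst (std_chart 4 i j k l \<rho>) \<longleftrightarrow> z \<in> T" if "z \<in> ?K" for z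
    proof -
      have zc: "z \<in> fermat_cone 4" "z \<in> cspace 4 - {czero}" using that KC by (auto simp: fermat_cone_def)
      have "z \<in> T \<longleftrightarrow> z k \<noteq> 0 \<and> z l / z k / \<rho> \<in> sector 4" using zc(2) T(2) by blast
      then show ?thesis using zc(1) by (simp add: std_chart_mem[OF s(1)])
    qed
    have "continuous_on (?K \<inter> T) (\<lambda>z. residue_norm h i j k l \<rho> (pclass z))"
      by (rule continuous_on_subset[OF continuous_residue_norm[OF h s(1,2)]]) (use KC KT in auto)
    moreover have "residue_norm h i j k l \<rho> (pclass z) = Q (pclass z)" if "z \<in> ?K \<inter> T" for z
      using Q[OF s(1,2), of "pclass z"] KT that by simp
    ultimately have "continuous_on (?K \<inter> T) (\<lambda>z. Q (pclass z))" by (rule continuous_on_eq)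
    then have "continuous (at z within ?K \<inter> T) (\<lambda>z. Q (pclass z))"
      using z s(3) KT[OF z] by (simp add: continuous_on_eq_continuous_within)
    \<comment> \<open>The domain of the standard chart is relatively open in \<open>?K\<close>, so
      continuity can be checked inside it.\<close>
    moreover have "at z within ?K \<inter> T = at z within ?K"
      by (rule at_within_nhd[OF _ T(1)]) (use z s(3) KT[OF z] in auto)
    ultimately show "continuous (at z within ?K) (\<lambda>z. Q (pclass z))" by simp
  qed
  moreover have "?K \<noteq> {}"
  proof -
    have "fermat_surface 4 \<noteq> {}" using fermat_projective_manifold[OF d] by (simp add: projective_manifold_def)
    then obtain z where "z \<in> fermat_cone 4" by (auto simp: fermat_surface_def)
    then show ?thesis by (rule pclass_unit_cone) blast
  qed
  ultimately obtain z where z: "z \<in> ?K" "\<And>y. y \<in> ?K \<Longrightarrow> Q (pclass z) \<le> Q (pclass y)"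
    using continuous_attains_inf[OF compact_unit_cone] by blast
  have "pclass z \<in> fermat_surface 4" using z(1) KC by (auto simp: fermat_surface_def)
  then obtain i j k l \<rho> where s: "perm4 i j k l" "\<rho> \<noteq> 0" "pclass z \<in> fst (std_chart 4 i j k l \<rho>)"
    by (rule std_chart_exists[OF d])
  show thesis
  proof (rule that[OF s])
    fix y assume y: "y \<in> fst (std_chart 4 i j k l \<rho>)"
    then obtain z' where "z' \<in> fermat_cone 4" "y = pclass z'" by (auto simp: std_chart_def)
    then obtain z'' where "z'' \<in> ?K" "y = pclass z''" using pclass_unit_cone by metis
    then show "residue_norm h i j k l \<rho> (pclass z) \<le> residue_norm h i j k l \<rho> y"
      using z(2)[of z''] Q[OF s] Q[OF s(1,2) y] by simp
  qed
qed

theorem fermat_quartic_not_uniformly_rc_positive: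
  "\<not> uniformly_rc_positive (FM 4) (tangent_bundle (FM 4))"
proof
  assume "uniformly_rc_positive (FM 4) (tangent_bundle (FM 4))"
  then obtain h where h: "hermitian_metric (FM 4) (tangent_bundle (FM 4)) h"
    and U: "\<And>x. x \<in> points (FM 4) \<Longrightarrow> uniformly_rc_positive_at (FM 4) (tangent_bundle (FM 4)) h x"
    unfolding uniformly_rc_positive_def by blast
  obtain i j k l \<rho> x where s: "perm4 i j k l" "\<rho> \<noteq> 0" "x \<in> fst (std_chart 4 i j k l \<rho>)"
    and m: "\<And>y. y \<in> fst (std_chart 4 i j k l \<rho>) \<Longrightarrow> residue_norm h i j k l \<rho> x \<le> residue_norm h i j k l \<rho> y"
    by (rule residue_norm_minimum[OF h]) (rule that)
  have d: "(4::nat) > 0" by simp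
  let ?s = "std_chart 4 i j k l \<rho>" and ?f = "std_lift 4 i j k l \<rho>"
  let ?W = "snd ?s ` fst ?s" and ?H = "\<lambda>w. h ?s (from_coords ?s w)"
  have sc: "?s \<in> charts (FM 4)" by (rule std_chart_in_charts[OF d s(1,2)])
  have "x \<in> points (FM 4)" unfolding points_def using s(3) by (intro UN_I[OF sc]) (simp add: case_prod_unfold)
  from U[OF this] obtain u where u: "u \<in> cspace 2 - {czero}"
    "\<And>v. v \<in> cspace 2 - {czero} \<Longrightarrow> curvature_form (FM 4) (tangent_bundle (FM 4)) h ?s ?s x u v > 0"
    unfolding uniformly_rc_positive_at_def tangent_bundle_simps[OF refl] cdim_FM using sc s(3) by blast
  have herm: "herm2 (h ?s y)" if "y \<in> fst ?s" for y
    using h sc that unfolding hermitian_metric_def herm2_def tangent_bundle_simps[OF refl] cdim_FM by blast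
  have hl: "hol_on 2 ?W (\<lambda>w. ?f w l)"
    using lift_std_lift[OF d s(1,2)] perm4_less[OF s(1)] std_chart_image[OF d s(1,2)] by (simp add: lift_def holv_def)
  have "\<exists>v\<in>cspace 2 - {czero}. \<not> Re (\<Sum>k<2. \<Sum>l<2. \<Sum>a<2. \<Sum>b<2.
      chern_curvature 2 ?H (snd ?s x) k l a b * u k * cnj (u l) * v a * cnj (v b)) > 0"
  proof (rule hermitian_determinant_no_minimum[where g="\<lambda>w. ?f w l ^ 3"])
    show "open_in_cspace 2 ?W" by (rule chart_openin[OF sc])
    show x: "snd ?s x \<in> ?W" using s(3) by blast
    show "u \<in> cspace 2" using u(1) by blast
    show "Ck_on (Suc (Suc 0)) 2 ?W (\<lambda>w. ?H w a b)" if "a < 2" "b < 2" for a b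
      using hermitian_metric_smooth[OF h sc that] unfolding smooth_fun_on_def by blast
    show "herm2 (?H w)" if "w \<in> ?W" for w using herm[OF snd_from_coords(2)[OF that]] .
    show "hol_on 2 ?W (\<lambda>w. ?f w l ^ 3)" by (rule hol_on_power[OF hl])
    \<comment> \<open>The l-th coordinate is nonzero throughout the chart, because 0 does not lie in
      the sector; so the holomorphic factor has no zero at the minimum.\<close>
    obtain z where z: "x = pclass z" using s(3) by (auto simp: std_chart_def)
    have "pclass (?f (snd ?s x)) \<in> fst ?s" using std_chart_inverse(2)[OF d s(1,2), of z] s(3) by (simp add: z)
    then have "?f (snd ?s x) l / ?f (snd ?s x) k / \<rho> \<in> sector 4" by (simp add: std_chart_mem[OF s(1)])
    then show "?f (snd ?s x) l ^ 3 \<noteq> 0" by (auto simp: sector_def)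
    show "Re (det2 (?H (snd ?s x))) * (cmod (?f (snd ?s x) l ^ 3))\<^sup>2 \<le> Re (det2 (?H w)) * (cmod (?f w l ^ 3))\<^sup>2" if "w \<in> ?W" for w
      using m[OF snd_from_coords(2)[OF that]] from_coords_snd[OF sc s(3)] snd_from_coords(1)[OF that]
      by (simp add: residue_norm_def Let_def)
  qed
  then obtain v where "v \<in> cspace 2 - {czero}" "\<not> curvature_form (FM 4) (tangent_bundle (FM 4)) h ?s ?s x u v > 0"
    unfolding curvature_form_def tangent_bundle_simps[OF refl] cdim_FM by blast
  with u(2) show False by blast
qed

text \<open>The condition \<open>n \<ge> 1\<close> excludes the point, where uniform RC-positivity
  would fail merely because there is no nonzero direction. The quartic serves for the first claim
  and the octic for the second.\<close>

theorem corollary1p3: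
  "(\<exists>N n X. projective_manifold N n X \<and> n \<ge> 1 \<and>
      rc_positive (as_cmanifold N n X) (T10 N n X) \<and>
      \<not> uniformly_rc_positive (as_cmanifold N n X) (T10 N n X)) \<and>
   (\<exists>N n X. projective_manifold N n X \<and>
      rc_positive (as_cmanifold N n X) (T10 N n X) \<and>
      \<not> rationally_connected N X)"
proof
  show "\<exists>N n X. projective_manifold N n X \<and> n \<ge> 1 \<and>
      rc_positive (as_cmanifold N n X) (T10 N n X) \<and>
      \<not> uniformly_rc_positive (as_cmanifold N n X) (T10 N n X)"
    by (rule exI[of _ 3], rule exI[of _ 2], rule exI[of _ "fermat_surface 4"])
      (simp add: fermat_projective_manifold fermat_rc_positive fermat_quartic_not_uniformly_rc_positive)
  show "\<exists>N n X. projective_manifold N n X \<and>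
      rc_positive (as_cmanifold N n X) (T10 N n X) \<and>
      \<not> rationally_connected N X"
    by (rule exI[of _ 3], rule exI[of _ 2], rule exI[of _ "fermat_surface 8"])
      (simp add: fermat_projective_manifold fermat_rc_positive fermat_octic_not_rationally_connected)
qed

end
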